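(* Let $n\in\{1,2\}$ and $p>1+\frac{2}{n}$. Put $k_0=1$ if $n=1$, and $k_0=1+\varepsilon$ if $n=2$, where $\varepsilon\in[0,2)$ is arbitrary. Let $u_0\in L^1(\mathbb{R}^n)\cap H^{k_0}(\mathbb{R}^n)$ and $u_1\in L^1(\mathbb{R}^n)\cap L^2(\mathbb{R}^n)$ have sufficiently small norm $\|u_0\|_{L^1}+\|u_0\|_{H^{k_0}}+\|u_1\|_{L^1}+\|u_1\|_{L^2}$ (i.e. at most some $\delta>0$ independent of the data), and let $u\in C([0,\infty);H^{k_0}(\mathbb{R}^n))$ be the unique global solution of $$\partial_t^2u-\Delta u+\partial_tu-\Delta\partial_tu=|u|^p\quad (t>0,\ x\in\mathbb{R}^n),\qquad u(0,x)=u_0(x),\quad \partial_tu(0,x)=u_1(x)$$ which satisfies $\||\nabla_x|^ku(t)\|_{L^2(\mathbb{R}^n)}\le C(1+t)^{-\frac n4-\frac k2}$ for all $t\ge0$, $k\in[0,k_0]$. Then $$\lim_{t\to\infty}t^{\frac n4+\frac k2}\,\||\nabla_x|^k(u(t)-MG_t)\|_{L^2(\mathbb{R}^n)}=0\qquad\text{for all } k\in[0,k_0],$$ where $$M=\int_{\mathbb{R}^n}(u_0(y)+u_1(y))\,dy+\int_0^\infty\int_{\mathbb{R}^n}|u(s,y)|^p\,dy\,ds .$$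
   Context: $G_t(x)=(4\pi t)^{-n/2}e^{-|x|^2/(4t)}$ is the Gauss kernel. $\hat g(\xi)=(2\pi)^{-n/2}\int_{\mathbb{R}^n}e^{-ix\cdot\xi}g(x)\,dx$ denotes the Fourier transform; $|\nabla_x|^k$ is the Fourier multiplier with symbol $|\xi|^k$; $H^k(\mathbb{R}^n)$ is the Sobolev space of real-valued functions with norm $\|g\|_{H^k}=(\|g\|_{L^2}^2+\||\nabla_x|^kg\|_{L^2}^2)^{1/2}$. Solutions are understood in the mild (integral) sense: $$u(t)=K_0(t)u_0+K_1(t)u_1+\int_0^tK_1(t-\tau)\,|u(\tau)|^p\,d\tau,$$ where $K_j(t)g=\mathcal{F}^{-1}[\mathcal{K}_j(t,\cdot)\hat g]$ ($j=0,1$) with $$\mathcal{K}_0(t,\xi)=\frac{e^{-t|\xi|^2}-|\xi|^2e^{-t}}{1-|\xi|^2},\qquad \mathcal{K}_1(t,\xi)=\frac{e^{-t|\xi|^2}-e^{-t}}{1-|\xi|^2}$$ (extended by continuity to $|\xi|=1$). The existence and uniqueness of the solution $u$ for sufficiently small data is the paper's preceding theorem. *)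

theory Defs
  imports "HOL-Analysis.Analysis"
begin

text \<open>
  \<open>\<real>\<^sup>n\<close> is rendered as a type \<open>'a::euclidean_space\<close> with \<open>n = DIM('a)\<close>. Elements of
  Lebesgue spaces are represented by Borel functions; all notions below respect equality
  almost everywhere.
\<close>

definition L2 :: "('a::euclidean_space \<Rightarrow> 'b::real_normed_vector) set" where
  "L2 = {f. f \<in> borel_measurable lborel \<and> integrable lborel (\<lambda>x. (norm (f x))\<^sup>2)}"

text \<open>Only meaningful on \<^const>\<open>L2\<close>: the Bochner integral of a non-integrable function is \<open>0\<close>.\<close>

definition L2_norm :: "('a::euclidean_space \<Rightarrow> 'b::real_normed_vector) \<Rightarrow> real" where
  "L2_norm f = sqrt (\<integral>x. (norm (f x))\<^sup>2 \<partial>lborel)"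

definition L1_norm :: "('a::euclidean_space \<Rightarrow> real) \<Rightarrow> real" where
  "L1_norm f = (\<integral>x. \<bar>f x\<bar> \<partial>lborel)"

definition fourier_integral :: "('a::euclidean_space \<Rightarrow> complex) \<Rightarrow> 'a \<Rightarrow> complex" where
  "fourier_integral g \<xi> =
     of_real ((2 * pi) powr (- (real DIM('a) / 2))) *
     (\<integral>x. exp (- (\<i> * of_real (x \<bullet> \<xi>))) * g x \<partial>lborel)"

text \<open>
  The Fourier transform on \<open>L\<^sup>2\<close>: the \<open>L\<^sup>2\<close>-limit, as \<open>R \<rightarrow> \<infinity>\<close>, of the Fourier integrals of the
  truncations of \<open>g\<close> to balls of radius \<open>R\<close> (which are in \<open>L\<^sup>1\<close>). It is determined up to a null
  set and agrees a.e. with \<^const>\<open>fourier_integral\<close> on \<open>L\<^sup>1 \<inter> L\<^sup>2\<close>.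
\<close>

definition is_fourier :: "('a::euclidean_space \<Rightarrow> complex) \<Rightarrow> ('a \<Rightarrow> complex) \<Rightarrow> bool" where
  "is_fourier g h \<longleftrightarrow>
     (let g\<^sub>R = (\<lambda>R x. indicator (cball 0 R) x *\<^sub>R g x) in
      h \<in> L2 \<and> (\<forall>R. fourier_integral (g\<^sub>R R) \<in> L2) \<and>
      ((\<lambda>R. L2_norm (\<lambda>\<xi>. fourier_integral (g\<^sub>R R) \<xi> - h \<xi>)) \<longlongrightarrow> 0) at_top)"

definition fourier :: "('a::euclidean_space \<Rightarrow> complex) \<Rightarrow> 'a \<Rightarrow> complex" where
  "fourier g = (SOME h. is_fourier g h)"

text \<open>Replacing \<open>x\<close> by \<open>- x\<close> turns the phase \<open>exp (- \<i> x \<bullet> \<xi>)\<close> into \<open>exp (\<i> x \<bullet> \<xi>)\<close>.\<close>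

definition inv_fourier :: "('a::euclidean_space \<Rightarrow> complex) \<Rightarrow> 'a \<Rightarrow> complex" where
  "inv_fourier h x = fourier h (- x)"

definition fourier_multiplier ::
  "('a::euclidean_space \<Rightarrow> real) \<Rightarrow> ('a \<Rightarrow> real) \<Rightarrow> 'a \<Rightarrow> complex" where
  "fourier_multiplier m g =
     inv_fourier (\<lambda>\<xi>. of_real (m \<xi>) * fourier (\<lambda>x. of_real (g x)) \<xi>)"

text \<open>
  \<open>|\<nabla>|\<^sup>k\<close>. As \<open>0 powr 0 = 0\<close>, the symbol for \<open>k = 0\<close> is \<open>1\<close> only away from the origin; this
  null set is immaterial.
\<close>

definition abs_nabla :: "real \<Rightarrow> ('a::euclidean_space \<Rightarrow> real) \<Rightarrow> 'a \<Rightarrow> complex" where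
  "abs_nabla k = fourier_multiplier (\<lambda>\<xi>. norm \<xi> powr k)"

definition sobolev :: "real \<Rightarrow> ('a::euclidean_space \<Rightarrow> real) set" where
  "sobolev k = {g. g \<in> L2 \<and>
     (\<lambda>\<xi>. of_real (norm \<xi> powr k) * fourier (\<lambda>x. of_real (g x)) \<xi>) \<in> L2}"

definition sobolev_norm :: "real \<Rightarrow> ('a::euclidean_space \<Rightarrow> real) \<Rightarrow> real" where
  "sobolev_norm k g = sqrt ((L2_norm g)\<^sup>2 + (L2_norm (abs_nabla k g))\<^sup>2)"

definition continuous_into_sobolev :: "real \<Rightarrow> (real \<Rightarrow> 'a::euclidean_space \<Rightarrow> real) \<Rightarrow> bool" where
  "continuous_into_sobolev k u \<longleftrightarrow>
     (\<forall>t\<ge>0. u t \<in> sobolev k) \<and>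
     (\<forall>s\<ge>0. ((\<lambda>t. sobolev_norm k (\<lambda>x. u t x - u s x)) \<longlongrightarrow> 0) (at s within {0..}))"

definition gauss_kernel :: "real \<Rightarrow> 'a::euclidean_space \<Rightarrow> real" where
  "gauss_kernel t x =
     (4 * pi * t) powr (- (real DIM('a) / 2)) * exp (- (norm x)\<^sup>2 / (4 * t))"

definition symbol0 :: "real \<Rightarrow> 'a::euclidean_space \<Rightarrow> real" where
  "symbol0 t \<xi> =
     (if norm \<xi> = 1 then (1 + t) * exp (- t)
      else (exp (- t * (norm \<xi>)\<^sup>2) - (norm \<xi>)\<^sup>2 * exp (- t)) / (1 - (norm \<xi>)\<^sup>2))"

definition symbol1 :: "real \<Rightarrow> 'a::euclidean_space \<Rightarrow> real" where
  "symbol1 t \<xi> =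
     (if norm \<xi> = 1 then t * exp (- t)
      else (exp (- t * (norm \<xi>)\<^sup>2) - exp (- t)) / (1 - (norm \<xi>)\<^sup>2))"

text \<open>The values on the unit sphere are the continuous extensions.\<close>

lemma continuous_extension_aux:
  fixes f :: "real \<Rightarrow> real" and \<xi> :: "'a::euclidean_space"
  assumes f: "(f has_real_derivative - c) (at 1)" and f1: "f 1 = 0" and \<xi>: "norm \<xi> = 1"
  shows "isCont (\<lambda>\<eta>::'a. if norm \<eta> = 1 then c else f ((norm \<eta>)\<^sup>2) / (1 - (norm \<eta>)\<^sup>2)) \<xi>"
proof -
  define g where "g r = (if r = 1 then c else f r / (1 - r))" for r
  have "((\<lambda>r. - ((f r - f 1) / (r - 1))) \<longlongrightarrow> c) (at 1)"
    using f tendsto_minus unfolding has_field_derivative_iff by fastforce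
  then have "(g \<longlongrightarrow> c) (at 1)"
    by (rule Lim_transform_eventually)
       (auto simp: eventually_at_filter g_def f1 divide_simps algebra_simps)
  then have "isCont g ((norm \<xi>)\<^sup>2)"
    by (simp add: isCont_def \<xi> g_def)
  moreover have "isCont (\<lambda>\<eta>::'a. (norm \<eta>)\<^sup>2) \<xi>"
    by (intro continuous_intros)
  ultimately have "isCont (\<lambda>\<eta>::'a. g ((norm \<eta>)\<^sup>2)) \<xi>"
    by (rule isCont_o2[rotated])
  moreover have "(norm \<eta>)\<^sup>2 = 1 \<longleftrightarrow> norm \<eta> = 1" for \<eta> :: 'a
    by (auto simp: power2_eq_1_iff) (metis neg_0_le_iff_le norm_ge_zero not_one_le_zero)
  ultimately show ?thesis
    by (simp add: g_def)
qed

lemma isCont_symbols_sphere: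
  fixes \<xi> :: "'a::euclidean_space"
  assumes "norm \<xi> = 1"
  shows "isCont (symbol0 t) \<xi>" and "isCont (symbol1 t) \<xi>"
proof -
  have "((\<lambda>r. exp (- t * r) - r * exp (- t)) has_real_derivative - ((1 + t) * exp (- t))) (at 1)"
    by (auto intro!: derivative_eq_intros simp: algebra_simps)
  from continuous_extension_aux[OF this _ assms] show "isCont (symbol0 t) \<xi>"
    by (simp add: symbol0_def[abs_def])
  have "((\<lambda>r. exp (- t * r) - exp (- t)) has_real_derivative - (t * exp (- t))) (at 1)"
    by (auto intro!: derivative_eq_intros simp: algebra_simps)
  from continuous_extension_aux[OF this _ assms] show "isCont (symbol1 t) \<xi>"
    by (simp add: symbol1_def[abs_def])
qed

text \<open>
  The integral over \<open>[a, b]\<close> of an \<open>L\<^sup>2\<close>-valued function. This is the definition of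
  \<^const>\<open>has_integral\<close> with the norm of \<open>L\<^sup>2\<close>, needed because \<open>L\<^sup>2\<close> is not a type here. For
  \<open>L\<^sup>2\<close>-continuous integrands, such as the Duhamel integrand below, it is the Riemann
  (and the Bochner) integral.
\<close>

definition has_L2_integral ::
  "(real \<Rightarrow> 'a::euclidean_space \<Rightarrow> complex) \<Rightarrow> ('a \<Rightarrow> complex) \<Rightarrow> real \<Rightarrow> real \<Rightarrow> bool" where
  "has_L2_integral F I a b \<longleftrightarrow>
     (\<forall>\<tau>\<in>{a..b}. F \<tau> \<in> L2) \<and> I \<in> L2 \<and>
     (\<forall>e>0. \<exists>\<gamma>. gauge \<gamma> \<and>
        (\<forall>D. D tagged_division_of {a..b} \<and> \<gamma> fine D \<longrightarrow>
           L2_norm (\<lambda>x. (\<Sum>(\<tau>, J)\<in>D. measure lborel J *\<^sub>R F \<tau> x) - I x) < e))"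

text \<open>
  Mild solutions of \<open>\<partial>\<^sub>t\<^sup>2u - \<Delta>u + \<partial>\<^sub>tu - \<Delta>\<partial>\<^sub>tu = |u|\<^sup>p\<close> with \<open>u(0) = u\<^sub>0\<close>, \<open>\<partial>\<^sub>tu(0) = u\<^sub>1\<close>; \<open>I\<close> is the
  Duhamel term.
\<close>

definition mild_solution ::
  "real \<Rightarrow> ('a::euclidean_space \<Rightarrow> real) \<Rightarrow> ('a \<Rightarrow> real) \<Rightarrow> (real \<Rightarrow> 'a \<Rightarrow> real) \<Rightarrow> bool" where
  "mild_solution p u\<^sub>0 u\<^sub>1 u \<longleftrightarrow>
     (\<forall>t\<ge>0. \<exists>I.
        has_L2_integral
          (\<lambda>\<tau>. fourier_multiplier (symbol1 (t - \<tau>)) (\<lambda>x. \<bar>u \<tau> x\<bar> powr p)) I 0 t \<and>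
        (AE x in lborel. of_real (u t x) =
           fourier_multiplier (symbol0 t) u\<^sub>0 x + fourier_multiplier (symbol1 t) u\<^sub>1 x + I x))"

definition total_mass ::
  "real \<Rightarrow> ('a::euclidean_space \<Rightarrow> real) \<Rightarrow> ('a \<Rightarrow> real) \<Rightarrow> (real \<Rightarrow> 'a \<Rightarrow> real) \<Rightarrow> real" where
  "total_mass p u\<^sub>0 u\<^sub>1 u =
     (\<integral>y. u\<^sub>0 y + u\<^sub>1 y \<partial>lborel) +
     (\<integral>s\<in>{0..}. (\<integral>y. \<bar>u s y\<bar> powr p \<partial>lborel) \<partial>lborel)"

end

theory Submission
  imports Defs "HOL-Probability.Probability" "HOL-Real_Asymp.Real_Asymp"
begin

text \<open>
  By Plancherel everything happens on the Fourier side, where \<open>K\<^sub>1(t)\<close> is the multiplier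
  \<open>(exp (- t |\<xi>|\<^sup>2) - exp (- t)) / (1 - |\<xi>|\<^sup>2)\<close>. It differs from the heat multiplier
  \<open>exp (- t |\<xi>|\<^sup>2)\<close> by \<open>O(|\<xi>|\<^sup>2)\<close> times a Gaussian at low frequencies and by an exponentially decaying term, with
  a gain of two derivatives, at high frequencies. For \<open>g \<in> L\<^sup>1\<close> the heat flow in turn is close to its
  mass times the Gaussian: rescaling \<open>\<xi>\<close> by \<open>\<surd>t\<close> and the continuity of the Fourier transform at \<open>0\<close> give
  \<open>o(t powr (- n/4 - k/2))\<close> by dominated convergence.

  The assumed decay and the Gagliardo-Nirenberg inequality give
  \<open>|u(\<tau>)|\<^sup>p = O((1 + \<tau>) powr (- 1 - \<eta>))\<close> in \<open>L\<^sup>1\<close> with \<open>\<eta> = n (p - 1) / 2 - 1 > 0\<close>, and the analogous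
  bound with an extra factor \<open>(1 + \<tau>) powr (- n/4)\<close> in \<open>L\<^sup>2\<close>. The Duhamel integral is compared with
  \<open>G\<^sub>t\<close> times the integral of the mass of \<open>|u|\<^sup>p\<close> over \<open>[0, t]\<close>: for \<open>\<tau> \<le> t/2\<close> by the above approximation of the kernel, and for
  \<open>\<tau> \<ge> t/2\<close> using only the decay of \<open>|u|\<^sup>p\<close>. If \<open>k \<ge> 2\<close> (hence \<open>n = 2\<close>), one derivative is moved
  onto \<open>|u|\<^sup>p\<close>, whose gradient is controlled by the \<open>L\<^sup>\<infinity>\<close> and \<open>H\<^sup>1\<close> decay of \<open>u\<close>.
\<close>

section \<open>The space \<open>L\<^sup>2\<close>\<close>

text \<open>Two obstacles shape the argument. The weight |xi|^k is unbounded, and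
  \<open>fourier\<close> is a choice fixed only up to null sets, so neither can simply be pulled
  through the L2-valued Duhamel integral. Riemann sums are transformed instead, with the weight
  truncated, and Fatou removes the truncation. The second obstacle is the range k < 3: at high
  frequency the kernel gains only two derivatives, and at k = 2 the factor (1 + t - \<tau>) powr (-
  k/2) has a logarithmically growing time integral. This is what forces a derivative onto |u|^p.
  Three errors separate the Duhamel integrand from its profile. Replacing the kernel by the heat
  kernel and shifting the time from t - \<tau> to t both gain a power of t, because each costs a
  factor |xi|^2. Replacing the heat flow by mass times Gaussian has no rate for merely integrable
  data. That error is therefore integrated in \<tau> by dominated convergence, with the decay of the
  mass as majorant. Plancherel and inversion themselves are obtained by damping with
  Gaussians.\<close>

lemma L2_measurable: "f \<in> L2 \<Longrightarrow> f \<in> borel_measurable borel"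
  by (simp add: L2_def)

lemma L2_norm_nonneg [simp]: "0 \<le> L2_norm f"
  by (simp add: L2_norm_def integral_nonneg)

lemma L2_norm_square: "(L2_norm f)\<^sup>2 = (\<integral>x. (norm (f x))\<^sup>2 \<partial>lborel)"
  by (simp add: L2_norm_def integral_nonneg)

lemma L2_integrable: "f \<in> L2 \<Longrightarrow> integrable lborel (\<lambda>x. (norm (f x))\<^sup>2)"
  by (simp add: L2_def)

lemma nn_integral_L2: "f \<in> L2 \<Longrightarrow> (\<integral>\<^sup>+x. ennreal ((norm (f x))\<^sup>2) \<partial>lborel) = ennreal ((L2_norm f)\<^sup>2)"
  by (simp add: L2_norm_square nn_integral_eq_integral L2_integrable)

text \<open>Working with the extended nonnegative integral yields membership and the norm bound from
  one estimate. A bound on \<open>L2_norm\<close> alone would prove nothing, because the norm takes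
  the default value 0 when the square is not integrable.\<close>

lemma L2_nnI:
  assumes [measurable]: "f \<in> borel_measurable borel"
    and le: "(\<integral>\<^sup>+x. ennreal ((norm (f x))\<^sup>2) \<partial>lborel) \<le> ennreal (B\<^sup>2)" and B: "0 \<le> B"
  shows "f \<in> L2" "L2_norm f \<le> B"
proof -
  have "integrable lborel (\<lambda>x. (norm (f x))\<^sup>2)"
    using le by (intro integrableI_bounded) (auto simp: le_less_trans)
  then show f: "f \<in> L2" by (simp add: L2_def)
  have "ennreal ((L2_norm f)\<^sup>2) \<le> ennreal (B\<^sup>2)"
    using le by (simp add: nn_integral_L2[OF f])
  then show "L2_norm f \<le> B"
    using B by (metis ennreal_le_iff power2_le_imp_le zero_le_power2)
qed

text \<open>The two codomains differ so that a complex function can be dominated by a real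
  weight.\<close>

lemma L2_dominated:
  fixes f :: "'a::euclidean_space \<Rightarrow> 'b::real_normed_vector"
    and g :: "'a \<Rightarrow> 'c::real_normed_vector"
  assumes f: "f \<in> borel_measurable borel" and g: "g \<in> L2" and C: "0 \<le> C"
    and le: "AE x in lborel. norm (f x) \<le> C * norm (g x)"
  shows "f \<in> L2" "L2_norm f \<le> C * L2_norm g"
proof -
  note [measurable] = f L2_measurable[OF g]
  have "(\<integral>\<^sup>+x. ennreal ((norm (f x))\<^sup>2) \<partial>lborel) \<le> (\<integral>\<^sup>+x. ennreal (C\<^sup>2) * ennreal ((norm (g x))\<^sup>2) \<partial>lborel)"
  proof (intro nn_integral_mono_AE eventually_mono[OF le])
    fix x assume "norm (f x) \<le> C * norm (g x)"
    then have "(norm (f x))\<^sup>2 \<le> (C * norm (g x))\<^sup>2" by (intro power_mono) auto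
    then show "ennreal ((norm (f x))\<^sup>2) \<le> ennreal (C\<^sup>2) * ennreal ((norm (g x))\<^sup>2)"
      by (simp add: power_mult_distrib flip: ennreal_mult)
  qed
  also have "\<dots> = ennreal ((C * L2_norm g)\<^sup>2)"
    by (simp add: nn_integral_cmult nn_integral_L2[OF g] power_mult_distrib ennreal_mult)
  finally have *: "(\<integral>\<^sup>+x. ennreal ((norm (f x))\<^sup>2) \<partial>lborel) \<le> ennreal ((C * L2_norm g)\<^sup>2)" .
  show "f \<in> L2" "L2_norm f \<le> C * L2_norm g"
    using L2_nnI[OF f *] C by (simp_all only: mult_nonneg_nonneg L2_norm_nonneg)
qed

lemma L2_mono:
  fixes f :: "'a::euclidean_space \<Rightarrow> 'b::real_normed_vector"
    and g :: "'a \<Rightarrow> 'c::real_normed_vector"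
  assumes "f \<in> borel_measurable borel" "g \<in> L2" "\<And>x. norm (f x) \<le> norm (g x)"
  shows "f \<in> L2" "L2_norm f \<le> L2_norm g"
  using L2_dominated[of f g 1] assms by auto

lemma L2_norm_cong_AE:
  assumes "f \<in> borel_measurable borel" "g \<in> borel_measurable borel" "AE x in lborel. norm (f x) = norm (g x)"
  shows "L2_norm f = L2_norm g"
  unfolding L2_norm_def using assms
  by (intro arg_cong[where f=sqrt] integral_cong_AE) (auto elim!: eventually_mono)

lemma L2_norm_cong: "(\<And>x. norm (f x) = norm (g x)) \<Longrightarrow> L2_norm f = L2_norm g"
  by (simp add: L2_norm_def)

lemma L2_cong_AE:
  assumes "f \<in> L2" "g \<in> borel_measurable borel" "AE x in lborel. norm (f x) = norm (g x)"
  shows "g \<in> L2"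
  using assms(3) by (intro L2_dominated(1)[OF assms(2,1), of 1]) (auto elim!: eventually_mono)

lemma L2_norm_eq_0:
  assumes f: "f \<in> L2" and "L2_norm f = 0"
  shows "AE x in lborel. f x = 0"
proof -
  have "AE x in lborel. (norm (f x))\<^sup>2 = 0"
    using integral_nonneg_eq_0_iff_AE[OF L2_integrable[OF f]] assms(2)
    by (simp add: L2_norm_def integral_nonneg)
  then show ?thesis by simp
qed

lemma L2_zero [simp]: "(\<lambda>x. 0) \<in> L2" "L2_norm (\<lambda>x. 0) = 0"
  by (simp_all add: L2_def L2_norm_def)

lemma L2_scaleR:
  assumes "f \<in> L2"
  shows "(\<lambda>x. c *\<^sub>R f x) \<in> L2" "L2_norm (\<lambda>x. c *\<^sub>R f x) = \<bar>c\<bar> * L2_norm f"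
  using assms by (auto simp: L2_def L2_norm_def power_mult_distrib real_sqrt_mult)

lemma L2_mult:
  fixes f :: "'a::euclidean_space \<Rightarrow> complex"
  assumes "f \<in> L2"
  shows "(\<lambda>x. c * f x) \<in> L2" "L2_norm (\<lambda>x. c * f x) = cmod c * L2_norm f"
  using assms by (auto simp: L2_def L2_norm_def power_mult_distrib real_sqrt_mult norm_mult)

lemma L2_uminus:
  assumes "f \<in> L2" shows "(\<lambda>x. - f x) \<in> L2" "L2_norm (\<lambda>x. - f x) = L2_norm f"
  using L2_scaleR[OF assms, of "-1"] by auto

lemma L2_of_real:
  fixes f :: "'a::euclidean_space \<Rightarrow> real"
  shows "f \<in> L2 \<Longrightarrow> (\<lambda>x. of_real (f x) :: complex) \<in> L2"
  and "L2_norm (\<lambda>x. of_real (f x) :: complex) = L2_norm f"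
  by (auto simp: L2_def L2_norm_def)

lemma add_square_le:
  fixes a b \<eta> :: real assumes "0 < \<eta>"
  shows "(a + b)\<^sup>2 \<le> (1 + \<eta>) * a\<^sup>2 + (1 + 1/\<eta>) * b\<^sup>2"
proof -
  have "0 \<le> (\<eta> * a - b)\<^sup>2 / \<eta>" using assms by simp
  also have "\<dots> = \<eta> * a\<^sup>2 - 2 * a * b + b\<^sup>2 / \<eta>"
    using assms by (simp add: power2_eq_square field_simps)
  finally show ?thesis by (simp add: power2_eq_square algebra_simps)
qed

text \<open>Minkowski by optimising a weighted Young inequality: \<open>add_square_le\<close> with
  \<eta> equal to the ratio of the norms is sharp. The choice \<eta> = 1 already settles
  membership.\<close>

lemma L2_add:
  fixes f g :: "'a::euclidean_space \<Rightarrow> 'b::{real_normed_vector,second_countable_topology}"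
  assumes f: "f \<in> L2" and g: "g \<in> L2"
  shows "(\<lambda>x. f x + g x) \<in> L2" and L2_norm_triangle: "L2_norm (\<lambda>x. f x + g x) \<le> L2_norm f + L2_norm g"
proof -
  note [measurable] = L2_measurable[OF f] L2_measurable[OF g]
  have *: "(\<integral>\<^sup>+x. ennreal ((norm (f x + g x))\<^sup>2) \<partial>lborel)
     \<le> ennreal ((1 + \<eta>) * (L2_norm f)\<^sup>2 + (1 + 1/\<eta>) * (L2_norm g)\<^sup>2)" if \<eta>: "\<eta> > 0" for \<eta>
  proof -
    have "(\<integral>\<^sup>+x. ennreal ((norm (f x + g x))\<^sup>2) \<partial>lborel)
      \<le> (\<integral>\<^sup>+x. ennreal (1+\<eta>) * ennreal ((norm (f x))\<^sup>2) + ennreal (1+1/\<eta>) * ennreal ((norm (g x))\<^sup>2) \<partial>lborel)"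
    proof (intro nn_integral_mono)
      fix x
      have "(norm (f x + g x))\<^sup>2 \<le> (norm (f x) + norm (g x))\<^sup>2"
        by (intro power_mono norm_triangle_ineq) auto
      also have "\<dots> \<le> (1+\<eta>) * (norm (f x))\<^sup>2 + (1+1/\<eta>) * (norm (g x))\<^sup>2"
        by (rule add_square_le[OF \<eta>])
      finally show "ennreal ((norm (f x + g x))\<^sup>2) \<le> ennreal (1+\<eta>) * ennreal ((norm (f x))\<^sup>2) + ennreal (1+1/\<eta>) * ennreal ((norm (g x))\<^sup>2)"
        using \<eta> by (simp flip: ennreal_mult ennreal_plus)
    qed
    also have "\<dots> = ennreal ((1 + \<eta>) * (L2_norm f)\<^sup>2 + (1 + 1/\<eta>) * (L2_norm g)\<^sup>2)"
      using \<eta> by (simp add: nn_integral_add nn_integral_cmult nn_integral_L2 f g ennreal_mult)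
    finally show ?thesis .
  qed
  have m: "(\<lambda>x. f x + g x) \<in> borel_measurable borel" by measurable
  have "(1 + 1) * (L2_norm f)\<^sup>2 + (1 + 1/1) * (L2_norm g)\<^sup>2 = (sqrt (2 * (L2_norm f)\<^sup>2 + 2 * (L2_norm g)\<^sup>2))\<^sup>2"
    by simp
  with *[of 1] show L: "(\<lambda>x. f x + g x) \<in> L2"
    by (intro L2_nnI(1)[OF m, of "sqrt (2 * (L2_norm f)\<^sup>2 + 2 * (L2_norm g)\<^sup>2)"]) auto
  show "L2_norm (\<lambda>x. f x + g x) \<le> L2_norm f + L2_norm g"
  \<comment> \<open>Here the ratio of the norms is undefined or zero, but one summand vanishes
    almost everywhere.\<close>
  proof (cases "L2_norm f = 0 \<or> L2_norm g = 0")
    case True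
    then show ?thesis
    proof
      assume "L2_norm f = 0"
      then have "AE x in lborel. f x = 0" by (rule L2_norm_eq_0[OF f])
      then have "L2_norm (\<lambda>x. f x + g x) = L2_norm g"
        by (intro L2_norm_cong_AE) (auto elim!: eventually_mono)
      then show ?thesis by simp
    next
      assume "L2_norm g = 0"
      then have "AE x in lborel. g x = 0" by (rule L2_norm_eq_0[OF g])
      then have "L2_norm (\<lambda>x. f x + g x) = L2_norm f"
        by (intro L2_norm_cong_AE) (auto elim!: eventually_mono)
      then show ?thesis by simp
    qed
  next
    case False
    then have F: "L2_norm f > 0" "L2_norm g > 0" by (auto simp: less_le)
    define a b where "a = L2_norm f" and "b = L2_norm g"
    have ab: "a > 0" "b > 0" using F by (auto simp: a_def b_def)
    \<comment> \<open>The choice \<eta> = b / a turns the two weighted squares into the square of a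
      + b.\<close>
    have "(1 + b/a) * a\<^sup>2 + (1 + 1/(b/a)) * b\<^sup>2 = (a + b)\<^sup>2"
      using ab by (simp add: field_simps power2_eq_square)
    with *[of "b/a", folded a_def b_def] ab
    have "(\<integral>\<^sup>+x. ennreal ((norm (f x + g x))\<^sup>2) \<partial>lborel) \<le> ennreal ((a+b)\<^sup>2)"
      by (metis divide_pos_pos)
    from L2_nnI(2)[OF m this] ab show ?thesis by (simp add: a_def b_def)
  qed
qed

lemma L2_diff:
  fixes f g :: "'a::euclidean_space \<Rightarrow> 'b::{real_normed_vector,second_countable_topology}"
  assumes f: "f \<in> L2" and g: "g \<in> L2"
  shows "(\<lambda>x. f x - g x) \<in> L2" and L2_norm_triangle_diff: "L2_norm (\<lambda>x. f x - g x) \<le> L2_norm f + L2_norm g"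
  using L2_add[OF f L2_uminus(1)[OF g]] L2_norm_triangle[OF f L2_uminus(1)[OF g]] L2_uminus(2)[OF g] by auto

lemma L2_norm_minus_commute: "L2_norm (\<lambda>x. f x - g x) = L2_norm (\<lambda>x. g x - f x)"
  by (rule L2_norm_cong) (simp add: norm_minus_commute)

lemma L2_norm_triangle_ineq3:
  fixes f g :: "'a::euclidean_space \<Rightarrow> 'b::{real_normed_vector,second_countable_topology}"
  assumes f: "f \<in> L2" and g: "g \<in> L2"
  shows "\<bar>L2_norm f - L2_norm g\<bar> \<le> L2_norm (\<lambda>x. f x - g x)"
  using L2_norm_triangle[OF L2_diff(1)[OF f g] g] L2_norm_triangle[OF L2_diff(1)[OF g f] f]
  by (simp add: L2_norm_minus_commute[of f g])

lemma L2_sum: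
  fixes f :: "'i \<Rightarrow> 'a::euclidean_space \<Rightarrow> 'b::{real_normed_vector,second_countable_topology}"
  assumes "finite S" "\<And>i. i \<in> S \<Longrightarrow> f i \<in> L2"
  shows "(\<lambda>x. \<Sum>i\<in>S. f i x) \<in> L2" and L2_norm_sum: "L2_norm (\<lambda>x. \<Sum>i\<in>S. f i x) \<le> (\<Sum>i\<in>S. L2_norm (f i))"
proof -
  have "(\<lambda>x. \<Sum>i\<in>S. f i x) \<in> L2 \<and> L2_norm (\<lambda>x. \<Sum>i\<in>S. f i x) \<le> (\<Sum>i\<in>S. L2_norm (f i))"
    using assms
  proof (induction S rule: finite_induct)
    case (insert i S)
    then have "f i \<in> L2" "(\<lambda>x. \<Sum>i\<in>S. f i x) \<in> L2" by auto
    from L2_add(1)[OF this] L2_norm_triangle[OF this] insert show ?case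
      by (auto simp: insert.hyps)
  qed auto
  then show "(\<lambda>x. \<Sum>i\<in>S. f i x) \<in> L2" "L2_norm (\<lambda>x. \<Sum>i\<in>S. f i x) \<le> (\<Sum>i\<in>S. L2_norm (f i))" by auto
qed

lemma L2_Cauchy_Schwarz:
  fixes f :: "'a::euclidean_space \<Rightarrow> 'b::real_normed_vector" and g :: "'a \<Rightarrow> 'c::real_normed_vector"
  assumes f: "f \<in> L2" and g: "g \<in> L2"
  shows "integrable lborel (\<lambda>x. norm (f x) * norm (g x))"
    "(\<integral>x. norm (f x) * norm (g x) \<partial>lborel) \<le> L2_norm f * L2_norm g"
proof -
  note [measurable] = L2_measurable[OF f] L2_measurable[OF g]
  have "(\<integral>\<^sup>+x. ennreal (norm (f x)) * ennreal (norm (g x)) \<partial>lborel)\<^sup>2 \<le>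
     (\<integral>\<^sup>+x. (ennreal (norm (f x)))^2 \<partial>lborel) * (\<integral>\<^sup>+x. (ennreal (norm (g x)))^2 \<partial>lborel)"
    by (rule Cauchy_Schwarz_nn_integral) auto
  also have "\<dots> = ennreal ((L2_norm f * L2_norm g)\<^sup>2)"
    by (simp add: ennreal_power nn_integral_L2 f g power_mult_distrib flip: ennreal_mult)
  finally have *: "(\<integral>\<^sup>+x. ennreal (norm (f x)) * ennreal (norm (g x)) \<partial>lborel)\<^sup>2 \<le> ennreal ((L2_norm f * L2_norm g)\<^sup>2)" .
  have *: "(\<integral>\<^sup>+x. ennreal (norm (f x) * norm (g x)) \<partial>lborel) \<le> ennreal (L2_norm f * L2_norm g)"
    (is "?I \<le> _")
  proof -
    have "(\<integral>\<^sup>+x. ennreal (norm (f x)) * ennreal (norm (g x)) \<partial>lborel) = ?I"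
      by (simp add: ennreal_mult)
    with * have **: "?I\<^sup>2 \<le> ennreal ((L2_norm f * L2_norm g)\<^sup>2)" by simp
    show ?thesis
    proof (cases ?I rule: ennreal_cases)
      case (real r)
      with ** show ?thesis
        by (simp add: ennreal_power ennreal_le_iff power2_le_iff_abs_le abs_le_iff)
    qed (use ** in \<open>simp add: top_unique\<close>)
  qed
  then show "integrable lborel (\<lambda>x. norm (f x) * norm (g x))"
    by (intro integrableI_bounded) (auto simp: le_less_trans)
  then show "(\<integral>x. norm (f x) * norm (g x) \<partial>lborel) \<le> L2_norm f * L2_norm g"
    using * by (subst (asm) nn_integral_eq_integral) (auto simp: ennreal_le_iff)
qed

text \<open>Lower semicontinuity of the norm under almost everywhere convergence. It is the means by
  which bounds are carried to limits and truncations are removed throughout.\<close>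

lemma L2_Fatou:
  fixes f :: "nat \<Rightarrow> 'a::euclidean_space \<Rightarrow> 'b::real_normed_vector"
  assumes f: "\<And>n. f n \<in> L2" and g: "g \<in> borel_measurable borel"
    and lim: "AE x in lborel. (\<lambda>n. f n x) \<longlonglongrightarrow> g x"
    and B: "eventually (\<lambda>n. L2_norm (f n) \<le> B) sequentially" "0 \<le> B"
  shows "g \<in> L2" "L2_norm g \<le> B"
proof -
  note [measurable] = L2_measurable[OF f] g
  have "(\<integral>\<^sup>+x. ennreal ((norm (g x))\<^sup>2) \<partial>lborel) = (\<integral>\<^sup>+x. liminf (\<lambda>n. ennreal ((norm (f n x))\<^sup>2)) \<partial>lborel)"
  proof (intro nn_integral_cong_AE eventually_mono[OF lim])
    fix x assume "(\<lambda>n. f n x) \<longlonglongrightarrow> g x"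
    then have "(\<lambda>n. ennreal ((norm (f n x))\<^sup>2)) \<longlonglongrightarrow> ennreal ((norm (g x))\<^sup>2)"
      by (intro tendsto_intros)
    then show "ennreal ((norm (g x))\<^sup>2) = liminf (\<lambda>n. ennreal ((norm (f n x))\<^sup>2))"
      by (intro lim_imp_Liminf[symmetric]) auto
  qed
  also have "\<dots> \<le> liminf (\<lambda>n. \<integral>\<^sup>+x. ennreal ((norm (f n x))\<^sup>2) \<partial>lborel)"
    by (rule nn_integral_liminf) auto
  also have "\<dots> = liminf (\<lambda>n. ennreal ((L2_norm (f n))\<^sup>2))"
    by (simp add: nn_integral_L2 f)
  also have "\<dots> \<le> ennreal (B\<^sup>2)"
  proof (rule order_trans[OF Liminf_mono[where g="\<lambda>_. ennreal (B\<^sup>2)"]])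
    show "\<forall>\<^sub>F n in sequentially. ennreal ((L2_norm (f n))\<^sup>2) \<le> ennreal (B\<^sup>2)"
      using B(1) by eventually_elim (auto intro!: ennreal_leI power_mono)
  qed (simp add: Liminf_const)
  finally show "g \<in> L2" "L2_norm g \<le> B"
    using L2_nnI[OF g _ B(2)] by blast+
qed

text \<open>A rapidly convergent subsequence converges almost everywhere, because
  \<open>\<Sum>k. 2^k |f (k+1) - f k|\<^sup>2\<close> is integrable.\<close>

lemma L2_complete:
  fixes f :: "nat \<Rightarrow> 'a::euclidean_space \<Rightarrow> complex"
  assumes f: "\<And>n. f n \<in> L2"
    and cauchy: "\<And>e. 0 < e \<Longrightarrow> \<exists>N. \<forall>m\<ge>N. \<forall>n\<ge>N. L2_norm (\<lambda>x. f m x - f n x) < e"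
  shows "\<exists>g\<in>L2. (\<lambda>n. L2_norm (\<lambda>x. f n x - g x)) \<longlonglongrightarrow> 0"
proof -
  note [measurable] = L2_measurable[OF f]
  obtain N where N: "\<And>k m n. m \<ge> N k \<Longrightarrow> n \<ge> N k \<Longrightarrow> L2_norm (\<lambda>x. f m x - f n x) < (1/2)^k"
    using cauchy[of "(1/2)^k" for k] by (metis zero_less_divide_1_iff zero_less_numeral zero_less_power)
  \<comment> \<open>Summing the thresholds instead of taking their maximum keeps \<open>r\<close>
    monotone and above \<open>N k\<close>; adding k makes it tend to infinity.\<close>
  define r where "r k = (\<Sum>i\<le>k. N i) + k" for k
  have rN: "r k \<ge> N k" for k
    unfolding r_def by (metis atMost_iff finite_atMost le_add1 le_trans member_le_sum order_refl zero_le)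
  have rS: "r (Suc k) \<ge> r k" for k by (simp add: r_def)
  have rk: "r k \<ge> k" for k by (simp add: r_def)
  define d where "d k x = f (r (Suc k)) x - f (r k) x" for k x
  have d: "d k \<in> L2" "L2_norm (d k) \<le> (1/2)^k" for k
    unfolding d_def[abs_def] using N[of k "r (Suc k)" "r k"] rN[of k] rS[of k] f by (auto intro: L2_diff less_imp_le)
  note [measurable] = L2_measurable[OF d(1)]
  have "(\<integral>\<^sup>+x. (\<Sum>k. ennreal (2^k * (norm (d k x))\<^sup>2)) \<partial>lborel) = (\<Sum>k. (\<integral>\<^sup>+x. ennreal (2^k * (norm (d k x))\<^sup>2) \<partial>lborel))"
    by (rule nn_integral_suminf) auto
  also have "\<dots> \<le> (\<Sum>k. ennreal ((1/2)^k))"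
  proof (intro suminf_le allI)
    fix k
    have "(\<integral>\<^sup>+x. ennreal (2^k * (norm (d k x))\<^sup>2) \<partial>lborel) = ennreal (2^k) * ennreal ((L2_norm (d k))\<^sup>2)"
      by (simp add: ennreal_mult nn_integral_cmult nn_integral_L2[OF d(1)])
    also have "\<dots> \<le> ennreal (2^k * ((1/2)^k)\<^sup>2)"
      using d(2)[of k] by (auto simp flip: ennreal_mult intro!: ennreal_leI power_mono)
    also have "2^k * ((1/2)^k)\<^sup>2 = (1/2::real)^k"
      by (simp add: power2_eq_square field_simps)
    finally show "(\<integral>\<^sup>+x. ennreal (2^k * (norm (d k x))\<^sup>2) \<partial>lborel) \<le> ennreal ((1/2)^k)" .
  qed auto
  also have "\<dots> < \<infinity>"
    by (subst suminf_ennreal2) (auto intro!: summable_geometric)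
  finally have "AE x in lborel. (\<Sum>k. ennreal (2^k * (norm (d k x))\<^sup>2)) \<noteq> \<infinity>"
    by (intro nn_integral_PInf_AE) auto
  then have conv: "AE x in lborel. convergent (\<lambda>k. f (r k) x)"
  proof eventually_elim
    case (elim x)
    then have "summable (\<lambda>k. 2^k * (norm (d k x))\<^sup>2)"
      by (intro summable_suminf_not_top) auto
    then have "(\<lambda>k. 2^k * (norm (d k x))\<^sup>2) \<longlonglongrightarrow> 0" by (rule summable_LIMSEQ_zero)
    then have "Bseq (\<lambda>k. 2^k * (norm (d k x))\<^sup>2)"
      by (intro convergent_imp_Bseq) (auto simp: convergent_def)
    then obtain K where K: "K > 0" "\<And>k. norm (2^k * (norm (d k x))\<^sup>2) \<le> K"
      by (auto elim: BseqE)
    \<comment> \<open>The terms of a convergent series are bounded, so the increments decay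
      geometrically with ratio sqrt (1/2).\<close>
    have "norm (d k x) \<le> sqrt K * (sqrt (1/2))^k" for k
    proof -
      have "(norm (d k x))\<^sup>2 \<le> K * (1/2)^k" using K(2)[of k] by (simp add: field_simps)
      then have "norm (d k x) \<le> sqrt (K * (1/2)^k)" by (rule real_le_rsqrt)
      then show ?thesis by (simp add: real_sqrt_mult real_sqrt_power)
    qed
    moreover have "summable (\<lambda>k. sqrt K * (sqrt (1/2))^k)"
      by (intro summable_mult summable_geometric) (auto simp: real_sqrt_divide)
    ultimately have "summable (\<lambda>k. d k x)"
      by (intro summable_comparison_test'[where f="\<lambda>k. d k x" and N=0 and g="\<lambda>k. sqrt K * (sqrt (1/2))^k"]) auto
    then have "convergent (\<lambda>n. (\<Sum>k<n. f (r (Suc k)) x - f (r k) x))"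
      by (simp add: d_def summable_iff_convergent)
    then have "convergent (\<lambda>n. f (r n) x - f (r 0) x)"
      by (subst (asm) sum_lessThan_telescope)
    then show "convergent (\<lambda>k. f (r k) x)"
      by (subst (asm) convergent_diff_const_right_iff)
  qed
  define g where "g x = (if convergent (\<lambda>k. f (r k) x) then lim (\<lambda>k. f (r k) x) else 0)" for x
  have [measurable]: "Measurable.pred borel (\<lambda>x. convergent (\<lambda>k. f (r k) x))"
    unfolding Cauchy_convergent_iff[symmetric] by measurable
  have [measurable]: "g \<in> borel_measurable borel"
    unfolding g_def[abs_def] by measurable
  have lim: "AE x in lborel. (\<lambda>k. f (r k) x) \<longlonglongrightarrow> g x"
    using conv by eventually_elim (auto simp: g_def convergent_LIMSEQ_iff)
  \<comment> \<open>Fatou is applied in the second index along the subsequence, so the estimate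
    holds for every member of the full sequence.\<close>
  have key: "(\<lambda>x. f n x - g x) \<in> L2 \<and> L2_norm (\<lambda>x. f n x - g x) \<le> e"
    if e: "e > 0" and n: "\<And>m. m \<ge> n \<Longrightarrow> L2_norm (\<lambda>x. f n x - f m x) < e" for n e
  proof -
    have "eventually (\<lambda>k. L2_norm (\<lambda>x. f n x - f (r k) x) \<le> e) sequentially"
      using n[OF order_trans[OF _ rk]] by (intro eventually_sequentiallyI[of n]) (rule less_imp_le)
    moreover have "AE x in lborel. (\<lambda>k. f n x - f (r k) x) \<longlonglongrightarrow> f n x - g x"
      using lim by eventually_elim (intro tendsto_intros)
    ultimately show ?thesis
      using L2_Fatou[of "\<lambda>k x. f n x - f (r k) x" "\<lambda>x. f n x - g x" e] e f by (auto intro: L2_diff)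
  qed
  obtain n where "\<And>m. m \<ge> n \<Longrightarrow> L2_norm (\<lambda>x. f n x - f m x) < 1"
    using cauchy[of 1] by auto
  from key[OF _ this] have "(\<lambda>x. f n x - g x) \<in> L2" by auto
  from L2_diff(1)[OF f[of n] this] have g: "g \<in> L2" by simp
  moreover have "(\<lambda>n. L2_norm (\<lambda>x. f n x - g x)) \<longlonglongrightarrow> 0"
  proof (rule LIMSEQ_I)
    fix e :: real assume e: "0 < e"
    then obtain M where M: "\<And>m n. m \<ge> M \<Longrightarrow> n \<ge> M \<Longrightarrow> L2_norm (\<lambda>x. f m x - f n x) < e/2"
      using cauchy[of "e/2"] by auto
    show "\<exists>no. \<forall>n\<ge>no. norm (L2_norm (\<lambda>x. f n x - g x) - 0) < e"
    proof (intro exI[of _ M] allI impI)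
      fix n assume "n \<ge> M"
      then have "L2_norm (\<lambda>x. f n x - g x) \<le> e/2"
        using key[of "e/2" n] M e by (meson half_gt_zero le_trans)
      then show "norm (L2_norm (\<lambda>x. f n x - g x) - 0) < e" using e by simp
    qed
  qed
  ultimately show ?thesis by blast
qed

section \<open>Gaussians and the Fourier transform on \<open>L\<^sup>1\<close>\<close>

text \<open>The parameter \<open>s\<close> of modulus 1 covers translations (s = 1) and the
  reflection (s = -1) in one statement; convolution and inversion need exactly these.\<close>

lemma distr_lborel_isometry:
  fixes a :: "'a::euclidean_space"
  assumes "\<bar>s\<bar> = 1"
  shows "distr lborel borel (\<lambda>x. a + s *\<^sub>R x) = (lborel :: 'a measure)"
proof -
  from assms have "s \<noteq> 0" by auto
  from lborel_affine[OF this, of a] assms show ?thesis by (simp add: density_1)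
qed

lemma nn_integral_lborel_isometry:
  fixes a :: "'a::euclidean_space"
  assumes "f \<in> borel_measurable borel" "\<bar>s\<bar> = 1"
  shows "(\<integral>\<^sup>+x. f (a + s *\<^sub>R x) \<partial>lborel) = (\<integral>\<^sup>+x. f x \<partial>lborel)"
  by (subst (2) distr_lborel_isometry[OF assms(2), of a, symmetric], subst nn_integral_distr)
     (use assms in auto)

lemma integrable_lborel_isometry:
  fixes a :: "'a::euclidean_space" and f :: "'a \<Rightarrow> 'b::{banach,second_countable_topology}"
  assumes "integrable lborel f" "\<bar>s\<bar> = 1"
  shows "integrable lborel (\<lambda>x. f (a + s *\<^sub>R x))"
  using assms(1) by (subst (asm) distr_lborel_isometry[OF assms(2), of a, symmetric], subst (asm) integrable_distr_eq) auto

lemma integral_lborel_isometry: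
  fixes a :: "'a::euclidean_space" and f :: "'a \<Rightarrow> 'b::{banach,second_countable_topology}"
  assumes "f \<in> borel_measurable borel" "\<bar>s\<bar> = 1"
  shows "(\<integral>x. f (a + s *\<^sub>R x) \<partial>lborel) = (\<integral>x. f x \<partial>lborel)"
  by (subst (2) distr_lborel_isometry[OF assms(2), of a, symmetric], subst integral_distr)
     (use assms in auto)

lemma AE_lborel_isometry:
  fixes a :: "'a::euclidean_space"
  assumes "AE x in lborel. P x" "\<bar>s\<bar> = 1"
  shows "AE x in lborel. P (a + s *\<^sub>R x)"
proof -
  from assms(1) obtain N where N: "{x. \<not> P x} \<subseteq> N" "emeasure lborel N = 0" "N \<in> sets borel"
    by (auto elim!: AE_E)
  have "AE x in lborel. x \<notin> N"
    using N by (intro AE_not_in) (auto simp: null_sets_def)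
  then have "AE x in lborel. a + s *\<^sub>R x \<notin> N"
    using N by (subst (asm) distr_lborel_isometry[OF assms(2), of a, symmetric], subst (asm) AE_distr_iff) auto
  then show ?thesis by eventually_elim (use N in auto)
qed

section \<open>Fourier integrals of Gaussians, reduced to one dimension\<close>

lemma integrable_lborel_prod:
  fixes f :: "'a::euclidean_space \<Rightarrow> real \<Rightarrow> complex"
  assumes "\<And>b. b \<in> Basis \<Longrightarrow> integrable lborel (f b)"
  shows "integrable lborel (\<lambda>x. \<Prod>b\<in>Basis. f b (x \<bullet> b))"
    and integral_lborel_prod: "(\<integral>x. (\<Prod>b\<in>Basis. f b (x \<bullet> b)) \<partial>lborel) = (\<Prod>b\<in>Basis. (\<integral>x. f b x \<partial>lborel))"
proof -
  interpret product_sigma_finite "\<lambda>_. lborel :: real measure" ..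
  have [measurable]: "f b \<in> borel_measurable borel" if "b \<in> Basis" for b
    using borel_measurable_integrable[OF assms[OF that]] by simp
  have m: "(\<lambda>x. \<Prod>b\<in>Basis. f b (x \<bullet> b)) \<in> borel_measurable borel" by measurable
  have eq: "(\<Prod>b\<in>Basis. f b ((\<Sum>b\<in>Basis. x b *\<^sub>R b) \<bullet> b)) = (\<Prod>b\<in>Basis. f b (x b))" for x
    by (intro prod.cong refl) (simp add: inner_sum_left_Basis)
  have m': "(\<lambda>f::'a \<Rightarrow> real. \<Sum>b\<in>Basis. f b *\<^sub>R b) \<in> (\<Pi>\<^sub>M b\<in>Basis. lborel) \<rightarrow>\<^sub>M borel"
    by measurable
  show "integrable lborel (\<lambda>x. \<Prod>b\<in>Basis. f b (x \<bullet> b))"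
    by (subst lborel_eq, subst integrable_distr_eq[OF m' m])
       (simp add: eq product_integrable_prod assms)
  show "(\<integral>x. (\<Prod>b\<in>Basis. f b (x \<bullet> b)) \<partial>lborel) = (\<Prod>b\<in>Basis. (\<integral>x. f b x \<partial>lborel))"
    by (subst lborel_eq, subst integral_distr[OF m' m])
       (simp add: eq product_integral_prod assms)
qed

text \<open>The oscillatory Gaussian integral is read off from the characteristic function of the
  standard normal law; the general case follows by scaling and by products over the
  coordinates.\<close>

lemma gaussian_fourier_std:
  "integrable lborel (\<lambda>x. std_normal_density x *\<^sub>R exp (\<i> * of_real (t * x)))"
  "(\<integral>x. std_normal_density x *\<^sub>R exp (\<i> * of_real (t * x)) \<partial>lborel) = of_real (exp (- (t\<^sup>2) / 2))"
proof -
  show "integrable lborel (\<lambda>x. std_normal_density x *\<^sub>R exp (\<i> * of_real (t * x)))"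
    by (rule Bochner_Integration.integrable_bound[of lborel std_normal_density]) auto
  have "(\<integral>x. std_normal_density x *\<^sub>R exp (\<i> * of_real (t * x)) \<partial>lborel) = char std_normal_distribution t"
    unfolding char_def by (subst integral_density) auto
  then show "(\<integral>x. std_normal_density x *\<^sub>R exp (\<i> * of_real (t * x)) \<partial>lborel) = of_real (exp (- (t\<^sup>2) / 2))"
    by (simp add: char_std_normal_distribution)
qed

lemma gaussian_fourier_1d:
  fixes \<epsilon> \<xi> :: real assumes \<epsilon>: "\<epsilon> > 0"
  defines "f \<equiv> \<lambda>x::real. exp (- (\<i> * of_real (x * \<xi>))) * of_real (exp (- \<epsilon> * x\<^sup>2))"
  shows "integrable lborel f" "(\<integral>x. f x \<partial>lborel) = of_real (sqrt (pi / \<epsilon>) * exp (- \<xi>\<^sup>2 / (4 * \<epsilon>)))"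
proof -
  \<comment> \<open>This scale makes half the square of c x equal to \<epsilon> x^2, matching the
    standard normal density.\<close>
  define c where "c = sqrt (2 * \<epsilon>)"
  have c: "c > 0" "c\<^sup>2 = 2 * \<epsilon>" using \<epsilon> by (auto simp: c_def)
  define g where "g x = std_normal_density x *\<^sub>R exp (\<i> * of_real (- \<xi> / c * x))" for x
  have fg: "f x = of_real (sqrt (2 * pi)) * g (0 + c * x)" for x
  proof -
    have "exp (- (c * x)\<^sup>2 / 2) = exp (- \<epsilon> * x\<^sup>2)"
      using c by (simp add: power_mult_distrib)
    then show ?thesis
      using c(1) by (simp add: f_def g_def std_normal_density_def scaleR_conv_of_real of_real_divide mult_ac)
  qed
  have g: "integrable lborel g" "(\<integral>x. g x \<partial>lborel) = of_real (exp (- \<xi>\<^sup>2 / (4 * \<epsilon>)))"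
    using gaussian_fourier_std[of "- \<xi> / c"] c by (simp_all add: g_def[abs_def] power_divide mult_ac)
  show "integrable lborel f"
    unfolding fg[abs_def] using c g(1) by (intro integrable_mult_right lborel_integrable_real_affine) auto
  have "(\<integral>x. f x \<partial>lborel) = of_real (sqrt (2 * pi)) * (\<integral>x. g (0 + c * x) \<partial>lborel)"
    unfolding fg[abs_def] by simp
  also have "(\<integral>x. g (0 + c * x) \<partial>lborel) = (\<integral>x. g x \<partial>lborel) / of_real c"
    using c by (subst (2) lborel_integral_real_affine[where c=c and t=0]) (auto simp: scaleR_conv_of_real)
  also have "of_real (sqrt (2 * pi)) * ((\<integral>x. g x \<partial>lborel) / of_real c) = of_real (sqrt (2 * pi) / c * exp (- \<xi>\<^sup>2 / (4 * \<epsilon>)))"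
    by (simp add: g)
  also have "sqrt (2 * pi) / c = sqrt (pi / \<epsilon>)"
    by (simp add: c_def real_sqrt_mult real_sqrt_divide)
  finally show "(\<integral>x. f x \<partial>lborel) = of_real (sqrt (pi / \<epsilon>) * exp (- \<xi>\<^sup>2 / (4 * \<epsilon>)))" .
qed

lemma norm_square_Basis: "(norm x)\<^sup>2 = (\<Sum>b\<in>Basis. (x \<bullet> b)\<^sup>2)" for x :: "'a::euclidean_space"
  by (simp only: power2_norm_eq_inner) (subst euclidean_inner, simp add: power2_eq_square)

lemma gaussian_fourier:
  fixes \<xi> :: "'a::euclidean_space" and \<epsilon> :: real assumes \<epsilon>: "\<epsilon> > 0"
  defines "f \<equiv> \<lambda>x. exp (- (\<i> * of_real (x \<bullet> \<xi>))) * of_real (exp (- \<epsilon> * (norm x)\<^sup>2))"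
  shows "integrable lborel f"
    "(\<integral>x. f x \<partial>lborel) = of_real ((pi / \<epsilon>) powr (real DIM('a) / 2) * exp (- (norm \<xi>)\<^sup>2 / (4 * \<epsilon>)))"
proof -
  have f: "f x = (\<Prod>b\<in>Basis. exp (- (\<i> * of_real ((x \<bullet> b) * (\<xi> \<bullet> b)))) * of_real (exp (- \<epsilon> * (x \<bullet> b)\<^sup>2)))" for x
  proof -
    have "exp (- (\<i> * of_real (x \<bullet> \<xi>))) = (\<Prod>b\<in>Basis. exp (- (\<i> * of_real ((x \<bullet> b) * (\<xi> \<bullet> b)))))"
      by (subst exp_sum[symmetric], simp, subst euclidean_inner) (simp add: sum_distrib_left sum_negf)
    moreover have "exp (- \<epsilon> * (norm x)\<^sup>2) = (\<Prod>b\<in>Basis. exp (- \<epsilon> * (x \<bullet> b)\<^sup>2))"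
      by (subst exp_sum[symmetric], simp, subst norm_square_Basis) (simp add: sum_distrib_left sum_negf)
    ultimately show ?thesis
      unfolding f_def prod.distrib by simp
  qed
  show "integrable lborel f"
    unfolding f[abs_def] by (rule integrable_lborel_prod) (rule gaussian_fourier_1d[OF \<epsilon>])
  have "(\<integral>x. f x \<partial>lborel) = (\<Prod>b\<in>(Basis::'a set). of_real (sqrt (pi / \<epsilon>) * exp (- (\<xi> \<bullet> b)\<^sup>2 / (4 * \<epsilon>))))"
    unfolding f[abs_def]
    by (subst integral_lborel_prod, rule gaussian_fourier_1d[OF \<epsilon>], intro prod.cong refl gaussian_fourier_1d(2)[OF \<epsilon>])
  also have "\<dots> = of_real (sqrt (pi / \<epsilon>) ^ DIM('a) * exp (- (norm \<xi>)\<^sup>2 / (4 * \<epsilon>)))"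
    by (simp add: prod.distrib norm_square_Basis sum_divide_distrib sum_negf flip: exp_sum of_real_prod)
  also have "sqrt (pi / \<epsilon>) ^ DIM('a) = (pi / \<epsilon>) powr (real DIM('a) / 2)"
    using \<epsilon> by (simp add: powr_half_sqrt[symmetric] powr_powr flip: powr_realpow)
  finally show "(\<integral>x. f x \<partial>lborel) = of_real ((pi / \<epsilon>) powr (real DIM('a) / 2) * exp (- (norm \<xi>)\<^sup>2 / (4 * \<epsilon>)))" .
qed

lemma gaussian_integral:
  assumes \<epsilon>: "\<epsilon> > 0"
  shows "integrable lborel (\<lambda>x::'a::euclidean_space. exp (- \<epsilon> * (norm x)\<^sup>2))"
    "(\<integral>x. exp (- \<epsilon> * (norm (x::'a))\<^sup>2) \<partial>lborel) = (pi / \<epsilon>) powr (real DIM('a) / 2)"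
proof -
  have "integrable lborel (\<lambda>x::'a. complex_of_real (exp (- \<epsilon> * (norm x)\<^sup>2)))"
    using gaussian_fourier(1)[OF \<epsilon>, of "0::'a"] by simp
  then show "integrable lborel (\<lambda>x::'a. exp (- \<epsilon> * (norm x)\<^sup>2))"
    using integrable_Re by fastforce
  have "complex_of_real (\<integral>x. exp (- \<epsilon> * (norm (x::'a))\<^sup>2) \<partial>lborel) = of_real ((pi / \<epsilon>) powr (real DIM('a) / 2))"
    using gaussian_fourier(2)[OF \<epsilon>, of "0::'a"] by (simp del: of_real_exp flip: integral_complex_of_real)
  then show "(\<integral>x. exp (- \<epsilon> * (norm (x::'a))\<^sup>2) \<partial>lborel) = (pi / \<epsilon>) powr (real DIM('a) / 2)"
    using of_real_eq_iff by blast
qed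

lemma gauss_kernel_measurable [measurable]: "gauss_kernel t \<in> borel_measurable borel"
  unfolding gauss_kernel_def[abs_def] by measurable

lemma gauss_kernel_nonneg: "0 \<le> gauss_kernel t x"
  by (simp add: gauss_kernel_def)

lemma gauss_kernel_integral:
  assumes t: "t > 0"
  shows "integrable lborel (gauss_kernel t :: 'a::euclidean_space \<Rightarrow> real)"
    "(\<integral>x. gauss_kernel t (x::'a) \<partial>lborel) = 1"
proof -
  have e: "gauss_kernel t x = (4 * pi * t) powr (- (real DIM('a) / 2)) * exp (- (1/(4*t)) * (norm x)\<^sup>2)" for x :: 'a
    by (simp add: gauss_kernel_def)
  have t4: "1/(4*t) > 0" using t by simp
  show "integrable lborel (gauss_kernel t :: 'a \<Rightarrow> real)"
    unfolding e[abs_def] by (intro integrable_mult_right gaussian_integral t4)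
  show "(\<integral>x. gauss_kernel t (x::'a) \<partial>lborel) = 1"
    unfolding e integral_mult_right_zero gaussian_integral(2)[OF t4]
    using t by (simp add: powr_minus field_simps)
qed

section \<open>Elementary properties of the Fourier integral of integrable functions\<close>

definition fourier_const :: "'a::euclidean_space itself \<Rightarrow> real" where
  "fourier_const _ = (2 * pi) powr (- (real DIM('a) / 2))"

lemma fourier_const_pos [simp]: "0 < fourier_const TYPE('a::euclidean_space)" "0 \<le> fourier_const TYPE('a)"
  by (auto simp: fourier_const_def)

lemma norm_exp_ii [simp]: "cmod (exp (- (\<i> * complex_of_real r))) = 1" "cmod (exp (\<i> * complex_of_real r)) = 1"
  by (simp_all add: norm_exp_eq_Re)

lemma fourier_integral_altdef:
  fixes g :: "'a::euclidean_space \<Rightarrow> complex"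
  shows "fourier_integral g \<xi> = of_real (fourier_const TYPE('a)) * (\<integral>x. exp (- (\<i> * of_real (x \<bullet> \<xi>))) * g x \<partial>lborel)"
  by (simp add: fourier_integral_def fourier_const_def)

lemma integrable_phase_mult:
  fixes g :: "'a::euclidean_space \<Rightarrow> complex"
  assumes "integrable lborel g"
  shows "integrable lborel (\<lambda>x. exp (- (\<i> * of_real (x \<bullet> \<xi>))) * g x)"
proof (rule Bochner_Integration.integrable_bound[OF assms])
  have [measurable]: "g \<in> borel_measurable borel" using borel_measurable_integrable[OF assms] by simp
  show "(\<lambda>x. exp (- (\<i> * of_real (x \<bullet> \<xi>))) * g x) \<in> borel_measurable lborel" by measurable
qed (simp add: norm_mult)

lemma fourier_integral_measurable:
  fixes g :: "'a::euclidean_space \<Rightarrow> complex"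
  assumes [measurable]: "g \<in> borel_measurable borel"
  shows "fourier_integral g \<in> borel_measurable borel"
  unfolding fourier_integral_altdef[abs_def] by measurable

lemma norm_fourier_integral_le:
  fixes g :: "'a::euclidean_space \<Rightarrow> complex"
  shows "norm (fourier_integral g \<xi>) \<le> fourier_const TYPE('a) * (\<integral>x. norm (g x) \<partial>lborel)"
proof -
  have "norm (\<integral>x. exp (- (\<i> * of_real (x \<bullet> \<xi>))) * g x \<partial>lborel) \<le> (\<integral>x. norm (exp (- (\<i> * of_real (x \<bullet> \<xi>))) * g x) \<partial>lborel)"
    by (rule integral_norm_bound)
  then show ?thesis by (simp add: fourier_integral_altdef norm_mult mult_left_mono)
qed

lemma fourier_integral_add:
  assumes "integrable lborel f" "integrable lborel g"
  shows "fourier_integral (\<lambda>x. f x + g x) \<xi> = fourier_integral f \<xi> + fourier_integral g \<xi>"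
  unfolding fourier_integral_altdef
  by (simp add: integrable_phase_mult assms Bochner_Integration.integral_add distrib_left)

lemma fourier_integral_diff:
  assumes "integrable lborel f" "integrable lborel g"
  shows "fourier_integral (\<lambda>x. f x - g x) \<xi> = fourier_integral f \<xi> - fourier_integral g \<xi>"
  unfolding fourier_integral_altdef
  by (simp add: integrable_phase_mult assms Bochner_Integration.integral_diff right_diff_distrib)

lemma fourier_integral_cmult: "fourier_integral (\<lambda>x. c * f x) \<xi> = c * fourier_integral f \<xi>"
  unfolding fourier_integral_altdef by (simp add: mult.left_commute[of _ c])

lemma integrable_pair_mult:
  fixes f :: "'a::euclidean_space \<Rightarrow> complex" and g :: "'b::euclidean_space \<Rightarrow> complex"
  assumes f: "integrable lborel f" and g: "integrable lborel g"
  shows "integrable (lborel \<Otimes>\<^sub>M lborel) (\<lambda>(x, y). f x * g y)"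
proof -
  have [measurable]: "f \<in> borel_measurable borel" "g \<in> borel_measurable borel"
    using f g by (auto dest: borel_measurable_integrable)
  show ?thesis
    by (rule lborel_pair.Fubini_integrable) (use f g in \<open>auto simp: norm_mult\<close>)
qed

text \<open>Fubini, with a phase symmetric in both variables. A modulated Gaussian in the role of
  \<open>h\<close> leads to inversion, a damped conjugate transform to Plancherel.\<close>

lemma fourier_multiplication_formula:
  fixes f h :: "'a::euclidean_space \<Rightarrow> complex"
  assumes f: "integrable lborel f" and h: "integrable lborel h"
  shows "(\<integral>\<xi>. fourier_integral f \<xi> * h \<xi> \<partial>lborel) = (\<integral>x. f x * fourier_integral h x \<partial>lborel)"
proof -
  have [measurable]: "f \<in> borel_measurable borel" "h \<in> borel_measurable borel"
    using f h by (auto dest: borel_measurable_integrable)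
  define c where "c = complex_of_real (fourier_const TYPE('a))"
  have I: "integrable (lborel \<Otimes>\<^sub>M lborel) (\<lambda>(x, \<xi>). exp (- (\<i> * of_real (x \<bullet> \<xi>))) * (f x * h \<xi>))"
    by (rule Bochner_Integration.integrable_bound[OF integrable_pair_mult[OF f h]]) (auto simp: norm_mult)
  have "(\<integral>\<xi>. fourier_integral f \<xi> * h \<xi> \<partial>lborel) = c * (\<integral>\<xi>. (\<integral>x. exp (- (\<i> * of_real (x \<bullet> \<xi>))) * (f x * h \<xi>) \<partial>lborel) \<partial>lborel)"
    unfolding fourier_integral_altdef c_def[symmetric] by (simp add: mult.assoc flip: integral_mult_left_zero)
  also have "(\<integral>\<xi>. (\<integral>x. exp (- (\<i> * of_real (x \<bullet> \<xi>))) * (f x * h \<xi>) \<partial>lborel) \<partial>lborel)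
      = (\<integral>x. (\<integral>\<xi>. exp (- (\<i> * of_real (x \<bullet> \<xi>))) * (f x * h \<xi>) \<partial>lborel) \<partial>lborel)"
    by (rule lborel_pair.Fubini_integral) (use I in simp)
  also have "c * \<dots> = (\<integral>x. f x * fourier_integral h x \<partial>lborel)"
    unfolding fourier_integral_altdef c_def[symmetric]
    by (simp add: mult_ac flip: integral_mult_right_zero)
       (simp add: inner_commute)
  finally show ?thesis .
qed

section \<open>Approximation by Gaussian convolution\<close>

text \<open>For open \<open>U\<close> the indicators of the translates converge pointwise from below on \<open>U\<close>,
  and translation preserves the measure.\<close>

lemma open_translate_tendsto:
  fixes U :: "'a::euclidean_space set"
  assumes U: "open U" "emeasure lborel U < \<infinity>" and h: "h \<longlonglongrightarrow> (0::'a)"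
  shows "(\<lambda>n. \<integral>x. \<bar>indicator U (x + h n) - indicator U x :: real\<bar> \<partial>lborel) \<longlonglongrightarrow> 0"
proof -
  have [measurable]: "U \<in> sets borel" using U by auto
  have iU: "integrable lborel (indicator U :: 'a \<Rightarrow> real)" using U by (simp add: integrable_indicator_iff)
  have iUh: "integrable lborel (\<lambda>x. indicator U (x + a) :: real)" for a
    using integrable_lborel_isometry[OF iU, of 1 a] by (simp add: add.commute)
  have sh: "(\<integral>x. indicator U (x + a) \<partial>lborel) = (\<integral>x. indicator U x \<partial>lborel :: real)" for a
    using integral_lborel_isometry[of "indicator U :: 'a \<Rightarrow> real" 1 a] by (simp add: add.commute)
  have "(\<lambda>n. \<integral>x. indicator U x * indicator U (x + h n) \<partial>lborel) \<longlonglongrightarrow> (\<integral>x. indicator U x \<partial>lborel :: real)"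
  proof (rule integral_dominated_convergence[where w="indicator U"])
    show "AE x in lborel. (\<lambda>n. indicator U x * indicator U (x + h n)) \<longlonglongrightarrow> (indicator U x :: real)"
    proof (intro AE_I2)
      fix x
      show "(\<lambda>n. indicator U x * indicator U (x + h n)) \<longlonglongrightarrow> (indicator U x :: real)"
      proof (cases "x \<in> U")
        case True
        have "(\<lambda>n. x + h n) \<longlonglongrightarrow> x + 0" by (intro tendsto_intros h)
        then have "eventually (\<lambda>n. x + h n \<in> U) sequentially"
          using topological_tendstoD[OF _ U(1)] True by auto
        then show ?thesis
          by (intro tendsto_eventually) (use True in \<open>auto elim!: eventually_mono\<close>)
      qed simp
    qed
  qed (auto simp: iU indicator_def)
  then have "(\<lambda>n. 2 * (\<integral>x. indicator U x \<partial>lborel) - 2 * (\<integral>x. indicator U x * indicator U (x + h n) \<partial>lborel)) \<longlonglongrightarrow>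
     2 * (\<integral>x. indicator U x \<partial>lborel) - 2 * (\<integral>x. indicator U x \<partial>lborel :: real)"
    by (intro tendsto_intros)
  also have "(\<lambda>n. 2 * (\<integral>x. indicator U x \<partial>lborel) - 2 * (\<integral>x. indicator U x * indicator U (x + h n) \<partial>lborel)) =
    (\<lambda>n. \<integral>x. \<bar>indicator U (x + h n) - indicator U x :: real\<bar> \<partial>lborel)"
  proof
    fix n
    have i: "integrable lborel (\<lambda>x. indicator U x * indicator U (x + h n) :: real)"
      by (rule Bochner_Integration.integrable_bound[OF iU]) (auto simp: indicator_def)
    \<comment> \<open>The difference of two indicators has modulus 1_A + 1_B - 2 1_A 1_B, and the
      two single integrals agree by translation invariance.\<close>
    have "(\<integral>x. \<bar>indicator U (x + h n) - indicator U x :: real\<bar> \<partial>lborel) =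
      (\<integral>x. indicator U (x + h n) + indicator U x - 2 * (indicator U x * indicator U (x + h n)) \<partial>lborel)"
      by (rule Bochner_Integration.integral_cong) (auto simp: indicator_def)
    also have "\<dots> = 2 * (\<integral>x. indicator U x \<partial>lborel) - 2 * (\<integral>x. indicator U x * indicator U (x + h n) \<partial>lborel)"
      using i iU iUh[of "h n"] sh[of "h n"] by simp
    finally show "2 * (\<integral>x. indicator U x \<partial>lborel) - 2 * (\<integral>x. indicator U x * indicator U (x + h n) \<partial>lborel) = (\<integral>x. \<bar>indicator U (x + h n) - indicator U x :: real\<bar> \<partial>lborel)" ..
  qed
  finally show ?thesis by simp
qed

lemma integrable_shift:
  fixes f :: "'a::euclidean_space \<Rightarrow> 'b::{banach,second_countable_topology}"
  shows "integrable lborel f \<Longrightarrow> integrable lborel (\<lambda>x. f (x + a))"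
  using integrable_lborel_isometry[of f 1 a] by (simp add: add.commute)

lemma integral_shift:
  fixes f :: "'a::euclidean_space \<Rightarrow> 'b::{banach,second_countable_topology}"
  shows "f \<in> borel_measurable borel \<Longrightarrow> (\<integral>x. f (x + a) \<partial>lborel) = (\<integral>x. f x \<partial>lborel)"
  using integral_lborel_isometry[of f 1 a] by (simp add: add.commute)

text \<open>The error f - g is counted at x and at x + a; translation invariance makes both counts
  equal, hence the factor 2.\<close>

lemma L1_translation_approx:
  fixes f g :: "'a::euclidean_space \<Rightarrow> 'b::{banach,second_countable_topology}"
  assumes f: "integrable lborel f" and g: "integrable lborel g"
  shows "(\<integral>x. norm (f (x + a) - f x) \<partial>lborel) \<le> (\<integral>x. norm (g (x + a) - g x) \<partial>lborel) + 2 * (\<integral>x. norm (f x - g x) \<partial>lborel)"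
proof -
  have [measurable]: "f \<in> borel_measurable borel" "g \<in> borel_measurable borel"
    using f g by (auto dest: borel_measurable_integrable)
  note i = integrable_shift[OF f, of a] integrable_shift[OF g, of a] f g
  have "(\<integral>x. norm (f (x + a) - f x) \<partial>lborel) \<le>
     (\<integral>x. norm (g (x + a) - g x) + norm (f (x + a) - g (x + a)) + norm (f x - g x) \<partial>lborel)"
  proof (intro integral_mono)
    fix x
    have "f (x + a) - f x = (g (x + a) - g x) + (f (x + a) - g (x + a)) - (f x - g x)" by simp
    then show "norm (f (x + a) - f x) \<le> norm (g (x + a) - g x) + norm (f (x + a) - g (x + a)) + norm (f x - g x)"
      using norm_triangle_ineq[of "g (x + a) - g x" "f (x + a) - g (x + a)"]
        norm_triangle_ineq4[of "(g (x + a) - g x) + (f (x + a) - g (x + a))" "f x - g x"] by simp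
  qed (use i in auto)
  also have "\<dots> = (\<integral>x. norm (g (x + a) - g x) \<partial>lborel) + (\<integral>x. norm (f (x + a) - g (x + a)) \<partial>lborel) + (\<integral>x. norm (f x - g x) \<partial>lborel)"
    using i by simp
  also have "(\<integral>x. norm (f (x + a) - g (x + a)) \<partial>lborel) = (\<integral>x. norm (f x - g x) \<partial>lborel)"
    by (rule integral_shift[of "\<lambda>x. norm (f x - g x)"]) measurable
  finally show ?thesis by simp
qed

text \<open>Functions on which translation is continuous form a closed subset of L1. The approximant
  may depend on the tolerance, which suits the induction over integrable functions.\<close>

lemma L1_translation_limit:
  fixes f :: "'a::euclidean_space \<Rightarrow> 'b::{banach,second_countable_topology}"
  assumes f: "integrable lborel f"
    and ap: "\<And>e. e > 0 \<Longrightarrow> \<exists>g. integrable lborel g \<and> (\<integral>x. norm (f x - g x) \<partial>lborel) < e \<and>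
      (\<lambda>n. \<integral>x. norm (g (x + h n) - g x) \<partial>lborel) \<longlonglongrightarrow> 0"
  shows "(\<lambda>n. \<integral>x. norm (f (x + h n) - f x) \<partial>lborel) \<longlonglongrightarrow> 0"
proof (rule LIMSEQ_I)
  fix e :: real assume e: "0 < e"
  then obtain g where g: "integrable lborel g" "(\<integral>x. norm (f x - g x) \<partial>lborel) < e/4"
    "(\<lambda>n. \<integral>x. norm (g (x + h n) - g x) \<partial>lborel) \<longlonglongrightarrow> 0" using ap[of "e/4"] by auto
  from order_tendstoD(2)[OF g(3), of "e/2"] e obtain N where
    N: "\<And>n. n \<ge> N \<Longrightarrow> (\<integral>x. norm (g (x + h n) - g x) \<partial>lborel) < e/2"
    by (auto simp: eventually_sequentially)
  show "\<exists>N. \<forall>n\<ge>N. norm ((\<integral>x. norm (f (x + h n) - f x) \<partial>lborel) - 0) < e"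
  proof (intro exI[of _ N] allI impI)
    fix n assume "n \<ge> N"
    with N[of n] g(2) L1_translation_approx[OF f g(1), of "h n"]
    show "norm ((\<integral>x. norm (f (x + h n) - f x) \<partial>lborel) - 0) < e"
      by (simp add: integral_nonneg)
  qed
qed

text \<open>Induction over integrable functions. An indicator is approximated from outside by an
  open set of slightly larger measure, for which \<open>open_translate_tendsto\<close> applies; sums
  and limits pass through the triangle inequality.\<close>

lemma L1_translation_continuous:
  fixes g :: "'a::euclidean_space \<Rightarrow> complex"
  assumes g: "integrable lborel g" and h: "h \<longlonglongrightarrow> (0::'a)"
  shows "(\<lambda>n. \<integral>x. norm (g (x + h n) - g x) \<partial>lborel) \<longlonglongrightarrow> 0"
  using g
proof (induction rule: integrable_induct)
  case (base A c)
  then have A[measurable]: "A \<in> sets borel" by simp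
  have iA: "integrable lborel (\<lambda>x. indicator A x *\<^sub>R c)" using base by (simp add: integrable_indicator_iff)
  show ?case
  proof (rule L1_translation_limit[OF iA])
    fix e :: real assume e: "e > 0"
    \<comment> \<open>Adding 1 to \<open>norm c\<close> keeps the quotient meaningful for c =
      0.\<close>
    obtain U where U: "open U" "A \<subseteq> U" "emeasure lborel (U - A) < ennreal (e / (norm c + 1))"
      using outer_regular_lborel[OF A, of "e / (norm c + 1)"] e by (auto simp: add_nonneg_pos)
    then have [measurable]: "U \<in> sets borel" by auto
    have fin: "emeasure lborel (U - A) < \<infinity>" using U(3) ennreal_less_top order_less_trans by (metis infinity_ennreal_def)
    have "emeasure lborel U = emeasure lborel (U - A) + emeasure lborel A"
      using U(2) by (subst plus_emeasure) (auto simp: Un_absorb1 intro!: arg_cong[where f="emeasure lborel"])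
    then have Ufin: "emeasure lborel U < \<infinity>" using fin base by (auto simp: less_top)
    have iU: "integrable lborel (\<lambda>x. indicator U x *\<^sub>R c)" using Ufin by (simp add: integrable_indicator_iff)
    have "(\<integral>x. norm (indicator A x *\<^sub>R c - indicator U x *\<^sub>R c) \<partial>lborel) = (\<integral>x. indicator (U - A) x * norm c \<partial>lborel)"
      using U(2) by (intro Bochner_Integration.integral_cong) (auto simp: indicator_def)
    also have "\<dots> = measure lborel (U - A) * norm c" by simp
    also have "measure lborel (U - A) * norm c \<le> e / (norm c + 1) * norm c"
      using U(3) fin e by (intro mult_right_mono) (auto simp: emeasure_eq_ennreal_measure ennreal_less_iff less_top[symmetric])
    also have "\<dots> < e" using e by (simp add: divide_less_eq add_nonneg_pos)
    finally have 1: "(\<integral>x. norm (indicator A x *\<^sub>R c - indicator U x *\<^sub>R c) \<partial>lborel) < e" .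
    have "(\<lambda>n. norm c * (\<integral>x. \<bar>indicator U (x + h n) - indicator U x :: real\<bar> \<partial>lborel)) \<longlonglongrightarrow> norm c * 0"
      by (intro tendsto_intros open_translate_tendsto U Ufin h)
    also have "(\<lambda>n. norm c * (\<integral>x. \<bar>indicator U (x + h n) - indicator U x :: real\<bar> \<partial>lborel)) =
       (\<lambda>n. \<integral>x. norm (indicator U (x + h n) *\<^sub>R c - indicator U x *\<^sub>R c) \<partial>lborel)"
      by (simp flip: integral_mult_right_zero scaleR_left_diff_distrib) (simp add: mult.commute)
    finally show "\<exists>g. integrable lborel g \<and> (\<integral>x. norm (indicator A x *\<^sub>R c - g x) \<partial>lborel) < e \<and>
      (\<lambda>n. \<integral>x. norm (g (x + h n) - g x) \<partial>lborel) \<longlonglongrightarrow> 0"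
      using 1 iU by (intro exI[of _ "\<lambda>x. indicator U x *\<^sub>R c"]) auto
  qed
next
  case (add f g)
  have [measurable]: "f \<in> borel_measurable borel" "g \<in> borel_measurable borel"
    using add by (auto dest: borel_measurable_integrable)
  show ?case
  proof (rule tendsto_sandwich[OF _ _ tendsto_const])
    show "(\<lambda>n. (\<integral>x. norm (f (x + h n) - f x) \<partial>lborel) + (\<integral>x. norm (g (x + h n) - g x) \<partial>lborel)) \<longlonglongrightarrow> 0"
      using tendsto_add[OF add(3,4)] by simp
    show "\<forall>\<^sub>F n in sequentially. (\<integral>x. norm (f (x + h n) + g (x + h n) - (f x + g x)) \<partial>lborel)
         \<le> (\<integral>x. norm (f (x + h n) - f x) \<partial>lborel) + (\<integral>x. norm (g (x + h n) - g x) \<partial>lborel)"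
    proof (intro always_eventually allI)
      fix n
      note i = integrable_shift[OF add(1), of "h n"] integrable_shift[OF add(2), of "h n"] add(1,2)
      have "(\<integral>x. norm (f (x + h n) + g (x + h n) - (f x + g x)) \<partial>lborel) \<le>
         (\<integral>x. norm (f (x + h n) - f x) + norm (g (x + h n) - g x) \<partial>lborel)"
        using i by (intro integral_mono) (auto simp: norm_diff_triangle_ineq)
      then show "(\<integral>x. norm (f (x + h n) + g (x + h n) - (f x + g x)) \<partial>lborel)
         \<le> (\<integral>x. norm (f (x + h n) - f x) \<partial>lborel) + (\<integral>x. norm (g (x + h n) - g x) \<partial>lborel)"
        using i by simp
    qed
  qed (simp add: integral_nonneg)
next
  case (lim f s)
  have [measurable]: "f \<in> borel_measurable borel" "\<And>i. s i \<in> borel_measurable borel"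
    using lim(1,4) by (auto dest: borel_measurable_integrable)
  have "(\<lambda>i. \<integral>x. norm (f x - s i x) \<partial>lborel) \<longlonglongrightarrow> (\<integral>x. 0 \<partial>(lborel :: 'a measure))"
  proof (rule integral_dominated_convergence[where w="\<lambda>x. 3 * norm (f x)"])
    show "AE x in lborel. (\<lambda>i. norm (f x - s i x)) \<longlonglongrightarrow> 0"
      using lim(2) by (intro AE_I2 tendsto_norm_zero) (auto intro!: tendsto_eq_intros)
    show "AE x in lborel. norm (norm (f x - s i x)) \<le> 3 * norm (f x)" for i
    proof (intro AE_I2)
      fix x
      have "norm (f x - s i x) \<le> norm (f x) + norm (s i x)" by (rule norm_triangle_ineq4)
      with lim(3)[of x i] show "norm (norm (f x - s i x)) \<le> 3 * norm (f x)" by simp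
    qed
  qed (use lim(4) in auto)
  then have t0: "(\<lambda>i. \<integral>x. norm (f x - s i x) \<partial>lborel) \<longlonglongrightarrow> 0" by simp
  show ?case
  proof (rule L1_translation_limit[OF lim(4)])
    fix e :: real assume e: "e > 0"
    from LIMSEQ_D[OF t0 e] obtain i where "norm ((\<integral>x. norm (f x - s i x) \<partial>lborel) - 0) < e" by auto
    then show "\<exists>g. integrable lborel g \<and> (\<integral>x. norm (f x - g x) \<partial>lborel) < e \<and>
      (\<lambda>n. \<integral>x. norm (g (x + h n) - g x) \<partial>lborel) \<longlonglongrightarrow> 0"
      using lim(1,5) by (intro exI[of _ "s i"]) auto
  qed
qed

section \<open>Convolution with the heat kernel as an approximate identity in L1\<close>

lemma gauss_kernel_minus: "gauss_kernel t (x - y) = gauss_kernel t (y - x)"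
  by (simp add: gauss_kernel_def norm_minus_commute)

text \<open>Half of the exponent is spent on the small factor; the other half is again a heat
  kernel, at time 2 t, and so still has integral 1.\<close>

lemma gauss_kernel_far:
  fixes h :: "'a::euclidean_space"
  assumes t: "t > 0" and h: "norm h \<ge> \<delta>" "\<delta> > 0"
  shows "gauss_kernel t h \<le> 2 powr (real DIM('a) / 2) * exp (- \<delta>\<^sup>2 / (8 * t)) * gauss_kernel (2 * t) h"
proof -
  have e: "exp (- (norm h)\<^sup>2 / (4 * t)) = exp (- (norm h)\<^sup>2 / (8 * t)) * exp (- (norm h)\<^sup>2 / (4 * (2 * t)))"
    using t by (simp flip: exp_add add: field_simps)
  have le: "exp (- (norm h)\<^sup>2 / (8 * t)) \<le> exp (- \<delta>\<^sup>2 / (8 * t))"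
    using t h by (simp add: divide_right_mono power_mono)
  have c: "(4 * pi * t) powr (- (real DIM('a) / 2)) = 2 powr (real DIM('a) / 2) * (4 * pi * (2 * t)) powr (- (real DIM('a) / 2))"
  proof -
    have "4 * pi * t = (4 * pi * (2 * t)) / 2" by simp
    then have "(4 * pi * t) powr (- (real DIM('a) / 2)) = (4 * pi * (2 * t)) powr (- (real DIM('a) / 2)) / 2 powr (- (real DIM('a) / 2))"
      using t by (metis powr_divide mult_nonneg_nonneg pi_ge_zero less_imp_le zero_le_numeral)
    then show ?thesis by (simp add: powr_minus_divide)
  qed
  define K where "K = 2 powr (real DIM('a) / 2) * (4 * pi * (2 * t)) powr (- (real DIM('a) / 2)) * exp (- (norm h)\<^sup>2 / (4 * (2 * t)))"
  have "K * exp (- (norm h)\<^sup>2 / (8 * t)) \<le> K * exp (- \<delta>\<^sup>2 / (8 * t))"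
    by (rule mult_left_mono[OF le]) (simp add: K_def)
  then show ?thesis
    unfolding gauss_kernel_def c e by (simp only: K_def mult_ac)
qed

text \<open>Convolution with the heat kernel, which is even. The argument y - x has the order in
  which the kernel arises as the transform of a modulated Gaussian.\<close>

definition gauss_conv :: "real \<Rightarrow> ('a::euclidean_space \<Rightarrow> complex) \<Rightarrow> 'a \<Rightarrow> complex" where
  "gauss_conv t g x = (\<integral>y. g y * of_real (gauss_kernel t (y - x)) \<partial>lborel)"

lemma gauss_conv_measurable:
  assumes [measurable]: "g \<in> borel_measurable borel"
  shows "gauss_conv t g \<in> borel_measurable borel"
  unfolding gauss_conv_def[abs_def] by measurable

lemma gauss_kernel_le:
  fixes x :: "'a::euclidean_space"
  assumes "t > 0"
  shows "gauss_kernel t x \<le> (4 * pi * t) powr (- (real DIM('a) / 2))"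
  unfolding gauss_kernel_def using assms
  by (intro mult_right_le_one_le) auto

lemma integrable_gauss_conv_integrand:
  fixes g :: "'a::euclidean_space \<Rightarrow> complex"
  assumes g: "integrable lborel g" and t: "t > 0"
  shows "integrable lborel (\<lambda>y. g y * of_real (gauss_kernel t (y - x)))"
proof (rule Bochner_Integration.integrable_bound)
  show "integrable lborel (\<lambda>y. g y * of_real ((4 * pi * t) powr (- (real DIM('a) / 2))))"
    using g by (rule integrable_mult_left)
  have [measurable]: "g \<in> borel_measurable borel" using g by (auto dest: borel_measurable_integrable)
  show "(\<lambda>y. g y * of_real (gauss_kernel t (y - x))) \<in> borel_measurable lborel" by measurable
  show "AE y in lborel. norm (g y * of_real (gauss_kernel t (y - x))) \<le> norm (g y * of_real ((4 * pi * t) powr (- (real DIM('a) / 2))))"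
    using gauss_kernel_le[OF t, where 'a='a] gauss_kernel_nonneg[of t, where 'a='a]
    by (intro AE_I2) (auto simp: norm_mult abs_of_nonneg intro!: mult_left_mono)
qed

text \<open>Minkowski over the shift h. Shifts below \<delta> are controlled by the continuity of
  translation, the others by \<open>gauss_kernel_far\<close>, whose kernel keeps mass 1 while its
  prefactor vanishes as t tends to 0.\<close>

lemma gauss_conv_L1_le:
  fixes g :: "'a::euclidean_space \<Rightarrow> complex"
  assumes g: "integrable lborel g" and t: "t > 0" and d: "\<delta> > 0"
    and small: "\<And>h. norm h < \<delta> \<Longrightarrow> (\<integral>x. norm (g (x + h) - g x) \<partial>lborel) \<le> e" and e: "e \<ge> 0"
  shows "integrable lborel (\<lambda>x. gauss_conv t g x - g x)"
   "(\<integral>x. norm (gauss_conv t g x - g x) \<partial>lborel) \<le> e + 2 * (\<integral>x. norm (g x) \<partial>lborel) * (2 powr (real DIM('a) / 2) * exp (- \<delta>\<^sup>2 / (8 * t)))"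
proof -
  have [measurable]: "g \<in> borel_measurable borel" using g by (auto dest: borel_measurable_integrable)
  note [measurable] = gauss_conv_measurable[of g t]
  note gk = gauss_kernel_integral[OF t, where 'a='a]
  have eq: "gauss_conv t g x - g x = (\<integral>h. of_real (gauss_kernel t h) * (g (x + h) - g x) \<partial>lborel)"
    and le: "ennreal (norm (gauss_conv t g x - g x)) \<le> (\<integral>\<^sup>+h. ennreal (gauss_kernel t h * norm (g (x + h) - g x)) \<partial>lborel)" for x
  proof -
    have i: "integrable lborel (\<lambda>h. of_real (gauss_kernel t h) * g (x + h))"
      using integrable_lborel_isometry[OF integrable_gauss_conv_integrand[OF g t, of x], of 1 x]
      by (simp add: mult.commute)
    have i2: "integrable lborel (\<lambda>h::'a. of_real (gauss_kernel t h) * g x)"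
      using gk(1) by (intro integrable_mult_left integrable_of_real)
    have "gauss_conv t g x = (\<integral>h. of_real (gauss_kernel t h) * g (x + h) \<partial>lborel)"
      unfolding gauss_conv_def
      using integral_lborel_isometry[of "\<lambda>y. g y * of_real (gauss_kernel t (y - x))" 1 x]
      by (simp add: mult.commute)
    moreover have "g x = (\<integral>h. of_real (gauss_kernel t (h::'a)) * g x \<partial>lborel)"
      using gk(2) by simp
    ultimately have "gauss_conv t g x - g x = (\<integral>h. of_real (gauss_kernel t h) * g (x + h) \<partial>lborel) - (\<integral>h. of_real (gauss_kernel t (h::'a)) * g x \<partial>lborel)"
      by simp
    also have "\<dots> = (\<integral>h. of_real (gauss_kernel t h) * (g (x + h) - g x) \<partial>lborel)"
      using i i2 by (simp add: right_diff_distrib)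
    finally show eq: "gauss_conv t g x - g x = (\<integral>h. of_real (gauss_kernel t h) * (g (x + h) - g x) \<partial>lborel)" .
    have "integrable lborel (\<lambda>h. of_real (gauss_kernel t h) * (g (x + h) - g x))"
      using i i2 by (simp add: right_diff_distrib)
    then have "ennreal (norm (gauss_conv t g x - g x)) \<le> (\<integral>\<^sup>+h. norm (of_real (gauss_kernel t h) * (g (x + h) - g x)) \<partial>lborel)"
      unfolding eq by (rule integral_norm_bound_ennreal)
    then show "ennreal (norm (gauss_conv t g x - g x)) \<le> (\<integral>\<^sup>+h. ennreal (gauss_kernel t h * norm (g (x + h) - g x)) \<partial>lborel)"
      by (simp add: norm_mult gauss_kernel_nonneg)
  qed
  define G where "G = (\<integral>x. norm (g x) \<partial>lborel)"
  define E where "E = 2 powr (real DIM('a) / 2) * exp (- \<delta>\<^sup>2 / (8 * t))"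
  have G: "G \<ge> 0" and E: "E \<ge> 0" by (auto simp: G_def E_def integral_nonneg)
  have t2: "2 * t > 0" using t by simp
  note gk2 = gauss_kernel_integral[OF t2, where 'a='a]
  have iN: "integrable lborel (\<lambda>x. norm (g (x + h) - g x))" for h
    using integrable_shift[OF g] g by auto
  have w2: "(\<integral>x. norm (g (x + h) - g x) \<partial>lborel) \<le> 2 * G" for h
  proof -
    have "(\<integral>x. norm (g (x + h) - g x) \<partial>lborel) \<le> (\<integral>x. norm (g (x + h)) + norm (g x) \<partial>lborel)"
      using iN integrable_shift[OF g] g by (intro integral_mono) (auto simp: norm_triangle_ineq4)
    also have "\<dots> = 2 * G"
      using integrable_shift[OF g] g integral_shift[of "\<lambda>x. norm (g x)" h] by (simp add: G_def)
    finally show ?thesis .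
  qed
  have "(\<integral>\<^sup>+x. ennreal (norm (gauss_conv t g x - g x)) \<partial>lborel) \<le>
     (\<integral>\<^sup>+x. (\<integral>\<^sup>+h. ennreal (gauss_kernel t h * norm (g (x + h) - g x)) \<partial>lborel) \<partial>lborel)"
    by (intro nn_integral_mono le)
  also have "\<dots> = (\<integral>\<^sup>+h. (\<integral>\<^sup>+x. ennreal (gauss_kernel t h * norm (g (x + h) - g x)) \<partial>lborel) \<partial>lborel)"
    by (rule lborel_pair.Fubini') measurable
  also have "\<dots> = (\<integral>\<^sup>+h. ennreal (gauss_kernel t h * (\<integral>x. norm (g (x + h) - g x) \<partial>lborel)) \<partial>lborel)"
  proof (intro nn_integral_cong)
    fix h :: 'a
    have "(\<integral>\<^sup>+x. ennreal (gauss_kernel t h * norm (g (x + h) - g x)) \<partial>lborel) =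
       ennreal (\<integral>x. gauss_kernel t h * norm (g (x + h) - g x) \<partial>lborel)"
      using iN by (intro nn_integral_eq_integral) (auto simp: gauss_kernel_nonneg)
    then show "(\<integral>\<^sup>+x. ennreal (gauss_kernel t h * norm (g (x + h) - g x)) \<partial>lborel) =
       ennreal (gauss_kernel t h * (\<integral>x. norm (g (x + h) - g x) \<partial>lborel))" by simp
  qed
  also have "\<dots> \<le> (\<integral>\<^sup>+h. ennreal (e * gauss_kernel t (h::'a) + 2 * G * E * gauss_kernel (2 * t) h) \<partial>lborel)"
  proof (intro nn_integral_mono ennreal_leI)
    fix h :: 'a
    show "gauss_kernel t h * (\<integral>x. norm (g (x + h) - g x) \<partial>lborel) \<le> e * gauss_kernel t h + 2 * G * E * gauss_kernel (2 * t) h"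
    proof (cases "norm h < \<delta>")
      case True
      have "gauss_kernel t h * (\<integral>x. norm (g (x + h) - g x) \<partial>lborel) \<le> e * gauss_kernel t h"
        unfolding mult.commute[of e] by (intro mult_left_mono small True gauss_kernel_nonneg)
      moreover have "0 \<le> 2 * G * E * gauss_kernel (2 * t) h"
        using G E gauss_kernel_nonneg[of "2*t" h] by simp
      ultimately show ?thesis by linarith
    next
      case False
      have "gauss_kernel t h * (\<integral>x. norm (g (x + h) - g x) \<partial>lborel) \<le> (E * gauss_kernel (2 * t) h) * (2 * G)"
        using gauss_kernel_far[OF t _ d, of h] False w2[of h] E gauss_kernel_nonneg[of "2*t" h]
        by (intro mult_mono) (auto simp: E_def integral_nonneg)
      moreover have "0 \<le> e * gauss_kernel t h" using e gauss_kernel_nonneg[of t h] by simp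
      ultimately show ?thesis by (simp add: mult_ac)
    qed
  qed
  also have "\<dots> = ennreal (\<integral>h. e * gauss_kernel t (h::'a) + 2 * G * E * gauss_kernel (2 * t) h \<partial>lborel)"
    using gk(1) gk2(1) e G E by (intro nn_integral_eq_integral) (auto simp: gauss_kernel_nonneg)
  also have "(\<integral>h. e * gauss_kernel t (h::'a) + 2 * G * E * gauss_kernel (2 * t) h \<partial>lborel) = e + 2 * G * E"
    using gk gk2 by simp
  finally have *: "(\<integral>\<^sup>+x. ennreal (norm (gauss_conv t g x - g x)) \<partial>lborel) \<le> ennreal (e + 2 * G * E)" .
  then show i: "integrable lborel (\<lambda>x. gauss_conv t g x - g x)"
    by (intro integrableI_bounded) (auto simp: le_less_trans)
  have "ennreal (\<integral>x. norm (gauss_conv t g x - g x) \<partial>lborel) \<le> ennreal (e + 2 * G * E)"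
    using * nn_integral_eq_integral[OF integrable_norm[OF i]] by simp
  then show "(\<integral>x. norm (gauss_conv t g x - g x) \<partial>lborel) \<le> e + 2 * (\<integral>x. norm (g x) \<partial>lborel) * (2 powr (real DIM('a) / 2) * exp (- \<delta>\<^sup>2 / (8 * t)))"
    using ennreal_le_iff[of "e + 2 * G * E"] e G E unfolding G_def[symmetric] E_def[symmetric] by simp
qed

lemma gauss_conv_tendsto_L1:
  fixes g :: "'a::euclidean_space \<Rightarrow> complex"
  assumes g: "integrable lborel g"
  shows "integrable lborel (\<lambda>x. gauss_conv (1 / real (Suc n)) g x - g x)"
    "(\<lambda>n. \<integral>x. norm (gauss_conv (1 / real (Suc n)) g x - g x) \<partial>lborel) \<longlonglongrightarrow> 0"
proof -
  define w where "w h = (\<integral>x. norm (g (x + h) - g x) \<partial>lborel)" for h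
  \<comment> \<open>Sequential continuity becomes a modulus of continuity: otherwise one could pick
    bad shifts of size below 1 / (n + 1) for every n.\<close>
  have small: "\<exists>\<delta>>0. \<forall>h. norm h < \<delta> \<longrightarrow> w h \<le> e" if e: "e > 0" for e
  proof (rule ccontr)
    assume "\<not> ?thesis"
    then have "\<And>\<delta>. \<delta> > 0 \<Longrightarrow> \<exists>h. norm h < \<delta> \<and> w h > e" by (auto simp: not_le)
    then have "\<exists>h. norm h < inverse (real (Suc n)) \<and> w h > e" for n by simp
    then obtain h where h: "\<And>n. norm (h n) < inverse (real (Suc n))" "\<And>n. w (h n) > e" by metis
    have "h \<longlonglongrightarrow> 0"
      by (rule tendsto_0_le[OF LIMSEQ_inverse_real_of_nat, of _ 1]) (use h(1) in \<open>auto intro!: less_imp_le always_eventually\<close>)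
    from L1_translation_continuous[OF g this] have "(\<lambda>n. w (h n)) \<longlonglongrightarrow> 0" by (simp add: w_def)
    from order_tendstoD(2)[OF this e] h(2) show False
      by (auto simp: eventually_sequentially) (meson less_asym order_refl)
  qed
  obtain \<delta> where "\<delta> > 0" "\<And>h. norm h < \<delta> \<Longrightarrow> w h \<le> 1" using small[of 1] by auto
  then show "integrable lborel (\<lambda>x. gauss_conv (1 / real (Suc n)) g x - g x)"
    by (intro gauss_conv_L1_le(1)[OF g, where \<delta>=\<delta> and e=1]) (auto simp: w_def)
  show "(\<lambda>n. \<integral>x. norm (gauss_conv (1 / real (Suc n)) g x - g x) \<partial>lborel) \<longlonglongrightarrow> 0"
  proof (rule LIMSEQ_I)
    fix e :: real assume e: "e > 0"
    then obtain \<delta> where d: "\<delta> > 0" "\<And>h. norm h < \<delta> \<Longrightarrow> w h \<le> e/2" using small[of "e/2"] by auto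
    define A where "A = 2 * (\<integral>x. norm (g x) \<partial>lborel) * 2 powr (real DIM('a) / 2)"
    have "(\<lambda>n. A * exp (- \<delta>\<^sup>2 / (8 * (1 / real (Suc n))))) \<longlonglongrightarrow> 0"
      using d(1) by real_asymp
    from order_tendstoD(2)[OF this, of "e/2"] e obtain N where
      N: "\<And>n. n \<ge> N \<Longrightarrow> A * exp (- \<delta>\<^sup>2 / (8 * (1 / real (Suc n)))) < e/2" by (auto simp: eventually_sequentially)
    show "\<exists>N. \<forall>n\<ge>N. norm ((\<integral>x. norm (gauss_conv (1 / real (Suc n)) g x - g x) \<partial>lborel) - 0) < e"
    proof (intro exI[of _ N] allI impI)
      fix n assume n: "n \<ge> N"
      have "(\<integral>x. norm (gauss_conv (1 / real (Suc n)) g x - g x) \<partial>lborel) \<le> e/2 + A * exp (- \<delta>\<^sup>2 / (8 * (1 / real (Suc n))))"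
        using gauss_conv_L1_le(2)[OF g, of "1 / real (Suc n)" \<delta> "e/2"] d e by (simp add: w_def A_def mult_ac)
      with N[OF n] have "(\<integral>x. norm (gauss_conv (1 / real (Suc n)) g x - g x) \<partial>lborel) < e" by simp
      then show "norm ((\<integral>x. norm (gauss_conv (1 / real (Suc n)) g x - g x) \<partial>lborel) - 0) < e"
        by (simp add: integral_nonneg)
    qed
  qed
qed

section \<open>The Fourier transform on \<open>L\<^sup>2\<close>\<close>

lemma fourier_integral_gaussian_phase:
  fixes x y :: "'a::euclidean_space"
  assumes t: "t > 0"
  shows "integrable lborel (\<lambda>\<xi>. exp (\<i> * of_real (x \<bullet> \<xi>)) * of_real (exp (- t * (norm \<xi>)\<^sup>2)))"
  and "fourier_integral (\<lambda>\<xi>. of_real (fourier_const TYPE('a)) * (exp (\<i> * of_real (x \<bullet> \<xi>)) * of_real (exp (- t * (norm \<xi>)\<^sup>2)))) y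
    = of_real (gauss_kernel t (y - x))"
proof -
  have e: "exp (- (\<i> * of_real (\<xi> \<bullet> y))) * (exp (\<i> * of_real (x \<bullet> \<xi>)) * of_real (exp (- t * (norm \<xi>)\<^sup>2)))
     = exp (- (\<i> * of_real (\<xi> \<bullet> (y - x)))) * of_real (exp (- t * (norm \<xi>)\<^sup>2))" for \<xi> y :: 'a
    by (simp add: inner_diff_right inner_commute right_diff_distrib flip: exp_add mult.assoc)
  show "integrable lborel (\<lambda>\<xi>. exp (\<i> * of_real (x \<bullet> \<xi>)) * of_real (exp (- t * (norm \<xi>)\<^sup>2)))"
    using e[of _ 0] gaussian_fourier(1)[OF t, of "0 - x"] by simp
  have "fourier_integral (\<lambda>\<xi>. of_real (fourier_const TYPE('a)) * (exp (\<i> * of_real (x \<bullet> \<xi>)) * of_real (exp (- t * (norm \<xi>)\<^sup>2)))) y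
    = of_real ((fourier_const TYPE('a))\<^sup>2 * (pi / t) powr (real DIM('a) / 2) * exp (- (norm (y - x))\<^sup>2 / (4 * t)))"
    unfolding fourier_integral_cmult unfolding fourier_integral_altdef e gaussian_fourier(2)[OF t]
    by (simp add: power2_eq_square)
  \<comment> \<open>The identity (2 pi)^2 = (4 pi t) (pi / t), raised to the power n/2.\<close>
  also have "(fourier_const TYPE('a))\<^sup>2 * (pi / t) powr (real DIM('a) / 2) = (4 * pi * t) powr (- (real DIM('a) / 2))"
  proof -
    have "(fourier_const TYPE('a))\<^sup>2 = ((2 * pi)\<^sup>2) powr (- (real DIM('a) / 2))"
      unfolding fourier_const_def power2_eq_square by (subst powr_mult) auto
    also have "\<dots> = inverse (((2 * pi)\<^sup>2) powr (real DIM('a) / 2))"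
      by (rule powr_minus)
    also have "((2 * pi)\<^sup>2) powr (real DIM('a) / 2) = (4 * pi * t) powr (real DIM('a) / 2) * (pi / t) powr (real DIM('a) / 2)"
      using t by (subst powr_mult[symmetric]) (auto simp: power2_eq_square field_simps)
    finally show ?thesis using t by (simp add: powr_minus field_simps)
  qed
  finally show "fourier_integral (\<lambda>\<xi>. of_real (fourier_const TYPE('a)) * (exp (\<i> * of_real (x \<bullet> \<xi>)) * of_real (exp (- t * (norm \<xi>)\<^sup>2)))) y
    = of_real (gauss_kernel t (y - x))" by (simp add: gauss_kernel_def)
qed

text \<open>Inversion up to a Gaussian: the multiplication formula moves the second transform onto
  the damping factor and produces the heat kernel. The damping makes \<open>f\<close> integrable,
  although the transform of \<open>g\<close> is merely known to be bounded.\<close>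

lemma gaussian_cutoff:
  fixes g :: "'a::euclidean_space \<Rightarrow> complex"
  assumes g: "integrable lborel g" and t: "t > 0"
  defines "f \<equiv> \<lambda>\<xi>. of_real (exp (- t * (norm \<xi>)\<^sup>2)) * fourier_integral g \<xi>"
  shows "integrable lborel f" "f \<in> L2" "fourier_integral f y = gauss_conv t g (- y)"
proof -
  have [measurable]: "g \<in> borel_measurable borel" using g by (auto dest: borel_measurable_integrable)
  note [measurable] = fourier_integral_measurable[of g]
  define K where "K = fourier_const TYPE('a) * (\<integral>x. norm (g x) \<partial>lborel)"
  have K: "K \<ge> 0" "\<And>\<xi>. norm (fourier_integral g \<xi>) \<le> K"
    using norm_fourier_integral_le[of g] by (auto simp: K_def intro!: mult_nonneg_nonneg integral_nonneg)
  have fm[measurable]: "f \<in> borel_measurable borel" unfolding f_def by measurable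
  have fle: "norm (f \<xi>) \<le> exp (- t * (norm \<xi>)\<^sup>2) * K" for \<xi>
    by (simp add: f_def norm_mult K mult_left_mono)
  show "integrable lborel f"
  proof (rule Bochner_Integration.integrable_bound)
    show "integrable lborel (\<lambda>\<xi>::'a. exp (- t * (norm \<xi>)\<^sup>2) * K)"
      by (intro integrable_mult_left gaussian_integral t)
    show "AE \<xi> in lborel. norm (f \<xi>) \<le> norm (exp (- t * (norm \<xi>)\<^sup>2) * K)"
      using fle K(1) by (intro AE_I2) (auto intro: order_trans)
  qed simp
  have "integrable lborel (\<lambda>\<xi>. (norm (f \<xi>))\<^sup>2)"
  proof (rule Bochner_Integration.integrable_bound)
    show "integrable lborel (\<lambda>\<xi>::'a. exp (- (2 * t) * (norm \<xi>)\<^sup>2) * K\<^sup>2)"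
      using t by (intro integrable_mult_left gaussian_integral) auto
    show "AE \<xi> in lborel. norm ((norm (f \<xi>))\<^sup>2) \<le> norm (exp (- (2 * t) * (norm \<xi>)\<^sup>2) * K\<^sup>2)"
    proof (intro AE_I2)
      fix \<xi> :: 'a
      have "(norm (f \<xi>))\<^sup>2 \<le> (exp (- t * (norm \<xi>)\<^sup>2) * K)\<^sup>2" by (intro power_mono fle) auto
      also have "\<dots> = exp (- (2 * t) * (norm \<xi>)\<^sup>2) * K\<^sup>2"
        by (simp add: power_mult_distrib exp_of_nat_mult[symmetric] mult.assoc)
      finally show "norm ((norm (f \<xi>))\<^sup>2) \<le> norm (exp (- (2 * t) * (norm \<xi>)\<^sup>2) * K\<^sup>2)" by simp
    qed
  qed simp
  then show "f \<in> L2" by (simp add: L2_def)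
  define h where "h \<xi> = of_real (fourier_const TYPE('a)) * (exp (\<i> * of_real ((- y) \<bullet> \<xi>)) * of_real (exp (- t * (norm \<xi>)\<^sup>2)))" for \<xi> :: 'a
  have h: "integrable lborel h"
    unfolding h_def by (intro integrable_mult_right fourier_integral_gaussian_phase t)
  have "fourier_integral f y = (\<integral>\<xi>. fourier_integral g \<xi> * h \<xi> \<partial>lborel)"
    unfolding fourier_integral_altdef[of f] unfolding f_def h_def integral_mult_right_zero[symmetric]
    by (intro Bochner_Integration.integral_cong) (auto simp: inner_commute)
  also have "\<dots> = (\<integral>x. g x * fourier_integral h x \<partial>lborel)"
    by (rule fourier_multiplication_formula[OF g h])
  also have "\<dots> = gauss_conv t g (- y)"
    unfolding h_def fourier_integral_gaussian_phase(2)[OF t] gauss_conv_def ..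
  finally show "fourier_integral f y = gauss_conv t g (- y)" .
qed

text \<open>One half of Plancherel, with damping. By the multiplication formula the left side is the
  pairing of \<open>g\<close> with its heat regularisation, and a kernel of mass 1 cannot increase
  the energy.\<close>

lemma gaussian_energy_le:
  fixes g :: "'a::euclidean_space \<Rightarrow> complex"
  assumes g: "integrable lborel g" "g \<in> L2" and t: "t > 0"
  shows "(\<integral>\<^sup>+\<xi>. ennreal (exp (- t * (norm \<xi>)\<^sup>2) * (norm (fourier_integral g \<xi>))\<^sup>2) \<partial>lborel) \<le> ennreal ((L2_norm g)\<^sup>2)"
proof -
  have [measurable]: "g \<in> borel_measurable borel" using g by (auto dest: borel_measurable_integrable)
  note [measurable] = fourier_integral_measurable[of g] gauss_conv_measurable[of g]
  define f where "f \<xi> = of_real (exp (- t * (norm \<xi>)\<^sup>2)) * fourier_integral g \<xi>" for \<xi>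
  define h where "h \<xi> = cnj (f \<xi>)" for \<xi>
  note f = gaussian_cutoff[OF g(1) t, folded f_def]
  have h: "integrable lborel h" using f(1) by (simp add: h_def[abs_def] integrable_cnj)
  have fh: "fourier_integral h x = cnj (gauss_conv t g x)" for x
  proof -
    have "(\<integral>y. exp (- (\<i> * of_real (y \<bullet> x))) * h y \<partial>lborel) = (\<integral>y. cnj (exp (- (\<i> * of_real (y \<bullet> (- x)))) * f y) \<partial>lborel)"
      by (intro Bochner_Integration.integral_cong) (simp_all add: exp_cnj h_def)
    also have "\<dots> = cnj (\<integral>y. exp (- (\<i> * of_real (y \<bullet> (- x)))) * f y \<partial>lborel)"
      by (rule Bochner_Integration.integral_cnj)
    finally have "fourier_integral h x = cnj (fourier_integral f (- x))"
      unfolding fourier_integral_altdef by simp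
    then show ?thesis using f(3)[of "-x"] by simp
  qed
  define K where "K = fourier_const TYPE('a) * (\<integral>x. norm (g x) \<partial>lborel)"
  have K: "\<And>\<xi>. norm (fourier_integral g \<xi>) \<le> K"
    using norm_fourier_integral_le[of g] by (auto simp: K_def)
  have eqh: "fourier_integral g \<xi> * h \<xi> = of_real (exp (- t * (norm \<xi>)\<^sup>2) * (norm (fourier_integral g \<xi>))\<^sup>2)" for \<xi>
    unfolding h_def f_def complex_cnj_mult complex_cnj_complex_of_real of_real_mult complex_norm_square
    by (simp add: mult_ac)
  have "integrable lborel (\<lambda>\<xi>. fourier_integral g \<xi> * h \<xi>)"
  proof (rule Bochner_Integration.integrable_bound)
    show "integrable lborel (\<lambda>\<xi>. K * norm (h \<xi>))" using h by simp
    show "(\<lambda>\<xi>. fourier_integral g \<xi> * h \<xi>) \<in> borel_measurable lborel"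
      using borel_measurable_integrable[OF h] by measurable
    show "AE \<xi> in lborel. norm (fourier_integral g \<xi> * h \<xi>) \<le> norm (K * norm (h \<xi>))"
      using order_trans[OF K abs_ge_self] by (intro AE_I2) (auto simp: norm_mult abs_mult intro!: mult_right_mono)
  qed
  then have i2: "integrable lborel (\<lambda>\<xi>. exp (- t * (norm \<xi>)\<^sup>2) * (norm (fourier_integral g \<xi>))\<^sup>2)"
    unfolding eqh using integrable_Re by fastforce
  have "ennreal (\<integral>\<xi>. exp (- t * (norm \<xi>)\<^sup>2) * (norm (fourier_integral g \<xi>))\<^sup>2 \<partial>lborel)
    = ennreal (norm (\<integral>\<xi>. fourier_integral g \<xi> * h \<xi> \<partial>lborel))"
    unfolding eqh integral_complex_of_real norm_of_real by (simp add: integral_nonneg)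
  also have "(\<integral>\<xi>. fourier_integral g \<xi> * h \<xi> \<partial>lborel) = (\<integral>x. g x * cnj (gauss_conv t g x) \<partial>lborel)"
    unfolding fourier_multiplication_formula[OF g(1) h] fh ..
  also have "ennreal (norm \<dots>) \<le> (\<integral>\<^sup>+x. norm (g x * cnj (gauss_conv t g x)) \<partial>lborel)"
  proof (cases "integrable lborel (\<lambda>x. g x * cnj (gauss_conv t g x))")
    case True then show ?thesis by (rule integral_norm_bound_ennreal)
  \<comment> \<open>The integral of a non-integrable product is 0 by default, so the bound is
    trivial.\<close>
  qed (simp add: not_integrable_integral_eq)
  also have "\<dots> \<le> (\<integral>\<^sup>+x. (\<integral>\<^sup>+y. ennreal (norm (g x) * norm (g y) * gauss_kernel t (y - x)) \<partial>lborel) \<partial>lborel)"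
  proof (intro nn_integral_mono)
    fix x
    have "ennreal (norm (gauss_conv t g x)) \<le> (\<integral>\<^sup>+y. norm (g y * of_real (gauss_kernel t (y - x))) \<partial>lborel)"
      unfolding gauss_conv_def by (intro integral_norm_bound_ennreal integrable_gauss_conv_integrand g t)
    then have "ennreal (norm (g x)) * ennreal (norm (gauss_conv t g x)) \<le> ennreal (norm (g x)) * (\<integral>\<^sup>+y. norm (g y * of_real (gauss_kernel t (y - x))) \<partial>lborel)"
      by (intro mult_left_mono) auto
    also have "\<dots> = (\<integral>\<^sup>+y. ennreal (norm (g x) * norm (g y) * gauss_kernel t (y - x)) \<partial>lborel)"
      by (subst nn_integral_cmult[symmetric]) (auto simp: norm_mult gauss_kernel_nonneg mult.assoc simp flip: ennreal_mult)
    finally show "ennreal (norm (g x * cnj (gauss_conv t g x))) \<le> (\<integral>\<^sup>+y. ennreal (norm (g x) * norm (g y) * gauss_kernel t (y - x)) \<partial>lborel)"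
      by (simp add: norm_mult ennreal_mult)
  qed
  \<comment> \<open>The inequality a b <= (a^2 + b^2) / 2 decouples x from y, after which the kernel
    integrates to 1 in the free variable.\<close>
  also have "\<dots> \<le> (\<integral>\<^sup>+x. (\<integral>\<^sup>+y. ennreal ((norm (g x))\<^sup>2 / 2 * gauss_kernel t (y - x)) + ennreal ((norm (g y))\<^sup>2 / 2 * gauss_kernel t (y - x)) \<partial>lborel) \<partial>lborel)"
  proof (intro nn_integral_mono)
    fix x y
    have "norm (g x) * norm (g y) \<le> (norm (g x))\<^sup>2 / 2 + (norm (g y))\<^sup>2 / 2"
      using sum_squares_bound[of "norm (g x)" "norm (g y)"] by simp
    then have "norm (g x) * norm (g y) * gauss_kernel t (y - x) \<le> ((norm (g x))\<^sup>2 / 2 + (norm (g y))\<^sup>2 / 2) * gauss_kernel t (y - x)"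
      by (intro mult_right_mono) (auto simp: gauss_kernel_nonneg)
    then have "ennreal (norm (g x) * norm (g y) * gauss_kernel t (y - x)) \<le>
      ennreal ((norm (g x))\<^sup>2 / 2 * gauss_kernel t (y - x) + (norm (g y))\<^sup>2 / 2 * gauss_kernel t (y - x))"
      unfolding distrib_right by (rule ennreal_leI)
    also have "\<dots> = ennreal ((norm (g x))\<^sup>2 / 2 * gauss_kernel t (y - x)) + ennreal ((norm (g y))\<^sup>2 / 2 * gauss_kernel t (y - x))"
      by (rule ennreal_plus) (auto simp: gauss_kernel_nonneg)
    finally show "ennreal (norm (g x) * norm (g y) * gauss_kernel t (y - x)) \<le>
      ennreal ((norm (g x))\<^sup>2 / 2 * gauss_kernel t (y - x)) + ennreal ((norm (g y))\<^sup>2 / 2 * gauss_kernel t (y - x))" .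
  qed
  also have "\<dots> = (\<integral>\<^sup>+x. (\<integral>\<^sup>+y. ennreal ((norm (g x))\<^sup>2 / 2 * gauss_kernel t (y - x)) \<partial>lborel) \<partial>lborel)
      + (\<integral>\<^sup>+x. (\<integral>\<^sup>+y. ennreal ((norm (g y))\<^sup>2 / 2 * gauss_kernel t (y - x)) \<partial>lborel) \<partial>lborel)"
    by (simp add: nn_integral_add)
  also have "(\<integral>\<^sup>+x. (\<integral>\<^sup>+y. ennreal ((norm (g y))\<^sup>2 / 2 * gauss_kernel t (y - x)) \<partial>lborel) \<partial>lborel)
     = (\<integral>\<^sup>+y. (\<integral>\<^sup>+x. ennreal ((norm (g y))\<^sup>2 / 2 * gauss_kernel t (x - y)) \<partial>lborel) \<partial>lborel)"
    by (subst lborel_pair.Fubini') (auto simp: gauss_kernel_minus[of t])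
  also have "(\<integral>\<^sup>+x. (\<integral>\<^sup>+y. ennreal ((norm (g x))\<^sup>2 / 2 * gauss_kernel t (y - x)) \<partial>lborel) \<partial>lborel) = ennreal ((L2_norm g)\<^sup>2 / 2)"
  proof -
    have "(\<integral>\<^sup>+y. ennreal ((norm (g x))\<^sup>2 / 2 * gauss_kernel t (y - x)) \<partial>lborel) = ennreal ((norm (g x))\<^sup>2 / 2)" for x
    proof -
      have "(\<integral>\<^sup>+y. ennreal (gauss_kernel t (y - x)) \<partial>lborel) = (\<integral>\<^sup>+y. ennreal (gauss_kernel t (y::'a)) \<partial>lborel)"
        using nn_integral_lborel_isometry[of "\<lambda>y. ennreal (gauss_kernel t y)" 1 "- x"] by simp
      also have "\<dots> = 1"
        using gauss_kernel_integral[OF t, where 'a='a] by (subst nn_integral_eq_integral) (auto simp: gauss_kernel_nonneg)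
      finally have "(\<integral>\<^sup>+y. ennreal (gauss_kernel t (y - x)) \<partial>lborel) = 1" .
      moreover have "(\<integral>\<^sup>+y. ennreal ((norm (g x))\<^sup>2 / 2 * gauss_kernel t (y - x)) \<partial>lborel)
        = (\<integral>\<^sup>+y. ennreal ((norm (g x))\<^sup>2 / 2) * ennreal (gauss_kernel t (y - x)) \<partial>lborel)"
        by (intro nn_integral_cong ennreal_mult) (auto simp: gauss_kernel_nonneg)
      ultimately show ?thesis by (subst (asm) nn_integral_cmult) auto
    qed
    then show ?thesis
      using L2_integrable[OF g(2)] by (simp add: nn_integral_eq_integral L2_norm_square)
  qed
  also have "ennreal ((L2_norm g)\<^sup>2 / 2) + ennreal ((L2_norm g)\<^sup>2 / 2) = ennreal ((L2_norm g)\<^sup>2)"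
    by (simp flip: ennreal_plus)
  finally show ?thesis
    by (subst nn_integral_eq_integral[OF i2]) auto
qed

text \<open>Fatou removes the damping along t = 1 / (n + 1).\<close>

lemma fourier_integral_L2:
  fixes g :: "'a::euclidean_space \<Rightarrow> complex"
  assumes g: "integrable lborel g" "g \<in> L2"
  shows "fourier_integral g \<in> L2" "L2_norm (fourier_integral g) \<le> L2_norm g"
proof -
  have [measurable]: "g \<in> borel_measurable borel" using g by (auto dest: borel_measurable_integrable)
  note m[measurable] = fourier_integral_measurable[of g]
  have "(\<integral>\<^sup>+\<xi>. ennreal ((norm (fourier_integral g \<xi>))\<^sup>2) \<partial>lborel)
     = (\<integral>\<^sup>+\<xi>. liminf (\<lambda>n. ennreal (exp (- (1 / real (Suc n)) * (norm \<xi>)\<^sup>2) * (norm (fourier_integral g \<xi>))\<^sup>2)) \<partial>lborel)"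
  proof (intro nn_integral_cong lim_imp_Liminf[symmetric] tendsto_ennrealI)
    fix \<xi> :: 'a
    have "(\<lambda>n. exp (- (1 / real (Suc n)) * (norm \<xi>)\<^sup>2)) \<longlonglongrightarrow> 1" by real_asymp
    from tendsto_mult[OF this tendsto_const]
    show "(\<lambda>n. exp (- (1 / real (Suc n)) * (norm \<xi>)\<^sup>2) * (norm (fourier_integral g \<xi>))\<^sup>2) \<longlonglongrightarrow> (norm (fourier_integral g \<xi>))\<^sup>2"
      by simp
  qed simp
  also have "\<dots> \<le> liminf (\<lambda>n. \<integral>\<^sup>+\<xi>. ennreal (exp (- (1 / real (Suc n)) * (norm \<xi>)\<^sup>2) * (norm (fourier_integral g \<xi>))\<^sup>2) \<partial>lborel)"
    by (rule nn_integral_liminf) measurable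
  also have "\<dots> \<le> ennreal ((L2_norm g)\<^sup>2)"
  proof (rule order_trans[OF Liminf_mono[where g="\<lambda>_. ennreal ((L2_norm g)\<^sup>2)"]])
    show "\<forall>\<^sub>F n in sequentially. (\<integral>\<^sup>+\<xi>. ennreal (exp (- (1 / real (Suc n)) * (norm \<xi>)\<^sup>2) * (norm (fourier_integral g \<xi>))\<^sup>2) \<partial>lborel) \<le> ennreal ((L2_norm g)\<^sup>2)"
      by (intro always_eventually allI gaussian_energy_le g) auto
  qed (simp add: Liminf_const)
  finally have *: "(\<integral>\<^sup>+\<xi>. ennreal ((norm (fourier_integral g \<xi>))\<^sup>2) \<partial>lborel) \<le> ennreal ((L2_norm g)\<^sup>2)" .
  show "fourier_integral g \<in> L2" "L2_norm (fourier_integral g) \<le> L2_norm g"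
    using L2_nnI[OF m * L2_norm_nonneg] by simp_all
qed

lemma L2_reflect:
  fixes f :: "'a::euclidean_space \<Rightarrow> 'b::{real_normed_vector,second_countable_topology}"
  assumes f: "f \<in> L2"
  shows "(\<lambda>x. f (- x)) \<in> L2" "L2_norm (\<lambda>x. f (- x)) = L2_norm f"
proof -
  note [measurable] = L2_measurable[OF f]
  show "(\<lambda>x. f (- x)) \<in> L2"
    using integrable_lborel_isometry[OF L2_integrable[OF f], of "-1" 0] by (simp add: L2_def)
  show "L2_norm (\<lambda>x. f (- x)) = L2_norm f"
    unfolding L2_norm_def using integral_lborel_isometry[of "\<lambda>x. (norm (f x))\<^sup>2" "-1" 0] by simp
qed

lemma L2_shift:
  fixes f :: "'a::euclidean_space \<Rightarrow> 'b::{real_normed_vector,second_countable_topology}"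
  assumes f: "f \<in> L2"
  shows "(\<lambda>x. f (x + a)) \<in> L2" "L2_norm (\<lambda>x. f (x + a)) = L2_norm f"
proof -
  note [measurable] = L2_measurable[OF f]
  show "(\<lambda>x. f (x + a)) \<in> L2"
    using integrable_shift[OF L2_integrable[OF f], of a] by (simp add: L2_def)
  show "L2_norm (\<lambda>x. f (x + a)) = L2_norm f"
    unfolding L2_norm_def using integral_shift[of "\<lambda>x. (norm (f x))\<^sup>2" a] by simp
qed

lemma gauss_conv_AE_subseq:
  fixes g :: "'a::euclidean_space \<Rightarrow> complex"
  assumes g: "integrable lborel g"
  shows "\<exists>r::nat\<Rightarrow>nat. strict_mono r \<and> (AE x in lborel. (\<lambda>n. gauss_conv (1 / real (Suc (r n))) g x) \<longlonglongrightarrow> g x)"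
proof -
  from tendsto_L1_AE_subseq[OF gauss_conv_tendsto_L1[OF g]] obtain r :: "nat \<Rightarrow> nat" where
    r: "strict_mono r" "AE x in lborel. (\<lambda>n. gauss_conv (1 / real (Suc (r n))) g x - g x) \<longlonglongrightarrow> 0" by auto
  from r(2) have "AE x in lborel. (\<lambda>n. gauss_conv (1 / real (Suc (r n))) g x) \<longlonglongrightarrow> g x"
    by eventually_elim (simp add: LIM_zero_iff)
  with r(1) show ?thesis by auto
qed

text \<open>The first half of Plancherel, applied to the damped transform in place of
  \<open>g\<close>, gives the opposite inequality for the regularisation. It survives in the limit
  because the regularisations converge to \<open>g\<close> almost everywhere along a
  subsequence.\<close>

lemma gauss_conv_L2:
  fixes g :: "'a::euclidean_space \<Rightarrow> complex"
  assumes g: "integrable lborel g" "g \<in> L2" and t: "t > 0"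
  shows "gauss_conv t g \<in> L2" "L2_norm (gauss_conv t g) \<le> L2_norm (fourier_integral g)"
proof -
  define f where "f \<xi> = of_real (exp (- t * (norm \<xi>)\<^sup>2)) * fourier_integral g \<xi>" for \<xi>
  note f = gaussian_cutoff[OF g(1) t, folded f_def]
  have eq: "fourier_integral f = (\<lambda>y. gauss_conv t g (- y))" using f(3) by auto
  have "(\<lambda>y. gauss_conv t g (- y)) \<in> L2" using fourier_integral_L2(1)[OF f(1,2)] by (simp add: eq)
  from L2_reflect[OF this] show L: "gauss_conv t g \<in> L2" by simp
  have "L2_norm (gauss_conv t g) = L2_norm (fourier_integral f)" using L2_reflect(2)[OF L] by (simp add: eq)
  also have "\<dots> \<le> L2_norm f" by (rule fourier_integral_L2[OF f(1,2)])
  also have "\<dots> \<le> L2_norm (fourier_integral g)"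
  proof (rule L2_mono(2)[OF _ fourier_integral_L2(1)[OF g]])
    show "f \<in> borel_measurable borel" by (rule L2_measurable[OF f(2)])
    show "norm (f x) \<le> norm (fourier_integral g x)" for x
      using t by (simp add: f_def norm_mult mult_left_le_one_le)
  qed
  finally show "L2_norm (gauss_conv t g) \<le> L2_norm (fourier_integral g)" .
qed

lemma Plancherel_L1_L2:
  fixes g :: "'a::euclidean_space \<Rightarrow> complex"
  assumes g: "integrable lborel g" "g \<in> L2"
  shows "L2_norm (fourier_integral g) = L2_norm g"
proof (rule antisym[OF fourier_integral_L2(2)[OF g]])
  obtain r :: "nat \<Rightarrow> nat" where r: "AE x in lborel. (\<lambda>n. gauss_conv (1 / real (Suc (r n))) g x) \<longlonglongrightarrow> g x"
    using gauss_conv_AE_subseq[OF g(1)] by auto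
  show "L2_norm g \<le> L2_norm (fourier_integral g)"
    by (rule L2_Fatou(2)[OF gauss_conv_L2(1)[OF g] L2_measurable[OF g(2)] r])
       (auto intro!: always_eventually gauss_conv_L2(2)[OF g])
qed

section \<open>Extension of the transform to all of L2 by truncation\<close>

definition trunc :: "real \<Rightarrow> ('a::euclidean_space \<Rightarrow> complex) \<Rightarrow> 'a \<Rightarrow> complex" where
  "trunc R g x = indicator (cball 0 R) x *\<^sub>R g x"

lemma is_fourier_altdef:
  "is_fourier g h \<longleftrightarrow> h \<in> L2 \<and> (\<forall>R. fourier_integral (trunc R g) \<in> L2) \<and>
      ((\<lambda>R. L2_norm (\<lambda>\<xi>. fourier_integral (trunc R g) \<xi> - h \<xi>)) \<longlongrightarrow> 0) at_top"
  by (simp add: is_fourier_def trunc_def[abs_def])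

lemma indicator_L2:
  assumes "A \<in> sets borel" "emeasure lborel A < \<infinity>"
  shows "(\<lambda>x. indicator A x :: real) \<in> L2"
proof -
  have "(\<lambda>x. (norm (indicator A x :: real))\<^sup>2) = (\<lambda>x. indicator A x)" by (auto simp: indicator_def)
  then show ?thesis using assms by (simp add: L2_def integrable_indicator_iff)
qed

lemma L2_imp_integrable_on:
  fixes g :: "'a::euclidean_space \<Rightarrow> complex"
  assumes g: "g \<in> L2" and A: "A \<in> sets borel" "emeasure lborel A < \<infinity>"
  shows "integrable lborel (\<lambda>x. indicator A x *\<^sub>R g x)"
proof -
  note [measurable] = L2_measurable[OF g] A(1)
  show ?thesis
    by (rule Bochner_Integration.integrable_bound[OF L2_Cauchy_Schwarz(1)[OF indicator_L2[OF A] g]]) auto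
qed

lemma trunc_L2:
  fixes g :: "'a::euclidean_space \<Rightarrow> complex"
  assumes g: "g \<in> L2"
  shows "trunc R g \<in> L2" "integrable lborel (trunc R g)"
proof -
  note [measurable] = L2_measurable[OF g]
  have [measurable]: "cball 0 R \<in> sets borel" by simp
  have m: "trunc R g \<in> borel_measurable borel" unfolding trunc_def[abs_def] by measurable
  show "trunc R g \<in> L2" by (rule L2_mono(1)[OF m g]) (simp add: trunc_def indicator_def)
  show "integrable lborel (trunc R g)"
    unfolding trunc_def[abs_def] by (rule L2_imp_integrable_on[OF g _ emeasure_lborel_cball_finite]) simp
qed

lemma trunc_tendsto:
  fixes g :: "'a::euclidean_space \<Rightarrow> complex"
  assumes g: "g \<in> L2"
  shows "((\<lambda>R. L2_norm (\<lambda>x. trunc R g x - g x)) \<longlongrightarrow> 0) at_top"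
proof -
  note [measurable] = L2_measurable[OF g] L2_measurable[OF trunc_L2(1)[OF g]]
  have "((\<lambda>R. \<integral>x. (norm (trunc R g x - g x))\<^sup>2 \<partial>lborel) \<longlongrightarrow> (\<integral>x. 0 \<partial>(lborel::'a measure))) at_top"
  proof (rule integral_dominated_convergence_at_top[where w="\<lambda>x. (norm (g x))\<^sup>2"])
    show "AE x in lborel. ((\<lambda>R. (norm (trunc R g x - g x))\<^sup>2) \<longlongrightarrow> 0) at_top"
    proof (intro AE_I2 tendsto_eventually)
      fix x
      show "\<forall>\<^sub>F R in at_top. (norm (trunc R g x - g x))\<^sup>2 = 0"
        using eventually_ge_at_top[of "norm x"] by eventually_elim (simp add: trunc_def)
    qed
    show "\<forall>\<^sub>F R in at_top. AE x in lborel. norm ((norm (trunc R g x - g x))\<^sup>2) \<le> (norm (g x))\<^sup>2"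
      by (intro always_eventually allI AE_I2) (simp add: trunc_def indicator_def)
  qed (use L2_integrable[OF g] in auto)
  then have "((\<lambda>R. sqrt (\<integral>x. (norm (trunc R g x - g x))\<^sup>2 \<partial>lborel)) \<longlongrightarrow> sqrt 0) at_top"
    by (intro tendsto_real_sqrt) simp
  then show ?thesis by (simp add: L2_norm_def)
qed

lemma L2_norm_triangle3:
  fixes f g h :: "'a::euclidean_space \<Rightarrow> complex"
  assumes "f \<in> L2" "g \<in> L2" "h \<in> L2"
  shows "L2_norm (\<lambda>x. f x - h x) \<le> L2_norm (\<lambda>x. f x - g x) + L2_norm (\<lambda>x. g x - h x)"
  using L2_norm_triangle[OF L2_diff(1)[OF assms(1,2)] L2_diff(1)[OF assms(2,3)]] by simp

lemma fourier_integral_diff_norm: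
  fixes f g :: "'a::euclidean_space \<Rightarrow> complex"
  assumes "integrable lborel f" "f \<in> L2" "integrable lborel g" "g \<in> L2"
  shows "L2_norm (\<lambda>\<xi>. fourier_integral f \<xi> - fourier_integral g \<xi>) = L2_norm (\<lambda>x. f x - g x)"
proof -
  have "fourier_integral (\<lambda>x. f x - g x) = (\<lambda>\<xi>. fourier_integral f \<xi> - fourier_integral g \<xi>)"
    using assms by (intro ext fourier_integral_diff)
  with Plancherel_L1_L2[of "\<lambda>x. f x - g x"] assms show ?thesis by (simp add: L2_diff)
qed

lemma is_fourier_exists:
  fixes g :: "'a::euclidean_space \<Rightarrow> complex"
  assumes g: "g \<in> L2"
  shows "\<exists>h. is_fourier g h"
proof -
  define T where "T R = trunc R g" for R
  define F where "F R = fourier_integral (T R)" for R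
  note T = trunc_L2[OF g, folded T_def]
  have F: "F R \<in> L2" for R unfolding F_def by (rule fourier_integral_L2(1)[OF T(2,1)])
  have FF: "L2_norm (\<lambda>x. F R x - F S x) \<le> L2_norm (\<lambda>x. T R x - g x) + L2_norm (\<lambda>x. T S x - g x)" for R S
    unfolding F_def fourier_integral_diff_norm[OF T(2,1) T(2,1)]
    using L2_norm_triangle3[OF T(1) g T(1), of R S] by (simp add: L2_norm_minus_commute[of g])
  have lim: "((\<lambda>R. L2_norm (\<lambda>x. T R x - g x)) \<longlongrightarrow> 0) at_top"
    using trunc_tendsto[OF g] by (simp add: T_def)
  then have limn: "(\<lambda>n. L2_norm (\<lambda>x. T (real n) x - g x)) \<longlonglongrightarrow> 0"
    by (rule filterlim_compose[OF _ filterlim_real_sequentially])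
  have "\<exists>N. \<forall>m\<ge>N. \<forall>n\<ge>N. L2_norm (\<lambda>x. F (real m) x - F (real n) x) < e" if "e > 0" for e
  proof -
    from order_tendstoD(2)[OF limn, of "e/2"] that obtain N where
      N: "\<And>n. n \<ge> N \<Longrightarrow> L2_norm (\<lambda>x. T (real n) x - g x) < e/2" by (auto simp: eventually_sequentially)
    have "L2_norm (\<lambda>x. F (real m) x - F (real n) x) < e" if "m \<ge> N" "n \<ge> N" for m n
      using FF[of "real m" "real n"] N[of m] N[of n] that by simp
    then show ?thesis by auto
  qed
  from L2_complete[of "\<lambda>n. F (real n)", OF F this] obtain h where
    h: "h \<in> L2" "(\<lambda>n. L2_norm (\<lambda>x. F (real n) x - h x)) \<longlonglongrightarrow> 0" by auto
  \<comment> \<open>Letting n tend to infinity with \<open>R\<close> fixed bounds the distance at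
    every real radius, so the limit along the integers is also the limit along
    \<open>at_top\<close>.\<close>
  have le: "L2_norm (\<lambda>x. F R x - h x) \<le> L2_norm (\<lambda>x. T R x - g x)" for R
  proof (rule LIMSEQ_le_const)
    have "(\<lambda>n. L2_norm (\<lambda>x. T R x - g x) + L2_norm (\<lambda>x. T (real n) x - g x) + L2_norm (\<lambda>x. F (real n) x - h x)) \<longlonglongrightarrow>
       L2_norm (\<lambda>x. T R x - g x) + 0 + 0"
      by (intro tendsto_intros limn h)
    then show "(\<lambda>n. L2_norm (\<lambda>x. T R x - g x) + L2_norm (\<lambda>x. T (real n) x - g x) + L2_norm (\<lambda>x. F (real n) x - h x)) \<longlonglongrightarrow>
       L2_norm (\<lambda>x. T R x - g x)" by simp
    show "\<exists>N. \<forall>n\<ge>N. L2_norm (\<lambda>x. F R x - h x) \<le> L2_norm (\<lambda>x. T R x - g x) + L2_norm (\<lambda>x. T (real n) x - g x) + L2_norm (\<lambda>x. F (real n) x - h x)"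
      using FF[of R] L2_norm_triangle3[OF F F h(1), of R] by (meson add_right_mono order_trans)
  qed
  have "((\<lambda>R. L2_norm (\<lambda>x. F R x - h x)) \<longlongrightarrow> 0) at_top"
    by (rule tendsto_sandwich[OF _ _ tendsto_const lim]) (use le in auto)
  with F h(1) have "is_fourier g h"
    by (auto simp: is_fourier_altdef F_def T_def)
  then show ?thesis by blast
qed

lemma is_fourier_fourier:
  fixes g :: "'a::euclidean_space \<Rightarrow> complex"
  shows "g \<in> L2 \<Longrightarrow> is_fourier g (fourier g)"
  unfolding fourier_def using is_fourier_exists[of g] by (rule someI_ex)

lemma fourier_L2:
  fixes g :: "'a::euclidean_space \<Rightarrow> complex"
  assumes "g \<in> L2"
  shows "fourier g \<in> L2"
  using is_fourier_fourier[OF assms] by (simp add: is_fourier_def Let_def)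

lemma L2_eq_AE:
  fixes f g :: "'a::euclidean_space \<Rightarrow> complex"
  assumes "f \<in> L2" "g \<in> L2" "\<And>e. e > 0 \<Longrightarrow> L2_norm (\<lambda>x. f x - g x) \<le> e"
  shows "AE x in lborel. f x = g x"
proof -
  have "L2_norm (\<lambda>x. f x - g x) \<le> 0" by (rule field_le_epsilon) (use assms(3) in auto)
  then have "L2_norm (\<lambda>x. f x - g x) = 0" by (simp add: antisym)
  from L2_norm_eq_0[OF L2_diff(1)[OF assms(1,2)] this] show ?thesis by simp
qed

lemma Plancherel:
  fixes g :: "'a::euclidean_space \<Rightarrow> complex"
  assumes g: "g \<in> L2"
  shows "L2_norm (fourier g) = L2_norm g"
proof -
  note F = is_fourier_fourier[OF g, unfolded is_fourier_altdef]
  note T = trunc_L2[OF g]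
  have "((\<lambda>R. L2_norm (fourier_integral (trunc R g))) \<longlongrightarrow> L2_norm (fourier g)) at_top"
  proof (rule Lim_transform2[OF tendsto_const])
    show "((\<lambda>R. L2_norm (fourier g) - L2_norm (fourier_integral (trunc R g))) \<longlongrightarrow> 0) at_top"
      by (rule tendsto_0_le[of "\<lambda>R. L2_norm (\<lambda>\<xi>. fourier_integral (trunc R g) \<xi> - fourier g \<xi>)" _ _ 1])
         (use F L2_norm_triangle_ineq3[of "fourier_integral (trunc _ g)" "fourier g"] in \<open>auto intro!: always_eventually simp: abs_minus_commute\<close>)
  qed
  moreover have "((\<lambda>R. L2_norm (trunc R g)) \<longlongrightarrow> L2_norm g) at_top"
  proof (rule Lim_transform2[OF tendsto_const])
    show "((\<lambda>R. L2_norm g - L2_norm (trunc R g)) \<longlongrightarrow> 0) at_top"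
      by (rule tendsto_0_le[OF trunc_tendsto[OF g], of _ 1])
         (use L2_norm_triangle_ineq3[OF T(1) g] in \<open>auto intro!: always_eventually simp: abs_minus_commute\<close>)
  qed
  ultimately show ?thesis
    unfolding Plancherel_L1_L2[OF T(2,1)] by (rule tendsto_unique[rotated]) simp
qed

text \<open>The form in which the defining limit of the chosen representative enters the rules
  below.\<close>

lemma fourier_approx:
  fixes g :: "'a::euclidean_space \<Rightarrow> complex"
  assumes g: "g \<in> L2" and e: "e > 0"
  obtains f where "f \<in> L2" "integrable lborel f" "L2_norm (\<lambda>x. f x - g x) \<le> e" "L2_norm (\<lambda>\<xi>. fourier_integral f \<xi> - fourier g \<xi>) \<le> e"
proof -
  note F = is_fourier_fourier[OF g, unfolded is_fourier_altdef]
  have "\<forall>\<^sub>F R in at_top. L2_norm (\<lambda>x. trunc R g x - g x) < e \<and> L2_norm (\<lambda>\<xi>. fourier_integral (trunc R g) \<xi> - fourier g \<xi>) < e"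
    using order_tendstoD(2)[OF trunc_tendsto[OF g] e]
      order_tendstoD(2)[OF conjunct2[OF conjunct2[OF F]] e]
    by (rule eventually_conj)
  then obtain R where "L2_norm (\<lambda>x. trunc R g x - g x) < e" "L2_norm (\<lambda>\<xi>. fourier_integral (trunc R g) \<xi> - fourier g \<xi>) < e"
    by (auto simp: eventually_at_top_linorder)
  with that[of "trunc R g"] trunc_L2[OF g] show thesis by (simp add: less_imp_le)
qed

text \<open>Two approximations of \<open>g\<close>, one from the definition and one supplied, have
  close transforms by Plancherel on integrable functions. Hence identities that are plain for
  Fourier integrals pass to L2; linearity, congruence, reflection and shift are instances.\<close>

lemma fourier_eqI:
  fixes g h :: "'a::euclidean_space \<Rightarrow> complex"
  assumes g: "g \<in> L2" and h: "h \<in> L2"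
    and ap: "\<And>e. e > 0 \<Longrightarrow> \<exists>f\<in>L2. integrable lborel f \<and> L2_norm (\<lambda>x. f x - g x) \<le> e \<and> L2_norm (\<lambda>\<xi>. fourier_integral f \<xi> - h \<xi>) \<le> e"
  shows "AE \<xi> in lborel. fourier g \<xi> = h \<xi>"
proof (rule L2_eq_AE[OF fourier_L2[OF g] h])
  fix e :: real assume e: "e > 0"
  then obtain f where f: "f \<in> L2" "integrable lborel f" "L2_norm (\<lambda>x. f x - g x) \<le> e/4" "L2_norm (\<lambda>\<xi>. fourier_integral f \<xi> - h \<xi>) \<le> e/4"
    using ap[of "e/4"] by auto
  have "e/4 > 0" using e by simp
  then obtain k where k: "k \<in> L2" "integrable lborel k" "L2_norm (\<lambda>x. k x - g x) \<le> e/4" "L2_norm (\<lambda>\<xi>. fourier_integral k \<xi> - fourier g \<xi>) \<le> e/4"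
    using fourier_approx[OF g] by metis
  have "L2_norm (\<lambda>\<xi>. fourier_integral k \<xi> - fourier_integral f \<xi>) = L2_norm (\<lambda>x. k x - f x)"
    by (rule fourier_integral_diff_norm[OF k(2,1) f(2,1)])
  also have "\<dots> \<le> e/4 + e/4"
    using L2_norm_triangle3[OF k(1) g f(1)] k(3) f(3) by (simp add: L2_norm_minus_commute[of g])
  finally have 1: "L2_norm (\<lambda>\<xi>. fourier_integral k \<xi> - fourier_integral f \<xi>) \<le> e/2" by simp
  note L = fourier_L2[OF g] fourier_integral_L2(1)[OF k(2,1)] fourier_integral_L2(1)[OF f(2,1)]
  have "L2_norm (\<lambda>x. fourier g x - h x) \<le> L2_norm (\<lambda>\<xi>. fourier g \<xi> - fourier_integral k \<xi>) + L2_norm (\<lambda>\<xi>. fourier_integral k \<xi> - h \<xi>)"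
    by (rule L2_norm_triangle3[OF L(1,2) h])
  also have "L2_norm (\<lambda>\<xi>. fourier_integral k \<xi> - h \<xi>) \<le> L2_norm (\<lambda>\<xi>. fourier_integral k \<xi> - fourier_integral f \<xi>) + L2_norm (\<lambda>\<xi>. fourier_integral f \<xi> - h \<xi>)"
    by (rule L2_norm_triangle3[OF L(2,3) h])
  finally show "L2_norm (\<lambda>x. fourier g x - h x) \<le> e"
    using 1 k(4) f(4) by (simp add: L2_norm_minus_commute[of "fourier g"])
qed

section \<open>Calculus rules and inversion for the transform on L2\<close>

lemma fourier_eq_integral:
  fixes g :: "'a::euclidean_space \<Rightarrow> complex"
  assumes "g \<in> L2" "integrable lborel g"
  shows "AE \<xi> in lborel. fourier g \<xi> = fourier_integral g \<xi>"
  by (rule fourier_eqI[OF assms(1) fourier_integral_L2(1)[OF assms(2,1)]], rule bexI[of _ g]) (use assms in simp_all)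

lemma fourier_linear:
  fixes f g :: "'a::euclidean_space \<Rightarrow> complex"
  assumes f: "f \<in> L2" and g: "g \<in> L2"
  shows "AE \<xi> in lborel. fourier (\<lambda>x. a * f x + b * g x) \<xi> = a * fourier f \<xi> + b * fourier g \<xi>"
proof (rule fourier_eqI)
  show "(\<lambda>x. a * f x + b * g x) \<in> L2" "(\<lambda>x. a * fourier f x + b * fourier g x) \<in> L2"
    using f g fourier_L2 by (auto intro!: L2_add L2_mult)
  fix e :: real assume e: "e > 0"
  define d where "d = e / (cmod a + cmod b + 1)"
  have d: "d > 0" "cmod a * d + cmod b * d \<le> e"
  proof -
    have s: "cmod a + cmod b + 1 > 0" by (simp add: add_nonneg_pos)
    then show "d > 0" using e by (simp add: d_def)
    have "cmod a * d + cmod b * d \<le> (cmod a + cmod b + 1) * d" using \<open>d > 0\<close> by (simp add: distrib_right)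
    also have "\<dots> = e" using s by (simp add: d_def)
    finally show "cmod a * d + cmod b * d \<le> e" .
  qed
  obtain f' where f': "f' \<in> L2" "integrable lborel f'" "L2_norm (\<lambda>x. f' x - f x) \<le> d" "L2_norm (\<lambda>\<xi>. fourier_integral f' \<xi> - fourier f \<xi>) \<le> d"
    using fourier_approx[OF f d(1)] .
  obtain g' where g': "g' \<in> L2" "integrable lborel g'" "L2_norm (\<lambda>x. g' x - g x) \<le> d" "L2_norm (\<lambda>\<xi>. fourier_integral g' \<xi> - fourier g \<xi>) \<le> d"
    using fourier_approx[OF g d(1)] .
  have key: "L2_norm (\<lambda>x. a * p x + b * q x - (a * r x + b * s x)) \<le> e"
    if "p \<in> L2" "q \<in> L2" "r \<in> L2" "s \<in> L2" "L2_norm (\<lambda>x. p x - r x) \<le> d" "L2_norm (\<lambda>x. q x - s x) \<le> d"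
    for p q r s :: "'a \<Rightarrow> complex"
  proof -
    have L: "(\<lambda>x. p x - r x) \<in> L2" "(\<lambda>x. q x - s x) \<in> L2" using that by (auto intro: L2_diff)
    have "L2_norm (\<lambda>x. a * p x + b * q x - (a * r x + b * s x)) = L2_norm (\<lambda>x. a * (p x - r x) + b * (q x - s x))"
      by (rule L2_norm_cong) (simp add: algebra_simps)
    also have "\<dots> \<le> cmod a * L2_norm (\<lambda>x. p x - r x) + cmod b * L2_norm (\<lambda>x. q x - s x)"
      using L2_norm_triangle[OF L2_mult(1)[OF L(1), of a] L2_mult(1)[OF L(2), of b]] L by (simp add: L2_mult)
    also have "\<dots> \<le> cmod a * d + cmod b * d" using that by (intro add_mono mult_left_mono) auto
    finally show ?thesis using d(2) by simp
  qed
  have i: "integrable lborel (\<lambda>x. a * f' x + b * g' x)" using f' g' by auto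
  have eq: "fourier_integral (\<lambda>x. a * f' x + b * g' x) \<xi> = a * fourier_integral f' \<xi> + b * fourier_integral g' \<xi>" for \<xi>
    using f'(2) g'(2) by (simp add: fourier_integral_add fourier_integral_cmult)
  show "\<exists>fa\<in>L2. integrable lborel fa \<and> L2_norm (\<lambda>x. fa x - (a * f x + b * g x)) \<le> e \<and>
              L2_norm (\<lambda>\<xi>. fourier_integral fa \<xi> - (a * fourier f \<xi> + b * fourier g \<xi>)) \<le> e"
    using f' g' f g fourier_L2 fourier_integral_L2(1) i
    by (intro bexI[of _ "\<lambda>x. a * f' x + b * g' x"] conjI) (auto simp: eq intro!: key L2_add L2_mult)
qed

lemma fourier_cong_AE:
  fixes f g :: "'a::euclidean_space \<Rightarrow> complex"
  assumes f: "f \<in> L2" and g: "g \<in> L2" and eq: "AE x in lborel. f x = g x"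
  shows "AE \<xi> in lborel. fourier f \<xi> = fourier g \<xi>"
proof (rule fourier_eqI[OF f fourier_L2[OF g]])
  fix e :: real assume e: "e > 0"
  obtain g' where g': "g' \<in> L2" "integrable lborel g'" "L2_norm (\<lambda>x. g' x - g x) \<le> e" "L2_norm (\<lambda>\<xi>. fourier_integral g' \<xi> - fourier g \<xi>) \<le> e"
    using fourier_approx[OF g e] .
  note [measurable] = L2_measurable[OF f] L2_measurable[OF g] L2_measurable[OF g'(1)]
  have "L2_norm (\<lambda>x. g' x - f x) = L2_norm (\<lambda>x. g' x - g x)"
    using eq by (intro L2_norm_cong_AE) (auto elim!: eventually_mono)
  with g' show "\<exists>h\<in>L2. integrable lborel h \<and> L2_norm (\<lambda>x. h x - f x) \<le> e \<and> L2_norm (\<lambda>\<xi>. fourier_integral h \<xi> - fourier g \<xi>) \<le> e"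
    by auto
qed

lemma fourier_reflect:
  fixes f :: "'a::euclidean_space \<Rightarrow> complex"
  assumes f: "f \<in> L2"
  shows "AE \<xi> in lborel. fourier (\<lambda>x. f (- x)) \<xi> = fourier f (- \<xi>)"
proof (rule fourier_eqI[OF L2_reflect(1)[OF f] L2_reflect(1)[OF fourier_L2[OF f]]])
  fix e :: real assume e: "e > 0"
  obtain g where g: "g \<in> L2" "integrable lborel g" "L2_norm (\<lambda>x. g x - f x) \<le> e" "L2_norm (\<lambda>\<xi>. fourier_integral g \<xi> - fourier f \<xi>) \<le> e"
    using fourier_approx[OF f e] .
  note [measurable] = L2_measurable[OF g(1)]
  have eq: "fourier_integral (\<lambda>x. g (- x)) \<xi> = fourier_integral g (- \<xi>)" for \<xi>
    unfolding fourier_integral_altdef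
    using integral_lborel_isometry[of "\<lambda>x. exp (- (\<i> * of_real (x \<bullet> (- \<xi>)))) * g x" "-1" 0] by simp
  show "\<exists>h\<in>L2. integrable lborel h \<and> L2_norm (\<lambda>x. h x - f (- x)) \<le> e \<and> L2_norm (\<lambda>\<xi>. fourier_integral h \<xi> - fourier f (- \<xi>)) \<le> e"
    using L2_reflect(1)[OF g(1)] integrable_lborel_isometry[OF g(2), of "-1" 0]
      L2_reflect(2)[OF L2_diff(1)[OF g(1) f]] L2_reflect(2)[OF L2_diff(1)[OF fourier_integral_L2(1)[OF g(2,1)] fourier_L2[OF f]]] g(3,4)
    by (intro bexI[of _ "\<lambda>x. g (- x)"] conjI) (auto simp: eq)
qed

lemma fourier_shift:
  fixes f :: "'a::euclidean_space \<Rightarrow> complex"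
  assumes f: "f \<in> L2"
  shows "AE \<xi> in lborel. fourier (\<lambda>x. f (x + a)) \<xi> = exp (\<i> * of_real (a \<bullet> \<xi>)) * fourier f \<xi>"
proof (rule fourier_eqI[OF L2_shift(1)[OF f]])
  note [measurable] = L2_measurable[OF fourier_L2[OF f]]
  show "(\<lambda>\<xi>. exp (\<i> * of_real (a \<bullet> \<xi>)) * fourier f \<xi>) \<in> L2"
    by (rule L2_mono(1)[OF _ fourier_L2[OF f]]) (auto simp: norm_mult)
  fix e :: real assume e: "e > 0"
  obtain g where g: "g \<in> L2" "integrable lborel g" "L2_norm (\<lambda>x. g x - f x) \<le> e" "L2_norm (\<lambda>\<xi>. fourier_integral g \<xi> - fourier f \<xi>) \<le> e"
    using fourier_approx[OF f e] .
  note [measurable] = L2_measurable[OF g(1)]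
  have eq: "fourier_integral (\<lambda>x. g (x + a)) \<xi> = exp (\<i> * of_real (a \<bullet> \<xi>)) * fourier_integral g \<xi>" for \<xi>
  proof -
    have "(\<integral>x. exp (- (\<i> * of_real (x \<bullet> \<xi>))) * g (x + a) \<partial>lborel) = (\<integral>x. exp (\<i> * of_real (a \<bullet> \<xi>)) * (exp (- (\<i> * of_real ((x + a) \<bullet> \<xi>))) * g (x + a)) \<partial>lborel)"
      by (intro Bochner_Integration.integral_cong refl) (simp add: inner_add_left distrib_left flip: exp_add mult.assoc)
    also have "\<dots> = exp (\<i> * of_real (a \<bullet> \<xi>)) * (\<integral>x. exp (- (\<i> * of_real (x \<bullet> \<xi>))) * g x \<partial>lborel)"
      by (subst integral_mult_right_zero, subst integral_shift[of "\<lambda>x. exp (- (\<i> * of_real (x \<bullet> \<xi>))) * g x"]) auto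
    finally show ?thesis unfolding fourier_integral_altdef by simp
  qed
  have "L2_norm (\<lambda>\<xi>. exp (\<i> * of_real (a \<bullet> \<xi>)) * fourier_integral g \<xi> - exp (\<i> * of_real (a \<bullet> \<xi>)) * fourier f \<xi>) = L2_norm (\<lambda>\<xi>. fourier_integral g \<xi> - fourier f \<xi>)"
    by (rule L2_norm_cong) (simp add: norm_mult flip: right_diff_distrib)
  then show "\<exists>h\<in>L2. integrable lborel h \<and> L2_norm (\<lambda>x. h x - f (x + a)) \<le> e \<and>
      L2_norm (\<lambda>\<xi>. fourier_integral h \<xi> - exp (\<i> * of_real (a \<bullet> \<xi>)) * fourier f \<xi>) \<le> e"
    using L2_shift(1)[OF g(1)] integrable_shift[OF g(2)]
      L2_shift(2)[OF L2_diff(1)[OF g(1) f]] g(3,4)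
    by (intro bexI[of _ "\<lambda>x. g (x + a)"] conjI) (auto simp: eq)
qed

lemma fourier_diff:
  fixes f g :: "'a::euclidean_space \<Rightarrow> complex"
  assumes f: "f \<in> L2" and g: "g \<in> L2"
  shows "AE \<xi> in lborel. fourier (\<lambda>x. f x - g x) \<xi> = fourier f \<xi> - fourier g \<xi>"
  using fourier_linear[OF f g, of 1 "-1"] by simp

lemma fourier_diff_norm:
  fixes f g :: "'a::euclidean_space \<Rightarrow> complex"
  assumes f: "f \<in> L2" and g: "g \<in> L2"
  shows "L2_norm (\<lambda>\<xi>. fourier f \<xi> - fourier g \<xi>) = L2_norm (\<lambda>x. f x - g x)"
proof -
  have "L2_norm (\<lambda>\<xi>. fourier f \<xi> - fourier g \<xi>) = L2_norm (fourier (\<lambda>x. f x - g x))"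
    using fourier_diff[OF f g] f g
    by (intro L2_norm_cong_AE) (auto intro!: L2_measurable L2_diff fourier_L2 elim!: eventually_mono)
  then show ?thesis using Plancherel[OF L2_diff(1)[OF f g]] by simp
qed

text \<open>The damped transforms converge in L2 to the transform of \<open>g\<close>, so their own
  transforms converge in L2 to \<open>fourier (fourier g)\<close>. These are also reflected heat
  regularisations of \<open>g\<close>, which converge almost everywhere along a subsequence; Fatou
  shows that both limits agree.\<close>

lemma fourier_fourier_L1:
  fixes g :: "'a::euclidean_space \<Rightarrow> complex"
  assumes g: "integrable lborel g" "g \<in> L2"
  shows "AE x in lborel. fourier (fourier g) x = g (- x)"
proof -
  define G where "G = fourier_integral g"
  have G: "G \<in> L2" unfolding G_def by (rule fourier_integral_L2(1)[OF g])
  note [measurable] = L2_measurable[OF G] L2_measurable[OF g(2)]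
  define f where "f n \<xi> = of_real (exp (- (1 / real (Suc n)) * (norm \<xi>)\<^sup>2)) * G \<xi>" for n \<xi>
  have f: "integrable lborel (f n)" "f n \<in> L2" "fourier_integral (f n) y = gauss_conv (1 / real (Suc n)) g (- y)" for n y
    unfolding f_def G_def using gaussian_cutoff[OF g(1), of "1 / real (Suc n)"] by simp_all
  have [measurable]: "f n \<in> borel_measurable borel" for n by (rule L2_measurable[OF f(2)])
  have fG: "(\<lambda>n. L2_norm (\<lambda>\<xi>. f n \<xi> - G \<xi>)) \<longlonglongrightarrow> 0"
  proof -
    have "(\<lambda>n. \<integral>\<xi>. (norm (f n \<xi> - G \<xi>))\<^sup>2 \<partial>lborel) \<longlonglongrightarrow> (\<integral>\<xi>. 0 \<partial>(lborel::'a measure))"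
    proof (rule integral_dominated_convergence[where w="\<lambda>\<xi>. (norm (G \<xi>))\<^sup>2"])
      show "AE \<xi> in lborel. (\<lambda>n. (norm (f n \<xi> - G \<xi>))\<^sup>2) \<longlonglongrightarrow> 0"
      proof (intro AE_I2)
        fix \<xi> :: 'a
        have "(\<lambda>n. exp (- (1 / real (Suc n)) * (norm \<xi>)\<^sup>2)) \<longlonglongrightarrow> 1" by real_asymp
        then have "(\<lambda>n. (norm (f n \<xi> - G \<xi>))\<^sup>2) \<longlonglongrightarrow> (norm (of_real 1 * G \<xi> - G \<xi>))\<^sup>2"
          unfolding f_def by (intro tendsto_intros)
        then show "(\<lambda>n. (norm (f n \<xi> - G \<xi>))\<^sup>2) \<longlonglongrightarrow> 0" by simp
      qed
      show "AE \<xi> in lborel. norm ((norm (f n \<xi> - G \<xi>))\<^sup>2) \<le> (norm (G \<xi>))\<^sup>2" for n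
      proof (intro AE_I2)
        fix \<xi> :: 'a
        define a where "a = exp (- (1 / real (Suc n)) * (norm \<xi>)\<^sup>2)"
        have a: "0 \<le> a" "a \<le> 1" by (auto simp: a_def)
        have "f n \<xi> - G \<xi> = of_real (a - 1) * G \<xi>" by (simp add: f_def a_def algebra_simps)
        then have "norm (f n \<xi> - G \<xi>) = \<bar>a - 1\<bar> * norm (G \<xi>)" by (simp only: norm_mult norm_of_real)
        also have "\<dots> \<le> norm (G \<xi>)" using a by (intro mult_left_le_one_le) auto
        finally show "norm ((norm (f n \<xi> - G \<xi>))\<^sup>2) \<le> (norm (G \<xi>))\<^sup>2" by (simp add: power_mono)
      qed
    qed (use L2_integrable[OF G] in auto)
    then have "(\<lambda>n. sqrt (\<integral>\<xi>. (norm (f n \<xi> - G \<xi>))\<^sup>2 \<partial>lborel)) \<longlonglongrightarrow> sqrt 0"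
      by (intro tendsto_real_sqrt) simp
    then show ?thesis by (simp add: L2_norm_def)
  qed
  obtain r :: "nat \<Rightarrow> nat" where r: "strict_mono r" "AE x in lborel. (\<lambda>n. gauss_conv (1 / real (Suc (r n))) g x) \<longlonglongrightarrow> g x"
    using gauss_conv_AE_subseq[OF g(1)] by auto
  have r2: "AE x in lborel. (\<lambda>n. fourier_integral (f (r n)) x) \<longlonglongrightarrow> g (- x)"
    unfolding f(3) using AE_lborel_isometry[OF r(2), of "-1" 0] by simp
  have fGr: "(\<lambda>n. L2_norm (\<lambda>\<xi>. f (r n) \<xi> - G \<xi>)) \<longlonglongrightarrow> 0"
    using LIMSEQ_subseq_LIMSEQ[OF fG r(1)] by (simp add: o_def)
  have "AE x in lborel. fourier G x = g (- x)"
  proof (rule L2_eq_AE[OF fourier_L2[OF G] L2_reflect(1)[OF g(2)]])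
    fix e :: real assume e: "e > 0"
    have L: "(\<lambda>x. fourier G x - fourier_integral (f (r n)) x) \<in> L2" for n
      using fourier_L2[OF G] fourier_integral_L2(1)[OF f(1,2)] by (rule L2_diff)
    have nm: "L2_norm (\<lambda>x. fourier G x - fourier_integral (f (r n)) x) = L2_norm (\<lambda>\<xi>. f (r n) \<xi> - G \<xi>)" for n
    proof -
      have "L2_norm (\<lambda>x. fourier G x - fourier_integral (f (r n)) x) = L2_norm (\<lambda>x. fourier G x - fourier (f (r n)) x)"
        using fourier_eq_integral[OF f(2,1), of "r n"] fourier_L2[OF G] fourier_L2[OF f(2)] fourier_integral_L2(1)[OF f(1,2)]
        by (intro L2_norm_cong_AE) (auto elim!: eventually_mono intro!: L2_measurable L2_diff)
      also have "\<dots> = L2_norm (\<lambda>x. G x - f (r n) x)" by (rule fourier_diff_norm[OF G f(2)])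
      finally show ?thesis by (simp add: L2_norm_minus_commute[of G])
    qed
    show "L2_norm (\<lambda>x. fourier G x - g (- x)) \<le> e"
    proof (rule L2_Fatou(2)[OF L])
      show "(\<lambda>x. fourier G x - g (- x)) \<in> borel_measurable borel"
        using fourier_L2[OF G] L2_reflect(1)[OF g(2)] by (intro L2_measurable L2_diff)
      show "AE x in lborel. (\<lambda>n. fourier G x - fourier_integral (f (r n)) x) \<longlonglongrightarrow> fourier G x - g (- x)"
        using r2 by eventually_elim (intro tendsto_intros)
      show "\<forall>\<^sub>F n in sequentially. L2_norm (\<lambda>x. fourier G x - fourier_integral (f (r n)) x) \<le> e"
        unfolding nm using order_tendstoD(2)[OF fGr e] by eventually_elim simp
    qed (use e in simp)
  qed
  moreover have "AE x in lborel. fourier (fourier g) x = fourier G x"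
    using fourier_eq_integral[OF g(2,1)] unfolding G_def[symmetric]
    by (rule fourier_cong_AE[OF fourier_L2[OF g(2)] G])
  ultimately show ?thesis by eventually_elim simp
qed

lemma fourier_fourier:
  fixes g :: "'a::euclidean_space \<Rightarrow> complex"
  assumes g: "g \<in> L2"
  shows "AE x in lborel. fourier (fourier g) x = g (- x)"
proof (rule L2_eq_AE[OF fourier_L2[OF fourier_L2[OF g]] L2_reflect(1)[OF g]])
  fix e :: real assume "e > 0"
  then have "e/2 > 0" by simp
  then obtain f where f: "f \<in> L2" "integrable lborel f" "L2_norm (\<lambda>x. f x - g x) \<le> e/2"
    using fourier_approx[OF g] by metis
  have "L2_norm (\<lambda>x. fourier (fourier g) x - g (- x)) \<le> L2_norm (\<lambda>x. fourier (fourier g) x - fourier (fourier f) x) + L2_norm (\<lambda>x. fourier (fourier f) x - g (- x))"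
    by (intro L2_norm_triangle3 fourier_L2 L2_reflect f g)
  also have "L2_norm (\<lambda>x. fourier (fourier g) x - fourier (fourier f) x) = L2_norm (\<lambda>x. g x - f x)"
    by (simp add: fourier_diff_norm fourier_L2 f g)
  also have "L2_norm (\<lambda>x. fourier (fourier f) x - g (- x)) = L2_norm (\<lambda>x. f (- x) - g (- x))"
    using fourier_fourier_L1[OF f(2,1)] f g
    by (intro L2_norm_cong_AE) (auto elim!: eventually_mono intro!: L2_measurable L2_diff fourier_L2 L2_reflect)
  also have "\<dots> = L2_norm (\<lambda>x. f x - g x)" by (rule L2_reflect(2)[OF L2_diff(1)[OF f(1) g]])
  finally show "L2_norm (\<lambda>x. fourier (fourier g) x - g (- x)) \<le> e"
    using f(3) by (simp add: L2_norm_minus_commute[of g])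
qed

lemma inv_fourier_L2:
  fixes h :: "'a::euclidean_space \<Rightarrow> complex"
  assumes h: "h \<in> L2"
  shows "inv_fourier h \<in> L2" "L2_norm (inv_fourier h) = L2_norm h"
    "AE \<xi> in lborel. fourier (inv_fourier h) \<xi> = h \<xi>"
proof -
  note F = fourier_L2[OF h]
  have e: "inv_fourier h = (\<lambda>x. fourier h (- x))" by (auto simp: inv_fourier_def)
  show "inv_fourier h \<in> L2" "L2_norm (inv_fourier h) = L2_norm h"
    unfolding e using L2_reflect[OF F] Plancherel[OF h] by auto
  have "AE \<xi> in lborel. fourier (fourier h) (- \<xi>) = h \<xi>"
    using AE_lborel_isometry[OF fourier_fourier[OF h], of "-1" 0] by simp
  with fourier_reflect[OF F] show "AE \<xi> in lborel. fourier (inv_fourier h) \<xi> = h \<xi>"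
    unfolding e by eventually_elim simp
qed

lemma inv_fourier_fourier:
  fixes g :: "'a::euclidean_space \<Rightarrow> complex"
  assumes g: "g \<in> L2"
  shows "AE x in lborel. inv_fourier (fourier g) x = g x"
  using AE_lborel_isometry[OF fourier_fourier[OF g], of "-1" 0] by (simp add: inv_fourier_def)

abbreviation fourier_real :: "('a::euclidean_space \<Rightarrow> real) \<Rightarrow> 'a \<Rightarrow> complex" where
  "fourier_real g \<equiv> fourier (\<lambda>x. of_real (g x))"

lemma fourier_real_L2:
  assumes "g \<in> L2"
  shows "fourier_real g \<in> L2" "L2_norm (fourier_real g) = L2_norm g"
  using fourier_L2[OF L2_of_real(1)[OF assms]] Plancherel[OF L2_of_real(1)[OF assms]]
  by (simp_all add: L2_of_real(2))

lemma fourier_real_diff: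
  assumes "f \<in> L2" "g \<in> L2"
  shows "AE \<xi> in lborel. fourier_real (\<lambda>x. f x - g x) \<xi> = fourier_real f \<xi> - fourier_real g \<xi>"
  using fourier_diff[OF L2_of_real(1)[OF assms(1)] L2_of_real(1)[OF assms(2)]] by simp

lemma fourier_multiplier_L2:
  fixes m :: "'a::euclidean_space \<Rightarrow> real"
  assumes "(\<lambda>\<xi>. of_real (m \<xi>) * fourier_real g \<xi>) \<in> L2"
  shows "fourier_multiplier m g \<in> L2"
    "L2_norm (fourier_multiplier m g) = L2_norm (\<lambda>\<xi>. of_real (m \<xi>) * fourier_real g \<xi>)"
    "AE \<xi> in lborel. fourier (fourier_multiplier m g) \<xi> = of_real (m \<xi>) * fourier_real g \<xi>"
  unfolding fourier_multiplier_def using inv_fourier_L2[OF assms] by auto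

section \<open>The Gagliardo-Nirenberg inequality\<close>

lemma nn_integral_powr_from_0:
  assumes a: "a > -1" and c: "c \<ge> 0"
  shows "(\<integral>\<^sup>+x. ennreal (x powr a) * indicator {0..c} x \<partial>lborel) = ennreal (c powr (a + 1) / (a + 1))"
proof -
  have "((\<lambda>x. x powr a * indicator {0..c} x) has_integral (c powr (a+1) / (a+1))) UNIV"
  proof -
    have "(\<lambda>x. x powr a * indicator {0..c} x) = (\<lambda>x. if x \<in> {0..c} then x powr a else 0)" by (auto simp: indicator_def)
    then show ?thesis using has_integral_powr_from_0[OF a c] has_integral_restrict_UNIV[of "{0..c}" "\<lambda>x. x powr a"] by simp
  qed
  from nn_integral_has_integral_lborel[OF _ _ this]
  have "(\<integral>\<^sup>+x. ennreal (x powr a * indicator {0..c} x) \<partial>lborel) = ennreal (c powr (a + 1) / (a + 1))" by simp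
  also have "(\<lambda>x. ennreal (x powr a * indicator {0..c} x)) = (\<lambda>x. ennreal (x powr a) * indicator {0..c} x)"
    by (auto simp: indicator_def)
  finally show ?thesis .
qed

lemma AE_inner_Basis_neq_0: "AE x in lborel. \<forall>b\<in>Basis. (x :: 'a::euclidean_space) \<bullet> b \<noteq> 0"
proof (rule eventually_ball_finite)
  show "\<forall>b\<in>Basis. AE x in lborel. (x::'a) \<bullet> b \<noteq> 0"
  proof
    fix b :: 'a assume b: "b \<in> Basis"
    have "negligible {x::'a. x \<bullet> b = 0}" using negligible_standard_hyperplane[OF b, of 0] by simp
    moreover have "closed {x::'a. x \<bullet> b = 0}" by (intro closed_Collect_eq continuous_intros)
    then have "{x::'a. x \<bullet> b = 0} \<in> sets borel" by simp
    ultimately have "{x::'a. x \<bullet> b = 0} \<in> null_sets lborel"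
      by (simp add: negligible_iff_null_sets null_sets_completion_iff)
    then show "AE x in lborel. (x::'a) \<bullet> b \<noteq> 0" by (rule AE_I') auto
  qed
qed simp

lemma AE_neq_0: "AE x in lborel. x \<noteq> (0 :: 'a::euclidean_space)"
  using AE_inner_Basis_neq_0[where 'a='a] by eventually_elim (use nonempty_Basis in auto)

text \<open>Since |x| dominates each coordinate, |x|^(-a) is at most the product of the
  |x_i|^(-a/n), and the ball lies in a cube; the integral factors into one-dimensional ones. The
  hypothesis a < n keeps each exponent above -1.\<close>

lemma nn_integral_norm_powr_ball:
  assumes a: "0 \<le> a" "a < real DIM('a::euclidean_space)"
  shows "\<exists>B>0. \<forall>A\<ge>0. (\<integral>\<^sup>+x. ennreal (norm (x::'a) powr (- a)) * indicator {x. norm x \<le> A} x \<partial>lborel)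
    \<le> ennreal (B * A powr (real DIM('a) - a))"
proof -
  define n where "n = real DIM('a)"
  have n: "n > 0" by (simp add: n_def)
  define c where "c = a / n"
  have c: "0 \<le> c" "c < 1" "c * n = a" using a n by (auto simp: c_def n_def[symmetric])
  define B where "B = (2 / (1 - c)) ^ DIM('a)"
  have "(\<integral>\<^sup>+x. ennreal (norm (x::'a) powr (- a)) * indicator {x. norm x \<le> A} x \<partial>lborel) \<le> ennreal (B * A powr (n - a))"
    if A: "A \<ge> 0" for A
  proof -
    define f where "f x = ennreal (\<bar>x\<bar> powr (- c)) * indicator {-A..A} x" for x :: real
    have [measurable]: "f \<in> borel_measurable borel" unfolding f_def[abs_def] by measurable
    have "(\<integral>\<^sup>+x. f x \<partial>lborel) \<le> (\<integral>\<^sup>+x. ennreal (x powr (- c)) * indicator {0..A} x + ennreal ((-x) powr (- c)) * indicator {0..A} (-x) \<partial>lborel)"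
      by (intro nn_integral_mono) (auto simp: f_def indicator_def)
    also have "\<dots> = (\<integral>\<^sup>+x. ennreal (x powr (- c)) * indicator {0..A} x \<partial>lborel) + (\<integral>\<^sup>+x. ennreal ((-x) powr (- c)) * indicator {0..A} (-x) \<partial>lborel)"
      by (rule nn_integral_add) measurable
    also have "(\<integral>\<^sup>+x. ennreal ((-x) powr (- c)) * indicator {0..A} (-x) \<partial>lborel) = (\<integral>\<^sup>+x. ennreal (x powr (- c)) * indicator {0..A} x \<partial>lborel)"
      using nn_integral_lborel_isometry[of "\<lambda>x. ennreal (x powr (- c)) * indicator {0..A} x" "-1" "0::real"] by simp
    also have "(\<integral>\<^sup>+x. ennreal (x powr (- c)) * indicator {0..A} x \<partial>lborel) = ennreal (A powr (- c + 1) / (- c + 1))"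
      using c A by (intro nn_integral_powr_from_0) auto
    also have "ennreal (A powr (- c + 1) / (- c + 1)) + ennreal (A powr (- c + 1) / (- c + 1)) = ennreal (2 / (1 - c) * A powr (1 - c))"
      using c by (simp flip: ennreal_plus)
    finally have f: "(\<integral>\<^sup>+x. f x \<partial>lborel) \<le> ennreal (2 / (1 - c) * A powr (1 - c))" .
    have "(\<integral>\<^sup>+x. ennreal (norm (x::'a) powr (- a)) * indicator {x. norm x \<le> A} x \<partial>lborel) \<le> (\<integral>\<^sup>+x. (\<Prod>b\<in>Basis. f ((x::'a) \<bullet> b)) \<partial>lborel)"
    \<comment> \<open>On a coordinate hyperplane \<open>0 powr (- c)\<close> is 0 and the comparison
      may fail, so these null sets are discarded.\<close>
    proof (intro nn_integral_mono_AE eventually_mono[OF AE_inner_Basis_neq_0])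
      fix x :: 'a assume x: "\<forall>b\<in>Basis. x \<bullet> b \<noteq> 0"
      show "ennreal (norm x powr (- a)) * indicator {x. norm x \<le> A} x \<le> (\<Prod>b\<in>Basis. f (x \<bullet> b))"
      proof (cases "norm x \<le> A")
        case True
        have in_A: "- A \<le> x \<bullet> b" "x \<bullet> b \<le> A" if "b \<in> Basis" for b
          using Basis_le_norm[OF that, of x] True by linarith+
        have "norm x powr (- a) = (\<Prod>b\<in>(Basis::'a set). norm x powr (- c))"
          using c(3) by (simp add: powr_powr n_def flip: powr_realpow' powr_power)
        also have "\<dots> \<le> (\<Prod>b\<in>Basis. \<bar>x \<bullet> b\<bar> powr (- c))"
          using x c Basis_le_norm[of _ x] by (intro prod_mono conjI powr_mono2') auto
        finally have "ennreal (norm x powr (- a)) \<le> (\<Prod>b\<in>Basis. ennreal (\<bar>x \<bullet> b\<bar> powr (- c)))"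
          by (subst prod_ennreal) (auto intro: ennreal_leI)
        also have "\<dots> = (\<Prod>b\<in>Basis. f (x \<bullet> b))"
          using in_A by (intro prod.cong refl) (auto simp: f_def indicator_def)
        finally show ?thesis using True by simp
      qed simp
    qed
    also have "\<dots> = (\<Prod>b\<in>(Basis::'a set). (\<integral>\<^sup>+x. f x \<partial>lborel))"
      by (rule nn_integral_lborel_prod) auto
    also have "\<dots> \<le> (\<Prod>b\<in>(Basis::'a set). ennreal (2 / (1 - c) * A powr (1 - c)))"
      by (intro prod_mono_ennreal f)
    also have "\<dots> = ennreal ((2 / (1 - c) * A powr (1 - c)) ^ DIM('a))"
      using c A by (simp add: ennreal_power)
    also have "(2 / (1 - c) * A powr (1 - c)) ^ DIM('a) = B * A powr (n - a)"
    proof -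
      have "(A powr (1 - c)) ^ DIM('a) = A powr ((1 - c) * n)"
        by (cases "A = 0") (use A n in \<open>auto simp: powr_powr n_def simp flip: powr_realpow\<close>)
      also have "(1 - c) * n = n - a" using c by (simp add: algebra_simps)
      finally show ?thesis by (simp only: B_def power_mult_distrib)
    qed
    finally show ?thesis .
  qed
  moreover have "B > 0" using c by (simp add: B_def)
  ultimately show ?thesis unfolding n_def by blast
qed

text \<open>Cauchy-Schwarz against a square integrable weight. Applied to a transform, it yields an
  L1 bound on the Fourier side and hence a bound in the supremum norm.\<close>

lemma L2_L1_bound:
  fixes h :: "'a::euclidean_space \<Rightarrow> complex" and w :: "'a \<Rightarrow> real"
  assumes h: "h \<in> borel_measurable borel" and w: "w \<in> L2" and wh: "g \<in> L2"
    and le: "AE x in lborel. norm (h x) \<le> \<bar>w x\<bar> * norm (g x :: complex)"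
  shows "integrable lborel h" "(\<integral>x. norm (h x) \<partial>lborel) \<le> L2_norm w * L2_norm g"
proof -
  note CS = L2_Cauchy_Schwarz[OF w wh, unfolded real_norm_def]
  show i: "integrable lborel h"
    by (rule Bochner_Integration.integrable_bound[OF CS(1)]) (use h le in auto)
  have "(\<integral>x. norm (h x) \<partial>lborel) \<le> (\<integral>x. \<bar>w x\<bar> * norm (g x) \<partial>lborel)"
    using le by (intro integral_mono_AE CS(1) integrable_norm[OF i])
  with CS(2) show "(\<integral>x. norm (h x) \<partial>lborel) \<le> L2_norm w * L2_norm g" by linarith
qed

lemma inv_fourier_bounded:
  fixes h :: "'a::euclidean_space \<Rightarrow> complex"
  assumes "h \<in> L2" "integrable lborel h"
  shows "AE x in lborel. norm (inv_fourier h x) \<le> fourier_const TYPE('a) * (\<integral>\<xi>. norm (h \<xi>) \<partial>lborel)"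
proof -
  have "AE x in lborel. fourier h (- x) = fourier_integral h (- x)"
    using AE_lborel_isometry[OF fourier_eq_integral[OF assms], of "-1" 0] by simp
  then show ?thesis
    by eventually_elim (simp add: inv_fourier_def norm_fourier_integral_le)
qed

lemma inv_fourier_add:
  fixes f g :: "'a::euclidean_space \<Rightarrow> complex"
  assumes "f \<in> L2" "g \<in> L2"
  shows "AE x in lborel. inv_fourier (\<lambda>\<xi>. f \<xi> + g \<xi>) x = inv_fourier f x + inv_fourier g x"
  using AE_lborel_isometry[OF fourier_linear[OF assms, of 1 1], of "-1" 0] by (simp add: inv_fourier_def)

text \<open>The level sets of \<open>u\<close> are estimated by splitting \<open>u\<close> at a frequency depending on the level,
  such that the low frequency part is bounded by half the level.\<close>

lemma level_set_bound:
  fixes u :: "'a::euclidean_space \<Rightarrow> real"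
  assumes u: "u \<in> L2" and q: "q > 2" and s: "s = real DIM('a) * (1/2 - 1/q)"
    and B: "B > 0" "\<And>A. A \<ge> 0 \<Longrightarrow> (\<integral>\<^sup>+x. ennreal (norm (x::'a) powr (- (2 * s))) * indicator {x. norm x \<le> A} x \<partial>lborel)
      \<le> ennreal (B * A powr (real DIM('a) - 2 * s))"
    and W: "(\<lambda>\<xi>. of_real (norm \<xi> powr s) * fourier_real u \<xi>) \<in> L2"
      "L2_norm (\<lambda>\<xi>. of_real (norm \<xi> powr s) * fourier_real u \<xi>) \<le> N" and N: "N > 0" and l: "l > 0"
  defines "D \<equiv> 2 * fourier_const TYPE('a) * sqrt B * N"
  shows "emeasure lborel {x. l \<le> \<bar>u x\<bar>} \<le>
    ennreal (4 / l\<^sup>2) * (\<integral>\<^sup>+\<xi>. ennreal ((norm (fourier_real u \<xi>))\<^sup>2) * indicator {\<xi>. l \<le> D * norm \<xi> powr (real DIM('a) / q)} \<xi> \<partial>lborel)"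
proof -
  define U where "U = fourier_real u"
  define n where "n = real DIM('a)"
  have n: "n > 0" by (simp add: n_def)
  have U: "U \<in> L2" unfolding U_def by (rule fourier_real_L2[OF u])
  have D: "D > 0" using B N by (simp add: D_def)
  note [measurable] = L2_measurable[OF U] L2_measurable[OF u]
  define S where "S = {\<xi>::'a. l \<le> D * norm \<xi> powr (n / q)}"
  have [measurable]: "S \<in> sets borel" unfolding S_def by measurable
  define v where "v \<xi> = indicator (- S) \<xi> *\<^sub>R U \<xi>" for \<xi>
  define w where "w \<xi> = indicator S \<xi> *\<^sub>R U \<xi>" for \<xi>
  have [measurable]: "v \<in> borel_measurable borel" "w \<in> borel_measurable borel"
    unfolding v_def[abs_def] w_def[abs_def] by measurable
  have v: "v \<in> L2" by (rule L2_mono(1)[OF _ U]) (auto simp: v_def indicator_def)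
  have w: "w \<in> L2" by (rule L2_mono(1)[OF _ U]) (auto simp: w_def indicator_def)
  \<comment> \<open>The radius solves D A^(n/q) = l, so the low frequencies lie in a ball. The
    constant \<open>D\<close> is chosen such that Cauchy-Schwarz on this ball bounds the low
    frequency part by exactly l / 2.\<close>
  define A where "A = (l / D) powr (q / n)"
  have A: "A \<ge> 0" by (simp add: A_def)
  have A2: "A powr (n / q) = l / D" using l D n q by (simp add: A_def powr_powr)
  have SA: "norm \<xi> \<le> A" if "\<xi> \<notin> S" for \<xi>
  proof -
    from that have "norm \<xi> powr (n / q) < A powr (n / q)" unfolding A2 S_def using D by (simp add: not_le field_simps)
    then show ?thesis using powr_less_cancel2[of "n/q"] n q A by (meson divide_pos_pos less_imp_le not_le norm_ge_zero powr_mono2 less_trans zero_less_numeral)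
  qed
  define z where "z \<xi> = norm \<xi> powr (- s) * indicator {\<xi>. norm \<xi> \<le> A} \<xi>" for \<xi> :: 'a
  have zm[measurable]: "z \<in> borel_measurable borel" unfolding z_def[abs_def] by measurable
  have z: "z \<in> L2" "L2_norm z \<le> sqrt B * (l / D)"
  proof -
    have "(\<integral>\<^sup>+\<xi>. ennreal ((norm (z \<xi>))\<^sup>2) \<partial>lborel) = (\<integral>\<^sup>+x. ennreal (norm (x::'a) powr (- (2 * s))) * indicator {x. norm x \<le> A} x \<partial>lborel)"
    proof (intro nn_integral_cong)
      fix \<xi> :: 'a
      have "(norm \<xi> powr (- s))\<^sup>2 = norm \<xi> powr (- (2 * s))"
        by (simp add: power2_eq_square flip: powr_add)
      then show "ennreal ((norm (z \<xi>))\<^sup>2) = ennreal (norm \<xi> powr (- (2 * s))) * indicator {x. norm x \<le> A} \<xi>"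
        by (simp add: z_def indicator_def)
    qed
    also have "\<dots> \<le> ennreal (B * A powr (real DIM('a) - 2 * s))" by (rule B(2)[OF A])
    \<comment> \<open>The exponent n - 2 s equals 2 n / q, which makes the integral over the ball a
      perfect square.\<close>
    also have "B * A powr (real DIM('a) - 2 * s) = (sqrt B * (l / D))\<^sup>2"
    proof -
      have "real DIM('a) - 2 * s = n / q + n / q" unfolding s n_def by (simp add: algebra_simps)
      then have "A powr (real DIM('a) - 2 * s) = (l / D)\<^sup>2"
        by (simp only: powr_add A2 power2_eq_square)
      then show ?thesis using B(1) by (simp only: power_mult_distrib real_sqrt_pow2 less_imp_le)
    qed
    finally have *: "(\<integral>\<^sup>+\<xi>. ennreal ((norm (z \<xi>))\<^sup>2) \<partial>lborel) \<le> ennreal ((sqrt B * (l / D))\<^sup>2)" .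
    have "0 \<le> sqrt B * (l / D)" using B l D by simp
    from L2_nnI[OF zm * this] show "z \<in> L2" "L2_norm z \<le> sqrt B * (l / D)" .
  qed
  \<comment> \<open>At the origin the two powers of 0 multiply to 0 instead of 1, so one point is
    excepted.\<close>
  have "AE \<xi> in lborel. norm (v \<xi>) \<le> \<bar>z \<xi>\<bar> * norm (of_real (norm \<xi> powr s) * U \<xi>)"
    using AE_neq_0
  proof eventually_elim
    case (elim \<xi>)
    show ?case
    proof (cases "\<xi> \<in> S")
      case False
      then show ?thesis using SA[OF False] elim
        by (simp add: z_def v_def norm_mult flip: mult.assoc powr_add)
    qed (simp add: v_def)
  qed
  from L2_L1_bound[OF _ z(1) W(1)[folded U_def] this]
  have v1: "integrable lborel v" "(\<integral>\<xi>. norm (v \<xi>) \<partial>lborel) \<le> L2_norm z * L2_norm (\<lambda>\<xi>. of_real (norm \<xi> powr s) * U \<xi>)"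
    by auto
  note v1(2)
  also have "L2_norm z * L2_norm (\<lambda>\<xi>. of_real (norm \<xi> powr s) * U \<xi>) \<le> (sqrt B * (l / D)) * N"
    using z(2) W(2) B l D by (intro mult_mono) (auto simp: U_def)
  finally have "fourier_const TYPE('a) * (\<integral>\<xi>. norm (v \<xi>) \<partial>lborel) \<le> fourier_const TYPE('a) * ((sqrt B * (l / D)) * N)"
    by (intro mult_left_mono) auto
  also have "\<dots> = l / 2" using B N fourier_const_pos(1)[where 'a='a] by (simp add: D_def less_imp_neq[symmetric])
  finally have v2: "fourier_const TYPE('a) * (\<integral>\<xi>. norm (v \<xi>) \<partial>lborel) \<le> l / 2" .
  have "AE x in lborel. of_real (u x) = inv_fourier v x + inv_fourier w x"
  proof -
    have "(\<lambda>\<xi>. v \<xi> + w \<xi>) = U" by (auto simp: v_def w_def indicator_def)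
    with inv_fourier_add[OF v w] inv_fourier_fourier[OF L2_of_real(1)[OF u], folded U_def]
    show ?thesis by (auto elim: eventually_elim2)
  qed
  with inv_fourier_bounded[OF v v1(1)]
  have "AE x in lborel. l \<le> \<bar>u x\<bar> \<longrightarrow> l / 2 \<le> norm (inv_fourier w x)"
  proof eventually_elim
    case (elim x)
    from elim(2) have "\<bar>u x\<bar> \<le> norm (inv_fourier v x) + norm (inv_fourier w x)"
      by (metis norm_of_real norm_triangle_ineq)
    then show ?case using elim(1) v2 by linarith
  qed
  note wL = inv_fourier_L2[OF w]
  note [measurable] = L2_measurable[OF wL(1)]
  \<comment> \<open>Chebyshev for the high frequency part, which reaches l / 2 wherever |u| reaches
    l.\<close>
  have "emeasure lborel {x. l \<le> \<bar>u x\<bar>} = (\<integral>\<^sup>+x. indicator {x. l \<le> \<bar>u x\<bar>} x \<partial>lborel)" by simp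
  also have "\<dots> \<le> (\<integral>\<^sup>+x. ennreal (4 / l\<^sup>2) * ennreal ((norm (inv_fourier w x))\<^sup>2) \<partial>lborel)"
  proof (intro nn_integral_mono_AE)
    show "AE x in lborel. indicator {x. l \<le> \<bar>u x\<bar>} x \<le> ennreal (4 / l\<^sup>2) * ennreal ((norm (inv_fourier w x))\<^sup>2)"
      using \<open>AE x in lborel. l \<le> \<bar>u x\<bar> \<longrightarrow> l / 2 \<le> norm (inv_fourier w x)\<close>
    proof eventually_elim
      case (elim x)
      show ?case
      proof (cases "l \<le> \<bar>u x\<bar>")
        case True
        then have "(l / 2)\<^sup>2 \<le> (norm (inv_fourier w x))\<^sup>2" using elim l by (intro power_mono) auto
        then have "1 \<le> 4 / l\<^sup>2 * (norm (inv_fourier w x))\<^sup>2" using l by (simp add: power_divide field_simps)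
        then show ?thesis using True by (simp flip: ennreal_mult)
      qed simp
    qed
  qed
  also have "\<dots> = ennreal (4 / l\<^sup>2) * (\<integral>\<^sup>+\<xi>. ennreal ((norm (w \<xi>))\<^sup>2) \<partial>lborel)"
    by (simp add: nn_integral_cmult nn_integral_L2[OF wL(1)] nn_integral_L2[OF w] wL(2))
  also have "(\<integral>\<^sup>+\<xi>. ennreal ((norm (w \<xi>))\<^sup>2) \<partial>lborel) = (\<integral>\<^sup>+\<xi>. ennreal ((norm (U \<xi>))\<^sup>2) * indicator S \<xi> \<partial>lborel)"
    by (intro nn_integral_cong) (auto simp: w_def indicator_def)
  finally show ?thesis by (simp add: S_def U_def n_def)
qed

text \<open>Layer cake and \<open>level_set_bound\<close>, followed by an exchange of integrals.
  Each frequency sees the levels up to D |xi|^(n/q), and over these l^(q-3) integrates to a multiple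
  of |xi|^(2 s); its exponent exceeds -1 because q > 2. A positive upper bound \<open>N\<close> in
  place of the norm keeps the threshold meaningful for u = 0.\<close>

lemma Gagliardo_Nirenberg:
  assumes q: "q > 2" and s: "s = real DIM('a::euclidean_space) * (1/2 - 1/q)"
  shows "\<exists>C\<ge>0. \<forall>(u::'a \<Rightarrow> real) N. u \<in> L2 \<and> (\<lambda>\<xi>. of_real (norm \<xi> powr s) * fourier_real u \<xi>) \<in> L2 \<and>
    L2_norm (\<lambda>\<xi>. of_real (norm \<xi> powr s) * fourier_real u \<xi>) \<le> N \<and> N > 0 \<longrightarrow>
    integrable lborel (\<lambda>x. \<bar>u x\<bar> powr q) \<and> (\<integral>x. \<bar>u x\<bar> powr q \<partial>lborel) \<le> C * N powr q"
proof -
  define n where "n = real DIM('a)"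
  have n: "n > 0" by (simp add: n_def)
  have "0 \<le> 2 * s" "2 * s < real DIM('a)" using q unfolding s by (auto simp: field_simps)
  from nn_integral_norm_powr_ball[OF this] obtain B where
    B: "B > 0" "\<And>A. A \<ge> 0 \<Longrightarrow> (\<integral>\<^sup>+x. ennreal (norm (x::'a) powr (- (2 * s))) * indicator {x. norm x \<le> A} x \<partial>lborel)
      \<le> ennreal (B * A powr (real DIM('a) - 2 * s))" by auto
  define K where "K = 2 * fourier_const TYPE('a) * sqrt B"
  have K: "K > 0" using B by (simp add: K_def)
  define C where "C = 4 * q / (q - 2) * K powr (q - 2)"
  have C: "C \<ge> 0" using q by (simp add: C_def)
  have "integrable lborel (\<lambda>x. \<bar>u x\<bar> powr q) \<and> (\<integral>x. \<bar>u x\<bar> powr q \<partial>lborel) \<le> C * N powr q"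
    if u: "u \<in> L2" and W: "(\<lambda>\<xi>. of_real (norm \<xi> powr s) * fourier_real u \<xi>) \<in> L2"
    "L2_norm (\<lambda>\<xi>. of_real (norm \<xi> powr s) * fourier_real u \<xi>) \<le> N" and N: "N > 0" for u :: "'a \<Rightarrow> real" and N
  proof -
    define U where "U = fourier_real u"
    have U: "U \<in> L2" unfolding U_def by (rule fourier_real_L2[OF u])
    define D where "D = K * N"
    have D: "D > 0" using K N by (simp add: D_def)
    note [measurable] = L2_measurable[OF U] L2_measurable[OF u]
    have lev: "emeasure lborel {x. l \<le> \<bar>u x\<bar>} \<le>
      ennreal (4 / l\<^sup>2) * (\<integral>\<^sup>+\<xi>. ennreal ((norm (U \<xi>))\<^sup>2) * indicator {\<xi>. l \<le> D * norm \<xi> powr (n / q)} \<xi> \<partial>lborel)" if "l > 0" for l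
      using level_set_bound[OF u q s B W N that] by (simp add: U_def D_def K_def n_def mult_ac)
    have "(\<integral>\<^sup>+x. ennreal (\<bar>u x\<bar> powr q) \<partial>lborel) = (\<integral>\<^sup>+x. (\<integral>\<^sup>+l. ennreal q * (ennreal (l powr (q - 1)) * indicator {0..\<bar>u x\<bar>} l) \<partial>lborel) \<partial>lborel)"
      using q by (intro nn_integral_cong) (simp add: nn_integral_cmult nn_integral_powr_from_0 flip: ennreal_mult)
    also have "\<dots> = (\<integral>\<^sup>+x. (\<integral>\<^sup>+l. ennreal q * (ennreal (l powr (q - 1)) * (indicator {0..} l * indicator {x. l \<le> \<bar>u x\<bar>} x)) \<partial>lborel) \<partial>lborel)"
      by (intro nn_integral_cong) (auto simp: indicator_def)
    also have "\<dots> = (\<integral>\<^sup>+l. (\<integral>\<^sup>+x. ennreal q * (ennreal (l powr (q - 1)) * (indicator {0..} l * indicator {x. l \<le> \<bar>u x\<bar>} x)) \<partial>lborel) \<partial>lborel)"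
      by (rule lborel_pair.Fubini') measurable
    also have "\<dots> = (\<integral>\<^sup>+l. ennreal q * (ennreal (l powr (q - 1)) * (indicator {0..} l * emeasure lborel {x. l \<le> \<bar>u x\<bar>})) \<partial>lborel)"
      by (intro nn_integral_cong) (simp add: nn_integral_cmult)
    also have "\<dots> \<le> (\<integral>\<^sup>+l. (\<integral>\<^sup>+\<xi>. ennreal (4 * q) * (ennreal (l powr (q - 3)) * (indicator {0..} l * (ennreal ((norm (U \<xi>))\<^sup>2) * indicator {\<xi>. l \<le> D * norm \<xi> powr (n / q)} \<xi>))) \<partial>lborel) \<partial>lborel)"
    proof (intro nn_integral_mono)
      fix l :: real
      define J where "J = (\<integral>\<^sup>+\<xi>. ennreal ((norm (U \<xi>))\<^sup>2) * indicator {\<xi>. l \<le> D * norm \<xi> powr (n / q)} \<xi> \<partial>lborel)"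
      show "ennreal q * (ennreal (l powr (q - 1)) * (indicator {0..} l * emeasure lborel {x. l \<le> \<bar>u x\<bar>})) \<le>
        (\<integral>\<^sup>+\<xi>. ennreal (4 * q) * (ennreal (l powr (q - 3)) * (indicator {0..} l * (ennreal ((norm (U \<xi>))\<^sup>2) * indicator {\<xi>. l \<le> D * norm \<xi> powr (n / q)} \<xi>))) \<partial>lborel)"
      proof (cases "l > 0")
        case True
        have "ennreal q * (ennreal (l powr (q - 1)) * (indicator {0..} l * emeasure lborel {x. l \<le> \<bar>u x\<bar>})) \<le>
          ennreal q * (ennreal (l powr (q - 1)) * (ennreal (4 / l\<^sup>2) * J))"
          using True lev[OF True] unfolding J_def by (intro mult_left_mono) auto
        also have "\<dots> = ennreal (q * (l powr (q - 1) * (4 / l\<^sup>2))) * J"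
        proof -
          have "ennreal (q * (l powr (q - 1) * (4 / l\<^sup>2))) = ennreal q * (ennreal (l powr (q - 1)) * ennreal (4 / l\<^sup>2))"
            using q by (subst ennreal_mult, simp, simp, subst ennreal_mult) simp_all
          then show ?thesis by (simp only: mult.assoc)
        qed
        also have "q * (l powr (q - 1) * (4 / l\<^sup>2)) = 4 * q * l powr (q - 3)"
        proof -
          have "l powr (q - 1) = l powr (q - 3) * l powr 2" by (simp flip: powr_add)
          then show ?thesis using True by simp
        qed
        also have "ennreal (4 * q * l powr (q - 3)) * J = (\<integral>\<^sup>+\<xi>. ennreal (4 * q) * (ennreal (l powr (q - 3)) * (indicator {0..} l * (ennreal ((norm (U \<xi>))\<^sup>2) * indicator {\<xi>. l \<le> D * norm \<xi> powr (n / q)} \<xi>))) \<partial>lborel)"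
          using True q by (simp add: J_def nn_integral_cmult ennreal_mult mult.assoc)
        finally show ?thesis .
      next
        case False
        \<comment> \<open>At l = 0 the power is 0 because a power of the base 0 vanishes; negative
          levels are cut off by the indicator.\<close>
        then have "l powr (q - 1) = 0 \<or> l < 0" by auto
        then show ?thesis by auto
      qed
    qed
    also have "\<dots> = (\<integral>\<^sup>+\<xi>. (\<integral>\<^sup>+l. ennreal (4 * q) * (ennreal (l powr (q - 3)) * (indicator {0..} l * (ennreal ((norm (U \<xi>))\<^sup>2) * indicator {\<xi>. l \<le> D * norm \<xi> powr (n / q)} \<xi>))) \<partial>lborel) \<partial>lborel)"
      by (rule lborel_pair.Fubini') measurable
    also have "\<dots> = (\<integral>\<^sup>+\<xi>. (\<integral>\<^sup>+l. ennreal (4 * q * (norm (U \<xi>))\<^sup>2) * (ennreal (l powr (q - 3)) * indicator {0..D * norm \<xi> powr (n / q)} l) \<partial>lborel) \<partial>lborel)"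
      using q by (intro nn_integral_cong) (auto simp: indicator_def ennreal_mult mult_ac)
    also have "\<dots> = (\<integral>\<^sup>+\<xi>. ennreal (C * N powr (q - 2)) * ennreal ((norm (of_real (norm \<xi> powr s) * U \<xi>))\<^sup>2) \<partial>lborel)"
    proof (intro nn_integral_cong)
      fix \<xi> :: 'a
      have "(\<integral>\<^sup>+l. ennreal (4 * q * (norm (U \<xi>))\<^sup>2) * (ennreal (l powr (q - 3)) * indicator {0..D * norm \<xi> powr (n / q)} l) \<partial>lborel)
         = ennreal (4 * q * (norm (U \<xi>))\<^sup>2) * ennreal ((D * norm \<xi> powr (n / q)) powr (q - 3 + 1) / (q - 3 + 1))"
        using q D by (subst nn_integral_cmult) (simp, subst nn_integral_powr_from_0, auto)
      also have "\<dots> = ennreal (4 * q * (norm (U \<xi>))\<^sup>2 * ((D * norm \<xi> powr (n / q)) powr (q - 2) / (q - 2)))"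
        using q by (simp flip: ennreal_mult)
      also have "4 * q * (norm (U \<xi>))\<^sup>2 * ((D * norm \<xi> powr (n / q)) powr (q - 2) / (q - 2))
         = C * N powr (q - 2) * (norm (of_real (norm \<xi> powr s) * U \<xi>))\<^sup>2"
      proof -
        \<comment> \<open>This is where the order \<open>s\<close> is forced: the integral over the
          levels must reproduce the square of the weight in the norm on the right.\<close>
        have "n / q * (q - 2) = s + s" using q unfolding s n_def by (simp add: field_simps)
        then have "(norm \<xi> powr (n / q)) powr (q - 2) = (norm \<xi> powr s)\<^sup>2"
          by (simp only: powr_powr powr_add power2_eq_square)
        then show ?thesis using D K N
          by (simp add: C_def D_def powr_mult norm_mult power_mult_distrib)
      qed
      finally show "(\<integral>\<^sup>+l. ennreal (4 * q * (norm (U \<xi>))\<^sup>2) * (ennreal (l powr (q - 3)) * indicator {0..D * norm \<xi> powr (n / q)} l) \<partial>lborel)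
        = ennreal (C * N powr (q - 2)) * ennreal ((norm (of_real (norm \<xi> powr s) * U \<xi>))\<^sup>2)"
        using C by (simp add: ennreal_mult)
    qed
    also have "\<dots> = ennreal (C * N powr (q - 2)) * ennreal ((L2_norm (\<lambda>\<xi>. of_real (norm \<xi> powr s) * U \<xi>))\<^sup>2)"
      by (simp add: nn_integral_cmult nn_integral_L2[OF W(1)[folded U_def]])
    also have "\<dots> \<le> ennreal (C * N powr q)"
    proof -
      have "C * N powr (q - 2) * (L2_norm (\<lambda>\<xi>. of_real (norm \<xi> powr s) * U \<xi>))\<^sup>2 \<le> C * N powr (q - 2) * N\<^sup>2"
        using C W(2) by (intro mult_left_mono power_mono) (auto simp: U_def)
      also have "\<dots> = C * N powr q"
        using N by (simp flip: powr_add powr_numeral)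
      finally show ?thesis using C by (simp flip: ennreal_mult)
    qed
    finally have *: "(\<integral>\<^sup>+x. ennreal (\<bar>u x\<bar> powr q) \<partial>lborel) \<le> ennreal (C * N powr q)" .
    then have "integrable lborel (\<lambda>x. \<bar>u x\<bar> powr q)"
      by (intro integrableI_bounded) (auto simp: le_less_trans)
    with * C show ?thesis by (simp add: nn_integral_eq_integral ennreal_le_iff)
  qed
  with C show ?thesis by blast
qed

section \<open>Gradients of powers\<close>

lemma abs_powr_diff_le:
  fixes a b p :: real
  assumes p: "p > 1"
  shows "\<bar>\<bar>a\<bar> powr p - \<bar>b\<bar> powr p\<bar> \<le> p * (max \<bar>a\<bar> \<bar>b\<bar>) powr (p - 1) * \<bar>a - b\<bar>"
proof -
  have *: "y powr p - x powr p \<le> p * y powr (p - 1) * (y - x)" if "0 \<le> x" "x < y" for x y :: real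
  proof -
    have D: "((\<lambda>z. z powr p) has_real_derivative p * z powr (p - 1)) (at z)" if "x < z" "z < y" for z
      using that \<open>0 \<le> x\<close> by (intro has_real_derivative_powr) auto
    have "\<exists>l z. x < z \<and> z < y \<and> DERIV (\<lambda>z. z powr p) z :> l \<and> y powr p - x powr p = (y - x) * l"
    proof (rule MVT)
      show "continuous_on {x..y} (\<lambda>z. z powr p)"
        using that p by (intro continuous_on_powr') (auto intro!: continuous_intros)
    qed (use that D in \<open>auto simp: real_differentiable_def\<close>)
    then obtain z where z: "x < z" "z < y" "y powr p - x powr p = (y - x) * (p * z powr (p - 1))"
      using D DERIV_unique by blast
    have "z powr (p - 1) \<le> y powr (p - 1)" using z that p by (intro powr_mono2) auto
    then have "(y - x) * (p * z powr (p - 1)) \<le> (y - x) * (p * y powr (p - 1))"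
      using that p by (intro mult_left_mono) auto
    then show ?thesis unfolding z(3) by (simp add: mult_ac)
  qed
  have mono: "x powr p \<le> y powr p" if "0 \<le> x" "x \<le> y" for x y :: real
    using that p by (intro powr_mono2) auto
  consider "\<bar>a\<bar> = \<bar>b\<bar>" | "\<bar>a\<bar> < \<bar>b\<bar>" | "\<bar>b\<bar> < \<bar>a\<bar>" by linarith
  then show ?thesis
  proof cases
    case 1
    then show ?thesis using p by simp
  next
    case 2
    have "\<bar>\<bar>a\<bar> powr p - \<bar>b\<bar> powr p\<bar> = \<bar>b\<bar> powr p - \<bar>a\<bar> powr p" using mono[of "\<bar>a\<bar>" "\<bar>b\<bar>"] 2 by simp
    also have "\<dots> \<le> p * \<bar>b\<bar> powr (p - 1) * (\<bar>b\<bar> - \<bar>a\<bar>)" using *[of "\<bar>a\<bar>" "\<bar>b\<bar>"] 2 by simp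
    also have "\<dots> \<le> p * \<bar>b\<bar> powr (p - 1) * \<bar>a - b\<bar>" using p by (intro mult_left_mono) auto
    finally show ?thesis using 2 by (simp add: max_def)
  next
    case 3
    have "\<bar>\<bar>a\<bar> powr p - \<bar>b\<bar> powr p\<bar> = \<bar>a\<bar> powr p - \<bar>b\<bar> powr p" using mono[of "\<bar>b\<bar>" "\<bar>a\<bar>"] 3 by simp
    also have "\<dots> \<le> p * \<bar>a\<bar> powr (p - 1) * (\<bar>a\<bar> - \<bar>b\<bar>)" using *[of "\<bar>b\<bar>" "\<bar>a\<bar>"] 3 by simp
    also have "\<dots> \<le> p * \<bar>a\<bar> powr (p - 1) * \<bar>a - b\<bar>" using p by (intro mult_left_mono) auto
    finally show ?thesis using 3 by (simp add: max_def)
  qed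
qed

lemma norm_exp_ii_minus_1_le: "cmod (exp (\<i> * complex_of_real x) - 1) \<le> \<bar>x\<bar>"
proof -
  have "cmod (exp (\<i> * complex_of_real x) - 1) = 2 * \<bar>sin (x / 2)\<bar>"
    by (rule dist_exp_i_1)
  also have "\<dots> \<le> 2 * \<bar>x / 2\<bar>" by (intro mult_left_mono abs_sin_x_le_abs_x) auto
  finally show ?thesis by simp
qed

text \<open>For Lipschitz \<open>\<Phi>\<close> the difference quotients of \<open>\<Phi> \<circ> u\<close> are dominated by those of \<open>u\<close>.\<close>

lemma directional_chain_bound:
  fixes u f :: "'a::euclidean_space \<Rightarrow> real"
  assumes u: "u \<in> L2" and f: "f \<in> L2"
    and L: "L \<ge> 0" "\<And>h. AE x in lborel. \<bar>f (x + h) - f x\<bar> \<le> L * \<bar>u (x + h) - u x\<bar>"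
    and W: "(\<lambda>\<xi>. of_real (norm \<xi>) * fourier_real u \<xi>) \<in> L2" and b: "b \<in> Basis"
  shows "(\<lambda>\<xi>. of_real (\<xi> \<bullet> b) * fourier_real f \<xi>) \<in> L2"
    "L2_norm (\<lambda>\<xi>. of_real (\<xi> \<bullet> b) * fourier_real f \<xi>) \<le> L * L2_norm (\<lambda>\<xi>. of_real (norm \<xi>) * fourier_real u \<xi>)"
proof -
  note fu = fourier_real_L2[OF u] and ff = fourier_real_L2[OF f]
  note [measurable] = L2_measurable[OF fu(1)] L2_measurable[OF ff(1)]
  define d where "d n = inverse (real (Suc n))" for n
  have d: "d n > 0" for n by (simp add: d_def)
  \<comment> \<open>By Plancherel a translation difference has the norm of its multiplier exp (i h .
    xi) - 1 applied to the transform.\<close>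
  have diff: "(\<lambda>\<xi>. (exp (\<i> * of_real (h \<bullet> \<xi>)) - 1) * fourier_real g \<xi>) \<in> L2 \<and>
     L2_norm (\<lambda>\<xi>. (exp (\<i> * of_real (h \<bullet> \<xi>)) - 1) * fourier_real g \<xi>) = L2_norm (\<lambda>x. g (x + h) - g x)"
    if g: "g \<in> L2" for h :: 'a and g
  proof -
    note [measurable] = L2_measurable[OF fourier_real_L2(1)[OF g]]
    have sh: "(\<lambda>x. g (x + h)) \<in> L2" by (rule L2_shift(1)[OF g])
    have L: "(\<lambda>x. g (x + h) - g x) \<in> L2" by (rule L2_diff(1)[OF sh g])
    have "AE \<xi> in lborel. fourier_real (\<lambda>x. g (x + h) - g x) \<xi> = (exp (\<i> * of_real (h \<bullet> \<xi>)) - 1) * fourier_real g \<xi>"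
      using fourier_real_diff[OF sh g] fourier_shift[OF L2_of_real(1)[OF g], of h]
      by eventually_elim (simp add: algebra_simps)
    then have ae': "AE \<xi> in lborel. norm (fourier_real (\<lambda>x. g (x + h) - g x) \<xi>) = norm ((exp (\<i> * of_real (h \<bullet> \<xi>)) - 1) * fourier_real g \<xi>)"
      by eventually_elim simp
    have m: "(\<lambda>\<xi>. (exp (\<i> * of_real (h \<bullet> \<xi>)) - 1) * fourier_real g \<xi>) \<in> borel_measurable borel" by measurable
    show ?thesis
      using L2_cong_AE[OF fourier_real_L2(1)[OF L] m ae'] L2_norm_cong_AE[OF L2_measurable[OF fourier_real_L2(1)[OF L]] m ae'] fourier_real_L2(2)[OF L]
      by simp
  qed
  define F where "F n \<xi> = (exp (\<i> * of_real ((d n *\<^sub>R b) \<bullet> \<xi>)) - 1) * fourier_real f \<xi>" for n \<xi>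
  define N where "N = L2_norm (\<lambda>\<xi>. of_real (norm \<xi>) * fourier_real u \<xi>)"
  have F: "F n \<in> L2" for n unfolding F_def[abs_def] using diff[OF f] by blast
  have Fn: "L2_norm (F n) \<le> d n * (L * N)" for n
  proof -
    have sh: "(\<lambda>x. f (x + d n *\<^sub>R b) - f x) \<in> L2" "(\<lambda>x. u (x + d n *\<^sub>R b) - u x) \<in> L2"
      using u f by (auto intro!: L2_diff L2_shift)
    have "L2_norm (F n) = L2_norm (\<lambda>x. f (x + d n *\<^sub>R b) - f x)" unfolding F_def[abs_def] using diff[OF f] by blast
    also have "\<dots> \<le> L * L2_norm (\<lambda>x. u (x + d n *\<^sub>R b) - u x)"
      using L(2)[of "d n *\<^sub>R b"] by (intro L2_dominated(2)[OF L2_measurable[OF sh(1)] sh(2) L(1)]) simp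
    finally have 1: "L2_norm (F n) \<le> L * L2_norm (\<lambda>x. u (x + d n *\<^sub>R b) - u x)" .
    have "L2_norm (\<lambda>x. u (x + d n *\<^sub>R b) - u x) = L2_norm (\<lambda>\<xi>. (exp (\<i> * of_real ((d n *\<^sub>R b) \<bullet> \<xi>)) - 1) * fourier_real u \<xi>)"
      using diff[OF u, of "d n *\<^sub>R b"] by simp
    also have "\<dots> \<le> d n * N"
      unfolding N_def
    proof (rule L2_dominated(2)[OF _ W])
      show "AE \<xi> in lborel. norm ((exp (\<i> * of_real ((d n *\<^sub>R b) \<bullet> \<xi>)) - 1) * fourier_real u \<xi>) \<le> d n * norm (of_real (norm \<xi>) * fourier_real u \<xi>)"
      proof (intro AE_I2)
        fix \<xi> :: 'a
        have "norm (exp (\<i> * of_real ((d n *\<^sub>R b) \<bullet> \<xi>)) - 1) \<le> \<bar>(d n *\<^sub>R b) \<bullet> \<xi>\<bar>" by (rule norm_exp_ii_minus_1_le)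
        also have "\<dots> \<le> d n * norm \<xi>"
          using d[of n] Basis_le_norm[OF b, of \<xi>] by (simp add: abs_mult inner_commute)
        finally show "norm ((exp (\<i> * of_real ((d n *\<^sub>R b) \<bullet> \<xi>)) - 1) * fourier_real u \<xi>) \<le> d n * norm (of_real (norm \<xi>) * fourier_real u \<xi>)"
          by (simp add: norm_mult mult_right_mono flip: mult.assoc)
      qed
    qed (use d[of n] in \<open>auto intro: less_imp_le\<close>)
    finally have "L * L2_norm (\<lambda>x. u (x + d n *\<^sub>R b) - u x) \<le> L * (d n * N)"
      using L(1) by (intro mult_left_mono)
    with 1 show ?thesis by (simp add: mult.left_commute)
  qed
  have lim: "(\<lambda>n. of_real (inverse (d n)) * F n \<xi>) \<longlonglongrightarrow> (\<i> * of_real (\<xi> \<bullet> b)) * fourier_real f \<xi>" for \<xi>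
  proof -
    have "DERIV (\<lambda>z. exp (\<i> * of_real (\<xi> \<bullet> b) * z)) 0 :> \<i> * of_real (\<xi> \<bullet> b)"
      by (auto intro!: derivative_eq_intros)
    then have *: "((\<lambda>z. (exp (\<i> * of_real (\<xi> \<bullet> b) * z) - 1) / z) \<longlongrightarrow> \<i> * of_real (\<xi> \<bullet> b)) (at 0)"
      by (simp add: DERIV_def)
    have "(\<lambda>n. complex_of_real (d n)) \<longlonglongrightarrow> of_real 0"
      unfolding d_def by (intro tendsto_of_real LIMSEQ_inverse_real_of_nat)
    then have "filterlim (\<lambda>n. complex_of_real (d n)) (at 0) sequentially"
      using d by (intro filterlim_atI) (auto simp: less_imp_neq[symmetric])
    from filterlim_compose[OF * this]
    have "(\<lambda>n. (exp (\<i> * of_real (\<xi> \<bullet> b) * of_real (d n)) - 1) / of_real (d n) * fourier_real f \<xi>) \<longlonglongrightarrow> \<i> * of_real (\<xi> \<bullet> b) * fourier_real f \<xi>"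
      by (intro tendsto_mult tendsto_const)
    then show ?thesis
      by (simp add: F_def inner_commute mult_ac divide_inverse)
  qed
  have inv: "(\<lambda>\<xi>. of_real (inverse (d n)) * F n \<xi>) \<in> L2 \<and> L2_norm (\<lambda>\<xi>. of_real (inverse (d n)) * F n \<xi>) \<le> L * N" for n
  proof -
    have "L2_norm (\<lambda>\<xi>. of_real (inverse (d n)) * F n \<xi>) = inverse (d n) * L2_norm (F n)"
      using d[of n] by (subst L2_mult(2)[OF F]) (simp add: norm_inverse)
    also have "\<dots> \<le> inverse (d n) * (d n * (L * N))"
      using d[of n] by (intro mult_left_mono Fn) auto
    also have "\<dots> = L * N" using d[of n] by simp
    finally show ?thesis using L2_mult(1)[OF F] by blast
  qed
  have m: "(\<lambda>\<xi>. \<i> * of_real (\<xi> \<bullet> b) * fourier_real f \<xi>) \<in> borel_measurable borel" by measurable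
  have LN: "0 \<le> L * N" using L by (simp add: N_def)
  \<comment> \<open>The divided differences are bounded by L N uniformly in the step size and
    converge at every frequency; Fatou then bounds the limit symbol, the derivative in direction
    b.\<close>
  have "(\<lambda>\<xi>. \<i> * of_real (\<xi> \<bullet> b) * fourier_real f \<xi>) \<in> L2"
    "L2_norm (\<lambda>\<xi>. \<i> * of_real (\<xi> \<bullet> b) * fourier_real f \<xi>) \<le> L * N"
    by (rule L2_Fatou[OF _ m _ _ LN, of "\<lambda>n \<xi>. of_real (inverse (d n)) * F n \<xi>"]; use inv lim in auto)+
  from this L2_mult[OF this(1), of "- \<i>"]
  show "(\<lambda>\<xi>. of_real (\<xi> \<bullet> b) * fourier_real f \<xi>) \<in> L2"
    "L2_norm (\<lambda>\<xi>. of_real (\<xi> \<bullet> b) * fourier_real f \<xi>) \<le> L * L2_norm (\<lambda>\<xi>. of_real (norm \<xi>) * fourier_real u \<xi>)"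
    by (simp_all add: N_def flip: mult.assoc)
qed

text \<open>The norm of xi is at most the sum of the moduli of its coordinates; summing the
  directional bounds costs the factor \<open>DIM('a)\<close>.\<close>

lemma gradient_chain_bound:
  fixes u f :: "'a::euclidean_space \<Rightarrow> real"
  assumes u: "u \<in> L2" and f: "f \<in> L2"
    and L: "L \<ge> 0" "\<And>h. AE x in lborel. \<bar>f (x + h) - f x\<bar> \<le> L * \<bar>u (x + h) - u x\<bar>"
    and W: "(\<lambda>\<xi>. of_real (norm \<xi>) * fourier_real u \<xi>) \<in> L2"
  shows "(\<lambda>\<xi>. of_real (norm \<xi>) * fourier_real f \<xi>) \<in> L2"
    "L2_norm (\<lambda>\<xi>. of_real (norm \<xi>) * fourier_real f \<xi>) \<le> DIM('a) * (L * L2_norm (\<lambda>\<xi>. of_real (norm \<xi>) * fourier_real u \<xi>))"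
proof -
  note ff = fourier_real_L2[OF f]
  note [measurable] = L2_measurable[OF ff(1)]
  note D = directional_chain_bound[OF u f L W]
  define G where "G b \<xi> = of_real \<bar>\<xi> \<bullet> b\<bar> * fourier_real f \<xi>" for b \<xi> :: 'a
  have Gm: "G b \<in> borel_measurable borel" for b unfolding G_def[abs_def] by measurable
  have G: "G b \<in> L2" "L2_norm (G b) \<le> L * L2_norm (\<lambda>\<xi>. of_real (norm \<xi>) * fourier_real u \<xi>)" if "b \<in> Basis" for b
    using L2_mono[OF Gm D(1)[OF that], of b] D(2)[OF that] by (simp_all add: G_def norm_mult)
  have m: "(\<lambda>\<xi>. of_real (norm \<xi>) * fourier_real f \<xi>) \<in> borel_measurable borel" by measurable
  have le: "norm (of_real (norm \<xi>) * fourier_real f \<xi>) \<le> norm (\<Sum>b\<in>Basis. G b \<xi>)" for \<xi>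
  proof -
    have "(\<Sum>b\<in>Basis. G b \<xi>) = of_real (\<Sum>b\<in>Basis. \<bar>\<xi> \<bullet> b\<bar>) * fourier_real f \<xi>"
      by (simp add: G_def sum_distrib_right)
    moreover have "norm \<xi> \<le> \<bar>\<Sum>b\<in>Basis. \<bar>\<xi> \<bullet> b\<bar>\<bar>" using norm_le_l1[of \<xi>] by linarith
    ultimately show ?thesis by (simp only: norm_mult norm_of_real abs_norm_cancel mult_right_mono norm_ge_zero)
  qed
  note S = L2_sum[OF finite_Basis, of G] L2_norm_sum[OF finite_Basis, of G]
  show "(\<lambda>\<xi>. of_real (norm \<xi>) * fourier_real f \<xi>) \<in> L2"
    by (rule L2_mono(1)[OF m S(1) le]) (use G in auto)
  have "L2_norm (\<lambda>\<xi>. of_real (norm \<xi>) * fourier_real f \<xi>) \<le> L2_norm (\<lambda>\<xi>. \<Sum>b\<in>Basis. G b \<xi>)"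
    by (rule L2_mono(2)[OF m S(1) le]) (use G in auto)
  also have "\<dots> \<le> (\<Sum>b\<in>Basis. L2_norm (G b))" by (rule S(2)) (use G in auto)
  also have "\<dots> \<le> (\<Sum>b\<in>(Basis::'a set). L * L2_norm (\<lambda>\<xi>. of_real (norm \<xi>) * fourier_real u \<xi>))"
    by (intro sum_mono G)
  finally show "L2_norm (\<lambda>\<xi>. of_real (norm \<xi>) * fourier_real f \<xi>) \<le> DIM('a) * (L * L2_norm (\<lambda>\<xi>. of_real (norm \<xi>) * fourier_real u \<xi>))"
    by simp
qed

section \<open>A square integrable weight for supremum bounds in the plane\<close>

lemma nn_integral_inverse_1_plus_square:
  assumes c: "c > 0"
  shows "(\<integral>\<^sup>+x. ennreal (inverse (1 + (c * x)\<^sup>2)) \<partial>lborel) = ennreal (pi / c)"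
proof -
  have i: "integrable lborel (\<lambda>x::real. inverse (1 + x\<^sup>2))" and v: "(\<integral>x. inverse (1 + x\<^sup>2) \<partial>lborel) = pi"
    using integrable_inverse_1_plus_square LBINT_inverse_1_plus_square
    by (auto simp: set_integrable_def interval_lebesgue_integral_def set_lebesgue_integral_def)
  have "ennreal pi = (\<integral>\<^sup>+x. ennreal (inverse (1 + x\<^sup>2)) \<partial>lborel)"
    using i v by (subst nn_integral_eq_integral) auto
  also have "\<dots> = ennreal c * (\<integral>\<^sup>+x. ennreal (inverse (1 + (c * x)\<^sup>2)) \<partial>lborel)"
    using c by (subst nn_integral_real_affine[where c=c and t=0]) auto
  finally have "ennreal (1/c) * ennreal pi = ennreal (1/c) * (ennreal c * (\<integral>\<^sup>+x. ennreal (inverse (1 + (c * x)\<^sup>2)) \<partial>lborel))" by simp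
  also have "\<dots> = (\<integral>\<^sup>+x. ennreal (inverse (1 + (c * x)\<^sup>2)) \<partial>lborel)"
    using c by (simp flip: mult.assoc ennreal_mult)
  finally show ?thesis using c by (simp flip: ennreal_mult)
qed

text \<open>In the plane the squared weight is a product of two equal factors, one for each
  coordinate. Keeping only that coordinate in each factor leaves two arctangent integrals.\<close>

lemma L2_weight_dim2:
  assumes dim: "DIM('a::euclidean_space) = 2" and T: "T > 0"
  defines "w \<equiv> \<lambda>\<xi>::'a. inverse (1 + T * (norm \<xi>)\<^sup>2)"
  shows "w \<in> L2" "L2_norm w \<le> pi * T powr (- 1/2)"
proof -
  have wm: "w \<in> borel_measurable borel" unfolding w_def by measurable
  have pos: "1 + T * (norm \<xi>)\<^sup>2 > 0" for \<xi> :: 'a using T by (simp add: add_pos_nonneg)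
  have "(\<integral>\<^sup>+\<xi>. ennreal ((norm (w \<xi>))\<^sup>2) \<partial>lborel) \<le> (\<integral>\<^sup>+\<xi>. (\<Prod>b\<in>Basis. ennreal (inverse (1 + (sqrt T * ((\<xi>::'a) \<bullet> b))\<^sup>2))) \<partial>lborel)"
  proof (intro nn_integral_mono)
    fix \<xi> :: 'a
    have "(norm (w \<xi>))\<^sup>2 = (\<Prod>b\<in>(Basis::'a set). inverse (1 + T * (norm \<xi>)\<^sup>2))"
      using dim pos[of \<xi>] by (simp add: w_def)
    also have "\<dots> \<le> (\<Prod>b\<in>Basis. inverse (1 + (sqrt T * (\<xi> \<bullet> b))\<^sup>2))"
    proof (intro prod_mono conjI le_imp_inverse_le)
      fix b :: 'a assume b: "b \<in> Basis"
      have "(\<xi> \<bullet> b)\<^sup>2 \<le> (norm \<xi>)\<^sup>2" using Basis_le_norm[OF b, of \<xi>] by (simp add: abs_le_square_iff[symmetric])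
      then show "1 + (sqrt T * (\<xi> \<bullet> b))\<^sup>2 \<le> 1 + T * (norm \<xi>)\<^sup>2"
        using T by (simp add: power_mult_distrib)
      show "0 < 1 + (sqrt T * (\<xi> \<bullet> b))\<^sup>2" by (simp add: add_pos_nonneg)
      show "0 \<le> inverse (1 + T * (norm \<xi>)\<^sup>2)" using pos[of \<xi>] by simp
    qed
    finally show "ennreal ((norm (w \<xi>))\<^sup>2) \<le> (\<Prod>b\<in>Basis. ennreal (inverse (1 + (sqrt T * (\<xi> \<bullet> b))\<^sup>2)))"
      by (subst prod_ennreal) (auto intro!: ennreal_leI add_nonneg_nonneg)
  qed
  also have "\<dots> = (\<Prod>b\<in>(Basis::'a set). (\<integral>\<^sup>+x. ennreal (inverse (1 + (sqrt T * x)\<^sup>2)) \<partial>lborel))"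
    by (rule nn_integral_lborel_prod) auto
  also have "\<dots> = ennreal ((pi / sqrt T)\<^sup>2)"
    using T dim by (simp add: nn_integral_inverse_1_plus_square ennreal_power)
  also have "pi / sqrt T = pi * T powr (- 1/2)"
    using T by (simp add: powr_minus_divide powr_half_sqrt)
  finally have *: "(\<integral>\<^sup>+\<xi>. ennreal ((norm (w \<xi>))\<^sup>2) \<partial>lborel) \<le> ennreal ((pi * T powr (- 1/2))\<^sup>2)" .
  show "w \<in> L2" "L2_norm w \<le> pi * T powr (- 1/2)"
    using L2_nnI[OF wm *] by auto
qed

section \<open>Decay of the nonlinearity\<close>

text \<open>The assumptions on \<open>u\<close> apart from the equation, moved to the Fourier side.
  Membership in \<open>L2\<close> stands beside each norm bound because a norm bound without it
  would be empty.\<close>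

locale decaying_flow =
  fixes p k\<^sub>0 C :: real and u :: "real \<Rightarrow> 'a::euclidean_space \<Rightarrow> real"
  assumes dim: "DIM('a) = 1 \<and> k\<^sub>0 = 1 \<or> DIM('a) = 2 \<and> 1 \<le> k\<^sub>0 \<and> k\<^sub>0 < 3"
    and p: "p > 1 + 2 / real DIM('a)"
    and C: "C > 0"
    and u_L2: "\<And>t. t \<ge> 0 \<Longrightarrow> u t \<in> L2"
    and u_decay: "\<And>t k. t \<ge> 0 \<Longrightarrow> 0 \<le> k \<Longrightarrow> k \<le> k\<^sub>0 \<Longrightarrow>
       (\<lambda>\<xi>. of_real (norm \<xi> powr k) * fourier_real (u t) \<xi>) \<in> L2 \<and>
       L2_norm (\<lambda>\<xi>. of_real (norm \<xi> powr k) * fourier_real (u t) \<xi>) \<le> C * (1 + t) powr (- (real DIM('a) / 4) - k / 2)"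
    and u_cont: "\<And>s. s \<ge> 0 \<Longrightarrow> ((\<lambda>t. L2_norm (\<lambda>x. u t x - u s x)) \<longlongrightarrow> 0) (at s within {0..})"
begin

definition "n = real DIM('a)"
definition "\<eta> = n * (p - 1) / 2 - 1"
definition "f t x = \<bar>u t x\<bar> powr p"

lemma n_bounds: "n > 0" "n \<le> 2" "n = 1 \<or> n = 2" using dim by (auto simp: n_def)

lemma eta_pos: "\<eta> > 0" using p n_bounds by (simp add: \<eta>_def n_def[symmetric] field_simps)

text \<open>In dimensions 1 and 2 the condition p > 1 + 2 / n exceeds 2.
  \<open>Gagliardo_Nirenberg\<close> therefore covers the exponents p, 2 p and 2 (p - 1), that is,
  the L1 and L2 norms of |u|^p and the L2 norm of |u|^(p-1).\<close>

lemma p_gt_2: "p > 2" using p dim by auto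

lemma k0_bounds: "1 \<le> k\<^sub>0" "k\<^sub>0 < 3" "k\<^sub>0 \<ge> 2 \<Longrightarrow> n = 2" using dim by (auto simp: n_def)

lemma u_measurable [measurable]: "t \<ge> 0 \<Longrightarrow> u t \<in> borel_measurable borel"
  using L2_measurable[OF u_L2] .

lemma Lq_decay:
  assumes q: "q > 2"
  shows "\<exists>D\<ge>0. \<forall>t\<ge>0. integrable lborel (\<lambda>x. \<bar>u t x\<bar> powr q) \<and>
    (\<integral>x. \<bar>u t x\<bar> powr q \<partial>lborel) \<le> D * (1 + t) powr (- (n * (q - 1) / 2))"
proof -
  define s where "s = n * (1/2 - 1/q)"
  have s: "0 \<le> s" "s \<le> k\<^sub>0"
  proof -
    show "0 \<le> s" using q n_bounds by (simp add: s_def field_simps)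
    \<comment> \<open>Because n is at most 2, the order \<open>s\<close> stays below 1 and thus
      within the range where decay is assumed.\<close>
    have "s \<le> 2 * (1/2)" unfolding s_def using q n_bounds by (intro mult_mono) auto
    then show "s \<le> k\<^sub>0" using k0_bounds by simp
  qed
  from Gagliardo_Nirenberg[OF q s_def[unfolded n_def]] obtain D where D: "D \<ge> 0"
    "\<And>(v::'a \<Rightarrow> real) N. v \<in> L2 \<Longrightarrow> (\<lambda>\<xi>. of_real (norm \<xi> powr s) * fourier_real v \<xi>) \<in> L2 \<Longrightarrow>
    L2_norm (\<lambda>\<xi>. of_real (norm \<xi> powr s) * fourier_real v \<xi>) \<le> N \<Longrightarrow> N > 0 \<Longrightarrow>
    integrable lborel (\<lambda>x. \<bar>v x\<bar> powr q) \<and> (\<integral>x. \<bar>v x\<bar> powr q \<partial>lborel) \<le> D * N powr q" by blast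
  show ?thesis
  proof (intro exI[of _ "D * C powr q"] conjI allI impI)
    fix t :: real assume t: "t \<ge> 0"
    define N where "N = C * (1 + t) powr (- (n / 4) - s / 2)"
    have N: "N > 0" using C t by (simp add: N_def)
    have *: "integrable lborel (\<lambda>x. \<bar>u t x\<bar> powr q) \<and> (\<integral>x. \<bar>u t x\<bar> powr q \<partial>lborel) \<le> D * N powr q"
      using u_decay[OF t s] by (intro D(2) u_L2 t N) (auto simp: N_def n_def)
    \<comment> \<open>With s = n (1/2 - 1/q) the decay exponent n/4 + s/2 equals n (q - 1) / (2
      q).\<close>
    have "(- (n / 4) - s / 2) * q = - (n * (q - 1) / 2)" using q by (simp add: s_def field_simps)
    then have "N powr q = C powr q * (1 + t) powr (- (n * (q - 1) / 2))"
      using C t by (simp add: N_def powr_mult powr_powr)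
    with * show "integrable lborel (\<lambda>x. \<bar>u t x\<bar> powr q)"
      "(\<integral>x. \<bar>u t x\<bar> powr q \<partial>lborel) \<le> D * C powr q * (1 + t) powr (- (n * (q - 1) / 2))" by auto
  qed (use D in auto)
qed

section \<open>Norms of the nonlinearity and their dependence on time\<close>

lemma f_nonneg: "f t x \<ge> 0" by (simp add: f_def)

lemma f_measurable [measurable]: "t \<ge> 0 \<Longrightarrow> f t \<in> borel_measurable borel"
  unfolding f_def[abs_def] by measurable

lemma powr_L2:
  assumes q: "q > 1"
  shows "\<exists>D\<ge>0. \<forall>t\<ge>0. (\<lambda>x. \<bar>u t x\<bar> powr q) \<in> L2 \<and> L2_norm (\<lambda>x. \<bar>u t x\<bar> powr q) \<le> D * (1 + t) powr (- (n * (2 * q - 1) / 4))"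
proof -
  from Lq_decay[of "2 * q"] q obtain D where D: "D \<ge> 0" "\<And>t. t \<ge> 0 \<Longrightarrow> integrable lborel (\<lambda>x. \<bar>u t x\<bar> powr (2 * q)) \<and>
    (\<integral>x. \<bar>u t x\<bar> powr (2 * q) \<partial>lborel) \<le> D * (1 + t) powr (- (n * (2 * q - 1) / 2))" by auto
  have sq: "(\<bar>u t x\<bar> powr q)\<^sup>2 = \<bar>u t x\<bar> powr (2 * q)" for t x
    by (simp add: power2_eq_square flip: powr_add)
  show ?thesis
  proof (intro exI[of _ "sqrt D"] conjI allI impI)
    fix t :: real assume t: "t \<ge> 0"
    note [measurable] = u_measurable[OF t]
    show "(\<lambda>x. \<bar>u t x\<bar> powr q) \<in> L2"
      using D(2)[OF t] by (simp add: L2_def sq)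
    have "L2_norm (\<lambda>x. \<bar>u t x\<bar> powr q) \<le> sqrt (D * (1 + t) powr (- (n * (2 * q - 1) / 2)))"
      using D(2)[OF t] by (simp add: L2_norm_def sq)
    also have "\<dots> = sqrt D * (1 + t) powr (- (n * (2 * q - 1) / 4))"
      using t by (simp add: real_sqrt_mult powr_half_sqrt[symmetric] powr_powr)
    finally show "L2_norm (\<lambda>x. \<bar>u t x\<bar> powr q) \<le> sqrt D * (1 + t) powr (- (n * (2 * q - 1) / 4))" .
  qed (use D in auto)
qed

lemma f_L1:
  obtains D where "D \<ge> 0" "\<And>t. t \<ge> 0 \<Longrightarrow> integrable lborel (f t)"
    "\<And>t. t \<ge> 0 \<Longrightarrow> (\<integral>x. f t x \<partial>lborel) \<le> D * (1 + t) powr (- (1 + \<eta>))"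
proof -
  have eq: "- (n * (p - 1) / 2) = - (1 + \<eta>)" by (simp add: \<eta>_def)
  show thesis using Lq_decay[OF p_gt_2] that unfolding f_def[abs_def] eq by blast
qed

lemma f_L2:
  obtains D where "D \<ge> 0" "\<And>t. t \<ge> 0 \<Longrightarrow> f t \<in> L2"
    "\<And>t. t \<ge> 0 \<Longrightarrow> L2_norm (f t) \<le> D * (1 + t) powr (- (1 + \<eta>) - n / 4)"
proof -
  have eq: "- (n * (2 * p - 1) / 4) = - (1 + \<eta>) - n / 4" by (simp add: \<eta>_def field_simps)
  from p_gt_2 have "p > 1" by simp
  from powr_L2[OF this] show thesis using that unfolding f_def[abs_def] eq by blast
qed

text \<open>Continuity of the nonlinearity in time with values in L1, from which the mass and the
  heat defects inherit theirs. It comes from \<open>abs_powr_diff_le\<close> and Cauchy-Schwarz,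
  since p - 1 > 1 makes |u|^(p-1) square integrable with a bound uniform in time.\<close>

lemma f_L1_lipschitz:
  obtains K where "K \<ge> 0" "\<And>s t. s \<ge> 0 \<Longrightarrow> t \<ge> 0 \<Longrightarrow> (\<integral>x. \<bar>f t x - f s x\<bar> \<partial>lborel) \<le> K * L2_norm (\<lambda>x. u t x - u s x)"
proof -
  from powr_L2[of "p - 1"] p_gt_2 obtain D where D: "D \<ge> 0" "\<And>t. t \<ge> 0 \<Longrightarrow> (\<lambda>x. \<bar>u t x\<bar> powr (p - 1)) \<in> L2 \<and>
    L2_norm (\<lambda>x. \<bar>u t x\<bar> powr (p - 1)) \<le> D * (1 + t) powr (- (n * (2 * (p - 1) - 1) / 4))" by auto
  have D2: "L2_norm (\<lambda>x. \<bar>u t x\<bar> powr (p - 1)) \<le> D" if t: "t \<ge> 0" for t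
  proof -
    have "n * (2 * (p - 1) - 1) / 4 \<ge> 0" using p_gt_2 n_bounds by (intro divide_nonneg_nonneg mult_nonneg_nonneg) auto
    then have "(1 + t) powr (- (n * (2 * (p - 1) - 1) / 4)) \<le> (1 + t) powr 0" using t by (intro powr_mono) auto
    then have "D * (1 + t) powr (- (n * (2 * (p - 1) - 1) / 4)) \<le> D * 1" using t D by (intro mult_left_mono) auto
    with D(2)[OF t] show ?thesis by linarith
  qed
  show thesis
  proof (rule that[of "p * (D + D)"])
    show "0 \<le> p * (D + D)" using D p_gt_2 by simp
    fix s t :: real assume st: "s \<ge> 0" "t \<ge> 0"
    note [measurable] = u_measurable[OF st(1)] u_measurable[OF st(2)]
    define g where "g x = \<bar>u t x\<bar> powr (p - 1) + \<bar>u s x\<bar> powr (p - 1)" for x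
    have gs: "(\<lambda>x. \<bar>u t x\<bar> powr (p - 1)) \<in> L2" "(\<lambda>x. \<bar>u s x\<bar> powr (p - 1)) \<in> L2"
      using D(2) st by blast+
    have g: "g \<in> L2" "L2_norm g \<le> D + D"
      using L2_add(1)[OF gs] L2_norm_triangle[OF gs] D2[OF st(1)] D2[OF st(2)]
      unfolding g_def[abs_def] by linarith+
    have d: "(\<lambda>x. u t x - u s x) \<in> L2" by (intro L2_diff u_L2 st)
    note CS = L2_Cauchy_Schwarz[OF g(1) d]
    have le: "\<bar>f t x - f s x\<bar> \<le> p * (norm (g x) * norm (u t x - u s x))" for x
    proof -
      have "(max \<bar>u t x\<bar> \<bar>u s x\<bar>) powr (p - 1) \<le> g x" by (simp add: g_def max_def)
      then have "p * (max \<bar>u t x\<bar> \<bar>u s x\<bar>) powr (p - 1) * \<bar>u t x - u s x\<bar> \<le> p * norm (g x) * \<bar>u t x - u s x\<bar>"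
        using p_gt_2 by (intro mult_right_mono mult_left_mono) auto
      moreover have "\<bar>f t x - f s x\<bar> \<le> p * (max \<bar>u t x\<bar> \<bar>u s x\<bar>) powr (p - 1) * \<bar>u t x - u s x\<bar>"
        unfolding f_def using p_gt_2 by (intro abs_powr_diff_le) simp
      ultimately show ?thesis unfolding real_norm_def mult.assoc by linarith
    qed
    have "(\<integral>x. \<bar>f t x - f s x\<bar> \<partial>lborel) \<le> (\<integral>x. p * (norm (g x) * norm (u t x - u s x)) \<partial>lborel)"
    proof (rule integral_mono[OF _ _ le])
      show i: "integrable lborel (\<lambda>x. p * (norm (g x) * norm (u t x - u s x)))" by (intro integrable_mult_right CS)
      show "integrable lborel (\<lambda>x. \<bar>f t x - f s x\<bar>)"
        by (rule Bochner_Integration.integrable_bound[OF i]) (use le st in \<open>auto intro: order_trans[OF _ abs_ge_self]\<close>)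
    qed
    also have "\<dots> = p * (\<integral>x. norm (g x) * norm (u t x - u s x) \<partial>lborel)" by simp
    also have "\<dots> \<le> p * ((D + D) * L2_norm (\<lambda>x. u t x - u s x))"
      using order_trans[OF CS(2) mult_right_mono[OF g(2) L2_norm_nonneg]] p_gt_2 by (intro mult_left_mono) auto
    finally show "(\<integral>x. \<bar>f t x - f s x\<bar> \<partial>lborel) \<le> p * (D + D) * L2_norm (\<lambda>x. u t x - u s x)" by (simp add: mult.assoc)
  qed
qed

text \<open>The weight 1 / (1 + T |xi|^2) with T = 1 + t balances the decay at orders 0 and 2: both
  parts of (1 + T |xi|^2) times the transform are of size T^(-1/2). The weight itself has norm of
  the same size, and the product is T^(-1).\<close>

lemma u_Linf:
  assumes "k\<^sub>0 \<ge> 2"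
  obtains D where "D \<ge> 0" "\<And>t. t \<ge> 0 \<Longrightarrow> AE x in lborel. \<bar>u t x\<bar> \<le> D * (1 + t) powr (- 1)"
proof (rule that[of "fourier_const TYPE('a) * (pi * (C + C))"])
  show "0 \<le> fourier_const TYPE('a) * (pi * (C + C))" using C by simp
  fix t :: real assume t: "t \<ge> 0"
  define T where "T = 1 + t"
  have T: "T > 0" "T \<ge> 1" using t by (auto simp: T_def)
  have n2: "n = 2" using k0_bounds assms by simp
  then have d2: "DIM('a) = 2" by (simp add: n_def)
  define U where "U = fourier_real (u t)"
  have U: "U \<in> L2" unfolding U_def by (rule fourier_real_L2[OF u_L2[OF t]])
  note [measurable] = L2_measurable[OF U]
  define U2 where "U2 \<xi> = of_real (norm \<xi> powr 2) * U \<xi>" for \<xi>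
  have U2: "U2 \<in> L2" "L2_norm U2 \<le> C * T powr (- (3/2))"
    using u_decay[OF t, of 2] assms n2 by (auto simp: U2_def[abs_def] U_def T_def n_def)
  have U0: "L2_norm U \<le> C * T powr (- (1/2))"
  proof -
    have "L2_norm U = L2_norm (\<lambda>\<xi>. of_real (norm \<xi> powr 0) * U \<xi>)"
      by (rule L2_norm_cong_AE) (measurable, use AE_neq_0 in eventually_elim, simp)
    also have "\<dots> \<le> C * T powr (- (1/2))"
      using u_decay[OF t, of 0] k0_bounds n2 by (simp add: U_def T_def n_def)
    finally show ?thesis .
  qed
  define w where "w \<xi> = inverse (1 + T * (norm \<xi>)\<^sup>2)" for \<xi> :: 'a
  have w: "w \<in> L2" "L2_norm w \<le> pi * T powr (- 1/2)"
    unfolding w_def[abs_def] using L2_weight_dim2[OF d2 T(1)] by auto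
  define g where "g \<xi> = U \<xi> + of_real T * U2 \<xi>" for \<xi>
  have g: "g \<in> L2" unfolding g_def[abs_def] by (intro L2_add L2_mult U U2)
  have "L2_norm g \<le> L2_norm U + T * L2_norm U2"
    unfolding g_def[abs_def] using L2_norm_triangle[OF U L2_mult(1)[OF U2(1), of "of_real T"]] L2_mult(2)[OF U2(1), of "of_real T"] T by simp
  also have "\<dots> \<le> C * T powr (- (1/2)) + T * (C * T powr (- (3/2)))"
    using U0 U2 T by (intro add_mono mult_left_mono) auto
  also have "T * (C * T powr (- (3/2))) = C * T powr (- (1/2))"
  proof -
    have "T * T powr (- (3/2)) = T powr 1 * T powr (- (3/2))" using T by simp
    also have "\<dots> = T powr (- (1/2))" by (subst powr_add[symmetric]) simp
    finally show ?thesis by (simp add: mult.left_commute)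
  qed
  finally have gn: "L2_norm g \<le> (C + C) * T powr (- (1/2))" by (simp add: algebra_simps)
  have Ug: "AE \<xi> in lborel. norm (U \<xi>) \<le> \<bar>w \<xi>\<bar> * norm (g \<xi>)"
    using AE_neq_0
  proof eventually_elim
    case (elim \<xi>)
    have "1 + T * (norm \<xi>)\<^sup>2 > 0" using T by (simp add: add_pos_nonneg)
    moreover have "g \<xi> = of_real (1 + T * (norm \<xi>)\<^sup>2) * U \<xi>"
      using elim by (simp add: g_def U2_def algebra_simps)
    then have "norm (g \<xi>) = (1 + T * (norm \<xi>)\<^sup>2) * norm (U \<xi>)"
      using \<open>1 + T * (norm \<xi>)\<^sup>2 > 0\<close> by (simp only: norm_mult norm_of_real abs_of_pos)
    ultimately show ?case by (simp add: w_def flip: mult.assoc)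
  qed
  note I = L2_L1_bound[OF L2_measurable[OF U] w(1) g Ug]
  have "(\<integral>\<xi>. norm (U \<xi>) \<partial>lborel) \<le> (pi * T powr (- 1/2)) * ((C + C) * T powr (- (1/2)))"
    using I(2) mult_mono[OF w(2) gn] T C by simp
  also have "\<dots> = pi * (C + C) * (T powr (- 1/2) * T powr (- (1/2)))" by (simp add: mult_ac)
  also have "T powr (- 1/2) * T powr (- (1/2)) = T powr (- 1)" by (subst powr_add[symmetric]) simp
  finally have I2: "fourier_const TYPE('a) * (\<integral>\<xi>. norm (U \<xi>) \<partial>lborel) \<le> fourier_const TYPE('a) * (pi * (C + C) * T powr (- 1))"
    by (intro mult_left_mono) auto
  show "AE x in lborel. \<bar>u t x\<bar> \<le> fourier_const TYPE('a) * (pi * (C + C)) * (1 + t) powr (- 1)"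
    using inv_fourier_bounded[OF U I(1)] inv_fourier_fourier[OF L2_of_real(1)[OF u_L2[OF t]], folded U_def]
  proof eventually_elim
    case (elim x)
    then have "\<bar>u t x\<bar> \<le> fourier_const TYPE('a) * (\<integral>\<xi>. norm (U \<xi>) \<partial>lborel)" by simp
    also note I2
    finally show ?case by (simp add: T_def mult.assoc)
  qed
qed

text \<open>On the range of u(t) the function |.|^p is Lipschitz with constant p (D / (1 +
  t))^(p-1). For n = 2 one has p - 1 = 1 + \<eta>, so the gradient of |u|^p decays faster than its
  L2 norm by the factor (1 + t)^(-1/2) inherited from the gradient of u.\<close>

lemma f_gradient:
  assumes k: "k\<^sub>0 \<ge> 2"
  obtains D where "D \<ge> 0" "\<And>t. t \<ge> 0 \<Longrightarrow> (\<lambda>\<xi>. of_real (norm \<xi>) * fourier_real (f t) \<xi>) \<in> L2"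
    "\<And>t. t \<ge> 0 \<Longrightarrow> L2_norm (\<lambda>\<xi>. of_real (norm \<xi>) * fourier_real (f t) \<xi>) \<le> D * (1 + t) powr (- (1 + \<eta>) - n / 4 - 1 / 2)"
proof -
  obtain D where D: "D \<ge> 0" "\<And>t. t \<ge> 0 \<Longrightarrow> AE x in lborel. \<bar>u t x\<bar> \<le> D * (1 + t) powr (- 1)"
    using u_Linf[OF k] by blast
  have n2: "n = 2" using k0_bounds k by simp
  have fL2: "f t \<in> L2" if "t \<ge> 0" for t using f_L2 that by blast
  have "(\<lambda>\<xi>. of_real (norm \<xi>) * fourier_real (f t) \<xi>) \<in> L2 \<and>
     L2_norm (\<lambda>\<xi>. of_real (norm \<xi>) * fourier_real (f t) \<xi>) \<le> DIM('a) * (p * D powr (p - 1) * C) * (1 + t) powr (- (1 + \<eta>) - n / 4 - 1 / 2)"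
    if t: "t \<ge> 0" for t
  proof -
    define L where "L = p * (D * (1 + t) powr (- 1)) powr (p - 1)"
    have L: "L \<ge> 0" using p_gt_2 by (simp add: L_def)
    have W: "(\<lambda>\<xi>. of_real (norm \<xi>) * fourier_real (u t) \<xi>) \<in> L2"
      "L2_norm (\<lambda>\<xi>. of_real (norm \<xi>) * fourier_real (u t) \<xi>) \<le> C * (1 + t) powr (- (n / 4) - 1 / 2)"
      using u_decay[OF t, of 1] k by (simp_all add: n_def)
    have lip: "AE x in lborel. \<bar>f t (x + h) - f t x\<bar> \<le> L * \<bar>u t (x + h) - u t x\<bar>" for h
    proof -
      have "AE x in lborel. \<bar>u t (x + h)\<bar> \<le> D * (1 + t) powr (- 1)"
        using AE_lborel_isometry[OF D(2)[OF t], of 1 h] by (simp add: add.commute)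
      with D(2)[OF t] show ?thesis
      proof eventually_elim
        case (elim x)
        have "\<bar>f t (x + h) - f t x\<bar> \<le> p * (max \<bar>u t (x + h)\<bar> \<bar>u t x\<bar>) powr (p - 1) * \<bar>u t (x + h) - u t x\<bar>"
          unfolding f_def using p_gt_2 by (intro abs_powr_diff_le) auto
        also have "\<dots> \<le> L * \<bar>u t (x + h) - u t x\<bar>"
          unfolding L_def using elim p_gt_2 by (intro mult_right_mono mult_left_mono powr_mono2) auto
        finally show ?case .
      qed
    qed
    note G = gradient_chain_bound[OF u_L2[OF t] fL2[OF t] L lip W(1)]
    have "L2_norm (\<lambda>\<xi>. of_real (norm \<xi>) * fourier_real (f t) \<xi>) \<le> DIM('a) * (L * (C * (1 + t) powr (- (n / 4) - 1 / 2)))"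
      using G(2) W(2) L by (auto intro!: order_trans[OF G(2)] mult_left_mono)
    also have "L * (C * (1 + t) powr (- (n / 4) - 1 / 2)) = p * D powr (p - 1) * C * ((1 + t) powr (- (p - 1)) * (1 + t) powr (- (n / 4) - 1 / 2))"
    proof -
      have "(D * (1 + t) powr (- 1)) powr (p - 1) = D powr (p - 1) * (1 + t) powr (- (p - 1))"
        using D(1) by (simp only: powr_mult powr_powr powr_ge_zero mult_minus1)
      then show ?thesis unfolding L_def by (simp only: mult_ac)
    qed
    also have "(1 + t) powr (- (p - 1)) * (1 + t) powr (- (n / 4) - 1 / 2) = (1 + t) powr (- (1 + \<eta>) - n / 4 - 1 / 2)"
    proof -
      have "- (p - 1) + (- (n / 4) - 1 / 2) = - (1 + \<eta>) - n / 4 - 1 / 2" using n2 by (simp add: \<eta>_def field_simps)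
      then show ?thesis by (simp only: powr_add[symmetric])
    qed
    finally show ?thesis using G(1) by (simp add: mult.assoc)
  qed
  moreover have "0 \<le> DIM('a) * (p * D powr (p - 1) * C)" using p_gt_2 C by simp
  ultimately show thesis using that by blast
qed

end

section \<open>The kernel\<close>

text \<open>The symbol of K_1 as a function of r = |xi|^2. The symbol of K_0 is the same function
  plus exp (- s), so all kernel estimates concern one real function.\<close>

definition kern :: "real \<Rightarrow> real \<Rightarrow> real" where
  "kern s r = (if r = 1 then s * exp (- s) else (exp (- s * r) - exp (- s)) / (1 - r))"

lemma norm_square_eq_1: "(norm x)\<^sup>2 = 1 \<longleftrightarrow> norm x = 1"
  using power2_eq_imp_eq[of "norm x" 1] by auto

lemma symbol1_kern: "symbol1 s \<xi> = kern s ((norm \<xi>)\<^sup>2)"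
  by (simp add: symbol1_def kern_def norm_square_eq_1)

lemma symbol0_kern: "symbol0 s \<xi> = kern s ((norm \<xi>)\<^sup>2) + exp (- s)"
  by (auto simp: symbol0_def kern_def norm_square_eq_1 field_simps)

lemma kern_measurable [measurable]: "kern s \<in> borel_measurable borel"
  unfolding kern_def[abs_def] by measurable

lemma mult_exp_neg_le: "x * exp (- x) \<le> (1::real)"
proof -
  have "x \<le> exp x" using exp_ge_add_one_self[of x] by linarith
  then show ?thesis by (simp add: exp_minus field_simps)
qed

lemma kern_nonneg:
  assumes "s \<ge> 0" shows "kern s r \<ge> 0"
proof -
  consider "r = 1" | "r < 1" | "r > 1" by linarith
  then show ?thesis
  proof cases
    case 2
    then have "s * r \<le> s * 1" using assms by (intro mult_left_mono) auto
    then show ?thesis using 2 by (simp add: kern_def)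
  next
    case 3
    then have "s * 1 \<le> s * r" using assms by (intro mult_left_mono) auto
    then show ?thesis using 3 by (simp add: kern_def divide_nonpos_neg)
  qed (use assms in \<open>simp add: kern_def\<close>)
qed

text \<open>Up to sign, \<open>kern s r\<close> is the difference quotient of x |-> exp (- s x)
  between r and 1, and convexity bounds it by the slope at the smaller point. The bound is uniform
  across the removable singularity.\<close>

lemma kern_le_min:
  assumes s: "s \<ge> 0"
  shows "kern s r \<le> s * exp (- s * min r 1)"
proof -
  have e: "exp (- a) - exp (- b) \<le> (b - a) * exp (- a)" for a b :: real
  proof -
    have "exp (- a) * (1 + (a - b)) \<le> exp (- a) * exp (a - b)"
      by (intro mult_left_mono exp_ge_add_one_self) auto
    then show ?thesis by (simp add: algebra_simps flip: exp_add)
  qed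
  consider "r = 1" | "r < 1" | "r > 1" by linarith
  then show ?thesis
  proof cases
    case 2
    have "exp (- (s * r)) - exp (- s) \<le> (s - s * r) * exp (- (s * r))" by (rule e)
    then have "(exp (- (s * r)) - exp (- s)) / (1 - r) \<le> ((s - s * r) * exp (- (s * r))) / (1 - r)"
      using 2 by (intro divide_right_mono) auto
    also have "\<dots> = s * exp (- (s * r))" using 2 by (simp add: field_simps)
    finally show ?thesis using 2 by (simp add: kern_def)
  next
    case 3
    have "exp (- s) - exp (- (s * r)) \<le> (s * r - s) * exp (- s)" by (rule e)
    then have "(exp (- s) - exp (- (s * r))) / (r - 1) \<le> ((s * r - s) * exp (- s)) / (r - 1)"
      using 3 by (intro divide_right_mono) auto
    also have "\<dots> = s * exp (- s)" using 3 by (simp add: field_simps)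
    also have "(exp (- s) - exp (- (s * r))) / (r - 1) = kern s r" using 3 by (simp add: kern_def field_simps)
    finally show ?thesis using 3 by simp
  qed (simp add: kern_def)
qed

lemma kern_low:
  assumes s: "s \<ge> 0" and r: "0 \<le> r" "r \<le> 1/2"
  shows "kern s r \<le> 2 * exp (- s * r)"
proof -
  have "kern s r \<le> exp (- s * r) / (1 - r)" using r by (simp add: kern_def divide_right_mono)
  also have "\<dots> \<le> exp (- s * r) / (1/2)" using r by (intro divide_left_mono) auto
  finally show ?thesis by simp
qed

text \<open>For r >= 2 the denominator r - 1 is at least (1 + r) / 3, which is the gain of two
  derivatives. For r between 1/2 and 2 the bound s exp (- s / 2) <= 4 exp (- s / 4) is used, and 1 +
  r <= 3 yields the constant 12.\<close>

lemma kern_high: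
  assumes s: "s \<ge> 0" and r: "r \<ge> 1/2"
  shows "kern s r \<le> 12 * exp (- s / 4) / (1 + r)"
proof (cases "r \<ge> 2")
  case True
  have "kern s r = (exp (- s) - exp (- s * r)) / (r - 1)" using True by (simp add: kern_def field_simps)
  also have "\<dots> \<le> exp (- s) / (r - 1)" using True by (intro divide_right_mono) auto
  also have "\<dots> \<le> exp (- s / 4) / ((1 + r) / 3)" using True s by (intro frac_le) auto
  also have "\<dots> \<le> 12 * exp (- s / 4) / (1 + r)" using True by (simp add: divide_right_mono)
  finally show ?thesis .
next
  case False
  have "kern s r \<le> s * exp (- s * min r 1)" by (rule kern_le_min[OF s])
  also have "\<dots> \<le> s * exp (- s * (1/2))"
  proof -
    have "s * (1/2) \<le> s * min r 1" using s r by (intro mult_left_mono) auto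
    then show ?thesis using s by (intro mult_left_mono) auto
  qed
  also have "\<dots> = 4 * ((s / 4) * exp (- (s / 4))) * exp (- s / 4)"
    by (simp flip: exp_add)
  also have "\<dots> \<le> 4 * 1 * exp (- s / 4)"
    by (intro mult_right_mono mult_left_mono mult_exp_neg_le) auto
  also have "\<dots> \<le> 12 * exp (- s / 4) / (1 + r)" using False r by (simp add: field_simps)
  finally show ?thesis .
qed

lemma kern_le_12:
  assumes s: "s \<ge> 0" and r: "0 \<le> r" shows "kern s r \<le> 12"
proof (cases "r \<le> 1/2")
  case True
  have "exp (- s * r) \<le> 1" using s r by simp
  with kern_low[OF s r True] show ?thesis by linarith
next
  case False
  have "kern s r \<le> 12 * exp (- s / 4) / (1 + r)" using False by (intro kern_high s) auto
  also have "\<dots> \<le> 12 * 1 / 1" using s r by (intro frac_le mult_left_mono) auto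
  finally show ?thesis by simp
qed

text \<open>At low frequency (1 - r) kern = exp (- s r) - exp (- s), so the difference equals r kern
  - exp (- s); the factor r = |xi|^2 is worth one power of time. At high frequency there is no
  cancellation, and 1 <= 2 r absorbs the heat term.\<close>

lemma kern_diff:
  assumes s: "s \<ge> 0" and r: "0 \<le> r"
  shows "\<bar>kern s r - exp (- s * r)\<bar> \<le> 2 * r * exp (- s * r) + 12 * exp (- s / 4) / (1 + r)"
proof (cases "r \<le> 1/2")
  case True
  have eq: "kern s r - exp (- s * r) = r * kern s r - exp (- s)"
    using True by (simp add: kern_def field_simps)
  have "\<bar>r * kern s r - exp (- s)\<bar> \<le> r * kern s r + exp (- s)"
    using kern_nonneg[OF s, of r] r by (simp add: abs_le_iff) 
  also have "r * kern s r \<le> r * (2 * exp (- s * r))" using kern_low[OF s r True] r by (intro mult_left_mono) auto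
  also have "exp (- s) \<le> 12 * exp (- s / 4) / (1 + r)"
  proof -
    have "exp (- s) \<le> exp (- s / 4)" using s by simp
    also have "\<dots> \<le> 12 * exp (- s / 4) / (1 + r)" using True r by (simp add: field_simps)
    finally show ?thesis .
  qed
  finally show ?thesis unfolding eq by (simp add: mult_ac)
next
  case False
  have "\<bar>kern s r - exp (- s * r)\<bar> \<le> kern s r + exp (- s * r)"
    using kern_nonneg[OF s, of r] by (simp add: abs_le_iff)
  also have "kern s r \<le> 12 * exp (- s / 4) / (1 + r)" using False by (intro kern_high s) auto
  also have "exp (- s * r) \<le> 2 * r * exp (- s * r)" using False by simp
  finally show ?thesis by simp
qed

lemma kern_decay:
  assumes s: "s \<ge> 0" and r: "0 \<le> r"
  shows "(1 + s) * r * kern s r \<le> 60"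
proof (cases "r \<le> 1/2")
  case True
  have "(1 + s) * r * kern s r \<le> (1 + s) * r * (2 * exp (- s * r))"
    using kern_low[OF s r True] s r by (intro mult_left_mono) auto
  also have "\<dots> = 2 * (r * exp (- s * r)) + 2 * ((s * r) * exp (- (s * r)))" by (simp add: algebra_simps)
  also have "\<dots> \<le> 2 * (1/2 * 1) + 2 * 1"
    using True s r by (intro add_mono mult_left_mono mult_mono mult_exp_neg_le) auto
  finally show ?thesis by simp
next
  case False
  have "(1 + s) * r * kern s r \<le> (1 + s) * r * (12 * exp (- s / 4) / (1 + r))"
    using kern_high[OF s, of r] False s r by (intro mult_left_mono) auto
  also have "\<dots> = (1 + s) * (12 * exp (- s / 4)) * (r / (1 + r))" by simp
  also have "\<dots> \<le> (1 + s) * (12 * exp (- s / 4)) * 1"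
    using s r by (intro mult_left_mono) auto
  also have "\<dots> = 12 * exp (- s / 4) + 48 * ((s / 4) * exp (- (s / 4)))" by (simp add: algebra_simps)
  also have "\<dots> \<le> 12 * 1 + 48 * 1" using s by (intro add_mono mult_left_mono mult_exp_neg_le) auto
  finally show ?thesis by simp
qed

text \<open>Interpolation between the uniform bound 12 and \<open>kern_decay\<close>: with x = (1 +
  s) r, the power x^(a/2) is at most 1 or at most x. The limit a <= 2 reflects the gain of two
  derivatives.\<close>

lemma kern_weight:
  fixes \<xi> :: "'a::euclidean_space"
  assumes s: "s \<ge> 0" and a: "0 \<le> a" "a \<le> 2"
  shows "norm \<xi> powr a * kern s ((norm \<xi>)\<^sup>2) \<le> 60 * (1 + s) powr (- (a / 2))"
proof -
  define r where "r = (norm \<xi>)\<^sup>2"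
  have r: "r \<ge> 0" by (simp add: r_def)
  define x where "x = (1 + s) * r"
  have x: "x \<ge> 0" using s r by (simp add: x_def)
  note k = kern_nonneg[OF s, of r]
  have xk: "x powr (a / 2) * kern s r \<le> 60"
  proof (cases "x \<le> 1")
    case True
    then have "x powr (a / 2) \<le> 1" using x a by (intro powr_le1) auto
    then have "x powr (a / 2) * kern s r \<le> 1 * 12" using kern_le_12[OF s r] k by (intro mult_mono) auto
    then show ?thesis by simp
  next
    case False
    then have "x powr (a / 2) \<le> x powr 1" using a by (intro powr_mono) auto
    then have "x powr (a / 2) * kern s r \<le> x * kern s r" using False k by (intro mult_right_mono) auto
    then show ?thesis using kern_decay[OF s r] by (simp add: x_def)
  qed
  have "norm \<xi> powr a = r powr (a / 2)"
  proof (cases "\<xi> = 0")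
    case False
    then have "r = norm \<xi> powr 2" by (simp add: r_def)
    then show ?thesis by (simp only: powr_powr) simp
  qed (simp add: r_def)
  then have "norm \<xi> powr a * kern s r = (1 + s) powr (- (a / 2)) * (x powr (a / 2) * kern s r)"
    using s by (simp add: x_def powr_mult powr_minus_divide)
  also have "\<dots> \<le> (1 + s) powr (- (a / 2)) * 60" by (intro mult_left_mono xk) auto
  finally show ?thesis by (simp add: r_def mult.commute)
qed

text \<open>At time 1 the gain of two derivatives is exact, so the kernel can be divided out. This
  allows regularity of the initial velocity to be recovered from that of the solution.\<close>

lemma kern_1_lower:
  assumes r: "0 \<le> r"
  shows "exp (- 1) / (1 + r) \<le> kern 1 r"
proof -
  have l: "exp (- 1) / (1 + r) \<le> exp (- 1)" using r by (simp add: field_simps)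
  consider "r = 1" | "r < 1" | "r > 1" by linarith
  then show ?thesis
  proof cases
    case 1
    then show ?thesis using l by (simp add: kern_def)
  next
    case 2
    have "1 + (1 - r) \<le> exp (1 - r)" by (rule exp_ge_add_one_self)
    then have "exp (- 1) * (1 - r) \<le> exp (- 1) * (exp (1 - r) - 1)" by (intro mult_left_mono) auto
    also have "\<dots> = exp (- r) - exp (- 1)" by (simp add: algebra_simps flip: exp_add)
    finally have "exp (- 1) \<le> kern 1 r" using 2 by (simp add: kern_def field_simps)
    with l show ?thesis by linarith
  next
    case 3
    have "1 + (r - 1) \<le> exp (r - 1)" by (rule exp_ge_add_one_self)
    then have "exp (- (r - 1)) \<le> 1 / r"
      using 3 unfolding exp_minus inverse_eq_divide by (intro divide_left_mono) auto
    then have "exp (- 1) * (1 - 1 / r) \<le> exp (- 1) * (1 - exp (- (r - 1)))" by (intro mult_left_mono) auto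
    also have "\<dots> = exp (- 1) - exp (- r)" by (simp add: algebra_simps flip: exp_add)
    finally have "exp (- 1) * (1 - 1 / r) / (r - 1) \<le> (exp (- 1) - exp (- r)) / (r - 1)"
      using 3 by (intro divide_right_mono) auto
    also have "\<dots> = kern 1 r" using 3 by (simp add: kern_def field_simps)
    also have "exp (- 1) * (1 - 1 / r) / (r - 1) = exp (- 1) / r" using 3 by (simp add: field_simps)
    finally have "exp (- 1) / r \<le> kern 1 r" .
    moreover have "exp (- 1) / (1 + r) \<le> exp (- 1) / r" using 3 by (intro divide_left_mono) auto
    ultimately show ?thesis by linarith
  qed
qed

section \<open>Weighted norms of Gaussians\<close>

lemma powr_exp_bounded:
  assumes b: "b \<ge> 0"
  shows "\<exists>c>0. \<forall>y\<ge>0. y powr b * exp (- y / 2) \<le> (c::real)"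
proof (cases "b = 0")
  case True
  have "y powr b * exp (- y / 2) \<le> 1 * 1" if "y \<ge> 0" for y
    using that True by (intro mult_mono) (auto simp: powr_zero_eq_one)
  then show ?thesis by (intro exI[of _ 1]) auto
next
  case False
  with b have b: "b > 0" by simp
  have "y powr b * exp (- y / 2) \<le> exp (b * ln (2 * b))" if "y \<ge> 0" for y
  proof (cases "y = 0")
    case False
    with that have y: "y > 0" by simp
    have "ln (y / (2 * b)) \<le> y / (2 * b) - 1" using y b by (intro ln_le_minus_one) auto
    then have "b * ln (y / (2 * b)) \<le> b * (y / (2 * b))" using b by (intro mult_left_mono) auto
    then have "b * ln y - y / 2 \<le> b * ln (2 * b)" using y b by (simp add: ln_div right_diff_distrib)
    then show ?thesis using y by (simp add: powr_def flip: exp_add)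
  qed (use b in auto)
  then show ?thesis by (intro exI[of _ "exp (b * ln (2 * b))"]) auto
qed

text \<open>With y = t |xi|^2, one half of the exponent absorbs the weight through the boundedness
  of y^(k/2) exp (- y / 2). The other half is a Gaussian of norm (pi / t)^(n/4).\<close>

lemma gauss_weight:
  assumes k: "k \<ge> 0"
  shows "\<exists>G>0. \<forall>t>0. (\<lambda>\<xi>::'a::euclidean_space. norm \<xi> powr k * exp (- t * (norm \<xi>)\<^sup>2)) \<in> L2 \<and>
    L2_norm (\<lambda>\<xi>::'a. norm \<xi> powr k * exp (- t * (norm \<xi>)\<^sup>2)) \<le> G * t powr (- (real DIM('a) / 4) - k / 2)"
proof -
  obtain c where c: "c > 0" "\<And>y. y \<ge> 0 \<Longrightarrow> y powr (k / 2) * exp (- y / 2) \<le> c"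
    using powr_exp_bounded[of "k / 2"] k by auto
  define d where "d = real DIM('a)"
  show ?thesis
  proof (intro exI[of _ "c * pi powr (d / 4)"] conjI allI impI)
    fix t :: real assume t: "t > 0"
    define h where "h \<xi> = exp (- (t / 2) * (norm \<xi>)\<^sup>2)" for \<xi> :: 'a
    have [measurable]: "h \<in> borel_measurable borel" unfolding h_def[abs_def] by measurable
    have hsq: "(h \<xi>)\<^sup>2 = exp (- t * (norm \<xi>)\<^sup>2)" for \<xi>
      by (simp add: h_def power2_eq_square flip: exp_add)
    have h: "h \<in> L2" using gaussian_integral(1)[OF t, where 'a='a] by (simp add: L2_def hsq)
    have hn: "L2_norm h = (pi / t) powr (d / 4)"
      unfolding L2_norm_def real_norm_def power2_abs hsq gaussian_integral(2)[OF t] using t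
      by (simp add: powr_half_sqrt[symmetric] powr_powr d_def)
    have le: "norm (norm \<xi> powr k * exp (- t * (norm \<xi>)\<^sup>2)) \<le> (c * t powr (- (k / 2))) * norm (h \<xi>)" for \<xi> :: 'a
    proof -
      have e: "norm \<xi> powr k = t powr (- (k / 2)) * (t * (norm \<xi>)\<^sup>2) powr (k / 2)"
      proof (cases "\<xi> = 0")
        case False
        then have "(norm \<xi>)\<^sup>2 = norm \<xi> powr 2" by simp
        then show ?thesis using t by (simp only: powr_mult powr_powr) (simp flip: powr_add mult.assoc)
      qed simp
      have "norm \<xi> powr k * exp (- t * (norm \<xi>)\<^sup>2) = t powr (- (k / 2)) * ((t * (norm \<xi>)\<^sup>2) powr (k / 2) * exp (- (t * (norm \<xi>)\<^sup>2) / 2)) * h \<xi>"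
        unfolding e h_def by (simp add: mult.assoc flip: exp_add)
      also have "\<dots> \<le> t powr (- (k / 2)) * c * h \<xi>"
        using t by (intro mult_right_mono mult_left_mono c) (auto simp: h_def)
      finally show ?thesis by (simp add: h_def mult_ac)
    qed
    have m: "(\<lambda>\<xi>::'a. norm \<xi> powr k * exp (- t * (norm \<xi>)\<^sup>2)) \<in> borel_measurable borel" by measurable
    have cp: "0 \<le> c * t powr (- (k / 2))" using c by simp
    note D = L2_dominated[OF m h cp AE_I2[OF le]]
    show "(\<lambda>\<xi>::'a. norm \<xi> powr k * exp (- t * (norm \<xi>)\<^sup>2)) \<in> L2" by (rule D(1))
    note D(2)
    also have "c * t powr (- (k / 2)) * L2_norm h = c * pi powr (d / 4) * (t powr (- (d / 4)) * t powr (- (k / 2)))"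
      using t by (simp add: hn powr_divide powr_minus_divide)
    also have "t powr (- (d / 4)) * t powr (- (k / 2)) = t powr (- (d / 4) - k / 2)"
      by (simp flip: powr_add)
    finally show "L2_norm (\<lambda>\<xi>::'a. norm \<xi> powr k * exp (- t * (norm \<xi>)\<^sup>2)) \<le> c * pi powr (d / 4) * t powr (- (real DIM('a) / 4) - k / 2)"
      by (simp add: d_def)
  qed (use c in auto)
qed

section \<open>Comparing the kernel with the heat semigroup and its profile\<close>

lemma fourier_real_bound:
  fixes g :: "'a::euclidean_space \<Rightarrow> real"
  assumes "g \<in> L2" "integrable lborel g"
  shows "AE \<xi> in lborel. norm (fourier_real g \<xi>) \<le> fourier_const TYPE('a) * (\<integral>x. \<bar>g x\<bar> \<partial>lborel)"
proof -
  have "AE \<xi> in lborel. fourier_real g \<xi> = fourier_integral (\<lambda>x. of_real (g x)) \<xi>"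
    using assms by (intro fourier_eq_integral L2_of_real) auto
  then show ?thesis
  proof eventually_elim
    case (elim \<xi>)
    then show ?case using norm_fourier_integral_le[of "\<lambda>x. of_real (g x)" \<xi>] by simp
  qed
qed

lemma norm_powr_plus_2: "norm x powr (k + 2) = norm x powr k * (norm x)\<^sup>2"
  by (simp add: powr_add)

lemma L2_dominated_add:
  fixes f :: "'a::euclidean_space \<Rightarrow> complex" and A :: "'a \<Rightarrow> real" and B :: "'a \<Rightarrow> complex"
  assumes f: "f \<in> borel_measurable borel" and A: "A \<in> L2" and B: "B \<in> L2" and ab: "a \<ge> 0" "b \<ge> 0"
    and le: "AE \<xi> in lborel. norm (f \<xi>) \<le> a * \<bar>A \<xi>\<bar> + b * norm (B \<xi>)"
  shows "f \<in> L2" "L2_norm f \<le> a * L2_norm A + b * L2_norm B"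
proof -
  note [measurable] = L2_measurable[OF A] L2_measurable[OF B]
  have A': "(\<lambda>\<xi>. a * \<bar>A \<xi>\<bar>) \<in> L2" "L2_norm (\<lambda>\<xi>. a * \<bar>A \<xi>\<bar>) \<le> a * L2_norm A"
    using ab by (auto intro!: L2_dominated[OF _ A ab(1)] simp: abs_mult)
  have B': "(\<lambda>\<xi>. b * norm (B \<xi>)) \<in> L2" "L2_norm (\<lambda>\<xi>. b * norm (B \<xi>)) \<le> b * L2_norm B"
    using ab by (auto intro!: L2_dominated[OF _ B ab(2)] simp: abs_mult)
  have "AE \<xi> in lborel. norm (f \<xi>) \<le> 1 * norm (a * \<bar>A \<xi>\<bar> + b * norm (B \<xi>))"
    using le by eventually_elim (use ab in auto)
  note D = L2_dominated[OF f L2_add(1)[OF A'(1) B'(1)] _ this]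
  show "f \<in> L2" using D(1) by simp
  show "L2_norm f \<le> a * L2_norm A + b * L2_norm B"
    using D(2) L2_norm_triangle[OF A'(1) B'(1)] A'(2) B'(2) by simp
qed

text \<open>The low frequency error in \<open>kern_diff\<close> carries |xi|^2 and is paired with
  the L1 norm of \<open>g\<close>, so it decays one power of time faster. The high frequency error
  decays exponentially and asks \<open>g\<close> for only k - 2 derivatives there, whence the weight
  in the hypothesis.\<close>

lemma kernel_approx:
  fixes g :: "'a::euclidean_space \<Rightarrow> real"
  assumes g: "g \<in> L2" "integrable lborel g" and s: "s > 0" and k: "k \<ge> 0"
    and h: "(\<lambda>\<xi>. of_real (norm \<xi> powr k / (1 + (norm \<xi>)\<^sup>2)) * fourier_real g \<xi>) \<in> L2"
    and G: "(\<lambda>\<xi>::'a. norm \<xi> powr (k + 2) * exp (- s * (norm \<xi>)\<^sup>2)) \<in> L2"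
  shows "(\<lambda>\<xi>. of_real (norm \<xi> powr k * (kern s ((norm \<xi>)\<^sup>2) - exp (- s * (norm \<xi>)\<^sup>2))) * fourier_real g \<xi>) \<in> L2"
    "L2_norm (\<lambda>\<xi>. of_real (norm \<xi> powr k * (kern s ((norm \<xi>)\<^sup>2) - exp (- s * (norm \<xi>)\<^sup>2))) * fourier_real g \<xi>) \<le>
      2 * fourier_const TYPE('a) * (\<integral>x. \<bar>g x\<bar> \<partial>lborel) * L2_norm (\<lambda>\<xi>::'a. norm \<xi> powr (k + 2) * exp (- s * (norm \<xi>)\<^sup>2))
      + 12 * exp (- s / 4) * L2_norm (\<lambda>\<xi>. of_real (norm \<xi> powr k / (1 + (norm \<xi>)\<^sup>2)) * fourier_real g \<xi>)"
proof -
  define m where "m = fourier_const TYPE('a) * (\<integral>x. \<bar>g x\<bar> \<partial>lborel)"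
  have m: "0 \<le> m" by (simp add: m_def integral_nonneg)
  note [measurable] = L2_measurable[OF fourier_real_L2(1)[OF g(1)]]
  have meas: "(\<lambda>\<xi>. of_real (norm \<xi> powr k * (kern s ((norm \<xi>)\<^sup>2) - exp (- s * (norm \<xi>)\<^sup>2))) * fourier_real g \<xi>) \<in> borel_measurable borel"
    by measurable
  have "AE \<xi> in lborel. norm (of_real (norm \<xi> powr k * (kern s ((norm \<xi>)\<^sup>2) - exp (- s * (norm \<xi>)\<^sup>2))) * fourier_real g \<xi>)
     \<le> (2 * m) * \<bar>norm \<xi> powr (k + 2) * exp (- s * (norm \<xi>)\<^sup>2)\<bar> + (12 * exp (- s / 4)) * norm (of_real (norm \<xi> powr k / (1 + (norm \<xi>)\<^sup>2)) * fourier_real g \<xi>)"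
    using fourier_real_bound[OF g, folded m_def]
  proof eventually_elim
    case (elim \<xi>)
    define r where "r = (norm \<xi>)\<^sup>2"
    define P where "P = norm (fourier_real g \<xi>)"
    define N where "N = norm \<xi> powr k"
    have r: "r \<ge> 0" and P: "0 \<le> P" "P \<le> m" and N: "N \<ge> 0" using elim by (auto simp: r_def P_def N_def)
    have r1: "1 + r > 0" using r by linarith
    have "N * \<bar>kern s r - exp (- s * r)\<bar> * P \<le> N * (2 * r * exp (- s * r) + 12 * exp (- s / 4) / (1 + r)) * P"
      using s r N P by (intro mult_right_mono mult_left_mono kern_diff) auto
    also have "\<dots> = (2 * (N * r * exp (- s * r))) * P + 12 * exp (- s / 4) * (N / (1 + r) * P)"
      by (simp add: algebra_simps)
    also have "\<dots> \<le> (2 * (N * r * exp (- s * r))) * m + 12 * exp (- s / 4) * (N / (1 + r) * P)"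
      using N r P by (intro add_right_mono mult_left_mono) auto
    finally show ?case
      unfolding norm_mult norm_of_real abs_mult abs_divide norm_powr_plus_2 r_def[symmetric] P_def[symmetric] N_def[symmetric]
      using r1 N r by (simp add: mult_ac)
  qed
  note D = L2_dominated_add[OF meas G h _ _ this]
  show "(\<lambda>\<xi>. of_real (norm \<xi> powr k * (kern s ((norm \<xi>)\<^sup>2) - exp (- s * (norm \<xi>)\<^sup>2))) * fourier_real g \<xi>) \<in> L2"
    "L2_norm (\<lambda>\<xi>. of_real (norm \<xi> powr k * (kern s ((norm \<xi>)\<^sup>2) - exp (- s * (norm \<xi>)\<^sup>2))) * fourier_real g \<xi>) \<le>
      2 * fourier_const TYPE('a) * (\<integral>x. \<bar>g x\<bar> \<partial>lborel) * L2_norm (\<lambda>\<xi>::'a. norm \<xi> powr (k + 2) * exp (- s * (norm \<xi>)\<^sup>2))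
      + 12 * exp (- s / 4) * L2_norm (\<lambda>\<xi>. of_real (norm \<xi> powr k / (1 + (norm \<xi>)\<^sup>2)) * fourier_real g \<xi>)"
    using D m by (simp_all add: m_def mult.assoc)
qed

text \<open>From 1 - exp (- \<tau> |xi|^2) <= \<tau> |xi|^2. In the Duhamel integral the growing
  factor \<tau> is paid for by the decay of the mass.\<close>

lemma heat_shift:
  fixes g :: "'a::euclidean_space \<Rightarrow> real"
  assumes g: "g \<in> L2" "integrable lborel g" and \<tau>: "0 \<le> \<tau>" "\<tau> < t" and k: "k \<ge> 0"
    and G: "(\<lambda>\<xi>::'a. norm \<xi> powr (k + 2) * exp (- (t - \<tau>) * (norm \<xi>)\<^sup>2)) \<in> L2"
  shows "(\<lambda>\<xi>. of_real (norm \<xi> powr k * (exp (- (t - \<tau>) * (norm \<xi>)\<^sup>2) - exp (- t * (norm \<xi>)\<^sup>2))) * fourier_real g \<xi>) \<in> L2"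
    "L2_norm (\<lambda>\<xi>. of_real (norm \<xi> powr k * (exp (- (t - \<tau>) * (norm \<xi>)\<^sup>2) - exp (- t * (norm \<xi>)\<^sup>2))) * fourier_real g \<xi>) \<le>
      \<tau> * fourier_const TYPE('a) * (\<integral>x. \<bar>g x\<bar> \<partial>lborel) * L2_norm (\<lambda>\<xi>::'a. norm \<xi> powr (k + 2) * exp (- (t - \<tau>) * (norm \<xi>)\<^sup>2))"
proof -
  define m where "m = fourier_const TYPE('a) * (\<integral>x. \<bar>g x\<bar> \<partial>lborel)"
  have m: "0 \<le> m" by (simp add: m_def integral_nonneg)
  note [measurable] = L2_measurable[OF fourier_real_L2(1)[OF g(1)]]
  have meas: "(\<lambda>\<xi>. of_real (norm \<xi> powr k * (exp (- (t - \<tau>) * (norm \<xi>)\<^sup>2) - exp (- t * (norm \<xi>)\<^sup>2))) * fourier_real g \<xi>) \<in> borel_measurable borel"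
    by measurable
  have "AE \<xi> in lborel. norm (of_real (norm \<xi> powr k * (exp (- (t - \<tau>) * (norm \<xi>)\<^sup>2) - exp (- t * (norm \<xi>)\<^sup>2))) * fourier_real g \<xi>)
     \<le> (\<tau> * m) * norm (norm \<xi> powr (k + 2) * exp (- (t - \<tau>) * (norm \<xi>)\<^sup>2))"
    using fourier_real_bound[OF g, folded m_def]
  proof eventually_elim
    case (elim \<xi>)
    define r where "r = (norm \<xi>)\<^sup>2"
    define P where "P = norm (fourier_real g \<xi>)"
    define N where "N = norm \<xi> powr k"
    have r: "r \<ge> 0" and P: "0 \<le> P" "P \<le> m" and N: "N \<ge> 0" using elim by (auto simp: r_def P_def N_def)
    define e where "e = exp (- (t - \<tau>) * r)"
    have "exp (- t * r) = exp (- (t - \<tau>) * r + - (\<tau> * r))" by (simp add: algebra_simps)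
    then have e: "e > 0" "exp (- t * r) = e * exp (- (\<tau> * r))" unfolding e_def exp_add by simp_all
    have tr: "0 \<le> \<tau> * r" using \<tau> r by simp
    have "1 - exp (- (\<tau> * r)) \<le> \<tau> * r" using exp_ge_add_one_self[of "- (\<tau> * r)"] by linarith
    then have "\<bar>1 - exp (- (\<tau> * r))\<bar> \<le> \<tau> * r" using tr by (simp add: abs_le_iff)
    then have "N * (e * \<bar>1 - exp (- (\<tau> * r))\<bar>) * P \<le> N * (e * (\<tau> * r)) * m"
      using e(1) N P tr by (intro mult_mono) auto
    moreover have "\<bar>e - exp (- t * r)\<bar> = e * \<bar>1 - exp (- (\<tau> * r))\<bar>"
    proof -
      have "e - exp (- t * r) = e * (1 - exp (- (\<tau> * r)))" unfolding e(2) right_diff_distrib by simp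
      then show ?thesis using e(1) by (simp only: abs_mult abs_of_pos)
    qed
    ultimately have "N * \<bar>e - exp (- t * r)\<bar> * P \<le> (\<tau> * m) * (N * r * e)" by (simp add: mult_ac)
    then show ?case
      unfolding norm_mult norm_of_real abs_mult norm_powr_plus_2 r_def[symmetric] P_def[symmetric] N_def[symmetric] e_def[symmetric]
      using N r e(1) by simp
  qed
  note D = L2_dominated[OF meas G _ this]
  show "(\<lambda>\<xi>. of_real (norm \<xi> powr k * (exp (- (t - \<tau>) * (norm \<xi>)\<^sup>2) - exp (- t * (norm \<xi>)\<^sup>2))) * fourier_real g \<xi>) \<in> L2"
    "L2_norm (\<lambda>\<xi>. of_real (norm \<xi> powr k * (exp (- (t - \<tau>) * (norm \<xi>)\<^sup>2) - exp (- t * (norm \<xi>)\<^sup>2))) * fourier_real g \<xi>) \<le>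
      \<tau> * fourier_const TYPE('a) * (\<integral>x. \<bar>g x\<bar> \<partial>lborel) * L2_norm (\<lambda>\<xi>::'a. norm \<xi> powr (k + 2) * exp (- (t - \<tau>) * (norm \<xi>)\<^sup>2))"
    using D m \<tau> by (simp_all add: m_def mult.assoc)
qed

text \<open>The weighted transform of the heat flow of \<open>g\<close> minus its mass times the
  Gauss kernel. It is built on \<open>fourier_integral\<close>, whose value at 0 is the normalised
  mass, whereas \<open>fourier\<close> is determined only almost everywhere.\<close>

definition heat_defect :: "real \<Rightarrow> real \<Rightarrow> ('a::euclidean_space \<Rightarrow> real) \<Rightarrow> 'a \<Rightarrow> complex" where
  "heat_defect k t g \<xi> = of_real (norm \<xi> powr k * exp (- t * (norm \<xi>)\<^sup>2)) *
     (fourier_integral (\<lambda>x. of_real (g x)) \<xi> - of_real (fourier_const TYPE('a) * (\<integral>x. g x \<partial>lborel)))"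

lemma fourier_integral_0:
  "fourier_integral (\<lambda>x. of_real (g x)) (0::'a::euclidean_space) = of_real (fourier_const TYPE('a) * (\<integral>x. g x \<partial>lborel))"
  by (simp add: fourier_integral_altdef)

lemma heat_defect_L2:
  fixes g :: "'a::euclidean_space \<Rightarrow> real"
  assumes g: "integrable lborel g" and G: "(\<lambda>\<xi>::'a. norm \<xi> powr k * exp (- t * (norm \<xi>)\<^sup>2)) \<in> L2"
  shows "heat_defect k t g \<in> L2"
    "L2_norm (heat_defect k t g) \<le> 2 * fourier_const TYPE('a) * (\<integral>x. \<bar>g x\<bar> \<partial>lborel) * L2_norm (\<lambda>\<xi>::'a. norm \<xi> powr k * exp (- t * (norm \<xi>)\<^sup>2))"
proof -
  have [measurable]: "g \<in> borel_measurable borel" using g by (auto dest: borel_measurable_integrable)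
  have [measurable]: "fourier_integral (\<lambda>x. complex_of_real (g x)) \<in> borel_measurable borel"
    by (rule fourier_integral_measurable) measurable
  have meas: "heat_defect k t g \<in> borel_measurable borel" unfolding heat_defect_def[abs_def] by measurable
  define m where "m = fourier_const TYPE('a) * (\<integral>x. \<bar>g x\<bar> \<partial>lborel)"
  have m: "0 \<le> m" by (simp add: m_def integral_nonneg)
  have b: "norm (fourier_integral (\<lambda>x. of_real (g x)) \<xi>) \<le> m" for \<xi>
    using norm_fourier_integral_le[of "\<lambda>x. of_real (g x)" \<xi>] by (simp add: m_def)
  have le: "AE \<xi> in lborel. norm (heat_defect k t g \<xi>) \<le> (2 * m) * norm (norm \<xi> powr k * exp (- t * (norm \<xi>)\<^sup>2))"
  proof (intro AE_I2)
    fix \<xi> :: 'a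
    define X Y where "X = norm (norm \<xi> powr k * exp (- t * (norm \<xi>)\<^sup>2))"
      and "Y = norm (fourier_integral (\<lambda>x. of_real (g x)) \<xi> - of_real (fourier_const TYPE('a) * (\<integral>x. g x \<partial>lborel)))"
    have "Y \<le> m + m"
      unfolding Y_def fourier_integral_0[symmetric] using b[of \<xi>] b[of 0] norm_triangle_ineq4 add_mono order_trans by metis
    then have "X * Y \<le> X * (m + m)" by (intro mult_left_mono) (auto simp: X_def)
    moreover have "norm (heat_defect k t g \<xi>) = X * Y"
      unfolding heat_defect_def X_def Y_def norm_mult[of "of_real (norm \<xi> powr k * exp (- t * (norm \<xi>)\<^sup>2))"] by (simp only: norm_of_real real_norm_def)
    ultimately show "norm (heat_defect k t g \<xi>) \<le> (2 * m) * norm (norm \<xi> powr k * exp (- t * (norm \<xi>)\<^sup>2))"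
      unfolding X_def[symmetric] by (simp add: mult.commute)
  qed
  note D = L2_dominated[OF meas G _ le]
  show "heat_defect k t g \<in> L2"
    "L2_norm (heat_defect k t g) \<le> 2 * fourier_const TYPE('a) * (\<integral>x. \<bar>g x\<bar> \<partial>lborel) * L2_norm (\<lambda>\<xi>::'a. norm \<xi> powr k * exp (- t * (norm \<xi>)\<^sup>2))"
    using D m by (simp_all add: m_def mult.assoc)
qed

lemma heat_defect_diff:
  fixes g g' :: "'a::euclidean_space \<Rightarrow> real"
  assumes g: "integrable lborel g" "integrable lborel g'"
  shows "heat_defect k t (\<lambda>x. g x - g' x) \<xi> = heat_defect k t g \<xi> - heat_defect k t g' \<xi>"
proof -
  have e1: "fourier_integral (\<lambda>x. complex_of_real (g x - g' x)) \<xi> = fourier_integral (\<lambda>x. of_real (g x)) \<xi> - fourier_integral (\<lambda>x. of_real (g' x)) \<xi>"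
    using g fourier_integral_diff[of "\<lambda>x. of_real (g x)" "\<lambda>x. of_real (g' x)"] by simp
  have e2: "(\<integral>x. g x - g' x \<partial>lborel) = (\<integral>x. g x \<partial>lborel) - (\<integral>x. g' x \<partial>lborel)"
    using g by simp
  show ?thesis unfolding heat_defect_def e1 e2 by (simp add: algebra_simps)
qed

lemma heat_defect_lipschitz:
  fixes g g' :: "'a::euclidean_space \<Rightarrow> real"
  assumes g: "integrable lborel g" "integrable lborel g'" and G: "(\<lambda>\<xi>::'a. norm \<xi> powr k * exp (- t * (norm \<xi>)\<^sup>2)) \<in> L2"
  shows "\<bar>L2_norm (heat_defect k t g) - L2_norm (heat_defect k t g')\<bar> \<le>
    2 * fourier_const TYPE('a) * (\<integral>x. \<bar>g x - g' x\<bar> \<partial>lborel) * L2_norm (\<lambda>\<xi>::'a. norm \<xi> powr k * exp (- t * (norm \<xi>)\<^sup>2))"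
proof -
  have "heat_defect k t (\<lambda>x. g x - g' x) = (\<lambda>\<xi>. heat_defect k t g \<xi> - heat_defect k t g' \<xi>)"
    by (rule ext, rule heat_defect_diff[OF g])
  then show ?thesis
    using L2_norm_triangle_ineq3[OF heat_defect_L2(1)[OF g(1) G] heat_defect_L2(1)[OF g(2) G]]
      heat_defect_L2(2)[of "\<lambda>x. g x - g' x", OF _ G] g by simp
qed

lemma fourier_integral_isCont:
  fixes g :: "'a::euclidean_space \<Rightarrow> complex"
  assumes g: "integrable lborel g"
  shows "isCont (fourier_integral g) \<xi>"
  unfolding continuous_at_sequentially o_def
proof (intro allI impI)
  fix X :: "nat \<Rightarrow> 'a" assume X: "X \<longlonglongrightarrow> \<xi>"
  have [measurable]: "g \<in> borel_measurable borel" using g by (auto dest: borel_measurable_integrable)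
  have "(\<lambda>n. \<integral>x. exp (- (\<i> * of_real (x \<bullet> X n))) * g x \<partial>lborel) \<longlonglongrightarrow> (\<integral>x. exp (- (\<i> * of_real (x \<bullet> \<xi>))) * g x \<partial>lborel)"
  proof (rule integral_dominated_convergence[where w="\<lambda>x. norm (g x)"])
    show "AE x in lborel. (\<lambda>n. exp (- (\<i> * of_real (x \<bullet> X n))) * g x) \<longlonglongrightarrow> exp (- (\<i> * of_real (x \<bullet> \<xi>))) * g x"
      by (intro AE_I2 tendsto_intros X)
  qed (use g in \<open>auto simp: norm_mult\<close>)
  then show "(\<lambda>n. fourier_integral g (X n)) \<longlonglongrightarrow> fourier_integral g \<xi>"
    unfolding fourier_integral_altdef by (intro tendsto_intros)
qed

text \<open>The transform is continuous at 0: its deviation from the value there is below a small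
  constant near 0 and, being bounded, below a multiple of |xi| elsewhere. The additional |xi| gains
  t^(-1/2), while the small constant meets the exact rate.\<close>

lemma heat_defect_tendsto:
  fixes g :: "'a::euclidean_space \<Rightarrow> real"
  assumes g: "integrable lborel g" and k: "k \<ge> 0"
  shows "((\<lambda>t. t powr (real DIM('a) / 4 + k / 2) * L2_norm (heat_defect k t g)) \<longlongrightarrow> 0) at_top"
proof -
  define d where "d = real DIM('a)"
  obtain G where G: "G > 0" "\<And>t. t > 0 \<Longrightarrow> (\<lambda>\<xi>::'a. norm \<xi> powr k * exp (- t * (norm \<xi>)\<^sup>2)) \<in> L2 \<and>
    L2_norm (\<lambda>\<xi>::'a. norm \<xi> powr k * exp (- t * (norm \<xi>)\<^sup>2)) \<le> G * t powr (- (d / 4) - k / 2)"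
    using gauss_weight[OF k, where 'a='a] by (auto simp: d_def)
  obtain G1 where G1: "G1 > 0" "\<And>t. t > 0 \<Longrightarrow> (\<lambda>\<xi>::'a. norm \<xi> powr (k + 1) * exp (- t * (norm \<xi>)\<^sup>2)) \<in> L2 \<and>
    L2_norm (\<lambda>\<xi>::'a. norm \<xi> powr (k + 1) * exp (- t * (norm \<xi>)\<^sup>2)) \<le> G1 * t powr (- (d / 4) - (k + 1) / 2)"
    using gauss_weight[of "k + 1", where 'a='a] k by (auto simp: d_def)
  define F where "F = fourier_integral (\<lambda>x. complex_of_real (g x))"
  define m where "m = fourier_const TYPE('a) * (\<integral>x. \<bar>g x\<bar> \<partial>lborel)"
  have m: "0 \<le> m" by (simp add: m_def integral_nonneg)
  have b: "norm (F \<xi>) \<le> m" for \<xi>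
    using norm_fourier_integral_le[of "\<lambda>x. of_real (g x)" \<xi>] by (simp add: m_def F_def)
  have hd: "heat_defect k t g \<xi> = of_real (norm \<xi> powr k * exp (- t * (norm \<xi>)\<^sup>2)) * (F \<xi> - F 0)" for t \<xi>
    unfolding F_def fourier_integral_0 heat_defect_def ..
  show ?thesis
    unfolding tendsto_iff
  proof (intro allI impI)
    fix e :: real assume e: "e > 0"
    \<comment> \<open>With this tolerance the part near the origin contributes e / 2.\<close>
    define e1 where "e1 = e / (2 * G)"
    have e1: "e1 > 0" using e G by (simp add: e1_def)
    have "isCont F 0" unfolding F_def using g by (intro fourier_integral_isCont) auto
    with e1 obtain \<delta> where \<delta>: "\<delta> > 0" "\<And>\<xi>. norm \<xi> < \<delta> \<Longrightarrow> norm (F \<xi> - F 0) < e1"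
      unfolding continuous_at_eps_delta by (auto simp: dist_norm)
    have Fd: "norm (F \<xi> - F 0) \<le> e1 + (2 * m / \<delta>) * norm \<xi>" for \<xi>
    proof (cases "norm \<xi> < \<delta>")
      case True
      then show ?thesis using \<delta>(2)[OF True] m \<delta>(1) by (simp add: add_increasing2 less_imp_le)
    next
      case False
      have "norm (F \<xi> - F 0) \<le> m + m" using b[of \<xi>] b[of 0] norm_triangle_ineq4 add_mono order_trans by metis
      also have "\<dots> \<le> (2 * m / \<delta>) * norm \<xi>"
        using False \<delta>(1) m mult_left_mono[of \<delta> "norm \<xi>" "2 * m / \<delta>"] by simp
      finally show ?thesis using e1 by linarith
    qed
    have main: "t powr (d / 4 + k / 2) * L2_norm (heat_defect k t g) \<le> e / 2 + (2 * m / \<delta>) * G1 * t powr (- (1/2))" if t: "t > 0" for t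
    proof -
      have Gt: "(\<lambda>\<xi>::'a. norm \<xi> powr k * exp (- t * (norm \<xi>)\<^sup>2)) \<in> L2" using G(2)[OF t] by blast
      have G1t: "(\<lambda>\<xi>::'a. complex_of_real (norm \<xi> powr (k + 1) * exp (- t * (norm \<xi>)\<^sup>2))) \<in> L2" using G1(2)[OF t] by (intro L2_of_real) blast
      have "AE \<xi> in lborel. norm (heat_defect k t g \<xi>) \<le> e1 * \<bar>norm \<xi> powr k * exp (- t * (norm \<xi>)\<^sup>2)\<bar> + (2 * m / \<delta>) * norm (complex_of_real (norm \<xi> powr (k + 1) * exp (- t * (norm \<xi>)\<^sup>2)))"
      proof (intro AE_I2)
        fix \<xi> :: 'a
        have "norm (heat_defect k t g \<xi>) = norm \<xi> powr k * exp (- t * (norm \<xi>)\<^sup>2) * norm (F \<xi> - F 0)"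
          unfolding hd norm_mult norm_of_real by simp
        also have "\<dots> \<le> norm \<xi> powr k * exp (- t * (norm \<xi>)\<^sup>2) * (e1 + (2 * m / \<delta>) * norm \<xi>)"
          by (intro mult_left_mono Fd) auto
        also have "\<dots> = e1 * (norm \<xi> powr k * exp (- t * (norm \<xi>)\<^sup>2)) + (2 * m / \<delta>) * ((norm \<xi> powr k * norm \<xi>) * exp (- t * (norm \<xi>)\<^sup>2))"
          by (simp add: algebra_simps)
        also have "norm \<xi> powr k * norm \<xi> = norm \<xi> powr (k + 1)" by (simp add: powr_add)
        finally show "norm (heat_defect k t g \<xi>) \<le> e1 * \<bar>norm \<xi> powr k * exp (- t * (norm \<xi>)\<^sup>2)\<bar> + (2 * m / \<delta>) * norm (complex_of_real (norm \<xi> powr (k + 1) * exp (- t * (norm \<xi>)\<^sup>2)))"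
          by (simp add: abs_mult norm_mult)
      qed
      from L2_dominated_add(2)[OF L2_measurable[OF heat_defect_L2(1)[OF g Gt]] Gt G1t _ _ this] e1 m \<delta>(1)
      have "L2_norm (heat_defect k t g) \<le> e1 * L2_norm (\<lambda>\<xi>::'a. norm \<xi> powr k * exp (- t * (norm \<xi>)\<^sup>2)) + (2 * m / \<delta>) * L2_norm (\<lambda>\<xi>::'a. norm \<xi> powr (k + 1) * exp (- t * (norm \<xi>)\<^sup>2))"
        unfolding L2_of_real(2) by simp
      also have "\<dots> \<le> e1 * (G * t powr (- (d / 4) - k / 2)) + (2 * m / \<delta>) * (G1 * t powr (- (d / 4) - (k + 1) / 2))"
        using G(2)[OF t] G1(2)[OF t] e1 m \<delta>(1) by (intro add_mono mult_left_mono) auto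
      finally have "t powr (d / 4 + k / 2) * L2_norm (heat_defect k t g) \<le>
        t powr (d / 4 + k / 2) * (e1 * (G * t powr (- (d / 4) - k / 2)) + (2 * m / \<delta>) * (G1 * t powr (- (d / 4) - (k + 1) / 2)))"
        by (intro mult_left_mono) auto
      also have "\<dots> = e1 * G * (t powr (d / 4 + k / 2) * t powr (- (d / 4) - k / 2)) + (2 * m / \<delta>) * G1 * (t powr (d / 4 + k / 2) * t powr (- (d / 4) - (k + 1) / 2))"
        by (simp add: algebra_simps)
      also have "t powr (d / 4 + k / 2) * t powr (- (d / 4) - k / 2) = 1" using t by (subst powr_add[symmetric]) simp
      also have "t powr (d / 4 + k / 2) * t powr (- (d / 4) - (k + 1) / 2) = t powr (- (1/2))" by (subst powr_add[symmetric]) (simp add: field_simps)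
      also have "e1 * G * 1 = e / 2" using G by (simp add: e1_def)
      finally show ?thesis .
    qed
    have "((\<lambda>t. (2 * m / \<delta>) * G1 * t powr (- (1/2))) \<longlongrightarrow> (2 * m / \<delta>) * G1 * 0) at_top"
      by (intro tendsto_intros tendsto_neg_powr filterlim_ident) auto
    from order_tendstoD(2)[OF this, of "e / 2"] e
    have "\<forall>\<^sub>F t in at_top. (2 * m / \<delta>) * G1 * t powr (- (1/2)) < e / 2" by simp
    then show "\<forall>\<^sub>F t in at_top. dist (t powr (real DIM('a) / 4 + k / 2) * L2_norm (heat_defect k t g)) 0 < e"
      using eventually_gt_at_top[of 0]
    proof eventually_elim
      case (elim t)
      then show ?case using main[of t] by (simp add: d_def abs_mult)
    qed
  qed
qed

section \<open>The Duhamel term\<close>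

lemma fourier_cmult:
  fixes f :: "'a::euclidean_space \<Rightarrow> complex"
  assumes f: "f \<in> L2"
  shows "AE \<xi> in lborel. fourier (\<lambda>x. a * f x) \<xi> = a * fourier f \<xi>"
  using fourier_linear[OF f f, of a 0] by simp

lemma fourier_add:
  fixes f g :: "'a::euclidean_space \<Rightarrow> complex"
  assumes f: "f \<in> L2" and g: "g \<in> L2"
  shows "AE \<xi> in lborel. fourier (\<lambda>x. f x + g x) \<xi> = fourier f \<xi> + fourier g \<xi>"
  using fourier_linear[OF f g, of 1 1] by simp

lemma fourier_sum:
  fixes f :: "'i \<Rightarrow> 'a::euclidean_space \<Rightarrow> complex"
  assumes "finite S" "\<And>i. i \<in> S \<Longrightarrow> f i \<in> L2"
  shows "AE \<xi> in lborel. fourier (\<lambda>x. \<Sum>i\<in>S. f i x) \<xi> = (\<Sum>i\<in>S. fourier (f i) \<xi>)"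
  using assms
proof (induction S rule: finite_induct)
  case empty
  show ?case using fourier_cmult[OF L2_zero(1), of 0] by simp
next
  case (insert i S)
  then have "f i \<in> L2" "(\<lambda>x. \<Sum>i\<in>S. f i x) \<in> L2" by (auto intro: L2_sum)
  from fourier_add[OF this] insert.IH insert.prems have
    "AE \<xi> in lborel. fourier (\<lambda>x. f i x + (\<Sum>i\<in>S. f i x)) \<xi> = fourier (f i) \<xi> + (\<Sum>i\<in>S. fourier (f i) \<xi>)"
    by (auto elim!: eventually_elim2)
  then show ?case using insert.hyps by simp
qed

text \<open>Bounds at each time are carried through a tagged division, where linearity applies to
  finitely many terms and the exceptional null sets stay null. Boundedness of \<open>w\<close> makes
  multiplication by it continuous on L2, so the error of the Riemann sum remains small.\<close>

lemma L2_integral_truncated_bound: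
  fixes w :: "'a::euclidean_space \<Rightarrow> real" and E :: "'a \<Rightarrow> complex"
  assumes I: "has_L2_integral \<Phi> I 0 T" and T: "T \<ge> 0"
    and w: "w \<in> borel_measurable borel" "\<And>\<xi>. 0 \<le> w \<xi>" "\<And>\<xi>. w \<xi> \<le> A"
    and E: "(\<lambda>\<xi>. of_real (w \<xi>) * E \<xi>) \<in> L2" "L2_norm (\<lambda>\<xi>. of_real (w \<xi>) * E \<xi>) \<le> N"
    and c: "(c has_integral M) {0..T}" and b: "(b has_integral B) {0..T}"
    and le: "\<And>\<tau>. \<tau> \<in> {0..T} \<Longrightarrow> (\<lambda>\<xi>. of_real (w \<xi>) * (fourier (\<Phi> \<tau>) \<xi> - of_real (c \<tau>) * E \<xi>)) \<in> L2 \<and>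
       L2_norm (\<lambda>\<xi>. of_real (w \<xi>) * (fourier (\<Phi> \<tau>) \<xi> - of_real (c \<tau>) * E \<xi>)) \<le> b \<tau>"
  shows "(\<lambda>\<xi>. of_real (w \<xi>) * (fourier I \<xi> - of_real M * E \<xi>)) \<in> L2"
    "L2_norm (\<lambda>\<xi>. of_real (w \<xi>) * (fourier I \<xi> - of_real M * E \<xi>)) \<le> B"
proof -
  have \<Phi>: "\<Phi> \<tau> \<in> L2" if "\<tau> \<in> {0..T}" for \<tau> using I that by (auto simp: has_L2_integral_def)
  have IL: "I \<in> L2" using I by (simp add: has_L2_integral_def)
  note [measurable] = w(1) L2_measurable[OF fourier_L2[OF IL]]
  have A: "A \<ge> 0" using w(2,3) order_trans by blast
  have N: "N \<ge> 0" using E(2) L2_norm_nonneg order_trans by blast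
  have w_mult: "(\<lambda>\<xi>. of_real (w \<xi>) * h \<xi>) \<in> L2 \<and> L2_norm (\<lambda>\<xi>. of_real (w \<xi>) * h \<xi>) \<le> A * L2_norm h" if h: "h \<in> L2" for h :: "'a \<Rightarrow> complex"
  proof -
    note [measurable] = L2_measurable[OF h]
    have m: "(\<lambda>\<xi>. of_real (w \<xi>) * h \<xi>) \<in> borel_measurable borel" by measurable
    have "AE \<xi> in lborel. norm (of_real (w \<xi>) * h \<xi>) \<le> A * norm (h \<xi>)"
      using w by (intro AE_I2) (auto simp: norm_mult intro!: mult_right_mono)
    from L2_dominated[OF m h A this] show ?thesis by blast
  qed
  have EM: "(\<lambda>\<xi>. of_real x * (of_real (w \<xi>) * E \<xi>)) \<in> L2" "L2_norm (\<lambda>\<xi>. of_real x * (of_real (w \<xi>) * E \<xi>)) \<le> \<bar>x\<bar> * N" for x :: real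
    using L2_mult[OF E(1), of "of_real x"] E(2) by (auto intro: mult_left_mono)
  have "(\<lambda>\<xi>. of_real (w \<xi>) * fourier I \<xi> - of_real M * (of_real (w \<xi>) * E \<xi>)) \<in> L2"
    using w_mult[OF fourier_L2[OF IL]] EM by (intro L2_diff) auto
  then show L: "(\<lambda>\<xi>. of_real (w \<xi>) * (fourier I \<xi> - of_real M * E \<xi>)) \<in> L2"
    by (simp add: algebra_simps)
  have main: "L2_norm (\<lambda>\<xi>. of_real (w \<xi>) * (fourier I \<xi> - of_real M * E \<xi>)) \<le> B + (A + 1 + N) * e" if e: "e > 0" for e
  proof -
    from I[unfolded has_L2_integral_def, THEN conjunct2, THEN conjunct2, THEN spec, THEN mp, OF e]
    obtain g1 where g1: "gauge g1" "\<forall>D. D tagged_division_of {0..T} \<and> g1 fine D \<longrightarrow>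
       L2_norm (\<lambda>x. (\<Sum>(\<tau>, J)\<in>D. measure lborel J *\<^sub>R \<Phi> \<tau> x) - I x) < e"
      by (elim exE conjE)
    from c[unfolded has_integral_real, THEN spec, THEN mp, OF e]
    obtain g2 where g2: "gauge g2" "\<forall>D. D tagged_division_of {0..T} \<and> g2 fine D \<longrightarrow>
       norm ((\<Sum>(x, k)\<in>D. measure lborel k *\<^sub>R c x) - M) < e"
      by (elim exE conjE)
    from b[unfolded has_integral_real, THEN spec, THEN mp, OF e]
    obtain g3 where g3: "gauge g3" "\<forall>D. D tagged_division_of {0..T} \<and> g3 fine D \<longrightarrow>
       norm ((\<Sum>(x, k)\<in>D. measure lborel k *\<^sub>R b x) - B) < e"
      by (elim exE conjE)
    \<comment> \<open>One division serves the L2 integral and both scalar integrals.\<close>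
    have "gauge (\<lambda>x. g1 x \<inter> (g2 x \<inter> g3 x))" using g1 g2 g3 by (intro gauge_Int)
    from fine_division_exists_real[OF this, of 0 T]
    obtain D where D: "D tagged_division_of {0..T}" "(\<lambda>x. g1 x \<inter> (g2 x \<inter> g3 x)) fine D" .
    have fines: "g1 fine D" "g2 fine D" "g3 fine D" using D(2) by (auto simp: fine_Int)
    have fD: "finite D" using D(1) by blast
    have tag: "\<tau> \<in> {0..T}" if "(\<tau>, J) \<in> D" for \<tau> J using tagged_division_ofD(2,3)[OF D(1) that] by blast
    define S where "S x = (\<Sum>(\<tau>, J)\<in>D. of_real (measure lborel J) * \<Phi> \<tau> x)" for x
    define m where "m = (\<Sum>(\<tau>, J)\<in>D. measure lborel J * c \<tau>)"
    define \<beta> where "\<beta> = (\<Sum>(\<tau>, J)\<in>D. measure lborel J * b \<tau>)"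
    have 1: "L2_norm (\<lambda>x. S x - I x) < e"
      using g1(2)[THEN spec, THEN mp, OF conjI, OF D(1) fines(1)] by (simp add: S_def scaleR_conv_of_real)
    have 2: "\<bar>m - M\<bar> < e" using g2(2)[THEN spec, THEN mp, OF conjI, OF D(1) fines(2)] by (simp add: m_def)
    have 3: "\<bar>\<beta> - B\<bar> < e" using g3(2)[THEN spec, THEN mp, OF conjI, OF D(1) fines(3)] by (simp add: \<beta>_def)
    have Sterm: "(\<lambda>x. case i of (\<tau>, J) \<Rightarrow> of_real (measure lborel J) * \<Phi> \<tau> x) \<in> L2" if "i \<in> D" for i
      using that tag by (cases i) (auto intro!: L2_mult \<Phi>)
    have SL: "S \<in> L2" unfolding S_def[abs_def] by (rule L2_sum(1)[OF fD Sterm])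
    have "AE \<xi> in lborel. \<forall>i\<in>D. fourier (\<lambda>x. case i of (\<tau>, J) \<Rightarrow> of_real (measure lborel J) * \<Phi> \<tau> x) \<xi> =
       (case i of (\<tau>, J) \<Rightarrow> of_real (measure lborel J) * fourier (\<Phi> \<tau>) \<xi>)"
    proof (rule eventually_ball_finite[OF fD], rule ballI)
      fix i assume i: "i \<in> D"
      obtain \<tau> J where ij: "i = (\<tau>, J)" by (cases i)
      show "AE \<xi> in lborel. fourier (\<lambda>x. case i of (\<tau>, J) \<Rightarrow> of_real (measure lborel J) * \<Phi> \<tau> x) \<xi> =
       (case i of (\<tau>, J) \<Rightarrow> of_real (measure lborel J) * fourier (\<Phi> \<tau>) \<xi>)"
        unfolding ij prod.case using fourier_cmult[OF \<Phi>[OF tag[OF i[unfolded ij]]]] .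
    qed
    moreover have "AE \<xi> in lborel. fourier (\<lambda>x. \<Sum>i\<in>D. case i of (\<tau>, J) \<Rightarrow> of_real (measure lborel J) * \<Phi> \<tau> x) \<xi> =
       (\<Sum>i\<in>D. fourier (\<lambda>x. case i of (\<tau>, J) \<Rightarrow> of_real (measure lborel J) * \<Phi> \<tau> x) \<xi>)"
      by (rule fourier_sum[OF fD]) (rule Sterm)
    ultimately
    have FS: "AE \<xi> in lborel. fourier S \<xi> = (\<Sum>(\<tau>, J)\<in>D. of_real (measure lborel J) * fourier (\<Phi> \<tau>) \<xi>)"
      unfolding S_def[abs_def] by eventually_elim simp
    define R where "R \<xi> = (\<Sum>(\<tau>, J)\<in>D. of_real (measure lborel J) * (of_real (w \<xi>) * (fourier (\<Phi> \<tau>) \<xi> - of_real (c \<tau>) * E \<xi>)))" for \<xi>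
    have Rt: "(\<lambda>\<xi>. case i of (\<tau>, J) \<Rightarrow> of_real (measure lborel J) * (of_real (w \<xi>) * (fourier (\<Phi> \<tau>) \<xi> - of_real (c \<tau>) * E \<xi>))) \<in> L2 \<and>
      L2_norm (\<lambda>\<xi>. case i of (\<tau>, J) \<Rightarrow> of_real (measure lborel J) * (of_real (w \<xi>) * (fourier (\<Phi> \<tau>) \<xi> - of_real (c \<tau>) * E \<xi>)))
        \<le> (case i of (\<tau>, J) \<Rightarrow> measure lborel J * b \<tau>)" if "i \<in> D" for i
    proof -
      obtain \<tau> J where ij: "i = (\<tau>, J)" by (cases i)
      note l = le[OF tag[OF that[unfolded ij]]]
      show ?thesis unfolding ij prod.case
        using l L2_mult[OF conjunct1[OF l], of "of_real (measure lborel J)"] by (simp add: mult_left_mono)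
    qed
    have RL: "R \<in> L2" unfolding R_def[abs_def] by (rule L2_sum(1)[OF fD]) (use Rt in blast)
    have "L2_norm R \<le> (\<Sum>i\<in>D. L2_norm (\<lambda>\<xi>. case i of (\<tau>, J) \<Rightarrow> of_real (measure lborel J) * (of_real (w \<xi>) * (fourier (\<Phi> \<tau>) \<xi> - of_real (c \<tau>) * E \<xi>))))"
      unfolding R_def[abs_def] by (rule L2_norm_sum[OF fD]) (use Rt in blast)
    also have "\<dots> \<le> \<beta>" unfolding \<beta>_def by (rule sum_mono) (use Rt in blast)
    finally have R: "L2_norm R \<le> B + e" using 3 by simp
    have d1: "(\<lambda>\<xi>. of_real (w \<xi>) * (fourier I \<xi> - fourier S \<xi>)) \<in> L2" "L2_norm (\<lambda>\<xi>. of_real (w \<xi>) * (fourier I \<xi> - fourier S \<xi>)) \<le> A * e"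
    proof -
      have l: "(\<lambda>\<xi>. fourier I \<xi> - fourier S \<xi>) \<in> L2" by (intro L2_diff fourier_L2 IL SL)
      have "L2_norm (\<lambda>\<xi>. fourier I \<xi> - fourier S \<xi>) \<le> e"
        using 1 by (simp add: fourier_diff_norm IL SL L2_norm_minus_commute[of I])
      then have "A * L2_norm (\<lambda>\<xi>. fourier I \<xi> - fourier S \<xi>) \<le> A * e" using A by (intro mult_left_mono)
      with w_mult[OF l] show "(\<lambda>\<xi>. of_real (w \<xi>) * (fourier I \<xi> - fourier S \<xi>)) \<in> L2" "L2_norm (\<lambda>\<xi>. of_real (w \<xi>) * (fourier I \<xi> - fourier S \<xi>)) \<le> A * e"
        by auto
    qed
    \<comment> \<open>The error splits into that of the L2-valued Riemann sum, the Riemann sum of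
      the compared integrands, and the error of the scalar Riemann sum of \<open>c\<close>.\<close>
    have "AE \<xi> in lborel. of_real (w \<xi>) * (fourier I \<xi> - of_real M * E \<xi>) =
       of_real (w \<xi>) * (fourier I \<xi> - fourier S \<xi>) + R \<xi> + of_real (m - M) * (of_real (w \<xi>) * E \<xi>)"
      using FS
    proof eventually_elim
      case (elim \<xi>)
      have "R \<xi> = of_real (w \<xi>) * ((\<Sum>(\<tau>, J)\<in>D. of_real (measure lborel J) * fourier (\<Phi> \<tau>) \<xi>) - (\<Sum>(\<tau>, J)\<in>D. of_real (measure lborel J * c \<tau>)) * E \<xi>)"
        unfolding R_def sum_distrib_right sum_subtractf[symmetric] sum_distrib_left
        by (rule sum.cong) (auto simp: algebra_simps)
      then have "R \<xi> = of_real (w \<xi>) * (fourier S \<xi> - of_real m * E \<xi>)"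
        by (simp add: elim m_def case_prod_unfold)
      then show ?case by (simp add: algebra_simps)
    qed
    then have "L2_norm (\<lambda>\<xi>. of_real (w \<xi>) * (fourier I \<xi> - of_real M * E \<xi>)) =
      L2_norm (\<lambda>\<xi>. of_real (w \<xi>) * (fourier I \<xi> - fourier S \<xi>) + R \<xi> + of_real (m - M) * (of_real (w \<xi>) * E \<xi>))"
      by (intro L2_norm_cong_AE[OF L2_measurable[OF L] L2_measurable[OF L2_add(1)[OF L2_add(1)[OF d1(1) RL] EM(1)]]])
         (erule eventually_mono, simp only:)
    also have "\<dots> \<le> L2_norm (\<lambda>\<xi>. of_real (w \<xi>) * (fourier I \<xi> - fourier S \<xi>) + R \<xi>) + L2_norm (\<lambda>\<xi>. of_real (m - M) * (of_real (w \<xi>) * E \<xi>))"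
      by (intro L2_norm_triangle L2_add d1 RL EM)
    also have "\<dots> \<le> L2_norm (\<lambda>\<xi>. of_real (w \<xi>) * (fourier I \<xi> - fourier S \<xi>)) + L2_norm R + L2_norm (\<lambda>\<xi>. of_real (m - M) * (of_real (w \<xi>) * E \<xi>))"
      by (intro add_right_mono L2_norm_triangle d1 RL)
    also have "\<dots> \<le> A * e + (B + e) + e * N"
      using EM(2)[of "m - M"] mult_right_mono[of "\<bar>m - M\<bar>" e N] 2 N by (intro add_mono d1 R) auto
    finally show ?thesis by (simp add: algebra_simps)
  qed
  show "L2_norm (\<lambda>\<xi>. of_real (w \<xi>) * (fourier I \<xi> - of_real M * E \<xi>)) \<le> B"
  proof (rule field_le_epsilon)
    fix e :: real assume e: "e > 0"
    \<comment> \<open>The three contributions are e times A, 1 and N.\<close>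
    have "A + 1 + N > 0" using A N by linarith
    then show "L2_norm (\<lambda>\<xi>. of_real (w \<xi>) * (fourier I \<xi> - of_real M * E \<xi>)) \<le> B + e"
      using main[of "e / (A + 1 + N)"] e by simp
  qed
qed

text \<open>The weight is set to 0 where it exceeds n. The truncations stay below \<open>w\<close>,
  so the assumed bounds persist, and at each frequency they equal \<open>w\<close> from some n on,
  so Fatou applies.\<close>

lemma L2_integral_weighted_bound:
  fixes w :: "'a::euclidean_space \<Rightarrow> real" and E :: "'a \<Rightarrow> complex"
  assumes I: "has_L2_integral \<Phi> I 0 T" and T: "T \<ge> 0"
    and w: "w \<in> borel_measurable borel" "\<And>\<xi>. 0 \<le> w \<xi>"
    and E: "E \<in> borel_measurable borel" "(\<lambda>\<xi>. of_real (w \<xi>) * E \<xi>) \<in> L2"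
    and c: "(c has_integral M) {0..T}" and b: "(b has_integral B) {0..T}"
    and le: "\<And>\<tau>. \<tau> \<in> {0..T} \<Longrightarrow> (\<lambda>\<xi>. of_real (w \<xi>) * (fourier (\<Phi> \<tau>) \<xi> - of_real (c \<tau>) * E \<xi>)) \<in> L2 \<and>
       L2_norm (\<lambda>\<xi>. of_real (w \<xi>) * (fourier (\<Phi> \<tau>) \<xi> - of_real (c \<tau>) * E \<xi>)) \<le> b \<tau>"
  shows "(\<lambda>\<xi>. of_real (w \<xi>) * (fourier I \<xi> - of_real M * E \<xi>)) \<in> L2"
    "L2_norm (\<lambda>\<xi>. of_real (w \<xi>) * (fourier I \<xi> - of_real M * E \<xi>)) \<le> B"
proof -
  have IL: "I \<in> L2" using I by (simp add: has_L2_integral_def)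
  have \<Phi>: "\<Phi> \<tau> \<in> L2" if "\<tau> \<in> {0..T}" for \<tau> using I that by (auto simp: has_L2_integral_def)
  note [measurable] = w(1) L2_measurable[OF fourier_L2[OF IL]] E(1)
  define v where "v n \<xi> = (if w \<xi> \<le> real n then w \<xi> else 0)" for n \<xi>
  have v: "v n \<in> borel_measurable borel" "0 \<le> v n \<xi>" "v n \<xi> \<le> real n" "v n \<xi> \<le> w \<xi>" for n \<xi>
    unfolding v_def[abs_def] using w by auto
  have vh: "(\<lambda>\<xi>. of_real (v n \<xi>) * h \<xi>) \<in> L2 \<and> L2_norm (\<lambda>\<xi>. of_real (v n \<xi>) * h \<xi>) \<le> L2_norm (\<lambda>\<xi>. of_real (w \<xi>) * h \<xi>)"
    if h: "(\<lambda>\<xi>. of_real (w \<xi>) * h \<xi>) \<in> L2" "h \<in> borel_measurable borel" for h :: "'a \<Rightarrow> complex" and n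
  proof -
    note [measurable] = h(2) v(1)
    have m: "(\<lambda>\<xi>. of_real (v n \<xi>) * h \<xi>) \<in> borel_measurable borel" by measurable
    have "norm (of_real (v n \<xi>) * h \<xi>) \<le> norm (of_real (w \<xi>) * h \<xi>)" for \<xi>
      using v w by (auto simp: norm_mult intro!: mult_right_mono)
    from L2_mono[OF m h(1) this] show ?thesis by blast
  qed
  have tr: "(\<lambda>\<xi>. of_real (v n \<xi>) * (fourier I \<xi> - of_real M * E \<xi>)) \<in> L2 \<and>
    L2_norm (\<lambda>\<xi>. of_real (v n \<xi>) * (fourier I \<xi> - of_real M * E \<xi>)) \<le> B" for n
  proof -
    have "(\<lambda>\<xi>. of_real (v n \<xi>) * (fourier (\<Phi> \<tau>) \<xi> - of_real (c \<tau>) * E \<xi>)) \<in> L2 \<and>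
       L2_norm (\<lambda>\<xi>. of_real (v n \<xi>) * (fourier (\<Phi> \<tau>) \<xi> - of_real (c \<tau>) * E \<xi>)) \<le> b \<tau>" if \<tau>: "\<tau> \<in> {0..T}" for \<tau>
    proof -
      note [measurable] = L2_measurable[OF fourier_L2[OF \<Phi>[OF \<tau>]]]
      have "(\<lambda>\<xi>. fourier (\<Phi> \<tau>) \<xi> - of_real (c \<tau>) * E \<xi>) \<in> borel_measurable borel" by measurable
      with vh[of "\<lambda>\<xi>. fourier (\<Phi> \<tau>) \<xi> - of_real (c \<tau>) * E \<xi>" n] le[OF \<tau>] show ?thesis by auto
    qed
    from L2_integral_truncated_bound[OF I T v(1) v(2) v(3) _ order_refl c b this] vh[OF E(2,1)] show ?thesis by blast
  qed
  have lim: "(\<lambda>n. of_real (v n \<xi>) * (fourier I \<xi> - of_real M * E \<xi>)) \<longlonglongrightarrow> of_real (w \<xi>) * (fourier I \<xi> - of_real M * E \<xi>)" for \<xi>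
  proof (rule tendsto_eventually)
    obtain N :: nat where "w \<xi> \<le> real N" using real_arch_simple by blast
    then show "\<forall>\<^sub>F n in sequentially. of_real (v n \<xi>) * (fourier I \<xi> - of_real M * E \<xi>) = of_real (w \<xi>) * (fourier I \<xi> - of_real M * E \<xi>)"
      by (intro eventually_sequentiallyI[of N]) (auto simp: v_def)
  qed
  have m: "(\<lambda>\<xi>. of_real (w \<xi>) * (fourier I \<xi> - of_real M * E \<xi>)) \<in> borel_measurable borel" by measurable
  have B0: "0 \<le> B" using tr[of 0] L2_norm_nonneg order_trans by blast
  show "(\<lambda>\<xi>. of_real (w \<xi>) * (fourier I \<xi> - of_real M * E \<xi>)) \<in> L2"
    "L2_norm (\<lambda>\<xi>. of_real (w \<xi>) * (fourier I \<xi> - of_real M * E \<xi>)) \<le> B"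
    by (rule L2_Fatou[OF _ m _ _ B0, of "\<lambda>n \<xi>. of_real (v n \<xi>) * (fourier I \<xi> - of_real M * E \<xi>)"]; use tr lim in auto)+
qed

section \<open>Scalar integrals in time\<close>

lemma set_integrable_powr_tail:
  assumes "\<eta> > 0"
  shows "set_integrable lborel {0..} (\<lambda>x::real. (1 + x) powr (- (1 + \<eta>)))"
proof -
  have "(\<integral>\<^sup>+x. ennreal ((1 + x) powr (- (1 + \<eta>))) * indicator {0::real..} x \<partial>lborel) = ennreal (0 - (- ((1 + 0) powr (- \<eta>) / \<eta>)))"
  proof (rule nn_integral_FTC_atLeast)
    show "((\<lambda>x. - ((1 + x) powr (- \<eta>) / \<eta>)) has_real_derivative (1 + x) powr (- (1 + \<eta>))) (at x)" if "0 \<le> x" for x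
      using that assms by (auto intro!: derivative_eq_intros simp: minus_diff_commute)
    have "((\<lambda>x::real. (1 + x) powr (- \<eta>)) \<longlongrightarrow> 0) at_top"
      using assms by (intro tendsto_neg_powr filterlim_tendsto_add_at_top[OF tendsto_const] filterlim_ident) auto
    then show "((\<lambda>x. - ((1 + x) powr (- \<eta>) / \<eta>)) \<longlongrightarrow> 0) at_top"
      using assms tendsto_minus[OF tendsto_divide[OF _ tendsto_const, of "\<lambda>x. (1 + x) powr (- \<eta>)" 0 at_top \<eta>]] by simp
  qed auto
  then have "integrable lborel (\<lambda>x::real. indicator {0..} x * (1 + x) powr (- (1 + \<eta>)))"
    by (intro integrableI_bounded) (auto simp: ennreal_mult' ennreal_indicator mult.commute)
  then show ?thesis by (simp add: set_integrable_def)
qed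

text \<open>Dominated convergence when integrand and interval both depend on t. The left side is the
  gauge integral that the Riemann sums produce, the limit a Lebesgue integral as in
  \<open>total_mass\<close>.\<close>

lemma set_integral_growing_interval_tendsto:
  fixes \<phi> :: "real \<Rightarrow> real \<Rightarrow> real"
  assumes c: "\<And>t. t > 0 \<Longrightarrow> continuous_on {0..} (\<phi> t)" and l: "continuous_on {0..} \<psi>"
    and bound: "\<And>t \<tau>. t > 0 \<Longrightarrow> \<tau> \<ge> 0 \<Longrightarrow> \<bar>\<phi> t \<tau>\<bar> \<le> W \<tau>" and W: "set_integrable lborel {0..} W"
    and lim: "\<And>\<tau>. \<tau> \<ge> 0 \<Longrightarrow> ((\<lambda>t. \<phi> t \<tau>) \<longlongrightarrow> \<psi> \<tau>) at_top"
  shows "((\<lambda>t. integral {0..t} (\<phi> t)) \<longlongrightarrow> (LINT \<tau>:{0..}|lborel. \<psi> \<tau>)) at_top"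
proof -
  have eq: "integral {0..t} (\<phi> t) = (\<integral>\<tau>. indicator {0..t} \<tau> *\<^sub>R \<phi> t \<tau> \<partial>lborel)" if t: "t > 0" for t
  proof -
    have "set_integrable lborel {0..t} (\<phi> t)"
      by (rule borel_integrable_atLeastAtMost'[OF continuous_on_subset[OF c[OF t]]]) auto
    from set_borel_integral_eq_integral(2)[OF this] show ?thesis by (simp add: set_lebesgue_integral_def)
  qed
  have m: "(\<lambda>\<tau>. indicator {0..t} \<tau> *\<^sub>R \<phi> t \<tau>) \<in> borel_measurable borel" if t: "t > 0" for t
    by (rule borel_measurable_continuous_on_indicator[OF _ continuous_on_subset[OF c[OF t]]]) auto
  \<comment> \<open>The value 0 for t <= 0 supplies measurability at every t, as dominated
    convergence along \<open>at_top\<close> requires.\<close>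
  define \<Phi> where "\<Phi> t = (if t > 0 then (\<lambda>\<tau>. indicator {0..t} \<tau> *\<^sub>R \<phi> t \<tau>) else (\<lambda>_. 0))" for t
  have "((\<lambda>t. \<integral>\<tau>. \<Phi> t \<tau> \<partial>lborel) \<longlongrightarrow> (\<integral>\<tau>. indicator {0..} \<tau> *\<^sub>R \<psi> \<tau> \<partial>lborel)) at_top"
  proof (rule integral_dominated_convergence_at_top[where w="\<lambda>\<tau>. indicator {0..} \<tau> * W \<tau>"])
    show "integrable lborel (\<lambda>\<tau>. indicator {0..} \<tau> * W \<tau>)" using W by (simp add: set_integrable_def)
    show "(\<lambda>\<tau>. indicator {0..} \<tau> *\<^sub>R \<psi> \<tau>) \<in> borel_measurable lborel"
      using borel_measurable_continuous_on_indicator[OF _ l] by simp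
    show "\<Phi> t \<in> borel_measurable lborel" for t
      using m[of t] by (simp add: \<Phi>_def)
    show "AE \<tau> in lborel. ((\<lambda>t. \<Phi> t \<tau>) \<longlongrightarrow> indicator {0..} \<tau> *\<^sub>R \<psi> \<tau>) at_top"
    proof (intro AE_I2)
      fix \<tau> :: real
      show "((\<lambda>t. \<Phi> t \<tau>) \<longlongrightarrow> indicator {0..} \<tau> *\<^sub>R \<psi> \<tau>) at_top"
      proof (cases "\<tau> \<ge> 0")
        case True
        have "\<forall>\<^sub>F t in at_top. \<phi> t \<tau> = \<Phi> t \<tau>"
          using eventually_ge_at_top[of \<tau>] eventually_gt_at_top[of 0]
          by eventually_elim (use True in \<open>simp add: \<Phi>_def\<close>)
        from Lim_transform_eventually[OF lim[OF True] this] True show ?thesis by simp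
      next
        case False
        then have "\<Phi> t \<tau> = 0" for t by (auto simp: \<Phi>_def)
        with False show ?thesis by simp
      qed
    qed
    show "\<forall>\<^sub>F t in at_top. AE \<tau> in lborel. norm (\<Phi> t \<tau>) \<le> indicator {0..} \<tau> * W \<tau>"
      using eventually_gt_at_top[of 0]
    proof eventually_elim
      case (elim t)
      show ?case
      proof (intro AE_I2)
        fix \<tau>
        have "0 \<le> W \<tau>" if "\<tau> \<ge> 0" using bound[OF elim that] by linarith
        then show "norm (\<Phi> t \<tau>) \<le> indicator {0..} \<tau> * W \<tau>"
          using elim bound[OF elim, of \<tau>] by (auto simp: \<Phi>_def indicator_def)
      qed
    qed
  qed
  moreover have "\<forall>\<^sub>F t in at_top. (\<integral>\<tau>. \<Phi> t \<tau> \<partial>lborel) = integral {0..t} (\<phi> t)"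
    using eventually_gt_at_top[of 0] by eventually_elim (simp add: \<Phi>_def eq)
  ultimately show ?thesis
    unfolding set_lebesgue_integral_def by (rule Lim_transform_eventually)
qed

lemma has_integral_powr_shift:
  fixes q t :: real
  assumes "q > -1" "t \<ge> 0"
  shows "((\<lambda>\<tau>. (1 + \<tau>) powr q) has_integral ((1 + t) powr (q + 1) - 1) / (q + 1)) {0..t}"
    "((\<lambda>\<tau>. (1 + t - \<tau>) powr q) has_integral ((1 + t) powr (q + 1) - 1) / (q + 1)) {0..t}"
proof -
  define F where "F \<tau> = (1 + \<tau>) powr (q + 1) / (q + 1)" for \<tau>
  have "((\<lambda>\<tau>. (1 + \<tau>) powr q) has_integral (F t - F 0)) {0..t}"
  proof (rule fundamental_theorem_of_calculus[OF assms(2)])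
    fix \<tau> assume "\<tau> \<in> {0..t}"
    then have "(F has_real_derivative (1 + \<tau>) powr q) (at \<tau> within {0..t})"
      unfolding F_def using assms by (auto intro!: derivative_eq_intros)
    then show "(F has_vector_derivative (1 + \<tau>) powr q) (at \<tau> within {0..t})"
      by (simp add: has_real_derivative_iff_has_vector_derivative)
  qed
  then show "((\<lambda>\<tau>. (1 + \<tau>) powr q) has_integral ((1 + t) powr (q + 1) - 1) / (q + 1)) {0..t}"
    by (simp add: F_def diff_divide_distrib)
  define G where "G \<tau> = - ((1 + t - \<tau>) powr (q + 1) / (q + 1))" for \<tau>
  have "((\<lambda>\<tau>. (1 + t - \<tau>) powr q) has_integral (G t - G 0)) {0..t}"
  proof (rule fundamental_theorem_of_calculus[OF assms(2)])
    fix \<tau> assume "\<tau> \<in> {0..t}"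
    then have "(G has_real_derivative (1 + t - \<tau>) powr q) (at \<tau> within {0..t})"
      unfolding G_def using assms by (auto intro!: derivative_eq_intros)
    then show "(G has_vector_derivative (1 + t - \<tau>) powr q) (at \<tau> within {0..t})"
      by (simp add: has_real_derivative_iff_has_vector_derivative)
  qed
  then show "((\<lambda>\<tau>. (1 + t - \<tau>) powr q) has_integral ((1 + t) powr (q + 1) - 1) / (q + 1)) {0..t}"
    by (simp add: G_def diff_divide_distrib)
qed

section \<open>Weighted bounds for the multipliers\<close>

lemma norm_powr_le_one_plus:
  assumes "0 \<le> k" "k \<le> l"
  shows "norm x powr k \<le> 1 + norm x powr l"
proof (cases "norm x \<le> 1")
  case True
  then have "norm x powr k \<le> 1" using assms by (intro powr_le1) auto
  then show ?thesis by (simp add: add_increasing2)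
next
  case False
  then have "norm x powr k \<le> norm x powr l" using assms by (intro powr_mono) auto
  then show ?thesis by simp
qed

text \<open>Since |xi|^k <= 1 + |xi|^l, membership at the two end orders suffices.\<close>

lemma weight_interpolate_L2:
  fixes h :: "'a::euclidean_space \<Rightarrow> complex"
  assumes h: "h \<in> L2" "(\<lambda>\<xi>. of_real (norm \<xi> powr l) * h \<xi>) \<in> L2" and k: "0 \<le> k" "k \<le> l"
  shows "(\<lambda>\<xi>. of_real (norm \<xi> powr k) * h \<xi>) \<in> L2"
proof -
  note [measurable] = L2_measurable[OF h(1)]
  have nL: "(\<lambda>\<xi>. norm (h \<xi>)) \<in> L2" "(\<lambda>\<xi>. norm (of_real (norm \<xi> powr l) * h \<xi>)) \<in> L2"
    using L2_mono(1)[OF _ h(1), of "\<lambda>\<xi>. norm (h \<xi>)"] L2_mono(1)[OF _ h(2), of "\<lambda>\<xi>. norm (of_real (norm \<xi> powr l) * h \<xi>)"] by auto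
  have m: "(\<lambda>\<xi>. of_real (norm \<xi> powr k) * h \<xi>) \<in> borel_measurable borel" by measurable
  show ?thesis
  proof (rule L2_mono(1)[OF m L2_add(1)[OF nL]])
    fix \<xi>
    have "norm \<xi> powr k * norm (h \<xi>) \<le> (1 + norm \<xi> powr l) * norm (h \<xi>)"
      by (intro mult_right_mono norm_powr_le_one_plus k) auto
    also have "\<dots> = norm (h \<xi>) + norm (of_real (norm \<xi> powr l) * h \<xi>)" by (simp add: norm_mult distrib_right)
    finally show "norm (of_real (norm \<xi> powr k) * h \<xi>) \<le> norm (norm (h \<xi>) + norm (of_real (norm \<xi> powr l) * h \<xi>))"
      by (simp add: norm_mult)
  qed
qed

lemma fourier_kern_multiplier:
  fixes g :: "'a::euclidean_space \<Rightarrow> real"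
  assumes g: "g \<in> L2" and s: "s \<ge> 0"
  shows "fourier_multiplier (symbol1 s) g \<in> L2"
    "AE \<xi> in lborel. fourier (fourier_multiplier (symbol1 s) g) \<xi> = of_real (kern s ((norm \<xi>)\<^sup>2)) * fourier_real g \<xi>"
    "fourier_multiplier (symbol0 s) g \<in> L2"
    "AE \<xi> in lborel. fourier (fourier_multiplier (symbol0 s) g) \<xi> = of_real (kern s ((norm \<xi>)\<^sup>2) + exp (- s)) * fourier_real g \<xi>"
proof -
  note F = fourier_real_L2(1)[OF g]
  note [measurable] = L2_measurable[OF F]
  have b: "0 \<le> kern s ((norm \<xi>)\<^sup>2)" "kern s ((norm \<xi>)\<^sup>2) \<le> 12" for \<xi> :: 'a
    using kern_nonneg[OF s] kern_le_12[OF s] by auto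
  have m1: "(\<lambda>\<xi>. of_real (symbol1 s \<xi>) * fourier_real g \<xi>) \<in> borel_measurable borel"
    unfolding symbol1_kern by measurable
  have m0: "(\<lambda>\<xi>. of_real (symbol0 s \<xi>) * fourier_real g \<xi>) \<in> borel_measurable borel"
    unfolding symbol0_kern by measurable
  have "(\<lambda>\<xi>. of_real (symbol1 s \<xi>) * fourier_real g \<xi>) \<in> L2"
  proof (rule L2_dominated(1)[OF m1 F, of 12])
    show "AE \<xi> in lborel. norm (of_real (symbol1 s \<xi>) * fourier_real g \<xi>) \<le> 12 * norm (fourier_real g \<xi>)"
      unfolding symbol1_kern norm_mult norm_of_real using b by (intro AE_I2 mult_right_mono) auto
  qed simp
  note M = fourier_multiplier_L2[of "symbol1 s" g, OF this]
  show "fourier_multiplier (symbol1 s) g \<in> L2" by (rule M(1))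
  show "AE \<xi> in lborel. fourier (fourier_multiplier (symbol1 s) g) \<xi> = of_real (kern s ((norm \<xi>)\<^sup>2)) * fourier_real g \<xi>"
    using M(3) by eventually_elim (simp only: symbol1_kern)
  have "(\<lambda>\<xi>. of_real (symbol0 s \<xi>) * fourier_real g \<xi>) \<in> L2"
  proof (rule L2_dominated(1)[OF m0 F, of 13])
    show "AE \<xi> in lborel. norm (of_real (symbol0 s \<xi>) * fourier_real g \<xi>) \<le> 13 * norm (fourier_real g \<xi>)"
      unfolding symbol0_kern norm_mult norm_of_real
    proof (intro AE_I2 mult_right_mono)
      fix \<xi> :: 'a
      have "exp (- s) \<le> 1" "exp (- s) > 0" using s by auto
      then show "\<bar>kern s ((norm \<xi>)\<^sup>2) + exp (- s)\<bar> \<le> 13" using b[of \<xi>] by linarith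
    qed auto
  qed simp
  note M = fourier_multiplier_L2[of "symbol0 s" g, OF this]
  show "fourier_multiplier (symbol0 s) g \<in> L2" by (rule M(1))
  show "AE \<xi> in lborel. fourier (fourier_multiplier (symbol0 s) g) \<xi> = of_real (kern s ((norm \<xi>)\<^sup>2) + exp (- s)) * fourier_real g \<xi>"
    using M(3) by eventually_elim (simp only: symbol0_kern)
qed

text \<open>Of the k derivatives, j rest on \<open>g\<close> and the kernel absorbs the other k - j,
  at most two, with the time decay of \<open>kern_weight\<close>.\<close>

lemma kern_weight_L2:
  fixes g :: "'a::euclidean_space \<Rightarrow> real"
  assumes g: "g \<in> L2" and j: "(\<lambda>\<xi>. of_real (norm \<xi> powr j) * fourier_real g \<xi>) \<in> L2"
    and k: "0 \<le> j" "j \<le> k" "k - j \<le> 2"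
  shows "(\<lambda>\<xi>. of_real (norm \<xi> powr k / (1 + (norm \<xi>)\<^sup>2)) * fourier_real g \<xi>) \<in> L2"
    "L2_norm (\<lambda>\<xi>. of_real (norm \<xi> powr k / (1 + (norm \<xi>)\<^sup>2)) * fourier_real g \<xi>) \<le> 2 * L2_norm (\<lambda>\<xi>. of_real (norm \<xi> powr j) * fourier_real g \<xi>)"
    "s \<ge> 0 \<Longrightarrow> (\<lambda>\<xi>. of_real (norm \<xi> powr k * kern s ((norm \<xi>)\<^sup>2)) * fourier_real g \<xi>) \<in> L2"
    "s \<ge> 0 \<Longrightarrow> L2_norm (\<lambda>\<xi>. of_real (norm \<xi> powr k * kern s ((norm \<xi>)\<^sup>2)) * fourier_real g \<xi>) \<le>
       60 * (1 + s) powr (- ((k - j) / 2)) * L2_norm (\<lambda>\<xi>. of_real (norm \<xi> powr j) * fourier_real g \<xi>)"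
proof -
  note [measurable] = L2_measurable[OF fourier_real_L2(1)[OF g]]
  have split: "norm \<xi> powr k = norm \<xi> powr (k - j) * norm \<xi> powr j" for \<xi> :: 'a
    by (simp flip: powr_add)
  have m1: "(\<lambda>\<xi>. of_real (norm \<xi> powr k / (1 + (norm \<xi>)\<^sup>2)) * fourier_real g \<xi>) \<in> borel_measurable borel" by measurable
  have "AE \<xi> in lborel. norm (of_real (norm \<xi> powr k / (1 + (norm \<xi>)\<^sup>2)) * fourier_real g \<xi>) \<le> 2 * norm (of_real (norm \<xi> powr j) * fourier_real g \<xi>)"
  proof (intro AE_I2)
    fix \<xi> :: 'a
    have pos: "1 + (norm \<xi>)\<^sup>2 > 0" by (simp add: add_pos_nonneg)
    have "norm \<xi> powr (k - j) \<le> 1 + norm \<xi> powr 2" using k by (intro norm_powr_le_one_plus) auto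
    then have "norm \<xi> powr (k - j) \<le> 2 * (1 + (norm \<xi>)\<^sup>2)" using pos by simp
    then have "norm \<xi> powr (k - j) * norm \<xi> powr j / (1 + (norm \<xi>)\<^sup>2) \<le> (2 * (1 + (norm \<xi>)\<^sup>2)) * norm \<xi> powr j / (1 + (norm \<xi>)\<^sup>2)"
      using pos by (intro divide_right_mono mult_right_mono) auto
    also have "\<dots> = 2 * norm \<xi> powr j"
    proof -
      have "(2 * R) * P / R = 2 * P" if "R > 0" for R P :: real using that by simp
      from this[OF pos] show ?thesis .
    qed
    finally have "norm \<xi> powr (k - j) * norm \<xi> powr j / (1 + (norm \<xi>)\<^sup>2) \<le> 2 * norm \<xi> powr j" .
    then show "norm (of_real (norm \<xi> powr k / (1 + (norm \<xi>)\<^sup>2)) * fourier_real g \<xi>) \<le> 2 * norm (of_real (norm \<xi> powr j) * fourier_real g \<xi>)"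
      unfolding norm_mult norm_of_real mult.assoc[symmetric] split using pos by (intro mult_right_mono) auto
  qed
  from L2_dominated[OF m1 j _ this]
  show "(\<lambda>\<xi>. of_real (norm \<xi> powr k / (1 + (norm \<xi>)\<^sup>2)) * fourier_real g \<xi>) \<in> L2"
    "L2_norm (\<lambda>\<xi>. of_real (norm \<xi> powr k / (1 + (norm \<xi>)\<^sup>2)) * fourier_real g \<xi>) \<le> 2 * L2_norm (\<lambda>\<xi>. of_real (norm \<xi> powr j) * fourier_real g \<xi>)"
    by simp_all
  assume s: "s \<ge> 0"
  have m2: "(\<lambda>\<xi>. of_real (norm \<xi> powr k * kern s ((norm \<xi>)\<^sup>2)) * fourier_real g \<xi>) \<in> borel_measurable borel" by measurable
  have "AE \<xi> in lborel. norm (of_real (norm \<xi> powr k * kern s ((norm \<xi>)\<^sup>2)) * fourier_real g \<xi>) \<le>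
     60 * (1 + s) powr (- ((k - j) / 2)) * norm (of_real (norm \<xi> powr j) * fourier_real g \<xi>)"
  proof (intro AE_I2)
    fix \<xi> :: 'a
    have "norm \<xi> powr (k - j) * kern s ((norm \<xi>)\<^sup>2) * norm \<xi> powr j \<le> 60 * (1 + s) powr (- ((k - j) / 2)) * norm \<xi> powr j"
      using k by (intro mult_right_mono kern_weight s) auto
    then have "\<bar>norm \<xi> powr k * kern s ((norm \<xi>)\<^sup>2)\<bar> \<le> 60 * (1 + s) powr (- ((k - j) / 2)) * \<bar>norm \<xi> powr j\<bar>"
      using kern_nonneg[OF s, of "(norm \<xi>)\<^sup>2"] by (simp add: split abs_mult mult_ac)
    then show "norm (of_real (norm \<xi> powr k * kern s ((norm \<xi>)\<^sup>2)) * fourier_real g \<xi>) \<le>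
     60 * (1 + s) powr (- ((k - j) / 2)) * norm (of_real (norm \<xi> powr j) * fourier_real g \<xi>)"
      unfolding norm_mult norm_of_real mult.assoc[symmetric] by (intro mult_right_mono) auto
  qed
  from L2_dominated[OF m2 j _ this]
  show "(\<lambda>\<xi>. of_real (norm \<xi> powr k * kern s ((norm \<xi>)\<^sup>2)) * fourier_real g \<xi>) \<in> L2"
    "L2_norm (\<lambda>\<xi>. of_real (norm \<xi> powr k * kern s ((norm \<xi>)\<^sup>2)) * fourier_real g \<xi>) \<le>
       60 * (1 + s) powr (- ((k - j) / 2)) * L2_norm (\<lambda>\<xi>. of_real (norm \<xi> powr j) * fourier_real g \<xi>)"
    by simp_all
qed

lemma heat_defect_fourier_real:
  fixes g :: "'a::euclidean_space \<Rightarrow> real"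
  assumes "g \<in> L2" "integrable lborel g"
  shows "AE \<xi> in lborel. heat_defect k t g \<xi> = of_real (norm \<xi> powr k * exp (- t * (norm \<xi>)\<^sup>2)) *
     (fourier_real g \<xi> - of_real (fourier_const TYPE('a) * (\<integral>x. g x \<partial>lborel)))"
proof -
  have "AE \<xi> in lborel. fourier_real g \<xi> = fourier_integral (\<lambda>x. of_real (g x)) \<xi>"
    using assms by (intro fourier_eq_integral L2_of_real) auto
  then show ?thesis by eventually_elim (simp add: heat_defect_def)
qed

lemma L2_norm_AE_sum:
  fixes X :: "'a::euclidean_space \<Rightarrow> complex"
  assumes X: "X \<in> borel_measurable borel" and Y: "Y \<in> L2" and Z: "Z \<in> L2"
    and eq: "AE \<xi> in lborel. X \<xi> = Y \<xi> + Z \<xi>"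
  shows "X \<in> L2" "L2_norm X \<le> L2_norm Y + L2_norm Z"
proof -
  have eq': "AE \<xi> in lborel. norm (Y \<xi> + Z \<xi>) = norm (X \<xi>)" using eq by eventually_elim simp
  show "X \<in> L2" by (rule L2_cong_AE[OF L2_add(1)[OF Y Z] X eq'])
  have "L2_norm X = L2_norm (\<lambda>\<xi>. Y \<xi> + Z \<xi>)"
    by (rule L2_norm_cong_AE[OF X L2_measurable[OF L2_add(1)[OF Y Z]], symmetric, THEN sym]) (use eq' in \<open>auto elim: eventually_mono\<close>)
  then show "L2_norm X \<le> L2_norm Y + L2_norm Z" using L2_norm_triangle[OF Y Z] by simp
qed

lemma powr_neg_le:
  fixes x T c b :: real
  assumes "x \<ge> T / c" "T > 0" "c > 0" "b \<ge> 0"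
  shows "x powr (- b) \<le> c powr b * T powr (- b)"
proof -
  have "x powr (- b) \<le> (T / c) powr (- b)" using assms by (intro powr_mono2') auto
  also have "\<dots> = c powr b * T powr (- b)" using assms by (simp add: powr_divide powr_minus field_simps)
  finally show ?thesis .
qed

context decaying_flow
begin

text \<open>The number of derivatives put on the nonlinearity, chosen so that the exponent in the kernel bound
  \<open>(1 + t - \<tau>) powr (- (k - deriv_order k) / 2)\<close> stays above \<open>- 1\<close>.\<close>

definition "deriv_order k = (if k < 2 then 0 else 1 :: real)"
definition "mass t = (\<integral>x. f t x \<partial>lborel)"

lemma deriv_order: "0 \<le> deriv_order k" "0 \<le> k \<Longrightarrow> deriv_order k \<le> k" "k \<le> k\<^sub>0 \<Longrightarrow> k - deriv_order k < 2"
  using k0_bounds by (auto simp: deriv_order_def)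

section \<open>The mass and the heat defect of the nonlinearity as functions of time\<close>

lemma f_in_L2:
  assumes "t \<ge> 0" shows "f t \<in> L2"
proof (rule f_L2)
  assume "\<And>t. t \<ge> 0 \<Longrightarrow> f t \<in> L2"
  then show ?thesis using assms .
qed

lemma f_integrable:
  assumes "t \<ge> 0" shows "integrable lborel (f t)"
proof (rule f_L1)
  assume "\<And>t. t \<ge> 0 \<Longrightarrow> integrable lborel (f t)"
  then show ?thesis using assms .
qed

lemma mass_abs: "(\<integral>x. \<bar>f t x\<bar> \<partial>lborel) = mass t"
  by (simp add: mass_def f_nonneg)

lemma mass_nonneg: "mass t \<ge> 0"
  by (simp add: mass_def f_nonneg integral_nonneg)

text \<open>Joins \<open>f_L2\<close> for order 0 and \<open>f_gradient\<close> for order 1, so that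
  later estimates need no distinction by k.\<close>

lemma f_weight:
  assumes k: "0 \<le> k" "k \<le> k\<^sub>0"
  obtains D where "D \<ge> 0" "\<And>t. t \<ge> 0 \<Longrightarrow> (\<lambda>\<xi>. of_real (norm \<xi> powr deriv_order k) * fourier_real (f t) \<xi>) \<in> L2"
    "\<And>t. t \<ge> 0 \<Longrightarrow> L2_norm (\<lambda>\<xi>. of_real (norm \<xi> powr deriv_order k) * fourier_real (f t) \<xi>) \<le> D * (1 + t) powr (- (1 + \<eta> + n / 4 + deriv_order k / 2))"
proof (cases "k < 2")
  case True
  then have j: "deriv_order k = 0" by (simp add: deriv_order_def)
  obtain D where D: "D \<ge> 0" "\<And>t. t \<ge> 0 \<Longrightarrow> f t \<in> L2" "\<And>t. t \<ge> 0 \<Longrightarrow> L2_norm (f t) \<le> D * (1 + t) powr (- (1 + \<eta>) - n / 4)"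
    by (rule f_L2) blast
  have "(\<lambda>\<xi>. of_real (norm \<xi> powr deriv_order k) * fourier_real (f t) \<xi>) \<in> L2 \<and>
    L2_norm (\<lambda>\<xi>. of_real (norm \<xi> powr deriv_order k) * fourier_real (f t) \<xi>) \<le> D * (1 + t) powr (- (1 + \<eta> + n / 4 + deriv_order k / 2))" if t: "t \<ge> 0" for t
  proof -
    note F = fourier_real_L2[OF f_in_L2[OF t]]
    note [measurable] = L2_measurable[OF F(1)]
    have m: "(\<lambda>\<xi>. of_real (norm \<xi> powr deriv_order k) * fourier_real (f t) \<xi>) \<in> borel_measurable borel" by measurable
    have "norm (of_real (norm \<xi> powr deriv_order k) * fourier_real (f t) \<xi>) \<le> norm (fourier_real (f t) \<xi>)" for \<xi>
      by (cases "\<xi> = 0") (auto simp: j norm_mult)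
    from L2_mono[OF m F(1) this] D(3)[OF t] F(2) show ?thesis by (simp add: j)
  qed
  with D(1) show thesis using that by blast
next
  case False
  then have j: "deriv_order k = 1" and k2: "k\<^sub>0 \<ge> 2" using k by (auto simp: deriv_order_def)
  obtain D where D: "D \<ge> 0" "\<And>t. t \<ge> 0 \<Longrightarrow> (\<lambda>\<xi>. of_real (norm \<xi>) * fourier_real (f t) \<xi>) \<in> L2"
    "\<And>t. t \<ge> 0 \<Longrightarrow> L2_norm (\<lambda>\<xi>. of_real (norm \<xi>) * fourier_real (f t) \<xi>) \<le> D * (1 + t) powr (- (1 + \<eta>) - n / 4 - 1 / 2)"
    by (rule f_gradient[OF k2]) blast
  have e: "- (1 + \<eta> + n / 4 + deriv_order k / 2) = - (1 + \<eta>) - n / 4 - 1 / 2" by (simp add: j)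
  have w: "complex_of_real (norm \<xi> powr deriv_order k) = of_real (norm \<xi>)" for \<xi> :: 'a by (simp add: j)
  show thesis
    by (rule that[OF D(1)]; unfold e w; rule D(2,3); assumption)
qed

lemma mass_lipschitz:
  obtains K where "K \<ge> 0" "\<And>s t. s \<ge> 0 \<Longrightarrow> t \<ge> 0 \<Longrightarrow> \<bar>mass t - mass s\<bar> \<le> K * L2_norm (\<lambda>x. u t x - u s x)"
proof -
  obtain K where K: "K \<ge> 0" "\<And>s t. s \<ge> 0 \<Longrightarrow> t \<ge> 0 \<Longrightarrow> (\<integral>x. \<bar>f t x - f s x\<bar> \<partial>lborel) \<le> K * L2_norm (\<lambda>x. u t x - u s x)"
    by (rule f_L1_lipschitz) blast
  show thesis
  proof (rule that[OF K(1)])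
    fix s t :: real assume st: "s \<ge> 0" "t \<ge> 0"
    have "mass t - mass s = (\<integral>x. f t x - f s x \<partial>lborel)" unfolding mass_def using f_integrable st by simp
    then have "\<bar>mass t - mass s\<bar> \<le> (\<integral>x. \<bar>f t x - f s x\<bar> \<partial>lborel)" using integral_abs_bound by metis
    with K(2)[OF st] show "\<bar>mass t - mass s\<bar> \<le> K * L2_norm (\<lambda>x. u t x - u s x)" by linarith
  qed
qed

lemma continuous_on_of_L2_lipschitz:
  fixes \<phi> :: "real \<Rightarrow> real"
  assumes "\<And>s t. s \<ge> 0 \<Longrightarrow> t \<ge> 0 \<Longrightarrow> \<bar>\<phi> t - \<phi> s\<bar> \<le> K * L2_norm (\<lambda>x. u t x - u s x)"
  shows "continuous_on {0..} \<phi>"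
  unfolding continuous_on_def
proof
  fix s :: real assume s: "s \<in> {0..}"
  have "((\<lambda>t. K * L2_norm (\<lambda>x. u t x - u s x)) \<longlongrightarrow> K * 0) (at s within {0..})"
    using s by (intro tendsto_intros u_cont) auto
  then have "((\<lambda>t. K * L2_norm (\<lambda>x. u t x - u s x)) \<longlongrightarrow> 0) (at s within {0..})" by simp
  then have "((\<lambda>t. \<phi> t - \<phi> s) \<longlongrightarrow> 0) (at s within {0..})"
  proof (rule Lim_null_comparison[rotated])
    show "\<forall>\<^sub>F t in at s within {0..}. norm (\<phi> t - \<phi> s) \<le> K * L2_norm (\<lambda>x. u t x - u s x)"
      using s assms by (auto simp: eventually_at intro!: exI[of _ 1])
  qed
  then show "(\<phi> \<longlongrightarrow> \<phi> s) (at s within {0..})" by (rule LIM_zero_cancel)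
qed

lemma mass_continuous: "continuous_on {0..} mass"
proof (rule mass_lipschitz)
  fix K assume "\<And>s t. s \<ge> 0 \<Longrightarrow> t \<ge> 0 \<Longrightarrow> \<bar>mass t - mass s\<bar> \<le> K * L2_norm (\<lambda>x. u t x - u s x)"
  then show ?thesis by (rule continuous_on_of_L2_lipschitz)
qed

lemma mass_has_integral: "t \<ge> 0 \<Longrightarrow> (mass has_integral integral {0..t} mass) {0..t}"
  by (intro integrable_integral integrable_continuous_interval continuous_on_subset[OF mass_continuous]) auto

lemma mass_decay:
  obtains D where "D \<ge> 0" "\<And>t. t \<ge> 0 \<Longrightarrow> mass t \<le> D * (1 + t) powr (- (1 + \<eta>))"
proof (rule f_L1)
  fix D assume D: "D \<ge> 0" "\<And>t. t \<ge> 0 \<Longrightarrow> (\<integral>x. f t x \<partial>lborel) \<le> D * (1 + t) powr (- (1 + \<eta>))"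
  show thesis by (rule that[OF D(1)]) (unfold mass_def, rule D(2))
qed

lemma mass_integral_tendsto:
  "((\<lambda>t. integral {0..t} mass) \<longlongrightarrow> (LINT \<tau>:{0..}|lborel. mass \<tau>)) at_top"
proof -
  obtain D where D: "D \<ge> 0" "\<And>t. t \<ge> 0 \<Longrightarrow> mass t \<le> D * (1 + t) powr (- (1 + \<eta>))" by (rule mass_decay) blast
  show ?thesis
  proof (rule set_integral_growing_interval_tendsto[where W="\<lambda>\<tau>. D * (1 + \<tau>) powr (- (1 + \<eta>))"])
    show "set_integrable lborel {0..} (\<lambda>\<tau>. D * (1 + \<tau>) powr (- (1 + \<eta>)))"
      by (intro set_integrable_mult_right set_integrable_powr_tail eta_pos)
  qed (use mass_continuous D mass_nonneg in auto)
qed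

text \<open>For fixed \<tau> the rescaled defect vanishes by \<open>heat_defect_tendsto\<close>,
  though without a rate. It is bounded uniformly in t by a multiple of the mass at time \<tau>,
  which is integrable, so the limit may be taken under the integral.\<close>

lemma heat_defect_integral_tendsto:
  assumes k: "k \<ge> 0"
  shows "\<And>t. t > 0 \<Longrightarrow> continuous_on {0..} (\<lambda>\<tau>. L2_norm (heat_defect k t (f \<tau>)))"
    "((\<lambda>t. t powr (n / 4 + k / 2) * integral {0..t} (\<lambda>\<tau>. L2_norm (heat_defect k t (f \<tau>)))) \<longlongrightarrow> 0) at_top"
proof -
  obtain G where G: "G > 0" "\<And>t. t > 0 \<Longrightarrow> (\<lambda>\<xi>::'a. norm \<xi> powr k * exp (- t * (norm \<xi>)\<^sup>2)) \<in> L2 \<and>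
    L2_norm (\<lambda>\<xi>::'a. norm \<xi> powr k * exp (- t * (norm \<xi>)\<^sup>2)) \<le> G * t powr (- (n / 4) - k / 2)"
    using gauss_weight[OF k, where 'a='a] by (auto simp: n_def)
  obtain K where K: "K \<ge> 0" "\<And>s t. s \<ge> 0 \<Longrightarrow> t \<ge> 0 \<Longrightarrow> (\<integral>x. \<bar>f t x - f s x\<bar> \<partial>lborel) \<le> K * L2_norm (\<lambda>x. u t x - u s x)"
    by (rule f_L1_lipschitz) blast
  obtain D where D: "D \<ge> 0" "\<And>t. t \<ge> 0 \<Longrightarrow> mass t \<le> D * (1 + t) powr (- (1 + \<eta>))" by (rule mass_decay) blast
  define F where "F = fourier_const TYPE('a)"
  have F: "F \<ge> 0" by (simp add: F_def)
  show cont: "continuous_on {0..} (\<lambda>\<tau>. L2_norm (heat_defect k t (f \<tau>)))" if t: "t > 0" for t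
  proof (rule continuous_on_of_L2_lipschitz)
    fix r s :: real assume rs: "r \<ge> 0" "s \<ge> 0"
    define g where "g = L2_norm (\<lambda>\<xi>::'a. norm \<xi> powr k * exp (- t * (norm \<xi>)\<^sup>2))"
    have "\<bar>L2_norm (heat_defect k t (f s)) - L2_norm (heat_defect k t (f r))\<bar> \<le> 2 * F * (\<integral>x. \<bar>f s x - f r x\<bar> \<partial>lborel) * g"
      unfolding F_def g_def using G(2)[OF t] rs by (intro heat_defect_lipschitz f_integrable) auto
    also have "\<dots> \<le> 2 * F * (K * L2_norm (\<lambda>x. u s x - u r x)) * g"
      using F by (intro mult_right_mono mult_left_mono K rs) (auto simp: g_def)
    finally show "\<bar>L2_norm (heat_defect k t (f s)) - L2_norm (heat_defect k t (f r))\<bar> \<le> (2 * F * K * g) * L2_norm (\<lambda>x. u s x - u r x)"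
      by (simp add: mult_ac)
  qed
  define \<phi> where "\<phi> t \<tau> = t powr (n / 4 + k / 2) * L2_norm (heat_defect k t (f \<tau>))" for t \<tau>
  have "((\<lambda>t. integral {0..t} (\<phi> t)) \<longlongrightarrow> (LINT \<tau>:{0::real..}|lborel. (0::real))) at_top"
  proof (rule set_integral_growing_interval_tendsto[where W="\<lambda>\<tau>. (2 * F * G * D) * (1 + \<tau>) powr (- (1 + \<eta>))"])
    show "continuous_on {0..} (\<phi> t)" if "t > 0" for t
      unfolding \<phi>_def by (intro continuous_intros cont that)
    show "set_integrable lborel {0..} (\<lambda>\<tau>. (2 * F * G * D) * (1 + \<tau>) powr (- (1 + \<eta>)))"
      by (intro set_integrable_mult_right set_integrable_powr_tail eta_pos)
    show "\<bar>\<phi> t \<tau>\<bar> \<le> (2 * F * G * D) * (1 + \<tau>) powr (- (1 + \<eta>))" if t: "t > 0" and \<tau>: "\<tau> \<ge> 0" for t \<tau>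
    proof -
      have "L2_norm (heat_defect k t (f \<tau>)) \<le> 2 * F * mass \<tau> * L2_norm (\<lambda>\<xi>::'a. norm \<xi> powr k * exp (- t * (norm \<xi>)\<^sup>2))"
        unfolding F_def mass_abs[symmetric] using G(2)[OF t] by (intro heat_defect_L2 f_integrable \<tau>) auto
      also have "\<dots> \<le> 2 * F * (D * (1 + \<tau>) powr (- (1 + \<eta>))) * (G * t powr (- (n / 4) - k / 2))"
        using G(2)[OF t] D F mass_nonneg[of \<tau>] by (intro mult_mono D(2) \<tau>) auto
      finally have "\<phi> t \<tau> \<le> t powr (n / 4 + k / 2) * (2 * F * (D * (1 + \<tau>) powr (- (1 + \<eta>))) * (G * t powr (- (n / 4) - k / 2)))"
        unfolding \<phi>_def by (intro mult_left_mono) auto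
      also have "\<dots> = 2 * F * G * D * (1 + \<tau>) powr (- (1 + \<eta>)) * (t powr (n / 4 + k / 2) * t powr (- (n / 4) - k / 2))"
        by (simp only: mult_ac)
      also have "t powr (n / 4 + k / 2) * t powr (- (n / 4) - k / 2) = 1" using t by (subst powr_add[symmetric]) simp
      finally show ?thesis by (simp add: \<phi>_def)
    qed
    show "((\<lambda>t. \<phi> t \<tau>) \<longlongrightarrow> 0) at_top" if "\<tau> \<ge> 0" for \<tau>
      using heat_defect_tendsto[OF f_integrable[OF that] k] by (simp add: \<phi>_def n_def)
  qed auto
  then show "((\<lambda>t. t powr (n / 4 + k / 2) * integral {0..t} (\<lambda>\<tau>. L2_norm (heat_defect k t (f \<tau>)))) \<longlongrightarrow> 0) at_top"
    by (simp add: \<phi>_def[abs_def])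
qed

section \<open>The Duhamel term against its Gaussian profile\<close>

definition "duhamel_integrand t \<tau> = fourier_multiplier (symbol1 (t - \<tau>)) (f \<tau>)"

text \<open>No cancellation is sought: for \<tau> close to t the kernel at time t - \<tau> does not
  resemble the heat kernel at time t, and the smallness must come from the factors
  \<open>f \<tau>\<close> and \<open>mass \<tau>\<close>.\<close>

lemma duhamel_integrand_late:
  fixes c :: real
  assumes k: "0 \<le> k" "k \<le> k\<^sub>0" and D: "\<And>t. t \<ge> 0 \<Longrightarrow> (\<lambda>\<xi>. of_real (norm \<xi> powr deriv_order k) * fourier_real (f t) \<xi>) \<in> L2"
    and \<tau>: "0 \<le> \<tau>" "\<tau> \<le> t" and G: "(\<lambda>\<xi>::'a. norm \<xi> powr k * exp (- t * (norm \<xi>)\<^sup>2)) \<in> L2"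
  defines "X \<equiv> \<lambda>\<xi>. of_real (norm \<xi> powr k) * (fourier (duhamel_integrand t \<tau>) \<xi> - of_real (c * mass \<tau>) * of_real (fourier_const TYPE('a) * exp (- t * (norm \<xi>)\<^sup>2)))"
  shows "X \<in> L2"
    "L2_norm X \<le> 60 * (1 + (t - \<tau>)) powr (- ((k - deriv_order k) / 2)) * L2_norm (\<lambda>\<xi>. of_real (norm \<xi> powr deriv_order k) * fourier_real (f \<tau>) \<xi>)
      + \<bar>c\<bar> * mass \<tau> * fourier_const TYPE('a) * L2_norm (\<lambda>\<xi>::'a. norm \<xi> powr k * exp (- t * (norm \<xi>)\<^sup>2))"
proof -
  define F where "F = fourier_const TYPE('a)"
  have F: "F \<ge> 0" by (simp add: F_def)
  have s: "t - \<tau> \<ge> 0" using \<tau> by simp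
  have jk: "k - deriv_order k \<le> 2" using deriv_order(3)[OF k(2)] by simp
  note K = fourier_kern_multiplier[OF f_in_L2[OF \<tau>(1)] s]
  note W = kern_weight_L2(3,4)[OF f_in_L2[OF \<tau>(1)] D[OF \<tau>(1)] deriv_order(1) deriv_order(2)[OF k(1)] jk s]
  note [measurable] = L2_measurable[OF fourier_L2[OF K(1)]]
  have m: "X \<in> borel_measurable borel" unfolding X_def duhamel_integrand_def by measurable
  define Z where "Z \<xi> = - complex_of_real (c * mass \<tau> * F) * of_real (norm \<xi> powr k * exp (- t * (norm \<xi>)\<^sup>2))" for \<xi> :: 'a
  have Z: "Z \<in> L2" "L2_norm Z = \<bar>c\<bar> * mass \<tau> * F * L2_norm (\<lambda>\<xi>::'a. norm \<xi> powr k * exp (- t * (norm \<xi>)\<^sup>2))"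
    unfolding Z_def[abs_def] using L2_mult[OF L2_of_real(1)[OF G], of "- complex_of_real (c * mass \<tau> * F)"] F mass_nonneg[of \<tau>]
    by (simp_all only: L2_of_real(2) norm_minus_cancel norm_of_real abs_mult abs_of_nonneg)
  have eq: "AE \<xi> in lborel. X \<xi> = of_real (norm \<xi> powr k * kern (t - \<tau>) ((norm \<xi>)\<^sup>2)) * fourier_real (f \<tau>) \<xi> + Z \<xi>"
    using K(2) by eventually_elim (simp add: X_def duhamel_integrand_def Z_def F_def algebra_simps)
  show "X \<in> L2" by (rule L2_norm_AE_sum(1)[OF m W(1) Z(1) eq])
  show "L2_norm X \<le> 60 * (1 + (t - \<tau>)) powr (- ((k - deriv_order k) / 2)) * L2_norm (\<lambda>\<xi>. of_real (norm \<xi> powr deriv_order k) * fourier_real (f \<tau>) \<xi>)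
      + \<bar>c\<bar> * mass \<tau> * fourier_const TYPE('a) * L2_norm (\<lambda>\<xi>::'a. norm \<xi> powr k * exp (- t * (norm \<xi>)\<^sup>2))"
    using L2_norm_AE_sum(2)[OF m W(1) Z(1) eq] W(2) Z(2) by (simp add: F_def)
qed

text \<open>The difference telescopes through the heat kernels at times t - \<tau> and t. In the
  factor 2 + \<tau> the 2 comes from \<open>kernel_approx\<close> and the \<tau> from
  \<open>heat_shift\<close>; 24 is 12 times the constant of \<open>kern_weight_L2\<close>.\<close>

lemma duhamel_integrand_early:
  assumes k: "0 \<le> k" "k \<le> k\<^sub>0" and D: "\<And>t. t \<ge> 0 \<Longrightarrow> (\<lambda>\<xi>. of_real (norm \<xi> powr deriv_order k) * fourier_real (f t) \<xi>) \<in> L2"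
    and \<tau>: "0 \<le> \<tau>" "\<tau> < t" and G: "\<And>t. t > 0 \<Longrightarrow> (\<lambda>\<xi>::'a. norm \<xi> powr k * exp (- t * (norm \<xi>)\<^sup>2)) \<in> L2"
    "\<And>t. t > 0 \<Longrightarrow> (\<lambda>\<xi>::'a. norm \<xi> powr (k + 2) * exp (- t * (norm \<xi>)\<^sup>2)) \<in> L2"
  defines "X \<equiv> \<lambda>\<xi>. of_real (norm \<xi> powr k) * (fourier (duhamel_integrand t \<tau>) \<xi> - of_real (mass \<tau>) * of_real (fourier_const TYPE('a) * exp (- t * (norm \<xi>)\<^sup>2)))"
  shows "X \<in> L2"
    "L2_norm X \<le> (2 + \<tau>) * fourier_const TYPE('a) * mass \<tau> * L2_norm (\<lambda>\<xi>::'a. norm \<xi> powr (k + 2) * exp (- (t - \<tau>) * (norm \<xi>)\<^sup>2))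
      + 24 * exp (- (t - \<tau>) / 4) * L2_norm (\<lambda>\<xi>. of_real (norm \<xi> powr deriv_order k) * fourier_real (f \<tau>) \<xi>)
      + L2_norm (heat_defect k t (f \<tau>))"
proof -
  have s: "t - \<tau> > 0" "t > 0" using \<tau> by auto
  have jk: "k - deriv_order k \<le> 2" using deriv_order(3)[OF k(2)] by simp
  note fL = f_in_L2[OF \<tau>(1)] f_integrable[OF \<tau>(1)]
  note K = fourier_kern_multiplier[OF fL(1) less_imp_le[OF s(1)]]
  note W = kern_weight_L2(1,2)[OF fL(1) D[OF \<tau>(1)] deriv_order(1) deriv_order(2)[OF k(1)] jk]
  note X1 = kernel_approx[OF fL s(1) k(1) W(1) G(2)[OF s(1)]]
  note X2 = heat_shift[OF fL \<tau> k(1) G(2)[OF s(1)]]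
  note X3 = heat_defect_L2(1)[OF fL(2) G(1)[OF s(2)]]
  note X12 = L2_add(1)[OF X1(1) X2(1)] L2_norm_triangle[OF X1(1) X2(1)]
  note [measurable] = L2_measurable[OF fourier_L2[OF K(1)]]
  have m: "X \<in> borel_measurable borel" unfolding X_def duhamel_integrand_def by measurable
  have eq: "AE \<xi> in lborel. X \<xi> = (of_real (norm \<xi> powr k * (kern (t - \<tau>) ((norm \<xi>)\<^sup>2) - exp (- (t - \<tau>) * (norm \<xi>)\<^sup>2))) * fourier_real (f \<tau>) \<xi>
     + of_real (norm \<xi> powr k * (exp (- (t - \<tau>) * (norm \<xi>)\<^sup>2) - exp (- t * (norm \<xi>)\<^sup>2))) * fourier_real (f \<tau>) \<xi>) + heat_defect k t (f \<tau>) \<xi>"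
    using K(2) heat_defect_fourier_real[OF fL, of k t]
  proof eventually_elim
    case (elim \<xi>)
    show ?case
      unfolding X_def duhamel_integrand_def elim mass_def
      by (simp only: of_real_mult of_real_diff) (simp only: algebra_simps)
  qed
  show "X \<in> L2" by (rule L2_norm_AE_sum(1)[OF m X12(1) X3 eq])
  have "12 * exp (- (t - \<tau>) / 4) * L2_norm (\<lambda>\<xi>. of_real (norm \<xi> powr k / (1 + (norm \<xi>)\<^sup>2)) * fourier_real (f \<tau>) \<xi>)
     \<le> 12 * exp (- (t - \<tau>) / 4) * (2 * L2_norm (\<lambda>\<xi>. of_real (norm \<xi> powr deriv_order k) * fourier_real (f \<tau>) \<xi>))"
    by (intro mult_left_mono W(2)) auto
  then show "L2_norm X \<le> (2 + \<tau>) * fourier_const TYPE('a) * mass \<tau> * L2_norm (\<lambda>\<xi>::'a. norm \<xi> powr (k + 2) * exp (- (t - \<tau>) * (norm \<xi>)\<^sup>2))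
      + 24 * exp (- (t - \<tau>) / 4) * L2_norm (\<lambda>\<xi>. of_real (norm \<xi> powr deriv_order k) * fourier_real (f \<tau>) \<xi>)
      + L2_norm (heat_defect k t (f \<tau>))"
    using L2_norm_AE_sum(2)[OF m X12(1) X3 eq] X12(2) X1(2) X2(2) unfolding mass_abs distrib_right by linarith
qed

text \<open>The first three terms bound the Duhamel integrand for \<open>\<tau> \<le> t / 2\<close>, where the kernel is compared with
  the heat kernel at time \<open>t\<close>; the last two for \<open>\<tau> \<ge> t / 2\<close>, where the kernel and the Gaussian are estimated separately.\<close>

definition "duhamel_bound c1 c2 c3 c4 k t \<tau> =
  c1 * (1 + t) powr (- (n / 4 + k / 2 + 1)) * (1 + \<tau>) powr (- min \<eta> (1/2))
  + c2 * exp (- t / 8)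
  + L2_norm (heat_defect k t (f \<tau>))
  + c3 * (1 + t) powr (- (1 + \<eta> + n / 4 + deriv_order k / 2)) * (1 + t - \<tau>) powr (- ((k - deriv_order k) / 2))
  + c4 * (1 + t) powr (- (n / 4 + k / 2 + 1 + \<eta>))"

lemma duhamel_integrand_bound:
  assumes k: "0 \<le> k" "k \<le> k\<^sub>0"
  obtains c1 c2 c3 c4 where "c1 \<ge> 0" "c2 \<ge> 0" "c3 \<ge> 0" "c4 \<ge> 0"
    "\<And>t \<tau>. t \<ge> 1 \<Longrightarrow> \<tau> \<in> {0..t} \<Longrightarrow>
      (\<lambda>\<xi>. of_real (norm \<xi> powr k) * (fourier (duhamel_integrand t \<tau>) \<xi> - of_real (mass \<tau>) * of_real (fourier_const TYPE('a) * exp (- t * (norm \<xi>)\<^sup>2)))) \<in> L2 \<and>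
      L2_norm (\<lambda>\<xi>. of_real (norm \<xi> powr k) * (fourier (duhamel_integrand t \<tau>) \<xi> - of_real (mass \<tau>) * of_real (fourier_const TYPE('a) * exp (- t * (norm \<xi>)\<^sup>2))))
       \<le> duhamel_bound c1 c2 c3 c4 k t \<tau>"
proof -
  define F where "F = fourier_const TYPE('a)"
  have F: "F \<ge> 0" by (simp add: F_def)
  define \<alpha> where "\<alpha> = n / 4 + k / 2"
  have \<alpha>: "\<alpha> \<ge> 0" using n_bounds k by (simp add: \<alpha>_def)
  define \<beta> where "\<beta> = 1 + \<eta> + n / 4 + deriv_order k / 2"
  have \<beta>: "\<beta> \<ge> 0" using n_bounds eta_pos deriv_order(1)[of k] by (simp add: \<beta>_def)
  obtain G where G: "G > 0" "\<And>t. t > 0 \<Longrightarrow> (\<lambda>\<xi>::'a. norm \<xi> powr k * exp (- t * (norm \<xi>)\<^sup>2)) \<in> L2 \<and>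
    L2_norm (\<lambda>\<xi>::'a. norm \<xi> powr k * exp (- t * (norm \<xi>)\<^sup>2)) \<le> G * t powr (- (n / 4) - k / 2)"
    using gauss_weight[OF k(1), where 'a='a] by (auto simp: n_def)
  obtain G2 where G2: "G2 > 0" "\<And>t. t > 0 \<Longrightarrow> (\<lambda>\<xi>::'a. norm \<xi> powr (k + 2) * exp (- t * (norm \<xi>)\<^sup>2)) \<in> L2 \<and>
    L2_norm (\<lambda>\<xi>::'a. norm \<xi> powr (k + 2) * exp (- t * (norm \<xi>)\<^sup>2)) \<le> G2 * t powr (- (n / 4) - (k + 2) / 2)"
    using gauss_weight[of "k + 2", where 'a='a] k by (auto simp: n_def)
  obtain D1 where D1: "D1 \<ge> 0" "\<And>t. t \<ge> 0 \<Longrightarrow> mass t \<le> D1 * (1 + t) powr (- (1 + \<eta>))" by (rule mass_decay) blast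
  obtain D2 where D2: "D2 \<ge> 0" "\<And>t. t \<ge> 0 \<Longrightarrow> (\<lambda>\<xi>. of_real (norm \<xi> powr deriv_order k) * fourier_real (f t) \<xi>) \<in> L2"
    "\<And>t. t \<ge> 0 \<Longrightarrow> L2_norm (\<lambda>\<xi>. of_real (norm \<xi> powr deriv_order k) * fourier_real (f t) \<xi>) \<le> D2 * (1 + t) powr (- (1 + \<eta> + n / 4 + deriv_order k / 2))"
    by (rule f_weight[OF k]) blast
  define c1 where "c1 = 2 * F * D1 * G2 * 4 powr (\<alpha> + 1)"
  define c2 where "c2 = 24 * D2"
  define c3 where "c3 = 60 * D2 * 2 powr \<beta>"
  define c4 where "c4 = D1 * F * G * 2 powr (1 + \<eta>) * 2 powr \<alpha>"
  have c: "c1 \<ge> 0" "c2 \<ge> 0" "c3 \<ge> 0" "c4 \<ge> 0"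
    using F D1(1) D2(1) G(1) G2(1) by (simp_all add: c1_def c2_def c3_def c4_def)
  show thesis
  proof (rule that[OF c])
    fix t \<tau> :: real assume t: "t \<ge> 1" and "\<tau> \<in> {0..t}"
    then have \<tau>: "0 \<le> \<tau>" "\<tau> \<le> t" by auto
    have t0: "t > 0" using t by simp
    define X where "X = (\<lambda>\<xi>. of_real (norm \<xi> powr k) * (fourier (duhamel_integrand t \<tau>) \<xi> - of_real (mass \<tau>) * of_real (fourier_const TYPE('a) * exp (- t * (norm \<xi>)\<^sup>2))))"
    define N where "N = L2_norm (\<lambda>\<xi>. of_real (norm \<xi> powr deriv_order k) * fourier_real (f \<tau>) \<xi>)"
    have N: "N \<ge> 0" "N \<le> D2 * (1 + \<tau>) powr (- \<beta>)" using D2(3)[OF \<tau>(1)] by (simp_all add: N_def \<beta>_def)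
    note m = mass_nonneg[of \<tau>] D1(2)[OF \<tau>(1)]
    \<comment> \<open>All summands are nonnegative, so the terms meant for one half of the interval
      may be added on the other; the bound is then integrated over [0, t] without a split.\<close>
    have bpos: "0 \<le> c1 * (1 + t) powr (- (\<alpha> + 1)) * (1 + \<tau>) powr (- min \<eta> (1/2))"
      "0 \<le> c2 * exp (- t / 8)" "0 \<le> c3 * (1 + t) powr (- \<beta>) * (1 + t - \<tau>) powr (- ((k - deriv_order k) / 2))"
      "0 \<le> c4 * (1 + t) powr (- (\<alpha> + 1 + \<eta>))"
      using c by auto
    have be: "duhamel_bound c1 c2 c3 c4 k t \<tau> = c1 * (1 + t) powr (- (\<alpha> + 1)) * (1 + \<tau>) powr (- min \<eta> (1/2))
      + c2 * exp (- t / 8) + L2_norm (heat_defect k t (f \<tau>))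
      + c3 * (1 + t) powr (- \<beta>) * (1 + t - \<tau>) powr (- ((k - deriv_order k) / 2))
      + c4 * (1 + t) powr (- (\<alpha> + 1 + \<eta>))"
      by (simp add: duhamel_bound_def \<alpha>_def \<beta>_def)
    have "X \<in> L2 \<and> L2_norm X \<le> duhamel_bound c1 c2 c3 c4 k t \<tau>"
    proof (cases "\<tau> \<le> t / 2")
      case True
      then have \<tau>t: "\<tau> < t" using t0 by simp
      \<comment> \<open>Here t - \<tau> >= t / 2, and t >= 1 turns this into a multiple of 1 + t,
        away from the singularity of the Gaussian norms at time 0.\<close>
      have s: "t - \<tau> > 0" "t - \<tau> \<ge> (1 + t) / 4" "t - \<tau> \<ge> t / 2" using True t by auto
      note E = duhamel_integrand_early[OF k D2(2) \<tau>(1) \<tau>t conjunct1[OF G(2)] conjunct1[OF G2(2)], folded X_def N_def]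
      have "L2_norm (\<lambda>\<xi>::'a. norm \<xi> powr (k + 2) * exp (- (t - \<tau>) * (norm \<xi>)\<^sup>2)) \<le> G2 * (t - \<tau>) powr (- (\<alpha> + 1))"
      proof -
        have e: "- (n / 4) - (k + 2) / 2 = - (\<alpha> + 1)" by (simp add: \<alpha>_def field_simps)
        show ?thesis using G2(2)[OF s(1)] unfolding e by blast
      qed
      also have "\<dots> \<le> G2 * (4 powr (\<alpha> + 1) * (1 + t) powr (- (\<alpha> + 1)))"
        using s(2) t \<alpha> G2(1) by (intro mult_left_mono powr_neg_le) auto
      finally have g2: "L2_norm (\<lambda>\<xi>::'a. norm \<xi> powr (k + 2) * exp (- (t - \<tau>) * (norm \<xi>)\<^sup>2)) \<le> G2 * (4 powr (\<alpha> + 1) * (1 + t) powr (- (\<alpha> + 1)))" .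
      have "(2 + \<tau>) * mass \<tau> \<le> (2 * (1 + \<tau>)) * (D1 * (1 + \<tau>) powr (- (1 + \<eta>)))"
        using \<tau> m by (intro mult_mono) auto
      also have "\<dots> = 2 * D1 * ((1 + \<tau>) powr 1 * (1 + \<tau>) powr (- (1 + \<eta>)))" using \<tau> by simp
      also have "(1 + \<tau>) powr 1 * (1 + \<tau>) powr (- (1 + \<eta>)) = (1 + \<tau>) powr (- \<eta>)" by (subst powr_add[symmetric]) simp
      \<comment> \<open>Capping the decay exponent at 1/2 keeps the power above -1, so its time
        integral is again a power even for \<eta> >= 1.\<close>
      also have "2 * D1 * (1 + \<tau>) powr (- \<eta>) \<le> 2 * D1 * (1 + \<tau>) powr (- min \<eta> (1/2))"
        using \<tau> D1(1) by (intro mult_left_mono powr_mono) auto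
      finally have "(2 + \<tau>) * mass \<tau> \<le> 2 * D1 * (1 + \<tau>) powr (- min \<eta> (1/2))" .
      then have "F * ((2 + \<tau>) * mass \<tau>) \<le> F * (2 * D1 * (1 + \<tau>) powr (- min \<eta> (1/2)))"
        using F by (rule mult_left_mono)
      then have "F * ((2 + \<tau>) * mass \<tau>) * L2_norm (\<lambda>\<xi>::'a. norm \<xi> powr (k + 2) * exp (- (t - \<tau>) * (norm \<xi>)\<^sup>2)) \<le>
        F * (2 * D1 * (1 + \<tau>) powr (- min \<eta> (1/2))) * (G2 * (4 powr (\<alpha> + 1) * (1 + t) powr (- (\<alpha> + 1))))"
        by (rule mult_mono[OF _ g2]) (use F D1(1) in auto)
      then have 1: "(2 + \<tau>) * fourier_const TYPE('a) * mass \<tau> * L2_norm (\<lambda>\<xi>::'a. norm \<xi> powr (k + 2) * exp (- (t - \<tau>) * (norm \<xi>)\<^sup>2))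
        \<le> c1 * (1 + t) powr (- (\<alpha> + 1)) * (1 + \<tau>) powr (- min \<eta> (1/2))"
        by (simp only: c1_def F_def mult_ac)
      have "(1 + \<tau>) powr (- \<beta>) \<le> (1 + \<tau>) powr 0" using \<tau> \<beta> by (intro powr_mono) auto
      then have "D2 * (1 + \<tau>) powr (- \<beta>) \<le> D2 * 1" using \<tau> D2(1) by (intro mult_left_mono) auto
      then have "N \<le> D2" using N(2) by linarith
      moreover have "exp (- (t - \<tau>) / 4) \<le> exp (- t / 8)" using s(3) by simp
      ultimately have "24 * exp (- (t - \<tau>) / 4) * N \<le> 24 * exp (- t / 8) * D2"
        using N(1) by (intro mult_mono mult_left_mono) auto
      then have 2: "24 * exp (- (t - \<tau>) / 4) * N \<le> c2 * exp (- t / 8)" by (simp add: c2_def mult_ac)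
      show ?thesis
        using E 1 2 bpos unfolding be by linarith
    next
      case False
      \<comment> \<open>In the second half 1 + \<tau> is comparable to 1 + t, so decay in \<tau>
        becomes decay in t.\<close>
      then have s: "1 + \<tau> \<ge> (1 + t) / 2" "t \<ge> (1 + t) / 2" using t by auto
      have Gt: "(\<lambda>\<xi>::'a. norm \<xi> powr k * exp (- t * (norm \<xi>)\<^sup>2)) \<in> L2" using G(2)[OF t0] by blast
      note L0 = duhamel_integrand_late[where c=1, unfolded mult_1 abs_one, OF k _ \<tau> Gt, folded X_def N_def]
      have L: "X \<in> L2" "L2_norm X \<le> 60 * (1 + (t - \<tau>)) powr (- ((k - deriv_order k) / 2)) * N
          + mass \<tau> * fourier_const TYPE('a) * L2_norm (\<lambda>\<xi>::'a. norm \<xi> powr k * exp (- t * (norm \<xi>)\<^sup>2))"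
        by (rule L0, rule D2(2), assumption)+
      have "N \<le> D2 * (2 powr \<beta> * (1 + t) powr (- \<beta>))"
        using s(1) t \<beta> D2(1) by (intro order_trans[OF N(2)] mult_left_mono powr_neg_le) auto
      then have "60 * (1 + (t - \<tau>)) powr (- ((k - deriv_order k) / 2)) * N \<le> 60 * (1 + (t - \<tau>)) powr (- ((k - deriv_order k) / 2)) * (D2 * (2 powr \<beta> * (1 + t) powr (- \<beta>)))"
        by (intro mult_left_mono) auto
      also have "\<dots> = c3 * (1 + t) powr (- \<beta>) * (1 + t - \<tau>) powr (- ((k - deriv_order k) / 2))"
        by (simp only: c3_def mult_ac add_diff_eq)
      finally have 1: "60 * (1 + (t - \<tau>)) powr (- ((k - deriv_order k) / 2)) * N \<le> c3 * (1 + t) powr (- \<beta>) * (1 + t - \<tau>) powr (- ((k - deriv_order k) / 2))" .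
      have "L2_norm (\<lambda>\<xi>::'a. norm \<xi> powr k * exp (- t * (norm \<xi>)\<^sup>2)) \<le> G * t powr (- \<alpha>)"
      proof -
        have e: "- (n / 4) - k / 2 = - \<alpha>" by (simp add: \<alpha>_def)
        show ?thesis using G(2)[OF t0] unfolding e by blast
      qed
      also have "\<dots> \<le> G * (2 powr \<alpha> * (1 + t) powr (- \<alpha>))"
        using s(2) t \<alpha> G(1) by (intro mult_left_mono powr_neg_le) auto
      finally have g: "L2_norm (\<lambda>\<xi>::'a. norm \<xi> powr k * exp (- t * (norm \<xi>)\<^sup>2)) \<le> G * (2 powr \<alpha> * (1 + t) powr (- \<alpha>))" .
      have "mass \<tau> \<le> D1 * (2 powr (1 + \<eta>) * (1 + t) powr (- (1 + \<eta>)))"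
        using s(1) t eta_pos D1(1) by (intro order_trans[OF m(2)] mult_left_mono powr_neg_le) auto
      then have "mass \<tau> * F * L2_norm (\<lambda>\<xi>::'a. norm \<xi> powr k * exp (- t * (norm \<xi>)\<^sup>2)) \<le>
        D1 * (2 powr (1 + \<eta>) * (1 + t) powr (- (1 + \<eta>))) * F * (G * (2 powr \<alpha> * (1 + t) powr (- \<alpha>)))"
        using F D1(1) m(1) by (intro mult_mono g mult_right_mono) auto
      also have "\<dots> = c4 * ((1 + t) powr (- (1 + \<eta>)) * (1 + t) powr (- \<alpha>))" by (simp only: c4_def mult_ac)
      also have "(1 + t) powr (- (1 + \<eta>)) * (1 + t) powr (- \<alpha>) = (1 + t) powr (- (\<alpha> + 1 + \<eta>))"
        by (subst powr_add[symmetric]) (simp add: algebra_simps)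
      finally have 2: "mass \<tau> * fourier_const TYPE('a) * L2_norm (\<lambda>\<xi>::'a. norm \<xi> powr k * exp (- t * (norm \<xi>)\<^sup>2)) \<le> c4 * (1 + t) powr (- (\<alpha> + 1 + \<eta>))"
        by (simp only: F_def)
      have hd: "0 \<le> L2_norm (heat_defect k t (f \<tau>))" by simp
      show ?thesis using L 1 2 bpos hd unfolding be by linarith
    qed
    then show "(\<lambda>\<xi>. of_real (norm \<xi> powr k) * (fourier (duhamel_integrand t \<tau>) \<xi> - of_real (mass \<tau>) * of_real (fourier_const TYPE('a) * exp (- t * (norm \<xi>)\<^sup>2)))) \<in> L2 \<and>
      L2_norm (\<lambda>\<xi>. of_real (norm \<xi> powr k) * (fourier (duhamel_integrand t \<tau>) \<xi> - of_real (mass \<tau>) * of_real (fourier_const TYPE('a) * exp (- t * (norm \<xi>)\<^sup>2))))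
       \<le> duhamel_bound c1 c2 c3 c4 k t \<tau>" by (simp only: X_def)
  qed
qed

text \<open>Every summand except the defect is integrated explicitly. After multiplication by the
  rate, the powers of 1 + t leave the exponents - min \<eta> (1/2) and - \<eta>; the lower limit of
  integration contributes a term of favourable sign that is dropped.\<close>

lemma duhamel_bound_integral:
  assumes k: "0 \<le> k" "k \<le> k\<^sub>0" and t: "t \<ge> 1" and c: "c1 \<ge> 0" "c3 \<ge> 0" and c2: "c2 \<ge> 0"
  obtains B where "(duhamel_bound c1 c2 c3 c4 k t has_integral B) {0..t}"
    "t powr (n / 4 + k / 2) * B \<le> c1 / (1 - min \<eta> (1/2)) * (1 + t) powr (- min \<eta> (1/2))
      + c2 * ((1 + t) powr (n / 4 + k / 2) * (t * exp (- t / 8)))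
      + t powr (n / 4 + k / 2) * integral {0..t} (\<lambda>\<tau>. L2_norm (heat_defect k t (f \<tau>)))
      + c3 / (1 - (k - deriv_order k) / 2) * (1 + t) powr (- \<eta>)
      + \<bar>c4\<bar> * (1 + t) powr (- \<eta>)"
proof -
  define \<alpha> where "\<alpha> = n / 4 + k / 2"
  have \<alpha>: "\<alpha> \<ge> 0" using n_bounds k by (simp add: \<alpha>_def)
  define \<beta> where "\<beta> = 1 + \<eta> + n / 4 + deriv_order k / 2"
  define e where "e = min \<eta> (1/2)"
  have e: "0 < e" "e \<le> 1/2" using eta_pos by (auto simp: e_def)
  define a where "a = (k - deriv_order k) / 2"
  have a: "0 \<le> a" "a < 1" using deriv_order[of k] k by (auto simp: a_def)
  define T where "T = 1 + t"
  have T: "T > 0" "t \<le> T" "T \<ge> 1" using t by (auto simp: T_def)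
  define H where "H = integral {0..t} (\<lambda>\<tau>. L2_norm (heat_defect k t (f \<tau>)))"
  have Hi: "((\<lambda>\<tau>. L2_norm (heat_defect k t (f \<tau>))) has_integral H) {0..t}"
    unfolding H_def using t k heat_defect_integral_tendsto(1)[OF k(1), of t]
    by (intro integrable_integral integrable_continuous_interval) (auto intro: continuous_on_subset)
  define B1 where "B1 = c1 * T powr (- (\<alpha> + 1)) * ((T powr (- e + 1) - 1) / (- e + 1))"
  define B3 where "B3 = c3 * T powr (- \<beta>) * ((T powr (- a + 1) - 1) / (- a + 1))"
  define B where "B = B1 + c2 * exp (- t / 8) * t + H + B3 + c4 * T powr (- (\<alpha> + 1 + \<eta>)) * t"
  have const: "((\<lambda>\<tau>. x) has_integral x * t) {0..t}" for x :: real
    using has_integral_const_real[of x 0 t] t by (simp add: mult.commute)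
  have i1: "((\<lambda>\<tau>. c1 * T powr (- (\<alpha> + 1)) * (1 + \<tau>) powr (- e)) has_integral B1) {0..t}"
    unfolding B1_def T_def using e t by (intro has_integral_mult_right has_integral_powr_shift) auto
  have i3: "((\<lambda>\<tau>. c3 * T powr (- \<beta>) * (1 + t - \<tau>) powr (- a)) has_integral B3) {0..t}"
    unfolding B3_def T_def using a t by (intro has_integral_mult_right has_integral_powr_shift) auto
  have int: "(duhamel_bound c1 c2 c3 c4 k t has_integral B) {0..t}"
  proof -
    have "duhamel_bound c1 c2 c3 c4 k t = (\<lambda>\<tau>. c1 * T powr (- (\<alpha> + 1)) * (1 + \<tau>) powr (- e) + c2 * exp (- t / 8)
      + L2_norm (heat_defect k t (f \<tau>)) + c3 * T powr (- \<beta>) * (1 + t - \<tau>) powr (- a) + c4 * T powr (- (\<alpha> + 1 + \<eta>)))"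
      by (simp add: duhamel_bound_def[abs_def] \<alpha>_def \<beta>_def e_def a_def T_def)
    then show ?thesis unfolding B_def by (simp only:) (intro has_integral_add i1 i3 Hi const)
  qed
  have ta: "t powr \<alpha> \<le> T powr \<alpha>" using T t \<alpha> by (intro powr_mono2) auto
  have 1: "t powr \<alpha> * B1 \<le> c1 / (1 - e) * T powr (- e)"
  proof -
    have "(T powr (- e + 1) - 1) / (- e + 1) \<le> T powr (- e + 1) / (1 - e)"
      using e by (simp add: divide_right_mono)
    then have "B1 \<le> c1 * T powr (- (\<alpha> + 1)) * (T powr (- e + 1) / (1 - e))"
      unfolding B1_def using c by (intro mult_left_mono) auto
    moreover have "0 \<le> c1 * T powr (- (\<alpha> + 1)) * (T powr (- e + 1) / (1 - e))" using c e by auto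
    ultimately have "t powr \<alpha> * B1 \<le> T powr \<alpha> * (c1 * T powr (- (\<alpha> + 1)) * (T powr (- e + 1) / (1 - e)))"
      using ta by (meson mult_left_mono mult_right_mono order_trans powr_ge_zero)
    also have "\<dots> = c1 / (1 - e) * (T powr \<alpha> * (T powr (- (\<alpha> + 1)) * T powr (- e + 1)))" by simp
    also have "T powr \<alpha> * (T powr (- (\<alpha> + 1)) * T powr (- e + 1)) = T powr (- e)" by (simp only: powr_add[symmetric]) simp
    finally show ?thesis .
  qed
  have 3: "t powr \<alpha> * B3 \<le> c3 / (1 - a) * T powr (- \<eta>)"
  proof -
    have "(T powr (- a + 1) - 1) / (- a + 1) \<le> T powr (- a + 1) / (1 - a)"
      using a by (simp add: divide_right_mono)
    then have "B3 \<le> c3 * T powr (- \<beta>) * (T powr (- a + 1) / (1 - a))"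
      unfolding B3_def using c by (intro mult_left_mono) auto
    moreover have "0 \<le> c3 * T powr (- \<beta>) * (T powr (- a + 1) / (1 - a))" using c a by auto
    ultimately have "t powr \<alpha> * B3 \<le> T powr \<alpha> * (c3 * T powr (- \<beta>) * (T powr (- a + 1) / (1 - a)))"
      using ta by (meson mult_left_mono mult_right_mono order_trans powr_ge_zero)
    also have "\<dots> = c3 / (1 - a) * (T powr \<alpha> * (T powr (- \<beta>) * T powr (- a + 1)))" by simp
    also have "T powr \<alpha> * (T powr (- \<beta>) * T powr (- a + 1)) = T powr (\<alpha> + (- \<beta> + (- a + 1)))" by (simp only: powr_add)
    \<comment> \<open>The derivative order cancels: what the kernel loses by passing a derivative
      on, the nonlinearity gains in decay.\<close>
    also have "\<alpha> + (- \<beta> + (- a + 1)) = - \<eta>" by (simp add: \<alpha>_def \<beta>_def a_def field_simps)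
    finally show ?thesis .
  qed
  have 2: "t powr \<alpha> * (c2 * exp (- t / 8) * t) \<le> c2 * (T powr \<alpha> * (t * exp (- t / 8)))" if "c2 \<ge> 0"
  proof -
    have "t powr \<alpha> * (c2 * exp (- t / 8) * t) \<le> T powr \<alpha> * (c2 * exp (- t / 8) * t)"
      using ta that t by (intro mult_right_mono) auto
    then show ?thesis by (simp only: mult_ac)
  qed
  have 4: "t powr \<alpha> * (c4 * T powr (- (\<alpha> + 1 + \<eta>)) * t) \<le> \<bar>c4\<bar> * T powr (- \<eta>)"
  proof -
    have "t powr \<alpha> * (c4 * T powr (- (\<alpha> + 1 + \<eta>)) * t) \<le> t powr \<alpha> * (\<bar>c4\<bar> * T powr (- (\<alpha> + 1 + \<eta>)) * t)"
      using t by (intro mult_left_mono mult_right_mono) auto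
    also have "\<dots> \<le> T powr \<alpha> * (\<bar>c4\<bar> * T powr (- (\<alpha> + 1 + \<eta>)) * T)"
      using ta t T by (intro mult_mono) auto
    also have "\<dots> = \<bar>c4\<bar> * (T powr \<alpha> * (T powr (- (\<alpha> + 1 + \<eta>)) * T powr 1))" using T by simp
    also have "T powr \<alpha> * (T powr (- (\<alpha> + 1 + \<eta>)) * T powr 1) = T powr (- \<eta>)" by (simp only: powr_add[symmetric]) simp
    finally show ?thesis .
  qed
  show thesis
    proof (rule that[OF int])
      have "t powr \<alpha> * B = t powr \<alpha> * B1 + t powr \<alpha> * (c2 * exp (- t / 8) * t) + t powr \<alpha> * H + t powr \<alpha> * B3 + t powr \<alpha> * (c4 * T powr (- (\<alpha> + 1 + \<eta>)) * t)"
        unfolding B_def by (simp only: distrib_left)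
      with 1 2[OF c2] 3 4 show "t powr (n / 4 + k / 2) * B \<le> c1 / (1 - min \<eta> (1/2)) * (1 + t) powr (- min \<eta> (1/2))
      + c2 * ((1 + t) powr (n / 4 + k / 2) * (t * exp (- t / 8)))
      + t powr (n / 4 + k / 2) * integral {0..t} (\<lambda>\<tau>. L2_norm (heat_defect k t (f \<tau>)))
      + c3 / (1 - (k - deriv_order k) / 2) * (1 + t) powr (- \<eta>)
      + \<bar>c4\<bar> * (1 + t) powr (- \<eta>)"
        unfolding \<alpha>_def[symmetric] e_def[symmetric] a_def[symmetric] T_def[symmetric] H_def[symmetric] by linarith
    qed
qed

text \<open>\<open>L2_integral_weighted_bound\<close> with the scalar function \<open>mass\<close>
  and a profile independent of \<tau> turns the comparison of integrands into one of integrals. What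
  remains are negative powers of time, an exponential and the vanishing defect integral.\<close>

lemma duhamel_tendsto:
  assumes k: "0 \<le> k" "k \<le> k\<^sub>0"
    and I: "\<And>t. t \<ge> 0 \<Longrightarrow> has_L2_integral (duhamel_integrand t) (I t) 0 t"
  defines "Y \<equiv> \<lambda>t \<xi>. of_real (norm \<xi> powr k) * (fourier (I t) \<xi> - of_real (integral {0..t} mass) * of_real (fourier_const TYPE('a) * exp (- t * (norm \<xi>)\<^sup>2)))"
  shows "t \<ge> 1 \<Longrightarrow> Y t \<in> L2"
    "((\<lambda>t. t powr (n / 4 + k / 2) * L2_norm (Y t)) \<longlongrightarrow> 0) at_top"
proof -
  obtain c1 c2 c3 c4 where c: "c1 \<ge> 0" "c2 \<ge> 0" "c3 \<ge> 0" "c4 \<ge> 0" and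
    bound: "\<And>t \<tau>. t \<ge> 1 \<Longrightarrow> \<tau> \<in> {0..t} \<Longrightarrow>
      (\<lambda>\<xi>. of_real (norm \<xi> powr k) * (fourier (duhamel_integrand t \<tau>) \<xi> - of_real (mass \<tau>) * of_real (fourier_const TYPE('a) * exp (- t * (norm \<xi>)\<^sup>2)))) \<in> L2 \<and>
      L2_norm (\<lambda>\<xi>. of_real (norm \<xi> powr k) * (fourier (duhamel_integrand t \<tau>) \<xi> - of_real (mass \<tau>) * of_real (fourier_const TYPE('a) * exp (- t * (norm \<xi>)\<^sup>2))))
       \<le> duhamel_bound c1 c2 c3 c4 k t \<tau>"
    by (rule duhamel_integrand_bound[OF k]) blast
  define R where "R t = c1 / (1 - min \<eta> (1/2)) * (1 + t) powr (- min \<eta> (1/2))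
      + c2 * ((1 + t) powr (n / 4 + k / 2) * (t * exp (- t / 8)))
      + t powr (n / 4 + k / 2) * integral {0..t} (\<lambda>\<tau>. L2_norm (heat_defect k t (f \<tau>)))
      + c3 / (1 - (k - deriv_order k) / 2) * (1 + t) powr (- \<eta>)
      + \<bar>c4\<bar> * (1 + t) powr (- \<eta>)" for t
  have main: "Y t \<in> L2 \<and> t powr (n / 4 + k / 2) * L2_norm (Y t) \<le> R t" if t: "t \<ge> 1" for t
  proof -
    obtain B where B: "(duhamel_bound c1 c2 c3 c4 k t has_integral B) {0..t}" "t powr (n / 4 + k / 2) * B \<le> R t"
      unfolding R_def by (rule duhamel_bound_integral[OF k t c(1) c(3) c(2), of c4]) blast
    have "(\<lambda>\<xi>::'a. norm \<xi> powr k * exp (- t * (norm \<xi>)\<^sup>2)) \<in> L2"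
      using gauss_weight[OF k(1), where 'a='a] t by auto
    from L2_mult(1)[OF L2_of_real(1)[OF this], of "of_real (fourier_const TYPE('a))"]
    have E: "(\<lambda>\<xi>::'a. of_real (norm \<xi> powr k) * complex_of_real (fourier_const TYPE('a) * exp (- t * (norm \<xi>)\<^sup>2))) \<in> L2"
      by (simp add: mult_ac)
    have t0: "t \<ge> 0" using t by simp
    have wm: "(\<lambda>\<xi>::'a. norm \<xi> powr k) \<in> borel_measurable borel" by measurable
    have Em: "(\<lambda>\<xi>::'a. complex_of_real (fourier_const TYPE('a) * exp (- t * (norm \<xi>)\<^sup>2))) \<in> borel_measurable borel" by measurable
    note L = L2_integral_weighted_bound[OF I[OF t0] t0 wm powr_ge_zero Em E mass_has_integral[OF t0] B(1) bound[OF t]]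
    have "Y t \<in> L2" "L2_norm (Y t) \<le> B" unfolding Y_def using L by auto
    then show ?thesis using B(2) mult_left_mono[of "L2_norm (Y t)" B "t powr (n / 4 + k / 2)"] by auto
  qed
  show "t \<ge> 1 \<Longrightarrow> Y t \<in> L2" using main by blast
  have T: "filterlim (\<lambda>t::real. 1 + t) at_top at_top" by real_asymp
  have p: "((\<lambda>t. (1 + t) powr (- b)) \<longlongrightarrow> 0) at_top" if "b > 0" for b :: real
    using that by (intro tendsto_neg_powr T) auto
  have ex: "((\<lambda>t. (1 + t) powr (n / 4 + k / 2) * (t * exp (- t / 8))) \<longlongrightarrow> 0) at_top"
    by real_asymp
  have "(R \<longlongrightarrow> c1 / (1 - min \<eta> (1/2)) * 0 + c2 * 0 + 0 + c3 / (1 - (k - deriv_order k) / 2) * 0 + \<bar>c4\<bar> * 0) at_top"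
    unfolding R_def using eta_pos by (intro tendsto_intros p ex heat_defect_integral_tendsto(2) k) auto
  then have R0: "(R \<longlongrightarrow> 0) at_top" by simp
  show "((\<lambda>t. t powr (n / 4 + k / 2) * L2_norm (Y t)) \<longlongrightarrow> 0) at_top"
  proof (rule tendsto_sandwich[OF _ _ tendsto_const R0])
    show "\<forall>\<^sub>F t in at_top. t powr (n / 4 + k / 2) * L2_norm (Y t) \<le> R t"
      using eventually_ge_at_top[of 1] by eventually_elim (use main in blast)
  qed simp
qed

end

section \<open>The asymptotic profile\<close>

lemma gauss_kernel_fourier:
  assumes t: "t > 0"
  shows "(gauss_kernel t :: 'a::euclidean_space \<Rightarrow> real) \<in> L2"
    "AE \<xi> in lborel. fourier_real (gauss_kernel t) (\<xi>::'a) = of_real (fourier_const TYPE('a) * exp (- t * (norm \<xi>)\<^sup>2))"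
proof -
  define c where "c = (4 * pi * t) powr (- (real DIM('a) / 2))"
  have t4: "1 / (4 * t) > 0" using t by simp
  have gk: "gauss_kernel t x = c * exp (- (1 / (4 * t)) * (norm x)\<^sup>2)" for x :: 'a
    by (simp add: gauss_kernel_def c_def)
  have b: "gauss_kernel t x \<le> c" for x :: 'a using gauss_kernel_le[OF t] by (simp add: c_def)
  have "integrable lborel (\<lambda>x::'a. (gauss_kernel t x)\<^sup>2)"
  proof (rule Bochner_Integration.integrable_bound)
    show "integrable lborel (\<lambda>x::'a. c * gauss_kernel t x)" by (intro integrable_mult_right gauss_kernel_integral t)
    show "AE x::'a in lborel. norm ((gauss_kernel t x)\<^sup>2) \<le> norm (c * gauss_kernel t x)"
    proof (intro AE_I2)
      fix x :: 'a
      have "gauss_kernel t x * gauss_kernel t x \<le> c * gauss_kernel t x"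
        by (intro mult_right_mono b gauss_kernel_nonneg)
      then show "norm ((gauss_kernel t x)\<^sup>2) \<le> norm (c * gauss_kernel t x)"
        by (simp add: power2_eq_square gauss_kernel_nonneg abs_mult c_def)
    qed
  qed measurable
  then show L: "(gauss_kernel t :: 'a \<Rightarrow> real) \<in> L2" by (simp add: L2_def)
  have i: "integrable lborel (\<lambda>x::'a. complex_of_real (gauss_kernel t x))"
    by (intro integrable_of_real gauss_kernel_integral t)
  have F: "fourier_integral (\<lambda>x. complex_of_real (gauss_kernel t x)) \<xi> = of_real (fourier_const TYPE('a) * exp (- t * (norm \<xi>)\<^sup>2))" for \<xi> :: 'a
  proof -
    have "(\<integral>x. exp (- (\<i> * of_real (x \<bullet> \<xi>))) * complex_of_real (gauss_kernel t x) \<partial>lborel)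
       = of_real c * (\<integral>x. exp (- (\<i> * of_real (x \<bullet> \<xi>))) * of_real (exp (- (1 / (4 * t)) * (norm x)\<^sup>2)) \<partial>lborel)"
      unfolding integral_mult_right_zero[symmetric] gk by (intro Bochner_Integration.integral_cong) (auto simp del: of_real_exp)
    also have "\<dots> = of_real (c * ((pi / (1 / (4 * t))) powr (real DIM('a) / 2) * exp (- (norm \<xi>)\<^sup>2 / (4 * (1 / (4 * t))))))"
      unfolding gaussian_fourier(2)[OF t4] by simp
    also have "c * ((pi / (1 / (4 * t))) powr (real DIM('a) / 2) * exp (- (norm \<xi>)\<^sup>2 / (4 * (1 / (4 * t))))) = exp (- t * (norm \<xi>)\<^sup>2)"
      using t by (simp add: c_def powr_minus mult_ac)
    finally show ?thesis unfolding fourier_integral_altdef by simp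
  qed
  show "AE \<xi> in lborel. fourier_real (gauss_kernel t) (\<xi>::'a) = of_real (fourier_const TYPE('a) * exp (- t * (norm \<xi>)\<^sup>2))"
    using fourier_eq_integral[OF L2_of_real(1)[OF L] i] by (simp only: F)
qed

locale mild_flow = decaying_flow p k\<^sub>0 C u for p k\<^sub>0 C :: real and u :: "real \<Rightarrow> 'a::euclidean_space \<Rightarrow> real" +
  fixes u\<^sub>0 u\<^sub>1 :: "'a \<Rightarrow> real"
  assumes u0: "u\<^sub>0 \<in> L2" "integrable lborel u\<^sub>0" "(\<lambda>\<xi>. of_real (norm \<xi> powr k\<^sub>0) * fourier_real u\<^sub>0 \<xi>) \<in> L2"
    and u1: "u\<^sub>1 \<in> L2" "integrable lborel u\<^sub>1"
    and mild: "mild_solution p u\<^sub>0 u\<^sub>1 u"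
begin

text \<open>The Duhamel terms exist for each time separately; choice collects them into one function
  of t, and the transform turns the mild formulation into an identity of symbols.\<close>

lemma duhamel_formula:
  obtains I where "\<And>t. t \<ge> 0 \<Longrightarrow> has_L2_integral (duhamel_integrand t) (I t) 0 t"
    "\<And>t. t \<ge> 0 \<Longrightarrow> AE \<xi> in lborel. fourier_real (u t) \<xi> =
       of_real (kern t ((norm \<xi>)\<^sup>2) + exp (- t)) * fourier_real u\<^sub>0 \<xi> + of_real (kern t ((norm \<xi>)\<^sup>2)) * fourier_real u\<^sub>1 \<xi> + fourier (I t) \<xi>"
proof -
  have "\<exists>I. has_L2_integral (duhamel_integrand t) I 0 t \<and> (AE \<xi> in lborel. fourier_real (u t) \<xi> =
       of_real (kern t ((norm \<xi>)\<^sup>2) + exp (- t)) * fourier_real u\<^sub>0 \<xi> + of_real (kern t ((norm \<xi>)\<^sup>2)) * fourier_real u\<^sub>1 \<xi> + fourier I \<xi>)"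
    if t: "t \<ge> 0" for t
  proof -
    from mild[unfolded mild_solution_def, rule_format, OF t] obtain I where
      I: "has_L2_integral (duhamel_integrand t) I 0 t" and
      eq: "AE x in lborel. of_real (u t x) = fourier_multiplier (symbol0 t) u\<^sub>0 x + fourier_multiplier (symbol1 t) u\<^sub>1 x + I x"
      unfolding duhamel_integrand_def[abs_def] f_def[abs_def] by blast
    have IL: "I \<in> L2" using I by (simp add: has_L2_integral_def)
    note K0 = fourier_kern_multiplier(3,4)[OF u0(1) t]
    note K1 = fourier_kern_multiplier(1,2)[OF u1(1) t]
    note S = L2_add(1)[OF K0(1) K1(1)]
    have "AE \<xi> in lborel. fourier_real (u t) \<xi> = fourier (\<lambda>x. fourier_multiplier (symbol0 t) u\<^sub>0 x + fourier_multiplier (symbol1 t) u\<^sub>1 x + I x) \<xi>"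
      by (rule fourier_cong_AE[OF L2_of_real(1)[OF u_L2[OF t]] L2_add(1)[OF S IL] eq])
    with fourier_add[OF S IL] fourier_add[OF K0(1) K1(1)] K0(2) K1(2)
    have "AE \<xi> in lborel. fourier_real (u t) \<xi> =
       of_real (kern t ((norm \<xi>)\<^sup>2) + exp (- t)) * fourier_real u\<^sub>0 \<xi> + of_real (kern t ((norm \<xi>)\<^sup>2)) * fourier_real u\<^sub>1 \<xi> + fourier I \<xi>"
      by eventually_elim simp
    with I show ?thesis by blast
  qed
  then have "\<forall>t. \<exists>I. t \<ge> 0 \<longrightarrow> has_L2_integral (duhamel_integrand t) I 0 t \<and> (AE \<xi> in lborel. fourier_real (u t) \<xi> =
       of_real (kern t ((norm \<xi>)\<^sup>2) + exp (- t)) * fourier_real u\<^sub>0 \<xi> + of_real (kern t ((norm \<xi>)\<^sup>2)) * fourier_real u\<^sub>1 \<xi> + fourier I \<xi>)" by blast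
  from choice[OF this] show thesis using that by blast
qed

lemma u0_weight: "0 \<le> k \<Longrightarrow> k \<le> k\<^sub>0 \<Longrightarrow> (\<lambda>\<xi>. of_real (norm \<xi> powr k) * fourier_real u\<^sub>0 \<xi>) \<in> L2"
  by (rule weight_interpolate_L2[OF fourier_real_L2(1)[OF u0(1)] u0(3)])

text \<open>The comparison of integrals with zero profile. As t is fixed, a crude bound uniform in
  \<tau> suffices; it feeds the regularity argument for \<open>u\<^sub>1\<close>.\<close>

lemma duhamel_weight_L2:
  assumes k: "0 \<le> k" "k \<le> k\<^sub>0" and t: "t \<ge> 0" and I: "has_L2_integral (duhamel_integrand t) I 0 t"
  shows "(\<lambda>\<xi>. of_real (norm \<xi> powr k) * fourier I \<xi>) \<in> L2"
proof -
  obtain D where D: "D \<ge> 0" "\<And>t. t \<ge> 0 \<Longrightarrow> (\<lambda>\<xi>. of_real (norm \<xi> powr deriv_order k) * fourier_real (f t) \<xi>) \<in> L2"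
    "\<And>t. t \<ge> 0 \<Longrightarrow> L2_norm (\<lambda>\<xi>. of_real (norm \<xi> powr deriv_order k) * fourier_real (f t) \<xi>) \<le> D * (1 + t) powr (- (1 + \<eta> + n / 4 + deriv_order k / 2))"
    by (rule f_weight[OF k]) blast
  have wm: "(\<lambda>\<xi>::'a. norm \<xi> powr k) \<in> borel_measurable borel" by measurable
  have zm: "(\<lambda>\<xi>::'a. 0 :: complex) \<in> borel_measurable borel" by measurable
  have zL: "(\<lambda>\<xi>::'a. of_real (norm \<xi> powr k) * (0::complex)) \<in> L2" by simp
  have c0: "((\<lambda>\<tau>. 0::real) has_integral 0) {0..t}" by simp
  have b0: "((\<lambda>\<tau>. 60 * D) has_integral (t - 0) *\<^sub>R (60 * D)) {0..t}" using has_integral_const_real[of "60 * D" 0 t] t by simp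
  have le: "(\<lambda>\<xi>. of_real (norm \<xi> powr k) * (fourier (duhamel_integrand t \<tau>) \<xi> - of_real 0 * 0)) \<in> L2 \<and>
     L2_norm (\<lambda>\<xi>. of_real (norm \<xi> powr k) * (fourier (duhamel_integrand t \<tau>) \<xi> - of_real 0 * 0)) \<le> 60 * D" if "\<tau> \<in> {0..t}" for \<tau>
  proof -
    from that have \<tau>: "\<tau> \<ge> 0" "t - \<tau> \<ge> 0" by auto
    have jk: "k - deriv_order k \<le> 2" using deriv_order(3)[OF k(2)] by simp
    note K = fourier_kern_multiplier(1,2)[OF f_in_L2[OF \<tau>(1)] \<tau>(2)]
    note W = kern_weight_L2(3,4)[OF f_in_L2[OF \<tau>(1)] D(2)[OF \<tau>(1)] deriv_order(1) deriv_order(2)[OF k(1)] jk \<tau>(2)]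
    note [measurable] = L2_measurable[OF fourier_L2[OF K(1)]]
    have m: "(\<lambda>\<xi>. of_real (norm \<xi> powr k) * (fourier (duhamel_integrand t \<tau>) \<xi> - of_real 0 * 0)) \<in> borel_measurable borel"
      unfolding duhamel_integrand_def by measurable
    have eq: "AE \<xi> in lborel. of_real (norm \<xi> powr k) * (fourier (duhamel_integrand t \<tau>) \<xi> - of_real 0 * 0) = of_real (norm \<xi> powr k * kern (t - \<tau>) ((norm \<xi>)\<^sup>2)) * fourier_real (f \<tau>) \<xi> + 0"
      using K(2) by eventually_elim (simp add: duhamel_integrand_def)
    note S = L2_norm_AE_sum[OF m W(1) L2_zero(1) eq]
    have "(1 + (t - \<tau>)) powr (- ((k - deriv_order k) / 2)) \<le> (1 + (t - \<tau>)) powr 0"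
      using \<tau> deriv_order(2)[OF k(1)] by (intro powr_mono) auto
    then have 1: "(1 + (t - \<tau>)) powr (- ((k - deriv_order k) / 2)) \<le> 1" using \<tau> by simp
    have "(1 + \<tau>) powr (- (1 + \<eta> + n / 4 + deriv_order k / 2)) \<le> (1 + \<tau>) powr 0"
      using \<tau> eta_pos n_bounds deriv_order(1)[of k] by (intro powr_mono) auto
    then have "D * (1 + \<tau>) powr (- (1 + \<eta> + n / 4 + deriv_order k / 2)) \<le> D * 1" using \<tau> D(1) by (intro mult_left_mono) auto
    then have 2: "L2_norm (\<lambda>\<xi>. of_real (norm \<xi> powr deriv_order k) * fourier_real (f \<tau>) \<xi>) \<le> D" using D(3)[OF \<tau>(1)] by linarith
    have "60 * (1 + (t - \<tau>)) powr (- ((k - deriv_order k) / 2)) * L2_norm (\<lambda>\<xi>. of_real (norm \<xi> powr deriv_order k) * fourier_real (f \<tau>) \<xi>) \<le> 60 * 1 * D"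
      using 1 2 by (intro mult_mono mult_left_mono) auto
    then show ?thesis using S W(2) by simp
  qed
  from L2_integral_weighted_bound(1)[OF I t wm powr_ge_zero zm zL c0 b0 le] show ?thesis by simp
qed

text \<open>For \<open>k > 2\<close> the hypothesis on \<open>u\<^sub>1\<close> alone does not make this function square integrable.
  It is recovered from the Sobolev regularity of the solution at time \<open>1\<close>, since \<open>kern 1 r\<close> is comparable to \<open>1 / (1 + r)\<close>.\<close>

lemma u1_weight:
  assumes k: "0 \<le> k" "k \<le> k\<^sub>0"
  shows "(\<lambda>\<xi>. of_real (norm \<xi> powr k / (1 + (norm \<xi>)\<^sup>2)) * fourier_real u\<^sub>1 \<xi>) \<in> L2"
proof -
  obtain I where I: "\<And>t. t \<ge> 0 \<Longrightarrow> has_L2_integral (duhamel_integrand t) (I t) 0 t"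
    "\<And>t. t \<ge> 0 \<Longrightarrow> AE \<xi> in lborel. fourier_real (u t) \<xi> =
       of_real (kern t ((norm \<xi>)\<^sup>2) + exp (- t)) * fourier_real u\<^sub>0 \<xi> + of_real (kern t ((norm \<xi>)\<^sup>2)) * fourier_real u\<^sub>1 \<xi> + fourier (I t) \<xi>"
    by (rule duhamel_formula) blast
  have IL: "I 1 \<in> L2" using I(1)[of 1] by (simp add: has_L2_integral_def)
  note [measurable] = L2_measurable[OF fourier_real_L2(1)[OF u1(1)]] L2_measurable[OF fourier_real_L2(1)[OF u0(1)]]
    L2_measurable[OF fourier_real_L2(1)[OF u_L2, of 1, simplified]] L2_measurable[OF fourier_L2[OF IL]]
  define A where "A \<xi> = of_real (norm \<xi> powr k) * fourier_real (u 1) \<xi>" for \<xi>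
  define B where "B \<xi> = of_real (norm \<xi> powr k) * fourier_real u\<^sub>0 \<xi>" for \<xi>
  define E where "E \<xi> = of_real (norm \<xi> powr k) * fourier (I 1) \<xi>" for \<xi>
  have A: "A \<in> L2" unfolding A_def[abs_def] using u_decay[of 1 k] k by simp
  have B: "B \<in> L2" unfolding B_def[abs_def] by (rule u0_weight[OF k])
  have E: "E \<in> L2" unfolding E_def[abs_def] by (rule duhamel_weight_L2[OF k _ I(1)]) auto
  have kb: "0 \<le> kern 1 ((norm \<xi>)\<^sup>2)" "kern 1 ((norm \<xi>)\<^sup>2) \<le> 12" for \<xi> :: 'a
    using kern_nonneg[of 1] kern_le_12[of 1] by auto
  have B': "(\<lambda>\<xi>. of_real (kern 1 ((norm \<xi>)\<^sup>2) + exp (- 1)) * B \<xi>) \<in> L2"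
  proof (rule L2_dominated(1)[OF _ B, of _ 13])
    show "(\<lambda>\<xi>. of_real (kern 1 ((norm \<xi>)\<^sup>2) + exp (- 1)) * B \<xi>) \<in> borel_measurable borel"
      unfolding B_def by measurable
    show "AE \<xi> in lborel. norm (of_real (kern 1 ((norm \<xi>)\<^sup>2) + exp (- 1)) * B \<xi>) \<le> 13 * norm (B \<xi>)"
      unfolding norm_mult norm_of_real
    proof (intro AE_I2 mult_right_mono)
      fix \<xi> :: 'a
      have "exp (- 1) \<le> (1::real)" "exp (- 1) > (0::real)" by auto
      then show "\<bar>kern 1 ((norm \<xi>)\<^sup>2) + exp (- 1)\<bar> \<le> 13" using kb[of \<xi>] by linarith
    qed auto
  qed simp
  \<comment> \<open>In the Fourier formula at time 1 every other term has the required weighted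
    regularity, so the kernel times the transform of \<open>u\<^sub>1\<close> has it too.\<close>
  define Z where "Z \<xi> = A \<xi> - of_real (kern 1 ((norm \<xi>)\<^sup>2) + exp (- 1)) * B \<xi> - E \<xi>" for \<xi>
  have Z: "Z \<in> L2" unfolding Z_def[abs_def] by (intro L2_diff A B' E)
  have m: "(\<lambda>\<xi>. of_real (norm \<xi> powr k / (1 + (norm \<xi>)\<^sup>2)) * fourier_real u\<^sub>1 \<xi>) \<in> borel_measurable borel" by measurable
  show ?thesis
  \<comment> \<open>The constant inverts the factor exp (- 1) in
    \<open>kern_1_lower\<close>.\<close>
  proof (rule L2_dominated(1)[OF m Z, of "exp 1"])
    show "AE \<xi> in lborel. norm (of_real (norm \<xi> powr k / (1 + (norm \<xi>)\<^sup>2)) * fourier_real u\<^sub>1 \<xi>) \<le> exp 1 * norm (Z \<xi>)"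
      using I(2)[of 1, simplified]
    proof eventually_elim
      case (elim \<xi>)
      have "Z \<xi> = of_real (norm \<xi> powr k * kern 1 ((norm \<xi>)\<^sup>2)) * fourier_real u\<^sub>1 \<xi>"
        unfolding Z_def A_def B_def E_def elim by (simp add: algebra_simps)
      then have nz: "norm (Z \<xi>) = norm \<xi> powr k * kern 1 ((norm \<xi>)\<^sup>2) * norm (fourier_real u\<^sub>1 \<xi>)"
        using kb[of \<xi>] by (simp add: norm_mult)
      have "exp (- 1) / (1 + (norm \<xi>)\<^sup>2) \<le> kern 1 ((norm \<xi>)\<^sup>2)" by (rule kern_1_lower) simp
      then have "exp 1 * (exp (- 1) / (1 + (norm \<xi>)\<^sup>2)) \<le> exp 1 * kern 1 ((norm \<xi>)\<^sup>2)" by (intro mult_left_mono) auto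
      then have "1 / (1 + (norm \<xi>)\<^sup>2) \<le> exp 1 * kern 1 ((norm \<xi>)\<^sup>2)" by (simp add: exp_minus)
      then have "norm \<xi> powr k * (1 / (1 + (norm \<xi>)\<^sup>2)) * norm (fourier_real u\<^sub>1 \<xi>) \<le> norm \<xi> powr k * (exp 1 * kern 1 ((norm \<xi>)\<^sup>2)) * norm (fourier_real u\<^sub>1 \<xi>)"
        by (intro mult_right_mono mult_left_mono) auto
      moreover have "norm (of_real (norm \<xi> powr k / (1 + (norm \<xi>)\<^sup>2)) * fourier_real u\<^sub>1 \<xi>) = norm \<xi> powr k * (1 / (1 + (norm \<xi>)\<^sup>2)) * norm (fourier_real u\<^sub>1 \<xi>)"
        unfolding norm_mult norm_of_real by simp
      ultimately show ?case unfolding nz by (simp only: mult_ac)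
    qed
  qed simp
qed

lemma asymptotics_fourier:
  assumes k: "0 \<le> k" "k \<le> k\<^sub>0"
  defines "M \<equiv> (\<integral>x. u\<^sub>0 x + u\<^sub>1 x \<partial>lborel) + (LINT \<tau>:{0..}|lborel. mass \<tau>)"
  defines "X \<equiv> \<lambda>t \<xi>. of_real (norm \<xi> powr k) * (fourier_real (u t) \<xi> - of_real M * of_real (fourier_const TYPE('a) * exp (- t * (norm \<xi>)\<^sup>2)))"
  shows "t \<ge> 1 \<Longrightarrow> X t \<in> L2"
    "((\<lambda>t. t powr (n / 4 + k / 2) * L2_norm (X t)) \<longlongrightarrow> 0) at_top"
proof -
  obtain I where I: "\<And>t. t \<ge> 0 \<Longrightarrow> has_L2_integral (duhamel_integrand t) (I t) 0 t"
    "\<And>t. t \<ge> 0 \<Longrightarrow> AE \<xi> in lborel. fourier_real (u t) \<xi> =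
       of_real (kern t ((norm \<xi>)\<^sup>2) + exp (- t)) * fourier_real u\<^sub>0 \<xi> + of_real (kern t ((norm \<xi>)\<^sup>2)) * fourier_real u\<^sub>1 \<xi> + fourier (I t) \<xi>"
    by (rule duhamel_formula) blast
  define Y where "Y t \<xi> = of_real (norm \<xi> powr k) * (fourier (I t) \<xi> - of_real (integral {0..t} mass) * of_real (fourier_const TYPE('a) * exp (- t * (norm \<xi>)\<^sup>2)))" for t and \<xi> :: 'a
  have Y: "\<And>t. t \<ge> 1 \<Longrightarrow> Y t \<in> L2" "((\<lambda>t. t powr (n / 4 + k / 2) * L2_norm (Y t)) \<longlongrightarrow> 0) at_top"
    using duhamel_tendsto[OF k I(1)] unfolding Y_def[abs_def] by blast+
  define \<alpha> where "\<alpha> = n / 4 + k / 2"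
  define F where "F = fourier_const TYPE('a)"
  have F: "F \<ge> 0" by (simp add: F_def)
  obtain G where G: "G > 0" "\<And>t. t > 0 \<Longrightarrow> (\<lambda>\<xi>::'a. norm \<xi> powr k * exp (- t * (norm \<xi>)\<^sup>2)) \<in> L2 \<and>
    L2_norm (\<lambda>\<xi>::'a. norm \<xi> powr k * exp (- t * (norm \<xi>)\<^sup>2)) \<le> G * t powr (- (n / 4) - k / 2)"
    using gauss_weight[OF k(1), where 'a='a] by (auto simp: n_def)
  obtain G2 where G2: "G2 > 0" "\<And>t. t > 0 \<Longrightarrow> (\<lambda>\<xi>::'a. norm \<xi> powr (k + 2) * exp (- t * (norm \<xi>)\<^sup>2)) \<in> L2 \<and>
    L2_norm (\<lambda>\<xi>::'a. norm \<xi> powr (k + 2) * exp (- t * (norm \<xi>)\<^sup>2)) \<le> G2 * t powr (- (n / 4) - (k + 2) / 2)"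
    using gauss_weight[of "k + 2", where 'a='a] k by (auto simp: n_def)
  \<comment> \<open>The two symbols differ only by exp (- t), so \<open>kern\<close> acts on the sum
    of the data, and what is left of \<open>u\<^sub>0\<close> is exponentially small.\<close>
  define g where "g x = u\<^sub>0 x + u\<^sub>1 x" for x
  have g: "g \<in> L2" "integrable lborel g" unfolding g_def[abs_def] using u0 u1 by (auto intro: L2_add)
  have gF: "AE \<xi> in lborel. fourier_real g \<xi> = fourier_real u\<^sub>0 \<xi> + fourier_real u\<^sub>1 \<xi>"
    using fourier_add[OF L2_of_real(1)[OF u0(1)] L2_of_real(1)[OF u1(1)]] by (simp add: g_def)
  note [measurable] = L2_measurable[OF fourier_real_L2(1)[OF g(1)]]
  define W where "W \<xi> = of_real (norm \<xi> powr k / (1 + (norm \<xi>)\<^sup>2)) * fourier_real g \<xi>" for \<xi>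
  have W: "W \<in> L2"
  proof -
    have m: "W \<in> borel_measurable borel"
      unfolding W_def[abs_def] by measurable
    have a: "(\<lambda>\<xi>. of_real (norm \<xi> powr k / (1 + (norm \<xi>)\<^sup>2)) * fourier_real u\<^sub>0 \<xi>) \<in> L2"
      by (rule kern_weight_L2(1)[OF u0(1) u0_weight[OF k] k(1)]) auto
    have ae: "AE \<xi> in lborel. W \<xi> = of_real (norm \<xi> powr k / (1 + (norm \<xi>)\<^sup>2)) * fourier_real u\<^sub>0 \<xi> +
      of_real (norm \<xi> powr k / (1 + (norm \<xi>)\<^sup>2)) * fourier_real u\<^sub>1 \<xi>"
      using gF by eventually_elim (simp only: W_def distrib_left)
    show ?thesis by (rule L2_norm_AE_sum(1)[OF m a u1_weight[OF k] ae])
  qed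
  \<comment> \<open>The Duhamel comparison yields the mass up to time t, whereas the profile carries
    the mass over all times; this is the missing tail with a negative sign.\<close>
  define \<Delta> where "\<Delta> t = integral {0..t} mass - (LINT \<tau>:{0..}|lborel. mass \<tau>)" for t
  define V0 where "V0 t \<xi> = of_real (exp (- t)) * (of_real (norm \<xi> powr k) * fourier_real u\<^sub>0 \<xi>)" for t \<xi>
  define V1 where "V1 t \<xi> = of_real (norm \<xi> powr k * (kern t ((norm \<xi>)\<^sup>2) - exp (- t * (norm \<xi>)\<^sup>2))) * fourier_real g \<xi>" for t \<xi>
  define V2 where "V2 t = heat_defect k t g" for t
  define V4 where "V4 t \<xi> = (of_real (\<Delta> t * F) * of_real (norm \<xi> powr k * exp (- t * (norm \<xi>)\<^sup>2)) :: complex)" for t and \<xi> :: 'a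
  define R where "R t = exp (- t) * L2_norm (\<lambda>\<xi>. of_real (norm \<xi> powr k) * fourier_real u\<^sub>0 \<xi>)
    + (2 * F * (\<integral>x. \<bar>g x\<bar> \<partial>lborel) * (G2 * t powr (- (\<alpha> + 1))) + 12 * exp (- t / 4) * L2_norm W)
    + L2_norm (V2 t) + L2_norm (Y t) + \<bar>\<Delta> t\<bar> * F * (G * t powr (- \<alpha>))" for t
  have main: "X t \<in> L2 \<and> L2_norm (X t) \<le> R t" if t: "t \<ge> 1" for t
  proof -
    have t0: "t > 0" using t by simp
    note Gt = conjunct1[OF G(2)[OF t0]] and G2t = conjunct1[OF G2(2)[OF t0]]
    have V0: "V0 t \<in> L2" "L2_norm (V0 t) = exp (- t) * L2_norm (\<lambda>\<xi>. of_real (norm \<xi> powr k) * fourier_real u\<^sub>0 \<xi>)"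
      unfolding V0_def[abs_def] using L2_mult[OF u0_weight[OF k], of "of_real (exp (- t))"] by (simp_all del: of_real_exp)
    have V1: "V1 t \<in> L2" "L2_norm (V1 t) \<le> 2 * F * (\<integral>x. \<bar>g x\<bar> \<partial>lborel) * (G2 * t powr (- (\<alpha> + 1))) + 12 * exp (- t / 4) * L2_norm W"
    proof -
      note A = kernel_approx[OF g t0 k(1) W[unfolded W_def[abs_def]] G2t, folded V1_def W_def F_def]
      show "V1 t \<in> L2" unfolding V1_def[abs_def] by (rule kernel_approx(1)[OF g t0 k(1) W[unfolded W_def[abs_def]] G2t])
      have e: "- (n / 4) - (k + 2) / 2 = - (\<alpha> + 1)" by (simp add: \<alpha>_def field_simps)
      have "2 * F * (\<integral>x. \<bar>g x\<bar> \<partial>lborel) * L2_norm (\<lambda>\<xi>::'a. norm \<xi> powr (k + 2) * exp (- t * (norm \<xi>)\<^sup>2)) \<le> 2 * F * (\<integral>x. \<bar>g x\<bar> \<partial>lborel) * (G2 * t powr (- (\<alpha> + 1)))"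
        using conjunct2[OF G2(2)[OF t0]] F unfolding e by (intro mult_left_mono) (auto simp: integral_nonneg)
      with kernel_approx(2)[OF g t0 k(1) W[unfolded W_def[abs_def]] G2t]
      show "L2_norm (V1 t) \<le> 2 * F * (\<integral>x. \<bar>g x\<bar> \<partial>lborel) * (G2 * t powr (- (\<alpha> + 1))) + 12 * exp (- t / 4) * L2_norm W"
        unfolding V1_def[abs_def] W_def[abs_def] F_def by linarith
    qed
    have V2: "V2 t \<in> L2" unfolding V2_def by (rule heat_defect_L2(1)[OF g(2) Gt])
    have V4: "V4 t \<in> L2" "L2_norm (V4 t) \<le> \<bar>\<Delta> t\<bar> * F * (G * t powr (- \<alpha>))"
    proof -
      have e: "- (n / 4) - k / 2 = - \<alpha>" by (simp add: \<alpha>_def)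
      note A = L2_mult[OF L2_of_real(1)[OF Gt], of "of_real (\<Delta> t * F)", unfolded L2_of_real(2) norm_of_real]
      show "V4 t \<in> L2" unfolding V4_def[abs_def] by (rule A(1))
      have "L2_norm (V4 t) = \<bar>\<Delta> t * F\<bar> * L2_norm (\<lambda>\<xi>::'a. norm \<xi> powr k * exp (- t * (norm \<xi>)\<^sup>2))"
        unfolding V4_def[abs_def] by (rule A(2))
      also have "\<dots> \<le> \<bar>\<Delta> t * F\<bar> * (G * t powr (- \<alpha>))"
        using conjunct2[OF G(2)[OF t0]] unfolding e by (intro mult_left_mono) auto
      finally show "L2_norm (V4 t) \<le> \<bar>\<Delta> t\<bar> * F * (G * t powr (- \<alpha>))" using F by (simp add: abs_mult)
    qed
    note [measurable] = L2_measurable[OF fourier_real_L2(1)[OF u_L2[of t]]]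
    have t0': "t \<ge> 0" using t by simp
    have m: "X t \<in> borel_measurable borel"
      using L2_measurable[OF fourier_real_L2(1)[OF u_L2[OF t0']]] unfolding X_def by measurable
    \<comment> \<open>In order: the exponential remainder of \<open>u\<^sub>0\<close>, kernel
      against heat flow, heat flow against its profile, Duhamel term against its profile, and the
      tail of the mass.\<close>
    have eq: "AE \<xi> in lborel. X t \<xi> = (V0 t \<xi> + (V1 t \<xi> + V2 t \<xi>)) + (Y t \<xi> + V4 t \<xi>)"
      using I(2)[OF t0'] gF heat_defect_fourier_real[OF g, of k t]
    proof eventually_elim
      case (elim \<xi>)
      have Mg: "M = (\<integral>x. g x \<partial>lborel) + (LINT \<tau>:{0..}|lborel. mass \<tau>)" by (simp add: M_def g_def)
      show ?case
        unfolding X_def V0_def V1_def V2_def V4_def Y_def \<Delta>_def elim Mg F_def of_real_mult of_real_add of_real_diff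
        by (simp only: algebra_simps)
    qed
    note S12 = L2_add(1)[OF V1(1) V2] L2_norm_triangle[OF V1(1) V2]
    note S012 = L2_add(1)[OF V0(1) S12(1)] L2_norm_triangle[OF V0(1) S12(1)]
    note SY4 = L2_add(1)[OF Y(1)[OF t] V4(1)] L2_norm_triangle[OF Y(1)[OF t] V4(1)]
    note S = L2_norm_AE_sum[OF m S012(1) SY4(1) eq]
    show ?thesis
      using S S12(2) S012(2) SY4(2) V0(2) V1(2) V4(2) unfolding R_def by linarith
  qed
  show "t \<ge> 1 \<Longrightarrow> X t \<in> L2" using main by blast
  have a1: "((\<lambda>t. t powr \<alpha> * exp (- t)) \<longlongrightarrow> 0) at_top" by real_asymp
  have a2: "((\<lambda>t. t powr \<alpha> * exp (- t / 4)) \<longlongrightarrow> 0) at_top" by real_asymp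
  have a3: "((\<lambda>t::real. t powr (- 1)) \<longlongrightarrow> 0) at_top" by (intro tendsto_neg_powr filterlim_ident) auto
  have a4: "((\<lambda>t. t powr \<alpha> * L2_norm (V2 t)) \<longlongrightarrow> 0) at_top"
    unfolding V2_def using heat_defect_tendsto[OF g(2) k(1)] by (simp add: \<alpha>_def n_def)
  have a5: "(\<Delta> \<longlongrightarrow> 0) at_top"
    unfolding \<Delta>_def[abs_def] using mass_integral_tendsto by (rule LIM_zero)
  define R' where "R' t = L2_norm (\<lambda>\<xi>. of_real (norm \<xi> powr k) * fourier_real u\<^sub>0 \<xi>) * (t powr \<alpha> * exp (- t))
    + 2 * F * (\<integral>x. \<bar>g x\<bar> \<partial>lborel) * G2 * t powr (- 1) + 12 * L2_norm W * (t powr \<alpha> * exp (- t / 4))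
    + t powr \<alpha> * L2_norm (V2 t) + t powr \<alpha> * L2_norm (Y t) + \<bar>\<Delta> t\<bar> * F * G" for t
  have R': "t powr \<alpha> * R t = R' t" if t: "t > 0" for t
  proof -
    \<comment> \<open>The kernel error has a full power of t to spare, while the tail of the mass
      meets the exact rate and vanishes only because \<Delta> does.\<close>
    have e1: "t powr \<alpha> * t powr (- (\<alpha> + 1)) = t powr (- 1)" by (subst powr_add[symmetric]) simp
    have e2: "t powr \<alpha> * t powr (- \<alpha>) = 1" using t by (subst powr_add[symmetric]) simp
    have "t powr \<alpha> * R t = L2_norm (\<lambda>\<xi>. of_real (norm \<xi> powr k) * fourier_real u\<^sub>0 \<xi>) * (t powr \<alpha> * exp (- t))
    + 2 * F * (\<integral>x. \<bar>g x\<bar> \<partial>lborel) * G2 * (t powr \<alpha> * t powr (- (\<alpha> + 1))) + 12 * L2_norm W * (t powr \<alpha> * exp (- t / 4))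
    + t powr \<alpha> * L2_norm (V2 t) + t powr \<alpha> * L2_norm (Y t) + \<bar>\<Delta> t\<bar> * F * G * (t powr \<alpha> * t powr (- \<alpha>))"
      unfolding R_def by (simp only: distrib_left mult_ac add_ac)
    then show ?thesis unfolding e1 e2 R'_def by simp
  qed
  have "(R' \<longlongrightarrow> L2_norm (\<lambda>\<xi>. of_real (norm \<xi> powr k) * fourier_real u\<^sub>0 \<xi>) * 0 + 2 * F * (\<integral>x. \<bar>g x\<bar> \<partial>lborel) * G2 * 0 + 12 * L2_norm W * 0 + 0 + 0 + \<bar>0\<bar> * F * G) at_top"
    unfolding R'_def by (intro tendsto_intros a1 a2 a3 a4 a5 Y(2)[folded \<alpha>_def])
  then have R0: "(R' \<longlongrightarrow> 0) at_top" by simp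
  have "((\<lambda>t. t powr \<alpha> * L2_norm (X t)) \<longlongrightarrow> 0) at_top"
  proof (rule tendsto_sandwich[OF _ _ tendsto_const R0])
    show "\<forall>\<^sub>F t in at_top. t powr \<alpha> * L2_norm (X t) \<le> R' t"
      using eventually_ge_at_top[of 1]
    proof eventually_elim
      case (elim t)
      then have "t powr \<alpha> * L2_norm (X t) \<le> t powr \<alpha> * R t" using main[OF elim] by (intro mult_left_mono) auto
      then show ?case using R'[of t] elim by simp
    qed
  qed simp
  then show "((\<lambda>t. t powr (n / 4 + k / 2) * L2_norm (X t)) \<longlongrightarrow> 0) at_top" by (simp only: \<alpha>_def)
qed

text \<open>The norm of \<open>abs_nabla\<close> may be read on the Fourier side once the weighted
  transform is known to lie in \<open>L2\<close>. For t >= 1 this comes with the Fourier form of the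
  asymptotics, which matches it almost everywhere.\<close>

lemma asymptotics:
  assumes k: "0 \<le> k" "k \<le> k\<^sub>0"
  shows "((\<lambda>t. t powr (real DIM('a) / 4 + k / 2) *
    L2_norm (abs_nabla k (\<lambda>x. u t x - total_mass p u\<^sub>0 u\<^sub>1 u * gauss_kernel t x))) \<longlongrightarrow> 0) at_top"
proof -
  define M where "M = (\<integral>x. u\<^sub>0 x + u\<^sub>1 x \<partial>lborel) + (LINT \<tau>:{0..}|lborel. mass \<tau>)"
  have M: "total_mass p u\<^sub>0 u\<^sub>1 u = M"
    by (simp add: total_mass_def M_def mass_def f_def)
  define X where "X t \<xi> = of_real (norm \<xi> powr k) * (fourier_real (u t) \<xi> - of_real M * of_real (fourier_const TYPE('a) * exp (- t * (norm \<xi>)\<^sup>2)))" for t \<xi>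
  have X: "\<And>t. t \<ge> 1 \<Longrightarrow> X t \<in> L2" "((\<lambda>t. t powr (n / 4 + k / 2) * L2_norm (X t)) \<longlongrightarrow> 0) at_top"
    using asymptotics_fourier[OF k] unfolding X_def[abs_def] M_def by blast+
  have eq: "L2_norm (abs_nabla k (\<lambda>x. u t x - M * gauss_kernel t x)) = L2_norm (X t)" if t: "t \<ge> 1" for t
  proof -
    have t0: "t > 0" "t \<ge> 0" using t by auto
    define w where "w x = u t x - M * gauss_kernel t x" for x
    note Gk = gauss_kernel_fourier[OF t0(1), where 'a='a]
    have GM: "(\<lambda>x::'a. M * gauss_kernel t x) \<in> L2" using L2_scaleR(1)[OF Gk(1), of M] by simp
    have w: "w \<in> L2" unfolding w_def[abs_def] by (intro L2_diff u_L2 t0 GM)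
    have "AE \<xi> in lborel. fourier_real w \<xi> = fourier_real (u t) \<xi> - of_real M * of_real (fourier_const TYPE('a) * exp (- t * (norm \<xi>)\<^sup>2))"
      using fourier_real_diff[OF u_L2[OF t0(2)] GM] fourier_cmult[OF L2_of_real(1)[OF Gk(1)], of "of_real M"] Gk(2)
      unfolding w_def[abs_def] by eventually_elim simp
    then have ae: "AE \<xi> in lborel. norm (X t \<xi>) = norm (of_real (norm \<xi> powr k) * fourier_real w \<xi>)"
      by eventually_elim (simp only: X_def)
    note [measurable] = L2_measurable[OF fourier_real_L2(1)[OF w]]
    have m: "(\<lambda>\<xi>. of_real (norm \<xi> powr k) * fourier_real w \<xi>) \<in> borel_measurable borel" by measurable
    have L: "(\<lambda>\<xi>. of_real (norm \<xi> powr k) * fourier_real w \<xi>) \<in> L2" by (rule L2_cong_AE[OF X(1)[OF t] m ae])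
    have "L2_norm (abs_nabla k w) = L2_norm (\<lambda>\<xi>. of_real (norm \<xi> powr k) * fourier_real w \<xi>)"
      unfolding abs_nabla_def by (rule fourier_multiplier_L2(2)[OF L])
    also have "\<dots> = L2_norm (X t)" by (rule L2_norm_cong_AE[OF L2_measurable[OF X(1)[OF t]] m ae, symmetric])
    finally show ?thesis by (simp only: w_def[abs_def])
  qed
  have "\<forall>\<^sub>F t in at_top. t powr (n / 4 + k / 2) * L2_norm (X t) = t powr (real DIM('a) / 4 + k / 2) *
    L2_norm (abs_nabla k (\<lambda>x. u t x - total_mass p u\<^sub>0 u\<^sub>1 u * gauss_kernel t x))"
    using eventually_ge_at_top[of 1] by eventually_elim (simp only: eq M n_def)
  from Lim_transform_eventually[OF X(2) this] show ?thesis .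
qed

end

section \<open>From the hypotheses on the solution to the abstract setting\<close>

lemma L2_norm_le_sobolev_norm: "L2_norm g \<le> sobolev_norm k g"
  by (simp add: sobolev_norm_def real_le_rsqrt)

text \<open>Sobolev regularity gives square integrability at the top order and interpolation gives
  it at the lower ones; only then do norms of \<open>abs_nabla\<close> translate into Fourier
  bounds. The maximum with 1 makes the constant positive.\<close>

lemma mild_flowI:
  fixes u :: "real \<Rightarrow> 'a::euclidean_space \<Rightarrow> real"
  assumes dim: "DIM('a) = 1 \<and> k\<^sub>0 = 1 \<or> DIM('a) = 2 \<and> 1 \<le> k\<^sub>0 \<and> k\<^sub>0 < 3"
    and p: "p > 1 + 2 / real DIM('a)"
    and u0: "integrable lborel u\<^sub>0" "u\<^sub>0 \<in> sobolev k\<^sub>0" and u1: "integrable lborel u\<^sub>1" "u\<^sub>1 \<in> L2"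
    and cont: "continuous_into_sobolev k\<^sub>0 u" and mild: "mild_solution p u\<^sub>0 u\<^sub>1 u"
    and decay: "\<And>t k. t \<ge> 0 \<Longrightarrow> k \<in> {0..k\<^sub>0} \<Longrightarrow>
       L2_norm (abs_nabla k (u t)) \<le> C * (1 + t) powr (- (real DIM('a) / 4) - k / 2)"
  shows "mild_flow p k\<^sub>0 (max C 1) u u\<^sub>0 u\<^sub>1"
proof
  show "DIM('a) = 1 \<and> k\<^sub>0 = 1 \<or> DIM('a) = 2 \<and> 1 \<le> k\<^sub>0 \<and> k\<^sub>0 < 3" by (rule dim)
  show "p > 1 + 2 / real DIM('a)" by (rule p)
  show "max C 1 > 0" by simp
  have s: "u t \<in> sobolev k\<^sub>0" if "t \<ge> 0" for t using cont that by (simp add: continuous_into_sobolev_def)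
  then show uL: "u t \<in> L2" if "t \<ge> 0" for t using that by (simp add: sobolev_def)
  show "(\<lambda>\<xi>. of_real (norm \<xi> powr k) * fourier_real (u t) \<xi>) \<in> L2 \<and>
       L2_norm (\<lambda>\<xi>. of_real (norm \<xi> powr k) * fourier_real (u t) \<xi>) \<le> max C 1 * (1 + t) powr (- (real DIM('a) / 4) - k / 2)"
    if t: "t \<ge> 0" and k: "0 \<le> k" "k \<le> k\<^sub>0" for t k
  proof -
    have W: "(\<lambda>\<xi>. of_real (norm \<xi> powr k) * fourier_real (u t) \<xi>) \<in> L2"
      using s[OF t] uL[OF t] by (intro weight_interpolate_L2[OF fourier_real_L2(1) _ k]) (auto simp: sobolev_def)
    have "L2_norm (\<lambda>\<xi>. of_real (norm \<xi> powr k) * fourier_real (u t) \<xi>) = L2_norm (abs_nabla k (u t))"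
      unfolding abs_nabla_def by (rule fourier_multiplier_L2(2)[OF W, symmetric])
    also have "\<dots> \<le> C * (1 + t) powr (- (real DIM('a) / 4) - k / 2)" using decay[OF t, of k] k by simp
    also have "\<dots> \<le> max C 1 * (1 + t) powr (- (real DIM('a) / 4) - k / 2)" by (intro mult_right_mono) auto
    finally show ?thesis using W by blast
  qed
  show "((\<lambda>t. L2_norm (\<lambda>x. u t x - u s x)) \<longlongrightarrow> 0) (at s within {0..})" if "s \<ge> 0" for s
  proof (rule tendsto_sandwich[OF _ _ tendsto_const])
    show "((\<lambda>t. sobolev_norm k\<^sub>0 (\<lambda>x. u t x - u s x)) \<longlongrightarrow> 0) (at s within {0..})"
      using cont that by (simp add: continuous_into_sobolev_def)
  qed (auto simp: L2_norm_le_sobolev_norm)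
qed (use u0 u1 mild in \<open>auto simp: sobolev_def\<close>)

theorem theorem1p2:
  fixes p k\<^sub>0 :: real
  assumes "(DIM('a::euclidean_space) = 1 \<and> k\<^sub>0 = 1) \<or>
           (DIM('a) = 2 \<and> (\<exists>\<epsilon>\<in>{0..<2}. k\<^sub>0 = 1 + \<epsilon>))"
    and "p > 1 + 2 / real DIM('a)"
  shows "\<exists>\<delta>>0. \<forall>(u\<^sub>0 :: 'a \<Rightarrow> real) (u\<^sub>1 :: 'a \<Rightarrow> real) (u :: real \<Rightarrow> 'a \<Rightarrow> real).
    integrable lborel u\<^sub>0 \<and> u\<^sub>0 \<in> sobolev k\<^sub>0 \<and>
    integrable lborel u\<^sub>1 \<and> u\<^sub>1 \<in> L2 \<and>
    L1_norm u\<^sub>0 + sobolev_norm k\<^sub>0 u\<^sub>0 + L1_norm u\<^sub>1 + L2_norm u\<^sub>1 \<le> \<delta> \<and>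
    continuous_into_sobolev k\<^sub>0 u \<and>
    mild_solution p u\<^sub>0 u\<^sub>1 u \<and>
    (\<exists>C. \<forall>t\<ge>0. \<forall>k\<in>{0..k\<^sub>0}.
       L2_norm (abs_nabla k (u t)) \<le> C * (1 + t) powr (- (real DIM('a) / 4) - k / 2))
    \<longrightarrow>
    (\<forall>k\<in>{0..k\<^sub>0}.
       ((\<lambda>t. t powr (real DIM('a) / 4 + k / 2) *
              L2_norm (abs_nabla k (\<lambda>x. u t x - total_mass p u\<^sub>0 u\<^sub>1 u * gauss_kernel t x)))
        \<longlongrightarrow> 0) at_top)"
proof -
  have dim: "DIM('a) = 1 \<and> k\<^sub>0 = 1 \<or> DIM('a) = 2 \<and> 1 \<le> k\<^sub>0 \<and> k\<^sub>0 < 3"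
    using assms(1) by auto
  show ?thesis
  proof (intro exI[of _ 1] conjI allI impI ballI)
    fix u\<^sub>0 u\<^sub>1 :: "'a \<Rightarrow> real" and u :: "real \<Rightarrow> 'a \<Rightarrow> real" and k
    assume *: "integrable lborel u\<^sub>0 \<and> u\<^sub>0 \<in> sobolev k\<^sub>0 \<and>
      integrable lborel u\<^sub>1 \<and> u\<^sub>1 \<in> L2 \<and>
      L1_norm u\<^sub>0 + sobolev_norm k\<^sub>0 u\<^sub>0 + L1_norm u\<^sub>1 + L2_norm u\<^sub>1 \<le> 1 \<and>
      continuous_into_sobolev k\<^sub>0 u \<and> mild_solution p u\<^sub>0 u\<^sub>1 u \<and>
      (\<exists>C. \<forall>t\<ge>0. \<forall>k\<in>{0..k\<^sub>0}.
         L2_norm (abs_nabla k (u t)) \<le> C * (1 + t) powr (- (real DIM('a) / 4) - k / 2))"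
      and k: "k \<in> {0..k\<^sub>0}"
    then obtain C where "\<And>t k. t \<ge> 0 \<Longrightarrow> k \<in> {0..k\<^sub>0} \<Longrightarrow>
         L2_norm (abs_nabla k (u t)) \<le> C * (1 + t) powr (- (real DIM('a) / 4) - k / 2)"
      by blast
    with * dim assms(2) interpret mild_flow p k\<^sub>0 "max C 1" u u\<^sub>0 u\<^sub>1
      by (intro mild_flowI) auto
    show "((\<lambda>t. t powr (real DIM('a) / 4 + k / 2) *
              L2_norm (abs_nabla k (\<lambda>x. u t x - total_mass p u\<^sub>0 u\<^sub>1 u * gauss_kernel t x)))
        \<longlongrightarrow> 0) at_top"
      using k by (intro asymptotics) auto
  qed simp
qed

end
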